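(* There exist constants $c_0,C_0>0$ such that the following holds. Let $a_{C, N}:=C\, \sqrt{\frac{\pi}{2}}\, \frac{\sqrt{\log\log N}}{\log N}$. For all $\theta>0$ and $C\ge C_0$, $$\mathbb{P}\left( \mathcal{C}_{N}\left( \mathcal{T}_N^+ \left( \theta,a_{C,N}\right) \right) \right)=O\big((\log N)^{-c_0 C^2}\big) \quad \text{as } N\to \infty .$$ Moreover, for all $\theta>0$ and $C\ge C_0$, $$\limsup_{N \to \infty} \mathbb{P}\left( \mathcal{C}_{N/2}\left( \mathcal{T}_N^+ \left( \theta, a_{C,N} \right) \right) \right)<1 .$$
   Context: For $n\ge 0$, $B_n:=[-n,n]^2\cap\mathbb{Z}^2$. The left (resp. right) side of $B_n$ is the set of its leftmost (resp. rightmost) vertices. For $0<n\le N$ and $A\subseteq B_N$, $\mathcal{C}_n(A)$ is the event that there exists a nearest-neighbor path in $\mathbb{Z}^2$, all of whose vertices lie in $A\cap B_n$, from the left side to the right side of $B_n$. Random walk with wired boundary: let $D=B_N$ ($N\ge1$ an integer) and contract all vertices of $D^c=\mathbb{Z}^2\setminus D$ into a single point $\varrho$. Let $E$ be the set of nearest-neighbor edges of $\mathbb{Z}^2$ between two vertices of $D$, together with all nearest-neighbor edges from $D$ to $D^c$ (which become edges from $D$ to $\varrho$, with multiplicity). Let $\widetilde S$ be the continuous-time random walk on the graph $(D\cup\{\varrho\},E)$ started from $\varrho$, with jump rate $1/4$ along every edge of $E$. Set $\ell^t_D(z):=\int_0^t\mathbf{1}_{\{\widetilde S_s=z\}}ds$,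 $\varsigma(t):=\inf\{s\ge0:\ell_D^s(\varrho)>t\}$ and $\mathfrak{L}^t_D(z):=\ell_D^{\varsigma(t)}(z)$ for $z\in D\cup\{\varrho\}$. For $\theta>0$ let $t_N:=\frac{\theta}{\pi}(\log N)^2$. For $a>0$, the set of thick points is $$\mathcal{T}_N^+(\theta,a):= \Big\{ z\in B_N: \mathfrak{L}^{t_N}_{B_N}(z)\ge \frac{(\sqrt{\theta}+a)^2}{\pi}(\log N)^2 \Big\}.$$ *)

theory Defs
  imports "HOL-Probability.Probability" "HOL-Library.Landau_Symbols"
begin

section \<open>Boxes and crossings in the square lattice\<close>

type_synonym site = "int \<times> int"

text \<open>The radius is real, so that the box of radius \<open>N/2\<close> makes sense for odd \<open>N\<close> as well.\<close>

definition lattice_box :: "real \<Rightarrow> site set" where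
  "lattice_box r = {z. \<bar>real_of_int (fst z)\<bar> \<le> r \<and> \<bar>real_of_int (snd z)\<bar> \<le> r}"

definition left_side :: "real \<Rightarrow> site set" where
  "left_side r = {z \<in> lattice_box r. \<forall>w\<in>lattice_box r. fst z \<le> fst w}"

definition right_side :: "real \<Rightarrow> site set" where
  "right_side r = {z \<in> lattice_box r. \<forall>w\<in>lattice_box r. fst w \<le> fst z}"

definition adjacent :: "site \<Rightarrow> site \<Rightarrow> bool" where
  "adjacent u v \<longleftrightarrow> \<bar>fst u - fst v\<bar> + \<bar>snd u - snd v\<bar> = 1"

definition crossing :: "real \<Rightarrow> site set \<Rightarrow> bool" where
  "crossing r A \<longleftrightarrow>
     (\<exists>p. p \<noteq> [] \<and> successively adjacent p \<and> set p \<subseteq> A \<inter> lattice_box r \<and>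
          hd p \<in> left_side r \<and> last p \<in> right_side r)"

section \<open>Random walk with wired boundary\<close>

text \<open>
  The state \<open>Some z\<close> is the vertex \<open>z\<close> of \<open>D\<close>; the state \<open>None\<close> is the point obtained by
  contracting the complement of \<open>D\<close>. Both orientations of every edge are kept, as pairs of
  vertices of the lattice \<^emph>\<open>before\<close> contraction; in this way several edges
  between the same vertex and the contracted point stay distinct.
\<close>

definition contract :: "site set \<Rightarrow> site \<Rightarrow> site option" where
  "contract D z = (if z \<in> D then Some z else None)"

definition darts :: "site set \<Rightarrow> (site \<times> site) set" where
  "darts D = {(u, v). adjacent u v \<and> (u \<in> D \<or> v \<in> D)}"

definition out_darts :: "site set \<Rightarrow> site option \<Rightarrow> (site \<times> site) set" where
  "out_darts D x = {e \<in> darts D. contract D (fst e) = x}"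

text \<open>
  The walk with jump rate 1/4 along every edge: at its \<open>n\<close>-th step, each dart \<open>e\<close> leaving the
  current state carries a fresh exponential clock \<open>\<omega> (n, e)\<close> of rate 1/4, and the walk jumps
  along the dart whose clock rings first. Ties, and accumulation of the jump times at a
  finite time, are null events.
\<close>

definition clock_space :: "site set \<Rightarrow> (nat \<times> site \<times> site \<Rightarrow> real) measure" where
  "clock_space D =
     PiM (UNIV \<times> darts D) (\<lambda>_. density lborel (\<lambda>x. ennreal (exponential_density (1/4) x)))"

primrec skeleton :: "site set \<Rightarrow> (nat \<times> site \<times> site \<Rightarrow> real) \<Rightarrow> nat \<Rightarrow> site option" where
  "skeleton D \<omega> 0 = None"
| "skeleton D \<omega> (Suc n) =
     contract D (snd (arg_min_on (\<lambda>e. \<omega> (n, e)) (out_darts D (skeleton D \<omega> n))))"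

definition holding_time :: "site set \<Rightarrow> (nat \<times> site \<times> site \<Rightarrow> real) \<Rightarrow> nat \<Rightarrow> real" where
  "holding_time D \<omega> n = Min ((\<lambda>e. \<omega> (n, e)) ` out_darts D (skeleton D \<omega> n))"

definition jump_time :: "site set \<Rightarrow> (nat \<times> site \<times> site \<Rightarrow> real) \<Rightarrow> nat \<Rightarrow> real" where
  "jump_time D \<omega> n = (\<Sum>k<n. holding_time D \<omega> k)"

definition walk :: "site set \<Rightarrow> (nat \<times> site \<times> site \<Rightarrow> real) \<Rightarrow> real \<Rightarrow> site option" where
  "walk D \<omega> t = skeleton D \<omega> (LEAST n. t < jump_time D \<omega> (Suc n))"

section \<open>Local times and thick points\<close>

definition local_time :: "(real \<Rightarrow> 's) \<Rightarrow> real \<Rightarrow> 's \<Rightarrow> real" where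
  "local_time X t z = (LBINT s:{0..t}. indicator {z} (X s))"

text \<open>The set below is almost surely nonempty for the walk considered here, so the
  infimum may be taken in the reals.\<close>

definition inverse_local_time :: "(real \<Rightarrow> 's) \<Rightarrow> 's \<Rightarrow> real \<Rightarrow> real" where
  "inverse_local_time X \<rho> t = Inf {s. 0 \<le> s \<and> local_time X s \<rho> > t}"

definition wired_local_time ::
    "site set \<Rightarrow> (nat \<times> site \<times> site \<Rightarrow> real) \<Rightarrow> real \<Rightarrow> site option \<Rightarrow> real" where
  "wired_local_time D \<omega> t x =
     local_time (walk D \<omega>) (inverse_local_time (walk D \<omega>) None t) x"

definition thick_points ::
    "nat \<Rightarrow> real \<Rightarrow> real \<Rightarrow> (nat \<times> site \<times> site \<Rightarrow> real) \<Rightarrow> site set" where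
  "thick_points N \<theta> a \<omega> =
     {z \<in> lattice_box (real N).
        wired_local_time (lattice_box (real N)) \<omega> (\<theta> / pi * (ln (real N))\<^sup>2) (Some z)
          \<ge> (sqrt \<theta> + a)\<^sup>2 / pi * (ln (real N))\<^sup>2}"

definition crossing_prob :: "real \<Rightarrow> nat \<Rightarrow> real \<Rightarrow> real \<Rightarrow> real" where
  "crossing_prob r N \<theta> a =
     \<P>(\<omega> in clock_space (lattice_box (real N)). crossing r (thick_points N \<theta> a \<omega>))"

definition thick_level :: "real \<Rightarrow> nat \<Rightarrow> real" where
  "thick_level C N = C * sqrt (pi / 2) * (sqrt (ln (ln (real N))) / ln (real N))"

end

theory Submission
  imports Defs "HOL-Real_Asymp.Real_Asymp"
begin

text \<open>
  Let \<open>t\<close> be the time parameter of the theorem and \<open>m = sqrt (2 * t)\<close>, which is of order \<open>ln N\<close>. By the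
  second Ray--Knight isomorphism (\<open>local_time_isomorphism\<close>), the local times plus half the square
  of an independent Gaussian free field \<open>\<phi>\<close> have the law of \<open>(\<phi> + m)\<^sup>2 / 2\<close>. With
  \<open>h = C * sqrt (ln (ln N))\<close>, a thick point is a point where the local time is at least
  \<open>(m + h)\<^sup>2 / 2\<close>; hence thick points cross with at most the probability that
  \<open>{\<bar>\<phi> + m\<bar> \<ge> m + h}\<close> crosses. The isomorphism is proved by comparing Laplace transforms: on the side of
  the walk a martingale computes them (\<open>laplace_mart_step\<close>, \<open>local_time_laplace\<close>), on the
  side of the field a translation (\<open>gff_laplace_shift\<close>), and Laplace transforms determine laws
  (\<open>joint_laplace_uniqueness\<close>).

  The gradients of \<open>\<phi>\<close> have bounded variance, so that with overwhelming probability no two neighbours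
  differ by \<open>2 * m\<close>. Then \<open>\<phi> + m\<close> has a constant sign along a crossing of
  \<open>{\<bar>\<phi> + m\<bar> \<ge> m + h}\<close>, and either \<open>{\<phi> \<ge> h}\<close> or \<open>{- \<phi> \<ge> 2 * m}\<close> crosses
  (\<open>gff_far_crossing\<close>). What remains is to bound crossings of level sets of the free field.

  The main estimate is \<open>spanning_cluster_bound\<close>. Explore the cluster \<open>K\<close> of \<open>{\<phi> \<ge> h}\<close> from the left side
  of the box. All that is learnt is that \<open>\<phi> \<ge> h\<close> on \<open>K\<close> and that \<open>\<phi> < h\<close> on the
  neighbours of \<open>K\<close> and on the other vertices of the left side. Conditionally on this, the
  mean of \<open>\<phi>\<close> is at least \<open>(h - const) * k\<close> up to a small boundary term, where \<open>k z\<close> is the probability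
  that the walk from \<open>z\<close> hits \<open>K\<close> before leaving the box (\<open>mean_lower\<close>): the information
  \<open>\<phi> < h\<close> at a vertex next to \<open>K\<close> lowers the Laplacian of the mean by a constant only, and such vertices are
  hardly easier to hit than \<open>K\<close> itself. Now test the field against the Laplacian of a function \<open>f\<close>
  of bounded energy. The resulting Gaussian variable \<open>energy D f \<phi>\<close> has bounded variance, but given that
  \<open>K\<close> meets every column of the central half of the box its conditional mean is at least a constant times
  \<open>h\<close> (\<open>hitting_lower_bound\<close>). Jensen's inequality for an exponential moment of this variable shows that
  the exploration spans the central half with probability at most \<open>exp (- const * h\<^sup>2)\<close>. For crossings of
  the whole box this is a power of \<open>ln N\<close>.

  In the box of half the size the left side lies in the bulk and this argument fails. There, for \<open>h > 0\<close>, a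
  horizontal crossing of \<open>{\<phi> \<ge> h}\<close> excludes a vertical crossing of \<open>{\<phi> \<le> - h}\<close>, and the two are equally
  likely (\<open>gff_crossing_le_half\<close>). The crossings at the height \<open>2 * m\<close> are again excluded by the exploration,
  now from each vertex of the left side separately: a factor \<open>N\<close> is harmless at a height of
  order \<open>ln N\<close>.
\<close>

section \<open>Discrete potential theory on finite subsets of the square lattice\<close>

definition nbrs :: "site \<Rightarrow> site set" where
  "nbrs z = {(fst z + 1, snd z), (fst z - 1, snd z), (fst z, snd z + 1), (fst z, snd z - 1)}"

lemma adjacent_iff_nbrs: "adjacent u v \<longleftrightarrow> v \<in> nbrs u"
  unfolding adjacent_def nbrs_def by (cases u; cases v) auto

lemma adjacent_sym: "adjacent u v \<longleftrightarrow> adjacent v u"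
  unfolding adjacent_def by (simp add: abs_minus_commute)

lemma nbrs_sym: "u \<in> nbrs v \<longleftrightarrow> v \<in> nbrs u"
  using adjacent_sym adjacent_iff_nbrs by blast

lemma finite_nbrs [simp]: "finite (nbrs z)"
  unfolding nbrs_def by simp

lemma card_nbrs [simp]: "card (nbrs z) = 4"
  unfolding nbrs_def by (simp add: card_insert_if)

lemma not_in_nbrs_self [simp]: "z \<notin> nbrs z"
  unfolding nbrs_def by (cases z) auto

lemma sum_nbrs:
  "sum f (nbrs z) = f (fst z + 1, snd z) + f (fst z - 1, snd z) + f (fst z, snd z + 1) + f (fst z, snd z - 1)"
  for f :: "site \<Rightarrow> 'a::comm_monoid_add"
  unfolding nbrs_def by (simp add: ac_simps)

lemma darts_eq: "darts D = (SIGMA u:D. nbrs u) \<union> (\<lambda>(u, v). (v, u)) ` (SIGMA u:D. nbrs u)"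
  unfolding darts_def adjacent_iff_nbrs using nbrs_sym by (auto simp: image_iff)

lemma finite_darts: "finite D \<Longrightarrow> finite (darts D)"
  unfolding darts_eq by auto

lemma darts_swap: "bij_betw (\<lambda>(u, v). (v, u)) (darts D) (darts D)"
  by (rule bij_betw_byWitness[of _ "\<lambda>(u, v). (v, u)"]) (auto simp: darts_def adjacent_sym)

definition lavg :: "(site \<Rightarrow> real) \<Rightarrow> site \<Rightarrow> real" where
  "lavg f z = (\<Sum>w\<in>nbrs z. f w) / 4"

definition lap :: "(site \<Rightarrow> real) \<Rightarrow> site \<Rightarrow> real" where
  "lap f z = f z - lavg f z"

text \<open>Each edge of conductance \<open>1/4\<close> occurs as two darts; halving the sum makes \<open>energy D f f\<close> the
  quadratic form of \<open>lap\<close>.\<close>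

definition energy :: "site set \<Rightarrow> (site \<Rightarrow> real) \<Rightarrow> (site \<Rightarrow> real) \<Rightarrow> real" where
  "energy D f g = (\<Sum>(u, v)\<in>darts D. (f u - f v) * (g u - g v)) / 8"

lemma lavg_mono: "(\<And>w. w \<in> nbrs z \<Longrightarrow> f w \<le> g w) \<Longrightarrow> lavg f z \<le> lavg g z"
  unfolding lavg_def by (auto intro: sum_mono divide_right_mono)

lemma lavg_const [simp]: "lavg (\<lambda>_. c) z = c"
  unfolding lavg_def by simp

lemma lavg_add: "lavg (\<lambda>z. f z + g z) z = lavg f z + lavg g z"
  unfolding lavg_def by (simp add: sum.distrib add_divide_distrib)

lemma lavg_diff: "lavg (\<lambda>z. f z - g z) z = lavg f z - lavg g z"
  unfolding lavg_def by (simp add: sum_subtractf diff_divide_distrib)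

lemma lavg_cmult: "lavg (\<lambda>z. c * f z) z = c * lavg f z"
  unfolding lavg_def by (simp add: sum_distrib_left)

lemma lap_add: "lap (\<lambda>z. f z + g z) z = lap f z + lap g z"
  unfolding lap_def by (simp add: lavg_add)

lemma lap_diff: "lap (\<lambda>z. f z - g z) z = lap f z - lap g z"
  unfolding lap_def by (simp add: lavg_diff)

lemma lap_cmult: "lap (\<lambda>z. c * f z) z = c * lap f z"
  unfolding lap_def by (simp add: lavg_cmult right_diff_distrib)

lemma energy_sym: "energy D f g = energy D g f"
  unfolding energy_def by (simp add: mult.commute)

lemma energy_add_left: "energy D (\<lambda>z. f z + g z) k = energy D f k + energy D g k"
  unfolding energy_def
  by (simp add: sum.distrib[symmetric] add_divide_distrib[symmetric] split_beta algebra_simps)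

lemma energy_cmult_left: "energy D (\<lambda>z. c * f z) k = c * energy D f k"
  unfolding energy_def by (simp add: sum_distrib_left split_beta algebra_simps)

lemma energy_add_right: "energy D k (\<lambda>z. f z + g z) = energy D k f + energy D k g"
  using energy_add_left energy_sym by metis

lemma energy_cmult_right: "energy D k (\<lambda>z. c * f z) = c * energy D k f"
  using energy_cmult_left energy_sym by metis

lemma energy_nonneg: "0 \<le> energy D f f"
  unfolding energy_def by (auto intro!: sum_nonneg)

lemma energy_square_add:
  "energy D (\<lambda>z. f z + c * g z) (\<lambda>z. f z + c * g z) =
     energy D f f + 2 * c * energy D g f + c\<^sup>2 * energy D g g"
  by (simp add: energy_add_left energy_add_right energy_cmult_left energy_cmult_right
      energy_sym[of D f g] power2_eq_square algebra_simps)

lemma sum_darts_in: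
  fixes F :: "site \<Rightarrow> site \<Rightarrow> real"
  assumes "finite D" "\<And>u v. u \<notin> D \<Longrightarrow> F u v = 0"
  shows "(\<Sum>(u, v)\<in>darts D. F u v) = (\<Sum>u\<in>D. \<Sum>v\<in>nbrs u. F u v)"
proof -
  have "(\<Sum>u\<in>D. \<Sum>v\<in>nbrs u. F u v) = (\<Sum>(u, v)\<in>(SIGMA u:D. nbrs u). F u v)"
    using assms(1) by (intro sum.Sigma) auto
  also have "\<dots> = (\<Sum>(u, v)\<in>darts D. F u v)"
    by (rule sum.mono_neutral_left[OF finite_darts[OF assms(1)]])
       (use assms(1) in \<open>auto simp: darts_def adjacent_iff_nbrs intro!: assms(2)\<close>)
  finally show ?thesis by simp
qed

lemma energy_green:
  assumes "finite D" and g: "\<And>z. z \<notin> D \<Longrightarrow> g z = 0"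
  shows "energy D f g = (\<Sum>z\<in>D. g z * lap f z)"
proof -
  have sw: "(\<Sum>(u, v)\<in>darts D. (f u - f v) * g v) = (\<Sum>(u, v)\<in>darts D. (f v - f u) * g u)"
    using sum.reindex_bij_betw[OF darts_swap, of "\<lambda>(u, v). (f u - f v) * g v" D]
    by (simp add: split_beta)
  have "(\<Sum>(u, v)\<in>darts D. (f u - f v) * (g u - g v)) =
      (\<Sum>(u, v)\<in>darts D. (f u - f v) * g u) - (\<Sum>(u, v)\<in>darts D. (f u - f v) * g v)"
    by (simp add: sum_subtractf[symmetric] split_beta algebra_simps)
  also have "\<dots> = 2 * (\<Sum>(u, v)\<in>darts D. (f u - f v) * g u)"
    unfolding sw by (simp add: sum_subtractf[symmetric] sum_distrib_left split_beta algebra_simps)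
  also have "(\<Sum>(u, v)\<in>darts D. (f u - f v) * g u) = (\<Sum>u\<in>D. \<Sum>v\<in>nbrs u. (f u - f v) * g u)"
    by (rule sum_darts_in[OF assms(1)]) (simp add: g)
  also have "\<dots> = (\<Sum>u\<in>D. 4 * (g u * lap f u))"
    by (intro sum.cong) (auto simp: lap_def lavg_def sum_subtractf sum_distrib_right[symmetric]
        algebra_simps)
  finally show ?thesis
    unfolding energy_def by (simp add: sum_distrib_left[symmetric])
qed

lemma energy_edge:
  assumes "finite D" "v \<in> nbrs u" "u \<in> D \<or> v \<in> D"
  shows "(f u - f v)\<^sup>2 \<le> 4 * energy D f f"
proof -
  have uv: "(u, v) \<in> darts D" "(v, u) \<in> darts D" "u \<noteq> v"
    using assms by (auto simp: darts_def adjacent_iff_nbrs nbrs_sym)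
  have "2 * (f u - f v)\<^sup>2 = (\<Sum>(u, v)\<in>{(u, v), (v, u)}. (f u - f v) * (f u - f v))"
    using uv by (simp add: power2_eq_square algebra_simps)
  also have "\<dots> \<le> (\<Sum>(u, v)\<in>darts D. (f u - f v) * (f u - f v))"
    using uv by (intro sum_mono2 finite_darts assms) auto
  finally show ?thesis unfolding energy_def by simp
qed

text \<open>The lattice condition behind all the correlation inequalities below. It holds edge by edge, since
  sorting the values at each end brings increments of opposite order closer together.\<close>

lemma energy_max_min:
  "energy D (\<lambda>z. max (a z) (b z)) (\<lambda>z. max (a z) (b z)) +
   energy D (\<lambda>z. min (a z) (b z)) (\<lambda>z. min (a z) (b z)) \<le> energy D a a + energy D b b"
proof -
  have *: "(max p q - max r s) * (max p q - max r s) + (min p q - min r s) * (min p q - min r s)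
      \<le> (p - r) * (p - r) + (q - s) * (q - s)" for p q r s :: real
  proof -
    have "0 \<le> (q - p) * (r - s)" if "p \<le> q" "s \<le> r"
      using that by simp
    moreover have "0 \<le> (p - q) * (s - r)" if "q \<le> p" "r \<le> s"
      using that by simp
    ultimately show ?thesis
      by (cases "p \<le> q"; cases "r \<le> s") (auto simp: max_def min_def algebra_simps)
  qed
  show ?thesis
    unfolding energy_def add_divide_distrib[symmetric] sum.distrib[symmetric]
    by (intro divide_right_mono sum_mono) (auto intro: *)
qed

text \<open>A leftmost minimiser has a strictly larger neighbour on its left.\<close>

lemma minimum_principle:
  assumes "finite U" and super: "\<And>z. z \<in> U \<Longrightarrow> 0 \<le> lap d z"
    and off: "\<And>z. z \<notin> U \<Longrightarrow> 0 \<le> d z"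
  shows "0 \<le> d z"
proof (rule ccontr)
  assume neg: "\<not> 0 \<le> d z"
  then have "z \<in> U" using off[of z] by blast
  define m where "m = Min (d ` U)"
  have mle: "m \<le> d w" if "w \<in> U" for w
    unfolding m_def using that assms(1) by auto
  have m0: "m < 0" using mle[OF \<open>z \<in> U\<close>] neg by simp
  define A where "A = {w \<in> U. d w = m}"
  have "m \<in> d ` U" unfolding m_def using assms(1) \<open>z \<in> U\<close> by (intro Min_in) auto
  then have A: "finite A" "A \<noteq> {}" unfolding A_def using assms(1) by auto
  define l where "l = Min (fst ` A)"
  have "l \<in> fst ` A" unfolding l_def using A by (intro Min_in) auto
  then obtain w where w: "w \<in> A" "fst w = l" by auto
  have lower: "m \<le> d v" for v using mle[of v] off[of v] m0 by linarith
  have left: "m < d (fst w - 1, snd w)"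
  proof (cases "(fst w - 1, snd w) \<in> A")
    case True
    then have "fst (fst w - 1, snd w) \<in> fst ` A" by (rule imageI)
    then have "l \<le> fst (fst w - 1, snd w)" unfolding l_def using A(1) by (intro Min_le) simp_all
    with w show ?thesis by simp
  next
    case False
    then show ?thesis
      using lower[of "(fst w - 1, snd w)"] off[of "(fst w - 1, snd w)"] m0
      unfolding A_def by fastforce
  qed
  have "4 * m < (\<Sum>v\<in>nbrs w. d v)"
    unfolding sum_nbrs using left lower[of "(fst w + 1, snd w)"] lower[of "(fst w, snd w + 1)"]
      lower[of "(fst w, snd w - 1)"] by linarith
  then have "lap d w < 0"
    using w unfolding lap_def lavg_def A_def by simp
  with super[of w] w show False unfolding A_def by auto
qed

text \<open>Perron's method: iterating the averaging operator from below increases to a solution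
  as soon as there is a supersolution.\<close>

lemma dirichlet_solution:
  fixes b s c S :: "site \<Rightarrow> real"
  assumes b: "\<And>z. z \<notin> D \<Longrightarrow> 0 \<le> b z \<and> b z \<le> S z"
    and s: "\<And>z. z \<in> D \<Longrightarrow> 0 \<le> s z" and c: "\<And>z. z \<in> D \<Longrightarrow> 0 \<le> c z"
    and S: "\<And>z. z \<in> D \<Longrightarrow> 0 \<le> S z" "\<And>z. z \<in> D \<Longrightarrow> s z + c z * lavg S z \<le> S z"
  shows "\<exists>u. (\<forall>z. z \<notin> D \<longrightarrow> u z = b z) \<and> (\<forall>z\<in>D. u z = s z + c z * lavg u z) \<and>
             (\<forall>z. 0 \<le> u z \<and> u z \<le> S z)"
proof -
  define T where "T u z = (if z \<in> D then s z + c z * lavg u z else b z)" for u z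
  define v where "v n = (T ^^ n) (\<lambda>z. if z \<in> D then 0 else b z)" for n
  have mono: "u z \<le> w z" if "\<And>z. u0 z \<le> w0 z" "u = T u0" "w = T w0" for u w u0 w0 z
    using that c[of z] lavg_mono[of z u0 w0] by (auto simp: T_def intro: mult_left_mono)
  have vSuc: "v (Suc n) = T (v n)" for n unfolding v_def by simp
  have nn: "0 \<le> v n z" for n z
  proof (induction n arbitrary: z)
    case 0 then show ?case using b by (auto simp: v_def)
  next
    case (Suc n)
    have "0 \<le> lavg (v n) z" using lavg_mono[of z "\<lambda>_. 0" "v n"] Suc by simp
    then show ?case using s[of z] c[of z] b[of z] unfolding vSuc T_def by auto
  qed
  have le: "v n z \<le> S z" for n z
  proof (induction n arbitrary: z)
    case 0 then show ?case using b S(1) by (auto simp: v_def)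
  next
    case (Suc n)
    have "v (Suc n) z \<le> T S z" by (rule mono[OF _ vSuc refl]) (rule Suc)
    then show ?case using S(2)[of z] b[of z] by (auto simp: T_def split: if_splits)
  qed
  have inc: "v n z \<le> v (Suc n) z" for n z
  proof (induction n arbitrary: z)
    case 0 then show ?case using nn[of 1 z] by (auto simp: v_def T_def)
  next
    case (Suc n)
    then show ?case using mono[OF Suc vSuc vSuc] by simp
  qed
  define u where "u z = lim (\<lambda>n. v n z)" for z
  have lim: "(\<lambda>n. v n z) \<longlonglongrightarrow> u z" for z
  proof -
    have "incseq (\<lambda>n. v n z)" using inc by (rule incseq_SucI)
    then have "convergent (\<lambda>n. v n z)"
      by (intro Bseq_mono_convergent BseqI'[of _ "S z"])
         (use nn le in \<open>auto simp: incseq_def\<close>)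
    then show ?thesis unfolding u_def by (simp add: convergent_LIMSEQ_iff)
  qed
  have fix1: "u z = T u z" for z
  proof (rule LIMSEQ_unique)
    show "(\<lambda>n. v (Suc n) z) \<longlonglongrightarrow> u z" using lim by (rule LIMSEQ_Suc)
    show "(\<lambda>n. v (Suc n) z) \<longlonglongrightarrow> T u z"
      unfolding vSuc T_def lavg_def by (auto intro!: tendsto_intros lim)
  qed
  have "u z = b z" if "z \<notin> D" for z using fix1[of z] that by (simp add: T_def)
  moreover have "u z = s z + c z * lavg u z" if "z \<in> D" for z
    using fix1[of z] that by (simp add: T_def)
  moreover have "0 \<le> u z \<and> u z \<le> S z" for z
    using LIMSEQ_le_const[OF lim[of z]] LIMSEQ_le_const2[OF lim[of z]] nn le by blast
  ultimately show ?thesis by blast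
qed

text \<open>A strictly superharmonic function that is positive on any given finite set if \<open>R\<close> is large; it serves
  as a supersolution, as a witness of the spectral gap and as a Lyapunov function.\<close>

definition paraboloid :: "real \<Rightarrow> site \<Rightarrow> real" where
  "paraboloid R z = R - ((real_of_int (fst z))\<^sup>2 + (real_of_int (snd z))\<^sup>2)"

lemma lap_paraboloid: "lap (paraboloid R) z = 1"
  unfolding lap_def lavg_def sum_nbrs paraboloid_def by (simp add: power2_eq_square field_simps)

lemma paraboloid_positive:
  assumes "finite D"
  obtains R where "\<And>z. z \<in> D \<Longrightarrow> 1 \<le> paraboloid R z"
    "\<And>z w. z \<in> D \<Longrightarrow> w \<in> nbrs z \<Longrightarrow> 1 \<le> paraboloid R w" "R \<ge> 1"
proof -
  let ?q = "\<lambda>z::site. (real_of_int (fst z))\<^sup>2 + (real_of_int (snd z))\<^sup>2"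
  let ?A = "D \<union> (\<Union>z\<in>D. nbrs z)"
  define R where "R = 1 + (\<Sum>z\<in>?A. ?q z)"
  have fin: "finite ?A" using assms by simp
  have bound: "?q z \<le> R - 1" if "z \<in> ?A" for z
    unfolding R_def using member_le_sum[OF that _ fin, of ?q] by simp
  have "1 \<le> paraboloid R z" if "z \<in> ?A" for z
    unfolding paraboloid_def using bound[OF that] by linarith
  moreover have "R \<ge> 1" unfolding R_def by (simp add: sum_nonneg)
  ultimately show ?thesis by (intro that[of R]) blast+
qed

text \<open>A strictly superharmonic positive function gives a spectral gap (Barta's argument):
  comparing \<open>(f u - f v)\<^sup>2\<close> with \<open>f u\<^sup>2 (1 - S v / S u) + f v\<^sup>2 (1 - S u / S v)\<close>
  leaves a perfect square.\<close>

lemma poincare: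
  assumes "finite D"
  obtains \<epsilon> where "\<epsilon> > 0"
    "\<And>f. (\<And>z. z \<notin> D \<Longrightarrow> f z = 0) \<Longrightarrow> \<epsilon> * (\<Sum>z\<in>D. (f z)\<^sup>2) \<le> energy D f f"
proof -
  obtain R where R: "\<And>z. z \<in> D \<Longrightarrow> 1 \<le> paraboloid R z"
    "\<And>z w. z \<in> D \<Longrightarrow> w \<in> nbrs z \<Longrightarrow> 1 \<le> paraboloid R w" "R \<ge> 1"
    using paraboloid_positive[OF assms] by metis
  let ?S = "paraboloid R"
  have "1 / R * (\<Sum>z\<in>D. (f z)\<^sup>2) \<le> energy D f f" if f: "\<And>z. z \<notin> D \<Longrightarrow> f z = 0" for f
  proof -
    have g0: "z \<notin> D \<Longrightarrow> (f z)\<^sup>2 / ?S z = 0" for z using f by simp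
    have "1 / R * (\<Sum>z\<in>D. (f z)\<^sup>2) \<le> (\<Sum>z\<in>D. (f z)\<^sup>2 / ?S z * lap ?S z)"
      unfolding lap_paraboloid sum_distrib_left
    proof (intro sum_mono)
      fix z assume "z \<in> D"
      have "?S z \<le> R" unfolding paraboloid_def by simp
      then have "1 / R \<le> 1 / ?S z" using R(1)[OF \<open>z \<in> D\<close>] by (intro divide_left_mono) auto
      then show "1 / R * (f z)\<^sup>2 \<le> (f z)\<^sup>2 / ?S z * 1"
        using mult_right_mono[of "1 / R" "1 / ?S z" "(f z)\<^sup>2"] by simp
    qed
    also have "\<dots> = energy D ?S (\<lambda>z. (f z)\<^sup>2 / ?S z)"
      by (rule energy_green[OF assms g0, symmetric])
    also have "\<dots> \<le> energy D f f"
      unfolding energy_def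
    proof (intro divide_right_mono sum_mono)
      fix e assume e: "e \<in> darts D"
      obtain u v where uv: "e = (u, v)" by (cases e)
      have pos: "1 \<le> ?S u" "1 \<le> ?S v"
        using e R(1)[of u] R(1)[of v] R(2)[of u v] R(2)[of v u] nbrs_sym[of u v]
        unfolding uv darts_def adjacent_iff_nbrs by blast+
      have "(f u - f v) * (f u - f v) - (?S u - ?S v) * ((f u)\<^sup>2 / ?S u - (f v)\<^sup>2 / ?S v)
          = (f u * ?S v - f v * ?S u)\<^sup>2 / (?S u * ?S v)"
        using pos by (simp add: field_simps power2_eq_square)
      also have "\<dots> \<ge> 0" using pos by simp
      finally show "(case e of (u, v) \<Rightarrow> (?S u - ?S v) * ((f u)\<^sup>2 / ?S u - (f v)\<^sup>2 / ?S v))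
          \<le> (case e of (u, v) \<Rightarrow> (f u - f v) * (f u - f v))"
        unfolding uv by simp
    qed simp
    finally show ?thesis .
  qed
  then show ?thesis using R(3) by (intro that[of "1 / R"]) auto
qed

text \<open>A multiple of the paraboloid is a supersolution.\<close>

lemma poisson_solution:
  assumes "finite D" "\<And>z. 0 \<le> s z"
  obtains u where "\<And>z. z \<notin> D \<Longrightarrow> u z = 0" "\<And>z. z \<in> D \<Longrightarrow> lap u z = s z" "\<And>z. 0 \<le> u z"
proof -
  obtain R where R: "\<And>z. z \<in> D \<Longrightarrow> 1 \<le> paraboloid R z"
    "\<And>z w. z \<in> D \<Longrightarrow> w \<in> nbrs z \<Longrightarrow> 1 \<le> paraboloid R w" "R \<ge> 1"
    using paraboloid_positive[OF assms(1)] by metis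
  define M where "M = (\<Sum>z\<in>D. s z)"
  have M: "s z \<le> M" if "z \<in> D" for z
    unfolding M_def using that assms by (intro member_le_sum) auto
  have M0: "0 \<le> M" unfolding M_def using assms by (intro sum_nonneg) auto
  define S where "S z = M * max 0 (paraboloid R z)" for z
  have Spos: "0 \<le> S z" for z unfolding S_def using M0 by simp
  have "s z + 1 * lavg S z \<le> S z" if "z \<in> D" for z
  proof -
    have "lavg S z = lavg (\<lambda>z. M * paraboloid R z) z"
      unfolding lavg_def S_def using R(2)[OF that] by (intro arg_cong2[of _ _ _ _ "(/)"] sum.cong) force+
    then have "lavg S z = M * (paraboloid R z - 1)"
      using lap_paraboloid[of R z] unfolding lap_def lavg_cmult by simp
    then show ?thesis using M[OF that] R(1)[OF that] by (simp add: S_def algebra_simps)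
  qed
  then obtain u where u: "\<forall>z. z \<notin> D \<longrightarrow> u z = 0" "\<forall>z\<in>D. u z = s z + 1 * lavg u z"
    "\<forall>z. 0 \<le> u z \<and> u z \<le> S z"
    using dirichlet_solution[of D "\<lambda>_. 0" S s "\<lambda>_. 1"] assms(2) Spos by auto
  show ?thesis
  proof (rule that[of u])
    show "lap u z = s z" if "z \<in> D" for z using u(2) that unfolding lap_def by force
  qed (use u in auto)
qed

text \<open>The probability that the walk from \<open>z\<close> hits \<open>K\<close> before it leaves \<open>D\<close>.\<close>

lemma hitting_potential:
  assumes "K \<subseteq> D"
  obtains k where "\<And>z. z \<in> K \<Longrightarrow> k z = 1" "\<And>z. z \<notin> D \<Longrightarrow> k z = 0"
    "\<And>z. z \<in> D - K \<Longrightarrow> lap k z = 0" "\<And>z. 0 \<le> k z" "\<And>z. k z \<le> 1"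
    "\<And>z. z \<in> K \<Longrightarrow> 0 \<le> lap k z"
proof -
  define b :: "site \<Rightarrow> real" where "b z = (if z \<in> K then 1 else 0)" for z
  have "\<exists>u. (\<forall>z. z \<notin> D - K \<longrightarrow> u z = b z) \<and> (\<forall>z\<in>D - K. u z = 0 + 1 * lavg u z) \<and>
             (\<forall>z. 0 \<le> u z \<and> u z \<le> 1)"
    by (rule dirichlet_solution) (simp_all add: b_def)
  then obtain k where k: "\<forall>z. z \<notin> D - K \<longrightarrow> k z = b z"
    "\<forall>z\<in>D - K. k z = 0 + 1 * lavg k z" "\<forall>z. 0 \<le> k z \<and> k z \<le> 1"
    by blast
  have "lavg k z \<le> 1" for z using lavg_mono[of z k "\<lambda>_. 1"] k(3) by simp
  then show ?thesis
    using k assms by (intro that[of k]) (auto simp: lap_def b_def)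
qed

section \<open>Integration over finitely many coordinates of a lattice field\<close>

abbreviation cfg :: "(site \<Rightarrow> real) measure" where
  "cfg \<equiv> PiM UNIV (\<lambda>_. borel)"

definition glue :: "site set \<Rightarrow> (site \<Rightarrow> real) \<Rightarrow> (site \<Rightarrow> real) \<Rightarrow> site \<Rightarrow> real" where
  "glue U \<psi> \<xi> z = (if z \<in> U then \<psi> z else \<xi> z)"

text \<open>Lebesgue measure in the coordinates in \<open>U\<close>, the others being frozen to the boundary values \<open>\<xi>\<close>.
  Keeping all fields on the whole lattice lets boundary values vary without a change of space.\<close>

definition flat :: "site set \<Rightarrow> (site \<Rightarrow> real) \<Rightarrow> (site \<Rightarrow> real) measure" where
  "flat U \<xi> = distr (PiM U (\<lambda>_. lborel)) cfg (\<lambda>\<psi>. glue U \<psi> \<xi>)"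

interpretation lebesgue_product: product_sigma_finite "\<lambda>_::site. lborel :: real measure"
  by standard

lemma space_cfg [simp]: "space cfg = UNIV"
  by (simp add: space_PiM PiE_UNIV_domain)

lemma measurable_cfgI:
  assumes "\<And>z. (\<lambda>x. f x z) \<in> borel_measurable M"
  shows "f \<in> measurable M cfg"
  by (rule measurable_PiM_single') (use assms in auto)

lemma measurable_site [measurable]: "(\<lambda>\<phi>. \<phi> z) \<in> borel_measurable cfg"
  by (rule measurable_component_singleton) simp

lemma measurable_site_lborel: "z \<in> U \<Longrightarrow> (\<lambda>\<psi>. \<psi> z) \<in> borel_measurable (PiM U (\<lambda>_. lborel))"
  using measurable_component_singleton[of z U "\<lambda>_. lborel :: real measure"] by simp

lemma measurable_glue [measurable]: "(\<lambda>\<psi>. glue U \<psi> \<xi>) \<in> measurable (PiM U (\<lambda>_. lborel)) cfg"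
proof (rule measurable_cfgI)
  fix z show "(\<lambda>\<psi>. glue U \<psi> \<xi> z) \<in> borel_measurable (PiM U (\<lambda>_. lborel))"
    by (cases "z \<in> U") (simp_all add: glue_def measurable_site_lborel)
qed

lemma measurable_glue_pair:
  "(\<lambda>(\<xi>, \<psi>). glue U \<psi> \<xi>) \<in> measurable (cfg \<Otimes>\<^sub>M PiM U (\<lambda>_. lborel)) cfg"
proof (rule measurable_cfgI)
  fix z
  have "(\<lambda>x. snd x z) \<in> borel_measurable (cfg \<Otimes>\<^sub>M PiM U (\<lambda>_. lborel))" if "z \<in> U"
    by (rule measurable_compose[OF measurable_snd measurable_site_lborel[OF that]])
  moreover have "(\<lambda>x. fst x z) \<in> borel_measurable (cfg \<Otimes>\<^sub>M PiM U (\<lambda>_. lborel))"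
    by (rule measurable_compose[OF measurable_fst measurable_site])
  ultimately show "(\<lambda>x. (case x of (\<xi>, \<psi>) \<Rightarrow> glue U \<psi> \<xi>) z)
      \<in> borel_measurable (cfg \<Otimes>\<^sub>M PiM U (\<lambda>_. lborel))"
    by (cases "z \<in> U") (simp_all add: glue_def split_beta)
qed

lemma measurable_upd_pair: "(\<lambda>(\<phi>, s). \<phi>(x := s)) \<in> measurable (cfg \<Otimes>\<^sub>M borel) cfg"
proof (rule measurable_cfgI)
  fix z :: site
  have "(\<lambda>x. fst x z) \<in> borel_measurable (cfg \<Otimes>\<^sub>M (borel :: real measure))"
    by (rule measurable_compose[OF measurable_fst measurable_site])
  then show "(\<lambda>p. (case p of (\<phi>, s) \<Rightarrow> \<phi>(x := s)) z) \<in> borel_measurable (cfg \<Otimes>\<^sub>M borel)"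
    by (cases "z = x") (simp_all add: split_beta)
qed

lemma measurable_upd [measurable]: "(\<lambda>s. \<phi>(x := s)) \<in> measurable borel cfg"
  by (rule measurable_cfgI) (auto simp: fun_upd_apply)

lemma sets_flat [simp, measurable_cong]: "sets (flat U \<xi>) = sets cfg"
  unfolding flat_def by simp

lemma space_flat [simp]: "space (flat U \<xi>) = UNIV"
  unfolding flat_def by simp

lemma nn_integral_flat:
  "F \<in> borel_measurable cfg \<Longrightarrow>
    (\<integral>\<^sup>+\<phi>. F \<phi> \<partial>flat U \<xi>) = (\<integral>\<^sup>+\<psi>. F (glue U \<psi> \<xi>) \<partial>PiM U (\<lambda>_. lborel))"
  unfolding flat_def by (rule nn_integral_distr) simp_all

lemma AE_flat: "AE \<phi> in flat U \<xi>. \<forall>z. z \<notin> U \<longrightarrow> \<phi> z = \<xi> z"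
proof -
  have "{\<phi> \<in> space cfg. \<forall>z. z \<notin> U \<longrightarrow> \<phi> z = \<xi> z} \<in> sets cfg"
    by measurable
  then show ?thesis
    unfolding flat_def by (subst AE_distr_iff) (auto simp: glue_def)
qed

lemma measurable_nn_integral_flat:
  assumes [measurable]: "F \<in> borel_measurable cfg" and "finite U"
  shows "(\<lambda>\<xi>. \<integral>\<^sup>+\<phi>. F \<phi> \<partial>flat U \<xi>) \<in> borel_measurable cfg"
proof -
  interpret s: sigma_finite_measure "PiM U (\<lambda>_::site. lborel :: real measure)"
    by (rule lebesgue_product.sigma_finite[OF assms(2)])
  have "(\<lambda>p. F (case p of (\<xi>, \<psi>) \<Rightarrow> glue U \<psi> \<xi>)) \<in> borel_measurable (cfg \<Otimes>\<^sub>M PiM U (\<lambda>_. lborel))"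
    by (rule measurable_compose[OF measurable_glue_pair assms(1)])
  then have "(\<lambda>\<xi>. \<integral>\<^sup>+\<psi>. F (glue U \<psi> \<xi>) \<partial>PiM U (\<lambda>_. lborel)) \<in> borel_measurable cfg"
    by (intro s.borel_measurable_nn_integral) (simp add: split_beta)
  then show ?thesis by (simp add: nn_integral_flat)
qed

lemma measurable_inner:
  assumes "F \<in> borel_measurable cfg"
  shows "(\<lambda>\<phi>. \<integral>\<^sup>+s. F (\<phi>(x := s)) \<partial>lborel) \<in> borel_measurable cfg"
proof -
  have "(\<lambda>p. F (case p of (\<phi>, s) \<Rightarrow> \<phi>(x := s))) \<in> borel_measurable (cfg \<Otimes>\<^sub>M borel)"
    by (rule measurable_compose[OF measurable_upd_pair assms])
  then show ?thesis
    by (intro lborel.borel_measurable_nn_integral) (simp add: split_beta measurable_pair_measure_countable1 cong: measurable_cong_sets)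
qed

lemma glue_insert:
  "x \<notin> U \<Longrightarrow> glue (insert x U) (\<psi>(x := s)) \<xi> = glue U \<psi> (\<xi>(x := s))"
  "x \<notin> U \<Longrightarrow> glue (insert x U) (\<psi>(x := s)) \<xi> = (glue U \<psi> \<xi>)(x := s)"
  by (auto simp: glue_def fun_eq_iff)

lemma flat_empty:
  assumes "F \<in> borel_measurable cfg"
  shows "(\<integral>\<^sup>+\<phi>. F \<phi> \<partial>flat {} \<xi>) = F \<xi>"
proof -
  have "glue {} \<psi> \<xi> = \<xi>" for \<psi> by (simp add: glue_def fun_eq_iff)
  then show ?thesis
    using assms by (simp add: nn_integral_flat PiM_empty nn_integral_count_space_finite)
qed

lemma flat_insert:
  assumes "finite U" "x \<notin> U" "F \<in> borel_measurable cfg"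
  shows "(\<integral>\<^sup>+\<phi>. F \<phi> \<partial>flat (insert x U) \<xi>) = (\<integral>\<^sup>+s. \<integral>\<^sup>+\<phi>. F \<phi> \<partial>flat U (\<xi>(x := s)) \<partial>lborel)"
    and "(\<integral>\<^sup>+\<phi>. F \<phi> \<partial>flat (insert x U) \<xi>) = (\<integral>\<^sup>+\<phi>. \<integral>\<^sup>+s. F (\<phi>(x := s)) \<partial>lborel \<partial>flat U \<xi>)"
proof -
  have m: "(\<lambda>\<psi>. F (glue (insert x U) \<psi> \<xi>)) \<in> borel_measurable (PiM (insert x U) (\<lambda>_. lborel))"
    by (rule measurable_compose[OF measurable_glue assms(3)])
  show "(\<integral>\<^sup>+\<phi>. F \<phi> \<partial>flat (insert x U) \<xi>) = (\<integral>\<^sup>+s. \<integral>\<^sup>+\<phi>. F \<phi> \<partial>flat U (\<xi>(x := s)) \<partial>lborel)"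
    by (simp add: nn_integral_flat assms(3) glue_insert[OF assms(2)]
        lebesgue_product.product_nn_integral_insert_rev[OF assms(1,2) m] del: fun_upd_apply)
  show "(\<integral>\<^sup>+\<phi>. F \<phi> \<partial>flat (insert x U) \<xi>) = (\<integral>\<^sup>+\<phi>. \<integral>\<^sup>+s. F (\<phi>(x := s)) \<partial>lborel \<partial>flat U \<xi>)"
    using glue_insert(2)[OF assms(2)]
    by (simp add: nn_integral_flat assms(3) measurable_inner
        lebesgue_product.product_nn_integral_insert[OF assms(1,2) m] del: fun_upd_apply)
qed

lemma flat_union:
  assumes "finite K" "finite U" "K \<inter> U = {}" "F \<in> borel_measurable cfg"
  shows "(\<integral>\<^sup>+\<phi>. F \<phi> \<partial>flat (K \<union> U) \<xi>) = (\<integral>\<^sup>+\<eta>. \<integral>\<^sup>+\<phi>. F \<phi> \<partial>flat U \<eta> \<partial>flat K \<xi>)"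
  using assms(1,3)
proof (induction K arbitrary: \<xi> rule: finite_induct)
  case empty
  then show ?case using assms by (simp add: flat_empty measurable_nn_integral_flat)
next
  case (insert x K)
  then show ?case
    using assms(2,4) by (simp add: flat_insert(1) measurable_nn_integral_flat del: fun_upd_apply)
qed

lemma flat_shift:
  assumes "finite U" "F \<in> borel_measurable cfg"
  shows "(\<integral>\<^sup>+\<phi>. F (\<lambda>z. \<phi> z + f z) \<partial>flat U \<xi>) = (\<integral>\<^sup>+\<phi>. F \<phi> \<partial>flat U (\<lambda>z. \<xi> z + f z))"
  using assms(1)
proof (induction U arbitrary: \<xi> rule: finite_induct)
  have "(\<lambda>\<phi> z. \<phi> z + f z) \<in> measurable cfg cfg"
    by (rule measurable_cfgI) measurable
  then have m: "(\<lambda>\<phi>. F (\<lambda>z. \<phi> z + f z)) \<in> borel_measurable cfg"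
    using assms(2) by (rule measurable_compose)
  {
    case empty
    then show ?case using assms m by (simp add: flat_empty)
  next
    case (insert x U)
    have "(\<integral>\<^sup>+\<phi>. F (\<lambda>z. \<phi> z + f z) \<partial>flat (insert x U) \<xi>) =
        (\<integral>\<^sup>+s. \<integral>\<^sup>+\<phi>. F \<phi> \<partial>flat U (\<lambda>z. (\<xi>(x := s)) z + f z) \<partial>lborel)"
      unfolding flat_insert(1)[OF insert(1,2) m] insert(3) ..
    also have "\<dots> = (\<integral>\<^sup>+s. \<integral>\<^sup>+\<phi>. F \<phi> \<partial>flat U ((\<lambda>z. \<xi> z + f z)(x := f x + 1 * s)) \<partial>lborel)"
      by (intro nn_integral_cong arg_cong[of _ _ "\<lambda>\<xi>. \<integral>\<^sup>+\<phi>. F \<phi> \<partial>flat U \<xi>"]) (auto simp: fun_eq_iff)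
    also have "\<dots> = (\<integral>\<^sup>+s. \<integral>\<^sup>+\<phi>. F \<phi> \<partial>flat U ((\<lambda>z. \<xi> z + f z)(x := s)) \<partial>lborel)"
      by (subst nn_integral_real_affine[where c = 1 and t = "f x"])
         (use measurable_compose[OF measurable_upd measurable_nn_integral_flat[OF assms(2) insert(1)]]
          in \<open>simp_all del: fun_upd_apply\<close>)
    finally show ?case using insert assms by (simp add: flat_insert(1) del: fun_upd_apply)
  }
qed

lemma flat_uminus:
  assumes "finite U" "F \<in> borel_measurable cfg"
  shows "(\<integral>\<^sup>+\<phi>. F (\<lambda>z. - \<phi> z) \<partial>flat U \<xi>) = (\<integral>\<^sup>+\<phi>. F \<phi> \<partial>flat U (\<lambda>z. - \<xi> z))"
  using assms(1)
proof (induction U arbitrary: \<xi> rule: finite_induct)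
  have "(\<lambda>\<phi> z. - \<phi> z) \<in> measurable cfg cfg"
    by (rule measurable_cfgI) measurable
  then have m: "(\<lambda>\<phi>. F (\<lambda>z. - \<phi> z)) \<in> borel_measurable cfg"
    using assms(2) by (rule measurable_compose)
  {
    case empty
    then show ?case using assms m by (simp add: flat_empty)
  next
    case (insert x U)
    have "(\<integral>\<^sup>+\<phi>. F (\<lambda>z. - \<phi> z) \<partial>flat (insert x U) \<xi>) =
        (\<integral>\<^sup>+s. \<integral>\<^sup>+\<phi>. F \<phi> \<partial>flat U (\<lambda>z. - (\<xi>(x := s)) z) \<partial>lborel)"
      unfolding flat_insert(1)[OF insert(1,2) m] insert(3) ..
    also have "\<dots> = (\<integral>\<^sup>+s. \<integral>\<^sup>+\<phi>. F \<phi> \<partial>flat U ((\<lambda>z. - \<xi> z)(x := 0 + (-1) * s)) \<partial>lborel)"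
      by (intro nn_integral_cong arg_cong[of _ _ "\<lambda>\<xi>. \<integral>\<^sup>+\<phi>. F \<phi> \<partial>flat U \<xi>"]) (auto simp: fun_eq_iff)
    also have "\<dots> = (\<integral>\<^sup>+s. \<integral>\<^sup>+\<phi>. F \<phi> \<partial>flat U ((\<lambda>z. - \<xi> z)(x := s)) \<partial>lborel)"
      by (subst nn_integral_real_affine[where c = "-1" and t = 0])
         (use measurable_compose[OF measurable_upd measurable_nn_integral_flat[OF assms(2) insert(1)]]
          in \<open>simp_all del: fun_upd_apply\<close>)
    finally show ?case using insert assms by (simp add: flat_insert(1) del: fun_upd_apply)
  }
qed

lemma flat_reindex:
  assumes "finite U" "inj \<sigma>" "F \<in> borel_measurable cfg"
  shows "(\<integral>\<^sup>+\<phi>. F (\<lambda>z. \<phi> (\<sigma> z)) \<partial>flat (\<sigma> ` U) \<xi>) = (\<integral>\<^sup>+\<phi>. F \<phi> \<partial>flat U (\<lambda>z. \<xi> (\<sigma> z)))"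
  using assms(1)
proof (induction U arbitrary: \<xi> rule: finite_induct)
  have "(\<lambda>\<phi> z. \<phi> (\<sigma> z)) \<in> measurable cfg cfg"
    by (rule measurable_cfgI) measurable
  then have m: "(\<lambda>\<phi>. F (\<lambda>z. \<phi> (\<sigma> z))) \<in> borel_measurable cfg"
    using assms(3) by (rule measurable_compose)
  {
    case empty
    then show ?case using assms m by (simp add: flat_empty)
  next
    case (insert x U)
    have notin: "\<sigma> x \<notin> \<sigma> ` U" "finite (\<sigma> ` U)" using insert by (auto simp: inj_image_mem_iff[OF assms(2)])
    have "(\<integral>\<^sup>+\<phi>. F (\<lambda>z. \<phi> (\<sigma> z)) \<partial>flat (\<sigma> ` insert x U) \<xi>) =
        (\<integral>\<^sup>+s. \<integral>\<^sup>+\<phi>. F \<phi> \<partial>flat U (\<lambda>z. (\<xi>(\<sigma> x := s)) (\<sigma> z)) \<partial>lborel)"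
      unfolding image_insert flat_insert(1)[OF notin(2,1) m] insert(3) ..
    also have "\<dots> = (\<integral>\<^sup>+s. \<integral>\<^sup>+\<phi>. F \<phi> \<partial>flat U ((\<lambda>z. \<xi> (\<sigma> z))(x := s)) \<partial>lborel)"
    proof -
      have "(\<lambda>z. (\<xi>(\<sigma> x := s)) (\<sigma> z)) = (\<lambda>z. \<xi> (\<sigma> z))(x := s)" for s
        by (rule ext) (simp add: inj_eq[OF assms(2)])
      then show ?thesis by presburger
    qed
    finally show ?case using insert assms by (simp add: flat_insert(1) del: fun_upd_apply)
  }
qed

section \<open>The four functions theorem\<close>

text \<open>Because \<open>(A - p) * (A - q) \<ge> 0\<close>.\<close>

lemma four_numbers:
  fixes p q A B :: ennreal
  assumes "p \<le> A" "q \<le> A" "p * q \<le> A * B"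
  shows "p + q \<le> A + B"
proof (cases "A = top \<or> B = top")
  case True then show ?thesis by auto
next
  case False
  define p' q' A' B' where "p' = enn2real p" "q' = enn2real q" "A' = enn2real A" "B' = enn2real B"
  have "p < top" "q < top" "A < top" "B < top"
    using False le_less_trans[OF assms(1)] le_less_trans[OF assms(2)] by (simp_all add: less_top)
  then have fin: "p = ennreal p'" "q = ennreal q'" "A = ennreal A'" "B = ennreal B'"
    unfolding p'_q'_A'_B'_def by simp_all
  have nn: "0 \<le> p'" "0 \<le> q'" "0 \<le> A'" "0 \<le> B'" unfolding p'_q'_A'_B'_def by auto
  have i: "p' \<le> A'" "q' \<le> A'" "p' * q' \<le> A' * B'"
    using assms nn unfolding fin by (simp_all add: ennreal_mult[symmetric])
  have "p' + q' \<le> A' + B'"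
  proof (cases "A' = 0")
    case True then show ?thesis using i nn by simp
  next
    case False
    have "0 \<le> (A' - p') * (A' - q')" using i by simp
    then have "A' * (p' + q') \<le> A' * (A' + B')" using i(3) by (simp add: algebra_simps)
    then show ?thesis using False nn by simp
  qed
  then show ?thesis unfolding fin using nn by (simp add: ennreal_plus[symmetric] del: ennreal_plus)
qed

text \<open>Both sides are integrals over pairs; symmetrised over the order of the two entries, the integrands
  compare pointwise.\<close>

lemma four_functions_line:
  fixes f1 f2 f3 f4 :: "real \<Rightarrow> ennreal"
  assumes [measurable]: "f1 \<in> borel_measurable borel" "f2 \<in> borel_measurable borel"
    "f3 \<in> borel_measurable borel" "f4 \<in> borel_measurable borel"
    and lat: "\<And>x y. f1 x * f2 y \<le> f3 (max x y) * f4 (min x y)"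
  shows "(\<integral>\<^sup>+x. f1 x \<partial>lborel) * (\<integral>\<^sup>+x. f2 x \<partial>lborel) \<le> (\<integral>\<^sup>+x. f3 x \<partial>lborel) * (\<integral>\<^sup>+x. f4 x \<partial>lborel)"
proof -
  have sym: "(\<integral>\<^sup>+x. \<integral>\<^sup>+y. (f x * g y + f y * g x) \<partial>lborel \<partial>lborel) =
      2 * ((\<integral>\<^sup>+x. f x \<partial>lborel) * (\<integral>\<^sup>+x. g x \<partial>lborel))"
    if [measurable]: "f \<in> borel_measurable borel" "g \<in> borel_measurable borel"
    for f g :: "real \<Rightarrow> ennreal"
    by (simp add: nn_integral_add nn_integral_cmult nn_integral_multc mult.commute mult_2)
  have pt: "f1 x * f2 y + f1 y * f2 x \<le> f3 x * f4 y + f3 y * f4 x" if "x \<le> y" for x y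
  proof -
    have "f1 x * f2 y * (f1 y * f2 x) = (f1 x * f2 x) * (f1 y * f2 y)" by (simp add: ac_simps)
    also have "\<dots> \<le> (f3 x * f4 x) * (f3 y * f4 y)"
      using lat[of x x] lat[of y y]
      by (intro mult_mono[of "f1 x * f2 x" "f3 x * f4 x" "f1 y * f2 y" "f3 y * f4 y"]) simp_all
    finally have "f1 x * f2 y + f1 y * f2 x \<le> f3 y * f4 x + f3 x * f4 y"
      using lat[of x y] lat[of y x] that by (intro four_numbers) (simp_all add: ac_simps max_def min_def split: if_splits)
    then show ?thesis by (simp add: ac_simps)
  qed
  have "(\<integral>\<^sup>+x. \<integral>\<^sup>+y. (f1 x * f2 y + f1 y * f2 x) \<partial>lborel \<partial>lborel) \<le>
      (\<integral>\<^sup>+x. \<integral>\<^sup>+y. (f3 x * f4 y + f3 y * f4 x) \<partial>lborel \<partial>lborel)"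
  proof (intro nn_integral_mono)
    fix x y show "f1 x * f2 y + f1 y * f2 x \<le> f3 x * f4 y + f3 y * f4 x"
      using pt[of x y] pt[of y x] by (cases "x \<le> y") (auto simp: ac_simps)
  qed
  then have "2 * ((\<integral>\<^sup>+x. f1 x \<partial>lborel) * (\<integral>\<^sup>+x. f2 x \<partial>lborel)) \<le> 2 * ((\<integral>\<^sup>+x. f3 x \<partial>lborel) * (\<integral>\<^sup>+x. f4 x \<partial>lborel))"
    by (simp add: sym)
  then show ?thesis by (simp add: ennreal_mult_le_mult_iff)
qed

text \<open>By Fubini and induction, the inner integrals inherit the lattice condition; the boundary values are
  treated as further coordinates, which yields monotonicity in them.\<close>

lemma four_functions:
  assumes "finite U" and m: "F1 \<in> borel_measurable cfg" "F2 \<in> borel_measurable cfg"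
    "F3 \<in> borel_measurable cfg" "F4 \<in> borel_measurable cfg"
    and lat: "\<And>a b. F1 a * F2 b \<le> F3 (\<lambda>z. max (a z) (b z)) * F4 (\<lambda>z. min (a z) (b z) :: real)"
  shows "(\<integral>\<^sup>+\<phi>. F1 \<phi> \<partial>flat U \<xi>) * (\<integral>\<^sup>+\<phi>. F2 \<phi> \<partial>flat U \<zeta>) \<le>
    (\<integral>\<^sup>+\<phi>. F3 \<phi> \<partial>flat U (\<lambda>z. max (\<xi> z) (\<zeta> z))) * (\<integral>\<^sup>+\<phi>. F4 \<phi> \<partial>flat U (\<lambda>z. min (\<xi> z) (\<zeta> z)))"
  using assms(1)
proof (induction U arbitrary: \<xi> \<zeta> rule: finite_induct)
  case empty
  then show ?case using m lat by (simp add: flat_empty)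
next
  case (insert x U)
  have mm: "(\<lambda>s. \<integral>\<^sup>+\<phi>. F \<phi> \<partial>flat U (\<xi>(x := s))) \<in> borel_measurable borel"
    if "F \<in> borel_measurable cfg" for F \<xi>
    by (rule measurable_compose[OF measurable_upd measurable_nn_integral_flat[OF that insert(1)]])
  have upd: "(\<lambda>z. max ((\<xi>(x := s)) z) ((\<zeta>(x := r)) z)) = (\<lambda>z. max (\<xi> z) (\<zeta> z))(x := max s r)"
    "(\<lambda>z. min ((\<xi>(x := s)) z) ((\<zeta>(x := r)) z)) = (\<lambda>z. min (\<xi> z) (\<zeta> z))(x := min s r)" for s r
    by (auto simp: fun_eq_iff)
  show ?case
    unfolding flat_insert(1)[OF insert(1,2) m(1)] flat_insert(1)[OF insert(1,2) m(2)]
      flat_insert(1)[OF insert(1,2) m(3)] flat_insert(1)[OF insert(1,2) m(4)]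
  proof (rule four_functions_line)
    fix s r
    show "(\<integral>\<^sup>+\<phi>. F1 \<phi> \<partial>flat U (\<xi>(x := s))) * (\<integral>\<^sup>+\<phi>. F2 \<phi> \<partial>flat U (\<zeta>(x := r))) \<le>
      (\<integral>\<^sup>+\<phi>. F3 \<phi> \<partial>flat U ((\<lambda>z. max (\<xi> z) (\<zeta> z))(x := max s r))) *
      (\<integral>\<^sup>+\<phi>. F4 \<phi> \<partial>flat U ((\<lambda>z. min (\<xi> z) (\<zeta> z))(x := min s r)))"
      using insert(3)[of "\<xi>(x := s)" "\<zeta>(x := r)"] unfolding upd .
  qed (auto intro!: mm m simp del: fun_upd_apply)
qed

section \<open>Gaussian weights\<close>

definition gw :: "site set \<Rightarrow> (site \<Rightarrow> real) \<Rightarrow> real" where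
  "gw D \<phi> = exp (- energy D \<phi> \<phi> / 2)"

lemma measurable_energy [measurable]: "(\<lambda>\<phi>. energy D f \<phi>) \<in> borel_measurable cfg"
  "(\<lambda>\<phi>. energy D \<phi> \<phi>) \<in> borel_measurable cfg"
  unfolding energy_def split_beta by measurable

lemma measurable_gw [measurable]: "gw D \<in> borel_measurable cfg"
  unfolding gw_def[abs_def] by measurable

lemma measurable_lavg [measurable]: "(\<lambda>\<phi>. lavg \<phi> z) \<in> borel_measurable cfg"
  unfolding lavg_def by measurable

lemma gw_pos: "0 < gw D \<phi>" and gw_nonneg [simp]: "0 \<le> gw D \<phi>"
  unfolding gw_def by simp_all

lemma flat_cong:
  assumes "\<And>z. z \<notin> U \<Longrightarrow> \<xi> z = \<zeta> z"
  shows "flat U \<xi> = flat U \<zeta>"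
proof -
  have "glue U \<psi> \<xi> = glue U \<psi> \<zeta>" for \<psi> using assms by (simp add: glue_def fun_eq_iff)
  then show ?thesis unfolding flat_def by simp
qed

lemma nn_integral_flat_mono:
  assumes "\<And>\<phi>. (\<And>z. z \<notin> U \<Longrightarrow> \<phi> z = \<xi> z) \<Longrightarrow> F \<phi> \<le> G \<phi>"
  shows "(\<integral>\<^sup>+\<phi>. F \<phi> \<partial>flat U \<xi>) \<le> (\<integral>\<^sup>+\<phi>. G \<phi> \<partial>flat U \<xi>)"
  by (rule nn_integral_mono_AE) (rule AE_mp[OF AE_flat], use assms in auto)

lemma nn_integral_flat_cong:
  assumes "\<And>\<phi>. (\<And>z. z \<notin> U \<Longrightarrow> \<phi> z = \<xi> z) \<Longrightarrow> F \<phi> = G \<phi>"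
  shows "(\<integral>\<^sup>+\<phi>. F \<phi> \<partial>flat U \<xi>) = (\<integral>\<^sup>+\<phi>. G \<phi> \<partial>flat U \<xi>)"
  by (rule nn_integral_cong_AE) (rule AE_mp[OF AE_flat], use assms in auto)

lemma integrable_gauss_exp:
  assumes "d > 0" shows "integrable lborel (\<lambda>s. exp (c * s - d * s\<^sup>2) :: real)"
proof -
  define \<sigma> where "\<sigma> = 1 / sqrt (2 * d)"
  have s: "\<sigma> > 0" "\<sigma>\<^sup>2 = 1 / (2 * d)" unfolding \<sigma>_def using assms by (simp_all add: power_divide)
  have "integrable lborel (\<lambda>s. (exp (c\<^sup>2 / (4 * d)) * sqrt (2 * pi * \<sigma>\<^sup>2)) * normal_density (c / (2 * d)) \<sigma> s)"
    using s by (intro integrable_mult_right integrable_normal_density) auto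
  also have "(\<lambda>s. (exp (c\<^sup>2 / (4 * d)) * sqrt (2 * pi * \<sigma>\<^sup>2)) * normal_density (c / (2 * d)) \<sigma> s)
     = (\<lambda>s. exp (c * s - d * s\<^sup>2))"
  proof
    fix s' :: real
    have "sqrt (2 * pi * \<sigma>\<^sup>2) > 0" using s(1) by (simp add: zero_less_mult_iff)
    moreover have "c\<^sup>2 / (4 * d) + - (s' - c / (2 * d))\<^sup>2 / (2 * \<sigma>\<^sup>2) = c * s' - d * s'\<^sup>2"
      unfolding s(2) using assms by (simp add: field_simps power2_eq_square)
    moreover have "\<sigma> \<noteq> 0" using s(1) by simp
    ultimately show "(exp (c\<^sup>2 / (4 * d)) * sqrt (2 * pi * \<sigma>\<^sup>2)) * normal_density (c / (2 * d)) \<sigma> s'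
       = exp (c * s' - d * s'\<^sup>2)"
      unfolding normal_density_def by (simp add: exp_add[symmetric] del: real_sqrt_mult)
  qed
  finally show ?thesis .
qed

lemma integrable_gauss_exp_abs:
  assumes "d > 0" shows "integrable lborel (\<lambda>s. exp (c * \<bar>s\<bar> - d * s\<^sup>2) :: real)"
proof (rule Bochner_Integration.integrable_bound)
  show "integrable lborel (\<lambda>s. exp (c * s - d * s\<^sup>2) + exp ((-c) * s - d * s\<^sup>2) :: real)"
    by (intro Bochner_Integration.integrable_add integrable_gauss_exp assms)
  show "AE s in lborel. norm (exp (c * \<bar>s\<bar> - d * s\<^sup>2)) \<le> norm (exp (c * s - d * s\<^sup>2) + exp ((-c) * s - d * s\<^sup>2))"
  proof (intro AE_I2)
    fix s :: real
    have "norm (exp (c * s - d * s\<^sup>2) + exp ((-c) * s - d * s\<^sup>2)) = exp (c * s - d * s\<^sup>2) + exp ((-c) * s - d * s\<^sup>2)"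
      using exp_gt_zero[of "c * s - d * s\<^sup>2"] exp_gt_zero[of "(-c) * s - d * s\<^sup>2"]
      unfolding real_norm_def by linarith
    then show "norm (exp (c * \<bar>s\<bar> - d * s\<^sup>2)) \<le> norm (exp (c * s - d * s\<^sup>2) + exp ((-c) * s - d * s\<^sup>2))"
      using exp_gt_zero[of "c * s - d * s\<^sup>2"] exp_gt_zero[of "(-c) * s - d * s\<^sup>2"]
      by (cases "s \<ge> 0") simp_all
  qed
qed simp

lemma energy_glue_lower:
  assumes "finite D" "U \<subseteq> D"
  obtains \<delta> B where "\<delta> > 0"
    "\<And>\<phi>. (\<And>z. z \<notin> U \<Longrightarrow> \<phi> z = \<xi> z) \<Longrightarrow> \<delta> * (\<Sum>z\<in>U. (\<phi> z)\<^sup>2) - B \<le> energy D \<phi> \<phi>"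
proof -
  obtain \<epsilon> where \<epsilon>: "\<epsilon> > 0"
    "\<And>f. (\<And>z. z \<notin> D \<Longrightarrow> f z = 0) \<Longrightarrow> \<epsilon> * (\<Sum>z\<in>D. (f z)\<^sup>2) \<le> energy D f f"
    using poincare[OF assms(1)] by metis
  define b where "b z = (if z \<in> U then 0 else \<xi> z)" for z
  have "\<epsilon> / 2 * (\<Sum>z\<in>U. (\<phi> z)\<^sup>2) - energy D b b \<le> energy D \<phi> \<phi>"
    if \<phi>: "\<And>z. z \<notin> U \<Longrightarrow> \<phi> z = \<xi> z" for \<phi>
  proof -
    let ?a = "\<lambda>z. \<phi> z + (-1) * b z"
    have a: "?a z = (if z \<in> U then \<phi> z else 0)" for z using \<phi> by (simp add: b_def)
    have "(\<Sum>z\<in>U. (\<phi> z)\<^sup>2) = (\<Sum>z\<in>D. (?a z)\<^sup>2)"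
      unfolding a using assms by (intro sum.mono_neutral_cong_left) auto
    then have "\<epsilon> * (\<Sum>z\<in>U. (\<phi> z)\<^sup>2) \<le> energy D ?a ?a"
      using \<epsilon>(2)[of ?a] a assms(2) by fastforce
    also have "\<dots> \<le> 2 * energy D \<phi> \<phi> + 2 * energy D b b"
      using energy_square_add[of D \<phi> "-1" b] energy_square_add[of D \<phi> 1 b]
        energy_nonneg[of D "\<lambda>z. \<phi> z + 1 * b z"] by simp
    finally show ?thesis by simp
  qed
  then show ?thesis using \<epsilon>(1) by (intro that[of "\<epsilon> / 2" "energy D b b"]) auto
qed

text \<open>The spectral gap makes the Gaussian weight beat any exponential of the coordinates.\<close>

lemma integrable_flat:
  assumes "finite D" "U \<subseteq> D" and m [measurable]: "F \<in> borel_measurable cfg"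
    and bound: "\<And>\<phi>. (\<And>z. z \<notin> U \<Longrightarrow> \<phi> z = \<xi> z) \<Longrightarrow> \<bar>F \<phi>\<bar> \<le> A * exp (c * (\<Sum>z\<in>U. \<bar>\<phi> z\<bar>)) * gw D \<phi>"
    and "0 \<le> A"
  shows "integrable (flat U \<xi>) (F :: _ \<Rightarrow> real)"
proof -
  have fU: "finite U" using assms finite_subset by auto
  obtain \<delta> B where \<delta>: "\<delta> > 0"
    "\<And>\<phi>. (\<And>z. z \<notin> U \<Longrightarrow> \<phi> z = \<xi> z) \<Longrightarrow> \<delta> * (\<Sum>z\<in>U. (\<phi> z)\<^sup>2) - B \<le> energy D \<phi> \<phi>"
    using energy_glue_lower[OF assms(1,2), of \<xi>] by metis
  let ?g = "\<lambda>\<psi>. A * exp (B / 2) * (\<Prod>z\<in>U. exp (c * \<bar>\<psi> z\<bar> - \<delta> / 2 * (\<psi> z)\<^sup>2))"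
  have "integrable (PiM U (\<lambda>_. lborel)) (\<lambda>\<psi>. F (glue U \<psi> \<xi>))"
  proof (rule Bochner_Integration.integrable_bound)
    show "integrable (PiM U (\<lambda>_. lborel)) ?g"
      using \<delta>(1)
      by (intro integrable_mult_right lebesgue_product.product_integrable_prod fU integrable_gauss_exp_abs) auto
    show "(\<lambda>\<psi>. F (glue U \<psi> \<xi>)) \<in> borel_measurable (PiM U (\<lambda>_. lborel))"
      by (rule measurable_compose[OF measurable_glue m])
    show "AE \<psi> in PiM U (\<lambda>_. lborel). norm (F (glue U \<psi> \<xi>)) \<le> norm (?g \<psi>)"
    proof (rule AE_I2)
      fix \<psi> :: "site \<Rightarrow> real"
      let ?\<phi> = "glue U \<psi> \<xi>"
      have \<phi>: "z \<notin> U \<Longrightarrow> ?\<phi> z = \<xi> z" for z by (simp add: glue_def)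
      have "gw D ?\<phi> \<le> exp (B / 2 - \<delta> / 2 * (\<Sum>z\<in>U. (?\<phi> z)\<^sup>2))"
        using \<delta>(2)[of ?\<phi>, OF \<phi>] unfolding gw_def by simp
      then have "A * exp (c * (\<Sum>z\<in>U. \<bar>?\<phi> z\<bar>)) * gw D ?\<phi> \<le>
          A * exp (c * (\<Sum>z\<in>U. \<bar>?\<phi> z\<bar>)) * exp (B / 2 - \<delta> / 2 * (\<Sum>z\<in>U. (?\<phi> z)\<^sup>2))"
        using \<open>0 \<le> A\<close> by (intro mult_left_mono) auto
      also have "\<dots> = A * exp (B / 2) * exp (\<Sum>z\<in>U. c * \<bar>?\<phi> z\<bar> - \<delta> / 2 * (?\<phi> z)\<^sup>2)"
        unfolding sum_subtractf sum_distrib_left[symmetric] by (simp add: mult.assoc exp_add[symmetric])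
      also have "\<dots> = ?g \<psi>"
        using fU by (simp add: exp_sum glue_def)
      finally show "norm (F ?\<phi>) \<le> norm (?g \<psi>)"
        using bound[of ?\<phi>, OF \<phi>] by simp
    qed
  qed
  then show ?thesis
    unfolding flat_def by (subst integrable_distr_eq) simp_all
qed

lemma integral_flat_insert:
  fixes F :: "(site \<Rightarrow> real) \<Rightarrow> real"
  assumes "finite U" "x \<notin> U" "integrable (flat (insert x U) \<xi>) F"
  shows "(\<integral>\<phi>. F \<phi> \<partial>flat (insert x U) \<xi>) = (\<integral>\<phi>. (\<integral>s. F (\<phi>(x := s)) \<partial>lborel) \<partial>flat U \<xi>)"
    (is "_ = integral\<^sup>L _ ?I")
proof -
  have m: "F \<in> borel_measurable cfg"
    using borel_measurable_integrable[OF assms(3)] by (simp cong: measurable_cong_sets)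
  have mp: "(\<lambda>p. F (case p of (\<phi>, s) \<Rightarrow> \<phi>(x := s))) \<in> borel_measurable (cfg \<Otimes>\<^sub>M lborel)"
    using measurable_compose[OF measurable_upd_pair m]
    by (simp cong: measurable_cong_sets)
  have "(\<lambda>\<phi>. \<integral>s. (\<lambda>\<phi> s. F (\<phi>(x := s))) \<phi> s \<partial>lborel) \<in> borel_measurable cfg"
    using lborel.borel_measurable_lebesgue_integral[of "\<lambda>\<phi> s. F (\<phi>(x := s))" cfg] mp
    by (simp add: split_beta)
  then have mI: "?I \<in> borel_measurable cfg" by (simp only:)
  have i: "integrable (PiM (insert x U) (\<lambda>_. lborel)) (\<lambda>\<psi>. F (glue (insert x U) \<psi> \<xi>))"
    using assms(3) m unfolding flat_def by (subst (asm) integrable_distr_eq) simp_all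
  have "(\<integral>\<phi>. F \<phi> \<partial>flat (insert x U) \<xi>) =
      (\<integral>\<psi>. F (glue (insert x U) \<psi> \<xi>) \<partial>PiM (insert x U) (\<lambda>_. lborel))"
    using m unfolding flat_def by (intro integral_distr) simp_all
  also have "\<dots> = (\<integral>\<psi>. ?I (glue U \<psi> \<xi>) \<partial>PiM U (\<lambda>_. lborel))"
    by (simp add: lebesgue_product.product_integral_insert[OF assms(1,2) i] glue_insert(2)[OF assms(2)]
        del: fun_upd_apply)
  also have "\<dots> = integral\<^sup>L (flat U \<xi>) ?I"
    using mI unfolding flat_def by (intro integral_distr[symmetric]) simp_all
  finally show ?thesis .
qed

lemma integral_flat_nonneg:
  fixes F :: "(site \<Rightarrow> real) \<Rightarrow> real"
  assumes "finite U" "x \<in> U" "integrable (flat U \<xi>) F" "\<And>\<phi>. 0 \<le> (\<integral>s. F (\<phi>(x := s)) \<partial>lborel)"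
  shows "0 \<le> (\<integral>\<phi>. F \<phi> \<partial>flat U \<xi>)"
proof -
  have U: "U = insert x (U - {x})" using assms(2) by auto
  have int: "integrable (flat (insert x (U - {x})) \<xi>) F" using assms(3) U by simp
  have "(\<integral>\<phi>. F \<phi> \<partial>flat (insert x (U - {x})) \<xi>) = (\<integral>\<phi>. (\<integral>s. F (\<phi>(x := s)) \<partial>lborel) \<partial>flat (U - {x}) \<xi>)"
    using assms(1) by (intro integral_flat_insert int) auto
  also have "\<dots> \<ge> 0" by (intro integral_nonneg_AE AE_I2 assms(4))
  finally show ?thesis using U by simp
qed

lemma energy_upd:
  assumes "finite D" "z \<in> D"
  shows "energy D (\<phi>(z := s)) (\<phi>(z := s)) =
    (s - lavg \<phi> z)\<^sup>2 + energy D (\<phi>(z := lavg \<phi> z)) (\<phi>(z := lavg \<phi> z))"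
proof -
  let ?d = "\<lambda>w. if w = z then 1 else 0 :: real"
  let ?f = "\<phi>(z := lavg \<phi> z)"
  have sp: "\<phi>(z := s) = (\<lambda>w. ?f w + (s - lavg \<phi> z) * ?d w)" by (auto simp: fun_eq_iff)
  have la: "lavg (\<lambda>w. if w = z then a else g w) z = lavg g z" for a g
    unfolding lavg_def by (intro arg_cong2[of _ _ _ _ "(/)"] sum.cong) auto
  have e: "energy D g ?d = lap g z" for g
    using assms by (subst energy_green[OF assms(1)]) (auto simp: if_distrib[of "\<lambda>x. x * _"] sum.delta cong: if_cong)
  have "lap ?f z = 0" using la[of "lavg \<phi> z" \<phi>] by (simp add: lap_def fun_upd_def)
  moreover have "lap ?d z = 1" using la[of 1 "\<lambda>_. 0"] by (simp add: lap_def)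
  ultimately have "energy D (\<lambda>w. ?f w + (s - lavg \<phi> z) * ?d w) (\<lambda>w. ?f w + (s - lavg \<phi> z) * ?d w) =
      (s - lavg \<phi> z)\<^sup>2 + energy D ?f ?f"
    using energy_square_add[of D ?f "s - lavg \<phi> z" ?d] e[of ?f] e[of ?d] energy_sym[of D ?d ?f]
    by (simp del: fun_upd_apply)
  then show ?thesis using sp by (simp only:)
qed

lemma gw_upd:
  assumes "finite D" "z \<in> D"
  shows "gw D (\<phi>(z := s)) = exp (- (s - lavg \<phi> z)\<^sup>2 / 2) * gw D (\<phi>(z := lavg \<phi> z))"
  unfolding gw_def energy_upd[OF assms, of \<phi> s]
  by (simp add: exp_add[symmetric] add_divide_distrib)

text \<open>Completing the square: tilting by \<open>exp (energy D f \<phi>)\<close> amounts to a translation by \<open>f\<close>.\<close>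

lemma gauss_tilt:
  assumes "finite D" "finite U" and f: "\<And>z. z \<notin> U \<Longrightarrow> f z = 0"
  shows "(\<integral>\<^sup>+\<phi>. ennreal (exp (energy D f \<phi>) * gw D \<phi>) \<partial>flat U \<xi>) =
    ennreal (exp (energy D f f / 2)) * (\<integral>\<^sup>+\<phi>. ennreal (gw D \<phi>) \<partial>flat U \<xi>)"
proof -
  have "exp (energy D f \<phi>) * gw D \<phi> = exp (energy D f f / 2) * gw D (\<lambda>z. \<phi> z + (- f z))" for \<phi>
    unfolding gw_def using energy_square_add[of D \<phi> "-1" f]
    by (simp add: exp_add[symmetric] field_simps)
  then have "(\<integral>\<^sup>+\<phi>. ennreal (exp (energy D f \<phi>) * gw D \<phi>) \<partial>flat U \<xi>) =
      (\<integral>\<^sup>+\<phi>. (\<lambda>\<phi>. ennreal (exp (energy D f f / 2)) * ennreal (gw D \<phi>)) (\<lambda>z. \<phi> z + (- f z)) \<partial>flat U \<xi>)"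
    by (simp add: ennreal_mult)
  also have "\<dots> = (\<integral>\<^sup>+\<phi>. ennreal (exp (energy D f f / 2)) * ennreal (gw D \<phi>) \<partial>flat U (\<lambda>z. \<xi> z + (- f z)))"
    by (rule flat_shift[OF assms(2)]) measurable
  also have "flat U (\<lambda>z. \<xi> z + (- f z)) = flat U \<xi>" by (rule flat_cong) (simp add: f)
  finally show ?thesis by (simp add: nn_integral_cmult)
qed

section \<open>The one-dimensional truncated Gaussian\<close>

lemma gauss_integrable_moment:
  "integrable lborel (\<lambda>s. exp (- (s - a)\<^sup>2 / 2) :: real)"
  "integrable lborel (\<lambda>s. s * exp (- (s - a)\<^sup>2 / 2) :: real)"
proof -
  have eq: "exp (- (s - a)\<^sup>2 / 2) = exp (- a\<^sup>2 / 2) * exp (a * s - 1 / 2 * s\<^sup>2)" for s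
    by (simp add: exp_add[symmetric] power2_eq_square field_simps)
  show "integrable lborel (\<lambda>s. exp (- (s - a)\<^sup>2 / 2) :: real)"
    unfolding eq by (intro integrable_mult_right integrable_gauss_exp) simp
  show "integrable lborel (\<lambda>s. s * exp (- (s - a)\<^sup>2 / 2) :: real)"
  proof (rule Bochner_Integration.integrable_bound)
    show "integrable lborel (\<lambda>s. exp (- a\<^sup>2 / 2) * exp ((\<bar>a\<bar> + 1) * \<bar>s\<bar> - 1 / 2 * s\<^sup>2))"
      by (intro integrable_mult_right integrable_gauss_exp_abs) simp
    have "\<bar>s\<bar> * exp (a * s) \<le> exp ((\<bar>a\<bar> + 1) * \<bar>s\<bar>)" for s
    proof -
      have "\<bar>s\<bar> \<le> exp \<bar>s\<bar>" using exp_ge_add_one_self[of "\<bar>s\<bar>"] by linarith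
      moreover have "a * s \<le> \<bar>a\<bar> * \<bar>s\<bar>" using abs_ge_self[of "a * s"] by (simp add: abs_mult)
      ultimately have "\<bar>s\<bar> * exp (a * s) \<le> exp \<bar>s\<bar> * exp (\<bar>a\<bar> * \<bar>s\<bar>)" by (intro mult_mono) auto
      then show ?thesis by (simp add: exp_add[symmetric] algebra_simps)
    qed
    then have "\<bar>s\<bar> * exp (a * s) / exp (1 / 2 * s\<^sup>2) \<le> exp ((\<bar>a\<bar> + 1) * \<bar>s\<bar>) / exp (1 / 2 * s\<^sup>2)" for s
      by (intro divide_right_mono) auto
    then have "exp (- a\<^sup>2 / 2) * (\<bar>s\<bar> * exp (a * s - 1 / 2 * s\<^sup>2)) \<le>
        exp (- a\<^sup>2 / 2) * exp ((\<bar>a\<bar> + 1) * \<bar>s\<bar> - 1 / 2 * s\<^sup>2)" for s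
      by (intro mult_left_mono) (simp_all only: exp_diff times_divide_eq_right exp_ge_zero)
    then show "AE s in lborel. norm (s * exp (- (s - a)\<^sup>2 / 2))
       \<le> norm (exp (- a\<^sup>2 / 2) * exp ((\<bar>a\<bar> + 1) * \<bar>s\<bar> - 1 / 2 * s\<^sup>2))"
      unfolding eq by (intro AE_I2) (simp only: real_norm_def abs_mult abs_exp_cancel mult.left_commute)
  qed simp
qed

lemma gauss_mean_zero: "(\<integral>s. (s - a) * exp (- (s - a)\<^sup>2 / 2) \<partial>lborel) = (0 :: real)"
proof -
  let ?f = "\<lambda>s::real. (s - a) * exp (- (s - a)\<^sup>2 / 2)"
  have "integral\<^sup>L lborel ?f = \<bar>-1\<bar> *\<^sub>R (\<integral>s. ?f (2 * a + (-1) * s) \<partial>lborel)"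
    by (rule lborel_integral_real_affine) simp
  also have "(\<lambda>s. ?f (2 * a + (-1) * s)) = (\<lambda>s. - ?f s)"
    by (auto simp: fun_eq_iff power2_eq_square algebra_simps)
  finally show ?thesis by simp
qed

text \<open>Mills' ratio bound \<open>exp (- c\<^sup>2 / 2) \<le> (1 + c) * (\<integral>r\<ge>c. exp (- r\<^sup>2 / 2))\<close>, obtained by
  differentiating \<open>- exp (- r\<^sup>2 / 2) / (1 + r)\<close>.\<close>

lemma mills_ratio:
  assumes "0 \<le> c"
  shows "(\<integral>\<^sup>+r\<in>{c..}. ennreal (r * exp (- r\<^sup>2 / 2)) \<partial>lborel) \<le>
    (\<integral>\<^sup>+r\<in>{c..}. ennreal ((1 + c) * exp (- r\<^sup>2 / 2)) \<partial>lborel)"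
proof -
  let ?E = "\<lambda>r::real. exp (- r\<^sup>2 / 2)"
  have "(\<integral>\<^sup>+r\<in>{c..}. ennreal (r * ?E r) \<partial>lborel) = ennreal (0 - (- ?E c))"
  proof (rule nn_integral_FTC_atLeast[where F = "\<lambda>r. - ?E r"])
    show "((\<lambda>r. - ?E r) has_real_derivative x * ?E x) (at x)" for x
      by (auto intro!: derivative_eq_intros)
    show "((\<lambda>r. - ?E r) \<longlongrightarrow> 0) at_top" by real_asymp
  qed (use assms in auto)
  also have "\<dots> = ennreal (0 - (- (1 + c) * ?E c / (1 + c)))"
  proof -
    have "- (1 + c) * ?E c / (1 + c) = - ?E c" using assms by (simp add: field_simps)
    then show ?thesis by simp
  qed
  also have "\<dots> = (\<integral>\<^sup>+r\<in>{c..}. ennreal ((1 + c) * (?E r * (r / (1 + r) + 1 / (1 + r)\<^sup>2))) \<partial>lborel)"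
  proof (rule nn_integral_FTC_atLeast[where F = "\<lambda>r. - (1 + c) * ?E r / (1 + r)", symmetric])
    show "((\<lambda>r. - (1 + c) * ?E r / (1 + r)) has_real_derivative
        (1 + c) * (?E x * (x / (1 + x) + 1 / (1 + x)\<^sup>2))) (at x)" if "c \<le> x" for x
      using that assms
      by (auto intro!: derivative_eq_intros simp: divide_simps power2_eq_square) (simp add: algebra_simps)
    show "((\<lambda>r. - (1 + c) * ?E r / (1 + r)) \<longlongrightarrow> 0) at_top" by real_asymp
  qed (use assms in auto)
  also have "\<dots> \<le> (\<integral>\<^sup>+r\<in>{c..}. ennreal ((1 + c) * ?E r) \<partial>lborel)"
  proof (intro nn_integral_mono)
    fix r :: real
    show "ennreal ((1 + c) * (?E r * (r / (1 + r) + 1 / (1 + r)\<^sup>2))) * indicator {c..} r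
        \<le> ennreal ((1 + c) * ?E r) * indicator {c..} r"
    proof (cases "c \<le> r")
      case True
      have "r * (1 + r) + 1 \<le> (1 + r)\<^sup>2" using True assms by (simp add: power2_eq_square algebra_simps)
      then have "(r * (1 + r) + 1) / (1 + r)\<^sup>2 \<le> 1" using True assms by simp
      moreover have "r / (1 + r) + 1 / (1 + r)\<^sup>2 = (r * (1 + r) + 1) / (1 + r)\<^sup>2"
        using True assms by (simp add: power2_eq_square divide_simps) 
      ultimately have "?E r * (r / (1 + r) + 1 / (1 + r)\<^sup>2) \<le> ?E r * 1"
        by (intro mult_left_mono) auto
      then show ?thesis using True assms by (auto intro!: ennreal_leI mult_left_mono)
    qed simp
  qed
  finally show ?thesis .
qed

text \<open>Cutting a unit Gaussian of mean \<open>a\<close> at the level \<open>h\<close> lowers its mean by at most \<open>1 + max 0 (a - h)\<close>,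
  written without dividing by the remaining mass. After the reflection \<open>r = a - s\<close> this is Mills' ratio.\<close>

lemma truncated_gauss_mean:
  fixes a h :: real
  shows "0 \<le> (\<integral>s. (s - a + 1 + max 0 (a - h)) * exp (- (s - a)\<^sup>2 / 2) * indicator {..<h} s \<partial>lborel)"
proof -
  define c where "c = max 0 (a - h)"
  let ?E = "\<lambda>r::real. exp (- r\<^sup>2 / 2)"
  let ?f = "\<lambda>s::real. (s - a + 1 + c) * exp (- (s - a)\<^sup>2 / 2) * (indicator {..<h} s :: real)"
  have iE: "integrable lborel ?E" "integrable lborel (\<lambda>r. r * ?E r)"
    using gauss_integrable_moment[of 0] by auto
  have i1: "integrable lborel (\<lambda>r. r * ?E r * indicator {c..} r)"
    "integrable lborel (\<lambda>r. (1 + c) * ?E r * indicator {c..} r)"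
    using iE by (auto intro!: integrable_real_mult_indicator integrable_mult_right)
  have i2: "integrable lborel (\<lambda>r. (1 + c - r) * ?E r * indicator {a - h<..} r)"
  proof -
    have "integrable lborel (\<lambda>r. ((1 + c) * ?E r - r * ?E r) * indicator {a - h<..} r)"
      using iE by (intro integrable_real_mult_indicator) auto
    then show ?thesis by (simp add: algebra_simps)
  qed
  have le: "(\<integral>r. r * ?E r * indicator {c..} r \<partial>lborel) \<le> (\<integral>r. (1 + c) * ?E r * indicator {c..} r \<partial>lborel)"
  proof -
    have "(\<integral>\<^sup>+r. ennreal (r * ?E r * indicator {c..} r) \<partial>lborel) \<le>
        (\<integral>\<^sup>+r. ennreal ((1 + c) * ?E r * indicator {c..} r) \<partial>lborel)"
    proof -
      have conv: "ennreal (g r * indicator {c..} r) = ennreal (g r) * indicator {c..} r" for g :: "real \<Rightarrow> real" and r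
        by (simp add: indicator_def)
      have "0 \<le> c" by (simp add: c_def)
      from mills_ratio[OF this] show ?thesis by (subst (1 2) conv)
    qed
    moreover have "AE r in lborel. 0 \<le> r * ?E r * indicator {c..} r"
      by (rule AE_I2) (auto simp: c_def indicator_def)
    moreover have "AE r in lborel. 0 \<le> (1 + c) * ?E r * indicator {c..} r"
      by (rule AE_I2) (auto simp: c_def indicator_def)
    ultimately show ?thesis
      using i1 by (simp add: nn_integral_eq_integral integral_nonneg_AE)
  qed
  have "0 \<le> (\<integral>r. (1 + c) * ?E r * indicator {c..} r - r * ?E r * indicator {c..} r \<partial>lborel)"
    using le i1 by (subst Bochner_Integration.integral_diff) auto
  also have "\<dots> \<le> (\<integral>r. (1 + c - r) * ?E r * indicator {a - h<..} r \<partial>lborel)"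
  proof (rule integral_mono_AE)
    show "AE r in lborel. (1 + c) * ?E r * indicator {c..} r - r * ?E r * indicator {c..} r
      \<le> (1 + c - r) * ?E r * indicator {a - h<..} r"
      using AE_lborel_singleton[of c]
      by eventually_elim (auto simp: c_def indicator_def algebra_simps max_def split: if_splits
          intro: mult_right_mono)
  qed (use i1 i2 in auto)
  also have "\<dots> = (\<integral>r. ?f (a + (-1) * r) \<partial>lborel)"
    by (intro Bochner_Integration.integral_cong) (auto simp: indicator_def)
  also have "\<dots> = integral\<^sup>L lborel ?f"
    using lborel_integral_real_affine[of "-1" ?f a] by simp
  finally show ?thesis unfolding c_def by (simp add: add.assoc)
qed

section \<open>The field outside a cluster\<close>

lemma nn_integral_flat_pos:
  assumes "finite U" and m: "F \<in> borel_measurable cfg"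
    and pos: "\<And>\<phi>. (\<And>z. z \<in> U \<Longrightarrow> h - 1 < \<phi> z \<and> \<phi> z < h) \<Longrightarrow> 0 < (F \<phi> :: real)"
  shows "0 < (\<integral>\<^sup>+\<phi>. ennreal (F \<phi>) \<partial>flat U \<xi>)"
proof (rule ccontr)
  let ?P = "PiM U (\<lambda>_. lborel) :: (site \<Rightarrow> real) measure"
  let ?box = "PiE U (\<lambda>_. {h - 1<..<h})"
  have mg: "(\<lambda>\<psi>. ennreal (F (glue U \<psi> \<xi>))) \<in> borel_measurable ?P"
    using measurable_compose[OF measurable_glue m] by measurable
  assume "\<not> ?thesis"
  then have "(\<integral>\<^sup>+\<psi>. ennreal (F (glue U \<psi> \<xi>)) \<partial>?P) = 0"
    using m by (simp add: nn_integral_flat)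
  then have "AE \<psi> in ?P. F (glue U \<psi> \<xi>) \<le> 0"
    using mg by (simp add: nn_integral_0_iff_AE ennreal_eq_0_iff)
  then obtain N where N: "{\<psi> \<in> space ?P. \<not> F (glue U \<psi> \<xi>) \<le> 0} \<subseteq> N" "emeasure ?P N = 0" "N \<in> sets ?P"
    by (auto elim: AE_E)
  have "?box \<subseteq> {\<psi> \<in> space ?P. \<not> F (glue U \<psi> \<xi>) \<le> 0}"
  proof
    fix \<psi> assume \<psi>: "\<psi> \<in> ?box"
    have "0 < F (glue U \<psi> \<xi>)" using \<psi> by (intro pos) (auto simp: glue_def)
    then show "\<psi> \<in> {\<psi> \<in> space ?P. \<not> F (glue U \<psi> \<xi>) \<le> 0}"
      using \<psi> by (auto simp: space_PiM)
  qed
  then have "emeasure ?P ?box \<le> emeasure ?P N" using N by (intro emeasure_mono) auto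
  moreover have "emeasure ?P ?box = 1"
    using assms(1) by (simp add: lebesgue_product.emeasure_PiM)
  ultimately show False using N(2) by simp
qed

lemma poisson_indicator:
  assumes "finite D"
  shows "\<exists>u. (\<forall>z. z \<notin> D \<longrightarrow> u z = 0) \<and> (\<forall>z\<in>D. lap u z = (if P z then 1 else 0)) \<and> (\<forall>z. 0 \<le> u z)"
proof -
  obtain u where "\<And>z. z \<notin> D \<Longrightarrow> u z = 0" "\<And>z. z \<in> D \<Longrightarrow> lap u z = (if P z then 1 else 0)" "\<And>z. 0 \<le> u z"
    by (rule poisson_solution[OF assms, where s = "\<lambda>z. if P z then 1 else 0"]) (simp, blast)
  then show ?thesis by blast
qed

lemma gw_lattice: "gw D a * gw D b \<le> gw D (\<lambda>z. max (a z) (b z)) * gw D (\<lambda>z. min (a z) (b z))"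
  unfolding gw_def exp_add[symmetric] using energy_max_min[of D a b] by simp

lemma gw_const: "gw D (\<lambda>z. \<phi> z + c) = gw D \<phi>"
  unfolding gw_def energy_def by simp

text \<open>A bound for the decrease of the Laplacian of the mean at a vertex where the field is known to lie
  below \<open>h\<close>: \<open>1\<close> comes from \<open>truncated_gauss_mean\<close>, \<open>exp 8\<close> from \<open>overshoot_bound\<close>.\<close>

definition loss :: real where "loss = 1 + exp 8"

text \<open>A lower bound for the mean of \<open>energy D f \<phi>\<close> given that the exploration has found a cluster with hitting
  potential \<open>k\<close>.\<close>

definition gain :: "site set \<Rightarrow> site set \<Rightarrow> real \<Rightarrow> (site \<Rightarrow> real) \<Rightarrow> (site \<Rightarrow> real) \<Rightarrow> real" where
  "gain D B h f k = (h - 16 * loss) * (\<Sum>z\<in>D. lap f z * k z) - loss * (\<Sum>z\<in>B. f z)"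

text \<open>The set \<open>K\<close> plays the role of an explored cluster of \<open>{\<phi> \<ge> h}\<close>; its unexplored neighbours,
  together with those of the starting vertices \<open>B\<close> that do not belong to it, are only known to carry a
  value below \<open>h\<close>. A vertex of \<open>B\<close> has a neighbour outside \<open>D\<close>, so that each vertex carrying such
  information is next to a fixed value; this keeps the variance there bounded.\<close>

locale pinned =
  fixes D K B :: "site set" and h :: real
  assumes finD: "finite D" and KD: "K \<subseteq> D" and BD: "B \<subseteq> D"
    and Bout: "\<And>y. y \<in> B \<Longrightarrow> nbrs y - D \<noteq> {}" and h0: "0 \<le> h"
begin

definition U where "U = D - K"
definition Y where "Y = (B \<union> {y \<in> D. nbrs y \<inter> K \<noteq> {}}) - K"
definition pin :: "site \<Rightarrow> real" where "pin z = (if z \<in> K then h else 0)"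
definition tw :: "(site \<Rightarrow> real) \<Rightarrow> real" where "tw \<phi> = gw D \<phi> * indicator {\<phi>. \<forall>y\<in>Y. \<phi> y < h} \<phi>"
definition mass :: real where "mass = (\<integral>\<phi>. tw \<phi> \<partial>flat U pin)"
definition mean :: "site \<Rightarrow> real" where "mean z = (\<integral>\<phi>. \<phi> z * tw \<phi> \<partial>flat U pin) / mass"

lemma UD: "U \<subseteq> D" and finU: "finite U" and YU: "Y \<subseteq> U"
  using finD BD unfolding U_def Y_def by auto

lemma tw_nonneg: "0 \<le> tw \<phi>" and tw_le: "tw \<phi> \<le> gw D \<phi>"
  unfolding tw_def by (auto simp: indicator_def)

lemma measurable_tw [measurable]: "tw \<in> borel_measurable cfg"
  unfolding tw_def[abs_def] by measurable

lemma integrable_tw: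
  assumes m: "F \<in> borel_measurable cfg" and "0 \<le> A"
    and b: "\<And>\<phi>. (\<And>z. z \<notin> U \<Longrightarrow> \<phi> z = pin z) \<Longrightarrow> \<bar>F \<phi>\<bar> \<le> A * exp (c * (\<Sum>z\<in>U. \<bar>\<phi> z\<bar>))"
  shows "integrable (flat U pin) (\<lambda>\<phi>. F \<phi> * tw \<phi>)"
proof (rule integrable_flat[OF finD UD _ _ \<open>0 \<le> A\<close>])
  show "(\<lambda>\<phi>. F \<phi> * tw \<phi>) \<in> borel_measurable cfg" using m by measurable
  fix \<phi> assume "\<And>z. z \<notin> U \<Longrightarrow> \<phi> z = pin z"
  then have "\<bar>F \<phi>\<bar> * tw \<phi> \<le> A * exp (c * (\<Sum>z\<in>U. \<bar>\<phi> z\<bar>)) * gw D \<phi>"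
    using tw_nonneg tw_le \<open>0 \<le> A\<close> by (intro mult_mono b) auto
  then show "\<bar>F \<phi> * tw \<phi>\<bar> \<le> A * exp (c * (\<Sum>z\<in>U. \<bar>\<phi> z\<bar>)) * gw D \<phi>"
    using tw_nonneg by (simp add: abs_mult)
qed

lemma site_le_exp: "z \<in> U \<Longrightarrow> \<bar>\<phi> z :: real\<bar> \<le> exp (1 * (\<Sum>z\<in>U. \<bar>\<phi> z\<bar>))"
proof -
  assume "z \<in> U"
  then have "\<bar>\<phi> z\<bar> \<le> (\<Sum>z\<in>U. \<bar>\<phi> z\<bar>)" using finU by (intro member_le_sum) auto
  then show ?thesis using exp_ge_add_one_self[of "\<Sum>z\<in>U. \<bar>\<phi> z\<bar>"]
    unfolding mult_1 by linarith
qed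

lemma site_bound:
  assumes "\<And>z. z \<notin> U \<Longrightarrow> \<phi> z = pin z"
  shows "\<bar>\<phi> z\<bar> \<le> (h + 1) * exp (1 * (\<Sum>z\<in>U. \<bar>\<phi> z\<bar>))"
proof (cases "z \<in> U")
  case True
  have "\<bar>\<phi> z\<bar> \<le> 1 * exp (1 * (\<Sum>z\<in>U. \<bar>\<phi> z\<bar>))" using site_le_exp[OF True, of \<phi>] by simp
  also have "\<dots> \<le> (h + 1) * exp (1 * (\<Sum>z\<in>U. \<bar>\<phi> z\<bar>))" using h0 by (intro mult_right_mono) auto
  finally show ?thesis .
next
  case False
  have "\<bar>\<phi> z\<bar> \<le> (h + 1) * 1" using assms[OF False] h0 by (simp add: pin_def)
  also have "\<dots> \<le> (h + 1) * exp (1 * (\<Sum>z\<in>U. \<bar>\<phi> z\<bar>))"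
    using h0 by (intro mult_left_mono) (auto intro: sum_nonneg)
  finally show ?thesis .
qed

lemma integrable_site: "integrable (flat U pin) (\<lambda>\<phi>. \<phi> z * tw \<phi>)"
  by (rule integrable_tw[where A = "h + 1" and c = 1, OF _ _ site_bound]) (use h0 in auto)

lemma integrable_tw0: "integrable (flat U pin) tw"
  using integrable_tw[of "\<lambda>_. 1" 1 0] by simp

lemma nn_integral_tw: "(\<integral>\<^sup>+\<phi>. tw \<phi> \<partial>flat U pin) = ennreal mass"
  unfolding mass_def by (rule nn_integral_eq_integral[OF integrable_tw0]) (simp add: tw_nonneg)

lemma mass_pos: "0 < mass"
proof -
  have "0 < (\<integral>\<^sup>+\<phi>. ennreal (tw \<phi>) \<partial>flat U pin)"
  proof (rule nn_integral_flat_pos[OF finU measurable_tw, where h = h])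
    fix \<phi> :: "site \<Rightarrow> real" assume "\<And>z. z \<in> U \<Longrightarrow> h - 1 < \<phi> z \<and> \<phi> z < h"
    then show "0 < tw \<phi>" using YU gw_pos[of D \<phi>] by (auto simp: tw_def indicator_def)
  qed
  then show ?thesis unfolding nn_integral_tw by simp
qed

lemma mean_off: "z \<notin> U \<Longrightarrow> mean z = pin z"
proof -
  assume z: "z \<notin> U"
  have "(\<integral>\<phi>. \<phi> z * tw \<phi> \<partial>flat U pin) = (\<integral>\<phi>. pin z * tw \<phi> \<partial>flat U pin)"
  proof (rule integral_cong_AE)
    show "AE \<phi> in flat U pin. \<phi> z * tw \<phi> = pin z * tw \<phi>"
      using AE_flat[of U pin]
    proof eventually_elim
      case (elim \<phi>)
      then have "\<phi> z = pin z" using z by blast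
      then show ?case by (simp only:)
    qed
  qed measurable
  also have "\<dots> = pin z * mass" unfolding mass_def by (rule integral_mult_right_zero)
  finally have "mean z = pin z * mass / mass" unfolding mean_def by (simp only:)
  then show ?thesis using mass_pos by simp
qed

text \<open>By the four functions theorem, removing the truncation and raising the boundary values to the
  constant \<open>h\<close> increases the field. Then \<open>\<phi> z - h\<close> is a centred Gaussian, whose variance \<open>f z\<close> is at most
  \<open>16\<close> because \<open>z\<close> is two steps away from the boundary, so that \<open>exp (f z / 2) \<le> exp 8\<close>.\<close>

lemma overshoot_bound:
  assumes y: "y \<in> D" "z \<in> nbrs y" "v \<in> nbrs y" "v \<notin> U"
  shows "(\<integral>\<phi>. max 0 (\<phi> z - h) * tw \<phi> \<partial>flat U pin) \<le> exp 8 * mass"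
proof (cases "z \<in> U")
  case False
  have "(\<integral>\<phi>. max 0 (\<phi> z - h) * tw \<phi> \<partial>flat U pin) = (\<integral>\<phi>. 0 \<partial>flat U pin)"
  proof (rule integral_cong_AE)
    show "AE \<phi> in flat U pin. max 0 (\<phi> z - h) * tw \<phi> = 0"
      using AE_flat[of U pin]
    proof eventually_elim
      case (elim \<phi>)
      then have "\<phi> z = pin z" using False by blast
      then show ?case using h0 by (simp add: pin_def)
    qed
  qed auto
  then show ?thesis using mass_pos by simp
next
  case True
  obtain f where f: "\<And>w. w \<notin> U \<Longrightarrow> f w = 0" "\<And>w. w \<in> U \<Longrightarrow> lap f w = (if w = z then 1 else 0)"
    using poisson_indicator[OF finU, of "\<lambda>w. w = z"] by blast
  have eval: "energy D f \<phi> = \<phi> z" if \<phi>: "\<And>w. w \<notin> U \<Longrightarrow> \<phi> w = 0" for \<phi>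
  proof -
    have "energy D f \<phi> = (\<Sum>w\<in>D. \<phi> w * lap f w)"
      using \<phi> UD by (intro energy_green[OF finD]) auto
    also have "\<dots> = (\<Sum>w\<in>D. if w = z then \<phi> z else 0)"
    proof (intro sum.cong refl)
      fix w assume "w \<in> D"
      then show "\<phi> w * lap f w = (if w = z then \<phi> z else 0)"
        using f(2)[of w] \<phi>[of w] True by (cases "w \<in> U") auto
    qed
    also have "\<dots> = \<phi> z" using True UD finD by auto
    finally show ?thesis .
  qed
  have ff: "energy D f f = f z" using eval[of f] f(1) by simp
  have "(f z)\<^sup>2 \<le> 16 * f z"
  proof -
    have e: "(f z - f y)\<^sup>2 \<le> 4 * f z" "(f y)\<^sup>2 \<le> 4 * f z"
      using energy_edge[OF finD, of z y f] energy_edge[OF finD, of v y f] y f(1)[of v] ff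
      by (auto simp: power2_commute)
    have "(f z)\<^sup>2 = (f z - f y)\<^sup>2 + 2 * ((f z - f y) * f y) + (f y)\<^sup>2"
      by (simp add: power2_eq_square algebra_simps)
    also have "2 * ((f z - f y) * f y) \<le> (f z - f y)\<^sup>2 + (f y)\<^sup>2"
      using sum_squares_bound[of "f z - f y" "f y"] by (simp only: mult.assoc)
    finally show ?thesis using e by linarith
  qed
  moreover have "0 \<le> f z" using ff energy_nonneg by metis
  ultimately have fz: "f z \<le> 16"
    by (cases "f z = 0") (auto simp: power2_eq_square)
  let ?G = "\<integral>\<^sup>+\<phi>. ennreal (gw D \<phi>) \<partial>flat U (\<lambda>_. h)"
  let ?J = "\<integral>\<^sup>+\<phi>. ennreal (max 0 (\<phi> z - h) * gw D \<phi>) \<partial>flat U (\<lambda>_. h)"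
  let ?I = "\<integral>\<^sup>+\<phi>. ennreal (max 0 (\<phi> z - h) * tw \<phi>) \<partial>flat U pin"
  have "?I * ?G \<le>
    (\<integral>\<^sup>+\<phi>. ennreal (max 0 (\<phi> z - h) * gw D \<phi>) \<partial>flat U (\<lambda>w. max (pin w) h)) *
    (\<integral>\<^sup>+\<phi>. ennreal (tw \<phi>) \<partial>flat U (\<lambda>w. min (pin w) h))"
  proof (rule four_functions[OF finU])
    fix a b :: "site \<Rightarrow> real"
    let ?M = "\<lambda>z. max (a z) (b z)" and ?m = "\<lambda>z. min (a z) (b z)"
    let ?i = "\<lambda>a. indicator {\<phi>. \<forall>y\<in>Y. \<phi> y < h} a :: real"
    have "max 0 (a z - h) * tw a * gw D b = (max 0 (a z - h) * ?i a) * (gw D a * gw D b)"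
      by (simp add: tw_def)
    also have "\<dots> \<le> (max 0 (?M z - h) * ?i ?m) * (gw D ?M * gw D ?m)"
      by (intro mult_mono gw_lattice) (auto simp: indicator_def)
    also have "\<dots> = max 0 (?M z - h) * gw D ?M * tw ?m" by (simp add: tw_def)
    finally show "ennreal (max 0 (a z - h) * tw a) * ennreal (gw D b)
        \<le> ennreal (max 0 (?M z - h) * gw D ?M) * ennreal (tw ?m)"
      by (simp add: ennreal_mult[symmetric] tw_nonneg ennreal_leI)
  qed measurable
  also have "(\<lambda>w. max (pin w) h) = (\<lambda>_. h)" using h0 by (auto simp: pin_def fun_eq_iff)
  also have "(\<lambda>w. min (pin w) h) = pin" using h0 by (auto simp: pin_def fun_eq_iff)
  finally have 1: "?I * ?G \<le> ?J * ennreal mass" unfolding nn_integral_tw .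
  have shift: "(\<integral>\<^sup>+\<phi>. F \<phi> \<partial>flat U (\<lambda>_. h)) = (\<integral>\<^sup>+\<phi>. F (\<lambda>w. \<phi> w + h) \<partial>flat U (\<lambda>_. 0))"
    if "F \<in> borel_measurable cfg" for F
  proof -
    have "flat U (\<lambda>_. h) = flat U (\<lambda>z. 0 + h)" by simp
    then show ?thesis using flat_shift[OF finU that, where f = "\<lambda>_. h" and \<xi> = "\<lambda>_. 0"] by (simp only:)
  qed
  have "?J \<le> (\<integral>\<^sup>+\<phi>. ennreal (exp (\<phi> z - h) * gw D \<phi>) \<partial>flat U (\<lambda>_. h))"
  proof (intro nn_integral_mono ennreal_leI mult_right_mono)
    fix \<phi> :: "site \<Rightarrow> real"
    show "max 0 (\<phi> z - h) \<le> exp (\<phi> z - h)"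
      using exp_ge_add_one_self[of "\<phi> z - h"] by (intro max.boundedI) (simp, linarith)
  qed simp
  also have "\<dots> = (\<integral>\<^sup>+\<phi>. ennreal (exp (\<phi> z) * gw D \<phi>) \<partial>flat U (\<lambda>_. 0))"
    by (subst shift) (simp_all add: gw_const)
  also have "\<dots> = (\<integral>\<^sup>+\<phi>. ennreal (exp (energy D f \<phi>) * gw D \<phi>) \<partial>flat U (\<lambda>_. 0))"
    by (rule nn_integral_flat_cong) (simp add: eval)
  also have "\<dots> = ennreal (exp (f z / 2)) * (\<integral>\<^sup>+\<phi>. ennreal (gw D \<phi>) \<partial>flat U (\<lambda>_. 0))"
    unfolding ff[symmetric] by (rule gauss_tilt[OF finD finU f(1)])
  also have "(\<integral>\<^sup>+\<phi>. ennreal (gw D \<phi>) \<partial>flat U (\<lambda>_. 0)) = ?G"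
    by (subst shift) (simp_all add: gw_const)
  also have "ennreal (exp (f z / 2)) * ?G \<le> ennreal (exp 8) * ?G"
    using fz by (intro mult_right_mono ennreal_leI) auto
  finally have 2: "?J \<le> ennreal (exp 8) * ?G" .
  have "0 < ?G" by (rule nn_integral_flat_pos[OF finU measurable_gw]) (rule gw_pos)
  moreover have "?G < top"
  proof -
    have "integrable (flat U (\<lambda>_. h)) (gw D)"
      by (rule integrable_flat[OF finD UD, where A = 1 and c = 0]) auto
    then show ?thesis by (simp add: nn_integral_eq_integral)
  qed
  moreover have "?G * ?I \<le> ?G * (ennreal (exp 8) * ennreal mass)"
    using 1 mult_right_mono[OF 2, of "ennreal mass"] by (simp add: ac_simps order_trans)
  ultimately have I: "?I \<le> ennreal (exp 8 * mass)"
    using mass_pos by (subst (asm) ennreal_mult_le_mult_iff) (auto simp: ennreal_mult)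
  have "integrable (flat U pin) (\<lambda>\<phi>. max 0 (\<phi> z - h) * tw \<phi>)"
  proof (rule integrable_tw[where A = 1 and c = 1])
    fix \<phi> :: "site \<Rightarrow> real"
    show "\<bar>max 0 (\<phi> z - h)\<bar> \<le> 1 * exp (1 * (\<Sum>z\<in>U. \<bar>\<phi> z\<bar>))"
      using site_le_exp[OF True, of \<phi>] h0 by (auto simp: max_def)
  qed auto
  then have "?I = ennreal (\<integral>\<phi>. max 0 (\<phi> z - h) * tw \<phi> \<partial>flat U pin)"
    by (rule nn_integral_eq_integral) (simp add: tw_nonneg)
  then show ?thesis using I mass_pos by (simp add: ennreal_le_iff)
qed

lemma tw_upd:
  assumes "z \<in> U"
  shows "tw (\<phi>(z := s)) = gw D (\<phi>(z := lavg \<phi> z)) * indicator {\<phi>. \<forall>y\<in>Y - {z}. \<phi> y < h} \<phi> *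
    (exp (- (s - lavg \<phi> z)\<^sup>2 / 2) * (if z \<in> Y then indicator {..<h} s else 1))"
proof -
  have "z \<in> D" using assms UD by auto
  then show ?thesis
    unfolding tw_def gw_upd[OF finD \<open>z \<in> D\<close>, of \<phi> s] by (auto simp: indicator_def)
qed

lemma lavg_upd: "lavg (\<phi>(z := s)) z = lavg \<phi> z"
  unfolding lavg_def by (intro arg_cong2[of _ _ _ _ "(/)"] sum.cong) auto

lemma lap_mean:
  "lap mean z = (\<integral>\<phi>. (\<phi> z - lavg \<phi> z) * tw \<phi> \<partial>flat U pin) / mass"
  and integrable_lap: "integrable (flat U pin) (\<lambda>\<phi>. (\<phi> z - lavg \<phi> z) * tw \<phi>)"
  and integrable_lavg: "integrable (flat U pin) (\<lambda>\<phi>. lavg \<phi> z * tw \<phi>)"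
proof -
  have l: "lavg \<phi> z * tw \<phi> = (\<Sum>w\<in>nbrs z. \<phi> w * tw \<phi>) / 4" for \<phi>
    unfolding lavg_def by (simp add: sum_distrib_right)
  have s: "(\<phi> z - lavg \<phi> z) * tw \<phi> = \<phi> z * tw \<phi> - lavg \<phi> z * tw \<phi>" for \<phi>
    by (simp add: algebra_simps)
  show i: "integrable (flat U pin) (\<lambda>\<phi>. lavg \<phi> z * tw \<phi>)"
    unfolding l by (intro integrable_divide Bochner_Integration.integrable_sum integrable_site)
  show "integrable (flat U pin) (\<lambda>\<phi>. (\<phi> z - lavg \<phi> z) * tw \<phi>)"
    unfolding s by (intro Bochner_Integration.integrable_diff integrable_site i)
  have "(\<integral>\<phi>. lavg \<phi> z * tw \<phi> \<partial>flat U pin) = (\<Sum>w\<in>nbrs z. \<integral>\<phi>. \<phi> w * tw \<phi> \<partial>flat U pin) / 4"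
    unfolding l using integrable_site by simp
  then show "lap mean z = (\<integral>\<phi>. (\<phi> z - lavg \<phi> z) * tw \<phi> \<partial>flat U pin) / mass"
    unfolding s lap_def lavg_def[of mean] mean_def Bochner_Integration.integral_diff[OF integrable_site i]
    by (simp only: sum_divide_distrib[symmetric] diff_divide_distrib divide_divide_eq_left mult.commute)
qed

text \<open>Where nothing is known, the field given its neighbours is a Gaussian centred at their average.\<close>

lemma lap_mean_free:
  assumes "z \<in> U" "z \<notin> Y"
  shows "0 \<le> lap mean z"
proof -
  have "0 \<le> (\<integral>\<phi>. (\<phi> z - lavg \<phi> z) * tw \<phi> \<partial>flat U pin)"
  proof (rule integral_flat_nonneg[OF finU assms(1) integrable_lap])
    fix \<phi> :: "site \<Rightarrow> real"
    let ?c = "gw D (\<phi>(z := lavg \<phi> z)) * indicator {\<phi>. \<forall>y\<in>Y - {z}. \<phi> y < h} \<phi>"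
    have "(\<integral>s. ((\<phi>(z := s)) z - lavg (\<phi>(z := s)) z) * tw (\<phi>(z := s)) \<partial>lborel) =
      (\<integral>s. ?c * ((s - lavg \<phi> z) * exp (- (s - lavg \<phi> z)\<^sup>2 / 2)) \<partial>lborel)"
      unfolding lavg_upd tw_upd[OF assms(1)] using assms(2)
      by (intro Bochner_Integration.integral_cong) auto
    also have "\<dots> = 0" using gauss_mean_zero by simp
    finally show "0 \<le> (\<integral>s. ((\<phi>(z := s)) z - lavg (\<phi>(z := s)) z) * tw (\<phi>(z := s)) \<partial>lborel)" by simp
  qed
  then show ?thesis unfolding lap_mean using mass_pos by simp
qed

text \<open>Given its neighbours, \<open>\<phi> y\<close> is a unit Gaussian about their average, cut at \<open>h\<close>. The cut costs at most
  \<open>1\<close> plus the excess of the average over \<open>h\<close>, and this excess has a bounded mean.\<close>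

lemma lap_mean_pushed:
  assumes "y \<in> Y"
  shows "- loss \<le> lap mean y"
proof -
  let ?T = "\<lambda>\<phi>. 1 + max 0 (lavg \<phi> y - h)"
  have yU: "y \<in> U" "y \<in> D" using assms YU UD by auto
  obtain v where v: "v \<in> nbrs y" "v \<notin> U"
    using assms Bout[of y] unfolding Y_def U_def by blast
  have ij: "integrable (flat U pin) (\<lambda>\<phi>. max 0 (\<phi> w - h) * tw \<phi>)" for w
  proof (rule integrable_tw[where A = "h + 1" and c = 1])
    fix \<phi> assume "\<And>z. z \<notin> U \<Longrightarrow> \<phi> z = pin z"
    then show "\<bar>max 0 (\<phi> w - h)\<bar> \<le> (h + 1) * exp (1 * (\<Sum>z\<in>U. \<bar>\<phi> z\<bar>))"
      using site_bound[of \<phi> w] h0 by (auto simp: max_def)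
  qed (use h0 in auto)
  have convex: "max 0 (lavg \<phi> y - h) \<le> (\<Sum>w\<in>nbrs y. max 0 (\<phi> w - h)) / 4" for \<phi>
  proof -
    have "lavg \<phi> y - h = (\<Sum>w\<in>nbrs y. \<phi> w - h) / 4"
      unfolding lavg_def by (simp add: sum_subtractf)
    also have "\<dots> \<le> (\<Sum>w\<in>nbrs y. max 0 (\<phi> w - h)) / 4"
      by (intro divide_right_mono sum_mono) auto
    finally show ?thesis
      by (intro max.boundedI divide_nonneg_nonneg sum_nonneg) auto
  qed
  have iT: "integrable (flat U pin) (\<lambda>\<phi>. ?T \<phi> * tw \<phi>)"
  proof (rule integrable_tw[where A = "2 + h" and c = 1])
    fix \<phi> assume \<phi>: "\<And>z. z \<notin> U \<Longrightarrow> \<phi> z = pin z"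
    let ?e = "exp (1 * (\<Sum>z\<in>U. \<bar>\<phi> z\<bar>))"
    have "max 0 (\<phi> w - h) \<le> (h + 1) * ?e" for w
      using site_bound[of \<phi> w] \<phi> h0 by (auto simp: max_def)
    then have "(\<Sum>w\<in>nbrs y. max 0 (\<phi> w - h)) / 4 \<le> (\<Sum>w\<in>nbrs y. (h + 1) * ?e) / 4"
      by (intro divide_right_mono sum_mono) auto
    then have "(\<Sum>w\<in>nbrs y. max 0 (\<phi> w - h)) / 4 \<le> (h + 1) * ?e" by simp
    with convex[of \<phi>] have "max 0 (lavg \<phi> y - h) \<le> (h + 1) * ?e" by (rule order_trans)
    moreover have "1 \<le> ?e" by (auto intro: sum_nonneg)
    ultimately have "?T \<phi> \<le> ?e + (h + 1) * ?e" by linarith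
    moreover have "0 \<le> ?T \<phi>" by simp
    moreover have "?e + (h + 1) * ?e = (2 + h) * ?e" by (simp add: algebra_simps)
    ultimately show "\<bar>?T \<phi>\<bar> \<le> (2 + h) * ?e" by linarith
  qed (use h0 in \<open>auto simp: measurable_lavg\<close>)
  have F: "(\<phi> y - lavg \<phi> y + 1 + max 0 (lavg \<phi> y - h)) * tw \<phi> =
      (\<phi> y - lavg \<phi> y) * tw \<phi> + ?T \<phi> * tw \<phi>" for \<phi>
    by (simp add: algebra_simps)
  have "0 \<le> (\<integral>\<phi>. (\<phi> y - lavg \<phi> y + 1 + max 0 (lavg \<phi> y - h)) * tw \<phi> \<partial>flat U pin)"
  proof (rule integral_flat_nonneg[OF finU yU(1)])
    show "integrable (flat U pin) (\<lambda>\<phi>. (\<phi> y - lavg \<phi> y + 1 + max 0 (lavg \<phi> y - h)) * tw \<phi>)"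
      unfolding F by (intro Bochner_Integration.integrable_add integrable_lap iT)
    fix \<phi> :: "site \<Rightarrow> real"
    let ?c = "gw D (\<phi>(y := lavg \<phi> y)) * indicator {\<phi>. \<forall>x\<in>Y - {y}. \<phi> x < h} \<phi>"
    let ?L = "\<lambda>s. (s - lavg \<phi> y + 1 + max 0 (lavg \<phi> y - h)) * exp (- (s - lavg \<phi> y)\<^sup>2 / 2) * indicator {..<h} s"
    have "(\<integral>s. ((\<phi>(y := s)) y - lavg (\<phi>(y := s)) y + 1 + max 0 (lavg (\<phi>(y := s)) y - h)) * tw (\<phi>(y := s)) \<partial>lborel)
      = (\<integral>s. ?c * ?L s \<partial>lborel)"
      unfolding lavg_upd tw_upd[OF yU(1)] using assms
      by (intro Bochner_Integration.integral_cong) auto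
    also have "\<dots> = ?c * integral\<^sup>L lborel ?L" by simp
    also have "\<dots> \<ge> 0" using truncated_gauss_mean by (intro mult_nonneg_nonneg) auto
    finally show "0 \<le> (\<integral>s. ((\<phi>(y := s)) y - lavg (\<phi>(y := s)) y + 1 + max 0 (lavg (\<phi>(y := s)) y - h)) * tw (\<phi>(y := s)) \<partial>lborel)" .
  qed
  also have "\<dots> = lap mean y * mass + (\<integral>\<phi>. ?T \<phi> * tw \<phi> \<partial>flat U pin)"
    unfolding F using integrable_lap[of y] iT mass_pos by (simp add: lap_mean)
  also have "(\<integral>\<phi>. ?T \<phi> * tw \<phi> \<partial>flat U pin) \<le>
      (\<integral>\<phi>. tw \<phi> + (\<Sum>w\<in>nbrs y. max 0 (\<phi> w - h) * tw \<phi>) / 4 \<partial>flat U pin)"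
  proof (rule integral_mono[OF iT])
    show "integrable (flat U pin) (\<lambda>\<phi>. tw \<phi> + (\<Sum>w\<in>nbrs y. max 0 (\<phi> w - h) * tw \<phi>) / 4)"
      by (intro Bochner_Integration.integrable_add integrable_tw0 integrable_divide Bochner_Integration.integrable_sum ij)
    fix \<phi>
    have "?T \<phi> * tw \<phi> \<le> (1 + (\<Sum>w\<in>nbrs y. max 0 (\<phi> w - h)) / 4) * tw \<phi>"
      using convex[of \<phi>] tw_nonneg by (intro mult_right_mono) auto
    then show "?T \<phi> * tw \<phi> \<le> tw \<phi> + (\<Sum>w\<in>nbrs y. max 0 (\<phi> w - h) * tw \<phi>) / 4"
      by (simp only: sum_distrib_right[symmetric] distrib_right mult_1 times_divide_eq_left)
  qed
  also have "(\<integral>\<phi>. tw \<phi> + (\<Sum>w\<in>nbrs y. max 0 (\<phi> w - h) * tw \<phi>) / 4 \<partial>flat U pin) =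
      mass + (\<Sum>w\<in>nbrs y. \<integral>\<phi>. max 0 (\<phi> w - h) * tw \<phi> \<partial>flat U pin) / 4"
    using ij integrable_tw0 by (simp add: mass_def)
  also have "\<dots> \<le> mass + (\<Sum>w\<in>nbrs y. exp 8 * mass) / 4"
    using v yU by (intro add_left_mono divide_right_mono sum_mono overshoot_bound) auto
  finally have "0 \<le> (lap mean y + loss) * mass" by (simp add: loss_def algebra_simps)
  then show ?thesis using mass_pos by (simp add: zero_le_mult_iff)
qed

text \<open>The minimum principle turns the local bounds on the Laplacian of the mean into a pointwise
  bound: the loss caused by the neighbours of \<open>K\<close> is of the same order as the hitting potential \<open>k\<close>
  of \<open>K\<close> itself, because a walk visiting a neighbour of \<open>K\<close> enters \<open>K\<close> with probability \<open>1/4\<close>.\<close>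

lemma mean_lower:
  assumes k: "\<And>z. z \<in> K \<Longrightarrow> k z = 1" "\<And>z. z \<notin> D \<Longrightarrow> k z = 0"
      "\<And>z. z \<in> D - K \<Longrightarrow> lap k z = 0" "\<And>z. 0 \<le> k z"
    and s: "\<And>z. z \<notin> D \<Longrightarrow> s z = 0" "\<And>z. z \<in> D \<Longrightarrow> lap s z = (if z \<in> B then 1 else 0)" "\<And>z. 0 \<le> s z"
  shows "(h - 16 * loss) * k z - loss * s z \<le> mean z"
proof -
  \<comment> \<open>a potential of the neighbours of \<open>K\<close>: superharmonic off \<open>K\<close>, with a drop of at least \<open>1\<close> next to \<open>K\<close>, and below \<open>16 * k\<close>\<close>
  define q where "q z = (if z \<in> K then 0 else 4 * min 1 (4 * k z))" for z
  have l0: "0 \<le> loss" by (simp add: loss_def add_nonneg_nonneg)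
  have q: "0 \<le> q z" "q z \<le> 4" "q z \<le> 16 * k z" for z using k(4)[of z] by (auto simp: q_def min_def)
  have qlap: "0 \<le> lap q z" "nbrs z \<inter> K \<noteq> {} \<Longrightarrow> 1 \<le> lap q z" if z: "z \<in> U" for z
  proof -
    have kz: "k z = lavg k z" using k(3)[of z] z unfolding U_def lap_def by simp
    have near: "1 \<le> lap q z" if "x \<in> nbrs z" "x \<in> K" for x
    proof -
      have "1 \<le> (\<Sum>w\<in>nbrs z. k w)"
        using that k(1)[of x] k(4) member_le_sum[of x "nbrs z" k] by simp
      then have "q z = 4" using kz z unfolding U_def q_def lavg_def by simp
      moreover have "(\<Sum>w\<in>nbrs z. q w) = q x + (\<Sum>w\<in>nbrs z - {x}. q w)"
        using that by (simp add: sum.remove)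
      moreover have "(\<Sum>w\<in>nbrs z - {x}. q w) \<le> (\<Sum>w\<in>nbrs z - {x}. 4)"
        by (intro sum_mono q)
      ultimately show ?thesis using that by (simp add: lap_def lavg_def q_def)
    qed
    show "1 \<le> lap q z" if "nbrs z \<inter> K \<noteq> {}" using near that by blast
    have "lavg q z \<le> 4" using lavg_mono[of z q "\<lambda>_. 4"] q by simp
    moreover have "lavg q z \<le> 16 * lavg k z" using lavg_mono[of z q "\<lambda>w. 16 * k w"] q by (simp add: lavg_cmult)
    ultimately show "0 \<le> lap q z"
      using kz z unfolding lap_def U_def by (auto simp: q_def min_def)
  qed
  let ?d = "\<lambda>z. (mean z - h * k z) + loss * (q z + s z)"
  have "0 \<le> ?d z"
  proof (rule minimum_principle[OF finU])
    fix z assume "z \<notin> U"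
    then have "z \<in> K \<or> z \<notin> D" unfolding U_def by auto
    then show "0 \<le> ?d z"
      using mean_off[OF \<open>z \<notin> U\<close>] k(1,2)[of z] q(1)[of z] s(3)[of z] l0 KD by (auto simp: pin_def)
  next
    fix z assume z: "z \<in> U"
    have zD: "z \<in> D" "z \<in> D - K" using z unfolding U_def by auto
    have "lap ?d z = lap mean z + loss * (lap q z + lap s z)"
      using k(3)[OF zD(2)] by (simp add: lap_add lap_diff lap_cmult)
    moreover have "- loss \<le> lap mean z" if "z \<in> Y" using lap_mean_pushed[OF that] .
    moreover have "1 \<le> lap q z + lap s z" if "z \<in> Y"
      using that qlap[OF z] s(2)[OF zD(1)] unfolding Y_def by (auto split: if_splits)
    moreover have "0 \<le> lap q z + lap s z" using qlap(1)[OF z] s(2)[OF zD(1)] by simp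
    moreover have "0 \<le> lap mean z" if "z \<notin> Y" using lap_mean_free[OF z that] .
    ultimately show "0 \<le> lap ?d z"
      using l0 mult_left_mono[of 1 "lap q z + lap s z" loss] by (cases "z \<in> Y") auto
  qed
  moreover have "loss * q z \<le> loss * (16 * k z)" using q(3) l0 by (rule mult_left_mono)
  ultimately show ?thesis by (simp add: algebra_simps)
qed

text \<open>Summation by parts turns the pairing of \<open>lap f\<close> with the potential \<open>s\<close> into a sum of \<open>f\<close> over \<open>B\<close>.\<close>

lemma mean_gain:
  assumes f: "\<And>z. z \<notin> D \<Longrightarrow> f z = 0" "\<And>z. z \<in> D \<Longrightarrow> 0 \<le> lap f z"
    and k: "\<And>z. z \<in> K \<Longrightarrow> k z = 1" "\<And>z. z \<notin> D \<Longrightarrow> k z = 0"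
      "\<And>z. z \<in> D - K \<Longrightarrow> lap k z = 0" "\<And>z. 0 \<le> k z"
  shows "gain D B h f k \<le> (\<Sum>z\<in>D. lap f z * mean z)"
proof -
  obtain s where s: "\<And>z. z \<notin> D \<Longrightarrow> s z = 0" "\<And>z. z \<in> D \<Longrightarrow> lap s z = (if z \<in> B then 1 else 0)" "\<And>z. 0 \<le> s z"
    using poisson_indicator[OF finD, of "\<lambda>w. w \<in> B"] by blast
  have "(\<Sum>z\<in>D. lap f z * s z) = energy D f s"
    using s(1) by (simp add: energy_green[OF finD] mult.commute)
  also have "\<dots> = (\<Sum>z\<in>D. f z * lap s z)"
    using f(1) by (subst energy_sym) (simp add: energy_green[OF finD])
  also have "\<dots> = (\<Sum>z\<in>D. if z \<in> B then f z else 0)" using s(2) by (intro sum.cong) auto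
  also have "\<dots> = (\<Sum>z\<in>B. f z)" using BD finD by (simp add: sum.If_cases Int_absorb1)
  finally have fs: "(\<Sum>z\<in>D. lap f z * s z) = (\<Sum>z\<in>B. f z)" .
  have "gain D B h f k = (\<Sum>z\<in>D. lap f z * ((h - 16 * loss) * k z - loss * s z))"
    unfolding gain_def fs[symmetric] sum_distrib_left sum_subtractf[symmetric]
    by (intro sum.cong refl) (simp add: algebra_simps)
  also have "\<dots> \<le> (\<Sum>z\<in>D. lap f z * mean z)"
    using f(2) by (intro sum_mono mult_left_mono mean_lower k s)
  finally show ?thesis .
qed

text \<open>Jensen's inequality, in the form \<open>exp x \<ge> 1 + x\<close>, for the field with the constant value \<open>h\<close> on \<open>K\<close>.\<close>

lemma tilt_pinned:
  assumes f: "\<And>z. z \<notin> D \<Longrightarrow> f z = 0" "\<And>z. z \<in> D \<Longrightarrow> 0 \<le> lap f z"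
    and k: "\<And>z. z \<in> K \<Longrightarrow> k z = 1" "\<And>z. z \<notin> D \<Longrightarrow> k z = 0"
      "\<And>z. z \<in> D - K \<Longrightarrow> lap k z = 0" "\<And>z. 0 \<le> k z"
    and "0 \<le> t"
  shows "ennreal (exp (t * gain D B h f k)) * ennreal mass \<le>
    (\<integral>\<^sup>+\<phi>. ennreal (exp (t * (\<Sum>z\<in>D. lap f z * \<phi> z)) * tw \<phi>) \<partial>flat U pin)"
proof -
  let ?X = "\<lambda>\<phi>. \<Sum>z\<in>D. lap f z * \<phi> z" and ?m = "gain D B h f k"
  have XX: "?X \<phi> * tw \<phi> = (\<Sum>z\<in>D. lap f z * (\<phi> z * tw \<phi>))" for \<phi>
    by (simp add: sum_distrib_right mult.assoc)
  have iX: "integrable (flat U pin) (\<lambda>\<phi>. ?X \<phi> * tw \<phi>)"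
    unfolding XX by (intro Bochner_Integration.integrable_sum integrable_mult_right integrable_site)
  have "(\<integral>\<phi>. ?X \<phi> * tw \<phi> \<partial>flat U pin) = (\<Sum>z\<in>D. lap f z * (mean z * mass))"
    unfolding XX mean_def using mass_pos integrable_site by simp
  also have "\<dots> = (\<Sum>z\<in>D. lap f z * mean z) * mass" by (simp add: sum_distrib_right mult.assoc)
  finally have mX: "?m * mass \<le> (\<integral>\<phi>. ?X \<phi> * tw \<phi> \<partial>flat U pin)"
    using mean_gain[OF f k] mass_pos by (simp add: mult_right_mono)
  define M where "M = (\<Sum>z\<in>D. lap f z)"
  have M: "0 \<le> M" "\<And>z. z \<in> D \<Longrightarrow> lap f z \<le> M"
    unfolding M_def using f(2) finD by (auto intro: sum_nonneg member_le_sum)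
  have iE: "integrable (flat U pin) (\<lambda>\<phi>. exp (t * ?X \<phi>) * tw \<phi>)"
  proof (rule integrable_tw[where A = "exp (t * M * (\<Sum>z\<in>K. h))" and c = "t * M"])
    fix \<phi> assume \<phi>: "\<And>z. z \<notin> U \<Longrightarrow> \<phi> z = pin z"
    have "?X \<phi> \<le> (\<Sum>z\<in>D. M * \<bar>\<phi> z\<bar>)"
    proof (rule sum_mono)
      fix z assume z: "z \<in> D"
      have "lap f z * \<phi> z \<le> lap f z * \<bar>\<phi> z\<bar>" using f(2)[OF z] by (intro mult_left_mono) auto
      also have "\<dots> \<le> M * \<bar>\<phi> z\<bar>" using M(2)[OF z] by (intro mult_right_mono) auto
      finally show "lap f z * \<phi> z \<le> M * \<bar>\<phi> z\<bar>" .
    qed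
    also have "\<dots> = M * ((\<Sum>z\<in>U. \<bar>\<phi> z\<bar>) + (\<Sum>z\<in>K. \<bar>\<phi> z\<bar>))"
      using finD KD unfolding U_def by (simp add: sum_distrib_left[symmetric] sum.subset_diff[of K D])
    also have "(\<Sum>z\<in>K. \<bar>\<phi> z\<bar>) = (\<Sum>z\<in>K. h)"
      using \<phi> h0 by (intro sum.cong) (auto simp: U_def pin_def)
    finally have "t * ?X \<phi> \<le> t * (M * ((\<Sum>z\<in>U. \<bar>\<phi> z\<bar>) + (\<Sum>z\<in>K. h)))"
      using \<open>0 \<le> t\<close> by (intro mult_left_mono)
    then show "\<bar>exp (t * ?X \<phi>)\<bar> \<le> exp (t * M * (\<Sum>z\<in>K. h)) * exp (t * M * (\<Sum>z\<in>U. \<bar>\<phi> z\<bar>))"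
      by (simp add: exp_add[symmetric] algebra_simps)
  qed auto
  have lin: "exp (t * ?m) * ((1 - t * ?m) * tw \<phi> + t * (?X \<phi> * tw \<phi>)) \<le> exp (t * ?X \<phi>) * tw \<phi>" for \<phi>
  proof -
    have "exp (t * ?m) * (1 + (t * ?X \<phi> - t * ?m)) \<le> exp (t * ?m) * exp (t * ?X \<phi> - t * ?m)"
      by (intro mult_left_mono exp_ge_add_one_self) simp
    then have "exp (t * ?m) * (1 + (t * ?X \<phi> - t * ?m)) * tw \<phi> \<le> exp (t * ?X \<phi>) * tw \<phi>"
      by (intro mult_right_mono tw_nonneg) (simp add: exp_diff)
    then show ?thesis by (simp add: algebra_simps)
  qed
  have "exp (t * ?m) * mass \<le> exp (t * ?m) * ((1 - t * ?m) * mass + t * (\<integral>\<phi>. ?X \<phi> * tw \<phi> \<partial>flat U pin))"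
    using mult_left_mono[OF mX \<open>0 \<le> t\<close>] by (intro mult_left_mono) (simp_all add: algebra_simps)
  also have "\<dots> = (\<integral>\<phi>. exp (t * ?m) * ((1 - t * ?m) * tw \<phi> + t * (?X \<phi> * tw \<phi>)) \<partial>flat U pin)"
    unfolding mass_def using integrable_tw0 iX by simp
  also have "\<dots> \<le> (\<integral>\<phi>. exp (t * ?X \<phi>) * tw \<phi> \<partial>flat U pin)"
    using integrable_tw0 iX iE lin by (intro integral_mono) auto
  finally have "ennreal (exp (t * ?m) * mass) \<le> ennreal (\<integral>\<phi>. exp (t * ?X \<phi>) * tw \<phi> \<partial>flat U pin)"
    by (rule ennreal_leI)
  also have "\<dots> = (\<integral>\<^sup>+\<phi>. ennreal (exp (t * ?X \<phi>) * tw \<phi>) \<partial>flat U pin)"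
    by (rule nn_integral_eq_integral[symmetric, OF iE]) (simp add: tw_nonneg)
  finally show ?thesis using mass_pos by (simp add: ennreal_mult)
qed

text \<open>The values on \<open>K\<close> may be any reals above \<open>h\<close>: increasing them only helps, by the four
  functions theorem again.\<close>

lemma tilt_above:
  assumes f: "\<And>z. z \<notin> D \<Longrightarrow> f z = 0" "\<And>z. z \<in> D \<Longrightarrow> 0 \<le> lap f z"
    and k: "\<And>z. z \<in> K \<Longrightarrow> k z = 1" "\<And>z. z \<notin> D \<Longrightarrow> k z = 0"
      "\<And>z. z \<in> D - K \<Longrightarrow> lap k z = 0" "\<And>z. 0 \<le> k z"
    and "0 \<le> t" and \<eta>: "\<And>z. z \<in> K \<Longrightarrow> h \<le> \<eta> z" "\<And>z. z \<notin> D \<Longrightarrow> \<eta> z = 0"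
  shows "ennreal (exp (t * gain D B h f k)) * (\<integral>\<^sup>+\<phi>. ennreal (tw \<phi>) \<partial>flat U \<eta>) \<le>
    (\<integral>\<^sup>+\<phi>. ennreal (exp (t * (\<Sum>z\<in>D. lap f z * \<phi> z)) * tw \<phi>) \<partial>flat U \<eta>)"
proof -
  let ?E = "\<lambda>\<phi>. exp (t * (\<Sum>z\<in>D. lap f z * \<phi> z))"
  let ?I = "\<integral>\<^sup>+\<phi>. ennreal (tw \<phi>) \<partial>flat U \<eta>" and ?J = "\<integral>\<^sup>+\<phi>. ennreal (?E \<phi> * tw \<phi>) \<partial>flat U \<eta>"
  have "?I * (\<integral>\<^sup>+\<phi>. ennreal (?E \<phi> * tw \<phi>) \<partial>flat U pin) \<le>
    (\<integral>\<^sup>+\<phi>. ennreal (?E \<phi> * tw \<phi>) \<partial>flat U (\<lambda>w. max (\<eta> w) (pin w))) *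
    (\<integral>\<^sup>+\<phi>. ennreal (tw \<phi>) \<partial>flat U (\<lambda>w. min (\<eta> w) (pin w)))"
  proof (rule four_functions[OF finU])
    fix a b :: "site \<Rightarrow> real"
    let ?M = "\<lambda>z. max (a z) (b z)" and ?m = "\<lambda>z. min (a z) (b z)"
    let ?i = "\<lambda>a. indicator {\<phi>. \<forall>y\<in>Y. \<phi> y < h} a :: real"
    have Eb: "?E b \<le> ?E ?M"
      using f(2) \<open>0 \<le> t\<close> by (intro exp_le_cancel_iff[THEN iffD2] mult_left_mono sum_mono) auto
    have "tw a * (?E b * tw b) = ?E b * (?i a * ?i b) * (gw D a * gw D b)"
      by (simp add: tw_def)
    also have "\<dots> \<le> ?E ?M * (?i ?M * ?i ?m) * (gw D ?M * gw D ?m)"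
      by (intro mult_mono[of "?E b * (?i a * ?i b)"] mult_mono[of "?E b"] gw_lattice Eb)
         (auto simp: indicator_def)
    also have "\<dots> = ?E ?M * tw ?M * tw ?m" by (simp add: tw_def)
    finally show "ennreal (tw a) * ennreal (?E b * tw b) \<le> ennreal (?E ?M * tw ?M) * ennreal (tw ?m)"
      by (simp add: ennreal_mult[symmetric] tw_nonneg ennreal_leI)
  qed measurable
  also have "flat U (\<lambda>w. max (\<eta> w) (pin w)) = flat U \<eta>"
  proof (rule flat_cong)
    fix z assume "z \<notin> U"
    then show "max (\<eta> z) (pin z) = \<eta> z" using \<eta>[of z] KD by (cases "z \<in> K") (auto simp: U_def pin_def)
  qed
  also have "flat U (\<lambda>w. min (\<eta> w) (pin w)) = flat U pin"
  proof (rule flat_cong)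
    fix z assume "z \<notin> U"
    then show "min (\<eta> z) (pin z) = pin z" using \<eta>[of z] KD by (cases "z \<in> K") (auto simp: U_def pin_def)
  qed
  finally have up: "?I * (\<integral>\<^sup>+\<phi>. ennreal (?E \<phi> * tw \<phi>) \<partial>flat U pin) \<le> ?J * ennreal mass"
    unfolding nn_integral_tw .
  have "?I * (ennreal (exp (t * gain D B h f k)) * ennreal mass) \<le> ?I * (\<integral>\<^sup>+\<phi>. ennreal (?E \<phi> * tw \<phi>) \<partial>flat U pin)"
    by (intro mult_left_mono tilt_pinned f k \<open>0 \<le> t\<close>) auto
  from order_trans[OF this up]
  have "ennreal mass * (ennreal (exp (t * gain D B h f k)) * ?I) \<le> ennreal mass * ?J"
    by (simp only: mult.commute mult.left_commute)
  then show ?thesis using mass_pos by (subst (asm) ennreal_mult_le_mult_iff) auto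
qed

definition cluster_event :: "(site \<Rightarrow> real) set" where
  "cluster_event = {\<phi>. (\<forall>z\<in>K. h \<le> \<phi> z) \<and> (\<forall>y\<in>Y. \<phi> y < h)}"

lemma measurable_cluster_event [measurable]: "cluster_event \<in> sets cfg"
proof -
  have "cluster_event = {\<phi>. \<forall>z\<in>K. h \<le> \<phi> z} \<inter> {\<phi>. \<forall>y\<in>Y. \<phi> y < h}" by (auto simp: cluster_event_def)
  then show ?thesis by simp
qed

text \<open>The event splits into the condition \<open>\<phi> \<ge> h\<close> on \<open>K\<close> and a truncation of the field outside; integrating the
  values on \<open>K\<close> last reduces the claim to \<open>tilt_above\<close>.\<close>

lemma cluster_tilt:
  assumes f: "\<And>z. z \<notin> D \<Longrightarrow> f z = 0" "\<And>z. z \<in> D \<Longrightarrow> 0 \<le> lap f z"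
    and k: "\<And>z. z \<in> K \<Longrightarrow> k z = 1" "\<And>z. z \<notin> D \<Longrightarrow> k z = 0"
      "\<And>z. z \<in> D - K \<Longrightarrow> lap k z = 0" "\<And>z. 0 \<le> k z"
    and "0 \<le> t"
  shows "ennreal (exp (t * gain D B h f k)) * (\<integral>\<^sup>+\<phi>. ennreal (gw D \<phi> * indicator cluster_event \<phi>) \<partial>flat D (\<lambda>_. 0)) \<le>
    (\<integral>\<^sup>+\<phi>. ennreal (exp (t * energy D f \<phi>) * gw D \<phi> * indicator cluster_event \<phi>) \<partial>flat D (\<lambda>_. 0))"
proof -
  let ?E = "\<lambda>\<phi>. exp (t * (\<Sum>z\<in>D. lap f z * \<phi> z))"
  have finK: "finite K" using KD finD finite_subset by auto
  have dec: "K \<inter> U = {}" "D = K \<union> U" using KD unfolding U_def by auto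
  have ind: "indicator cluster_event \<phi> = indicator {\<phi>. \<forall>z\<in>K. h \<le> \<phi> z} \<phi> * (indicator {\<phi>. \<forall>y\<in>Y. \<phi> y < h} \<phi> :: real)" for \<phi>
    by (auto simp: cluster_event_def indicator_def)
  have split: "(\<integral>\<^sup>+\<phi>. ennreal (F \<phi> * gw D \<phi> * indicator cluster_event \<phi>) \<partial>flat D (\<lambda>_. 0)) =
      (\<integral>\<^sup>+\<eta>. indicator {\<phi>. \<forall>z\<in>K. h \<le> \<phi> z} \<eta> * (\<integral>\<^sup>+\<phi>. ennreal (F \<phi> * tw \<phi>) \<partial>flat U \<eta>) \<partial>flat K (\<lambda>_. 0))"
    if [measurable]: "F \<in> borel_measurable cfg" and F0: "\<And>\<phi>. 0 \<le> F \<phi>" for F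
  proof -
    have "(\<integral>\<^sup>+\<phi>. ennreal (F \<phi> * gw D \<phi> * indicator cluster_event \<phi>) \<partial>flat U \<eta>) =
        indicator {\<phi>. \<forall>z\<in>K. h \<le> \<phi> z} \<eta> * (\<integral>\<^sup>+\<phi>. ennreal (F \<phi> * tw \<phi>) \<partial>flat U \<eta>)" for \<eta>
    proof -
      have "(\<integral>\<^sup>+\<phi>. ennreal (F \<phi> * gw D \<phi> * indicator cluster_event \<phi>) \<partial>flat U \<eta>) =
        (\<integral>\<^sup>+\<phi>. indicator {\<phi>. \<forall>z\<in>K. h \<le> \<phi> z} \<eta> * ennreal (F \<phi> * tw \<phi>) \<partial>flat U \<eta>)"
      proof (rule nn_integral_flat_cong)
        fix \<phi> assume "\<And>z. z \<notin> U \<Longrightarrow> \<phi> z = \<eta> z"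
        then have "(\<forall>z\<in>K. h \<le> \<phi> z) = (\<forall>z\<in>K. h \<le> \<eta> z)" using dec by (metis disjoint_iff)
        then show "ennreal (F \<phi> * gw D \<phi> * indicator cluster_event \<phi>) =
            indicator {\<phi>. \<forall>z\<in>K. h \<le> \<phi> z} \<eta> * ennreal (F \<phi> * tw \<phi>)"
          by (cases "\<forall>z\<in>K. h \<le> \<eta> z") (simp_all add: ind tw_def ac_simps)
      qed
      then show ?thesis by (simp add: nn_integral_cmult)
    qed
    moreover have "(\<lambda>\<phi>. ennreal (F \<phi> * gw D \<phi> * indicator cluster_event \<phi>)) \<in> borel_measurable cfg"
      by measurable
    ultimately show ?thesis
      using flat_union[OF finK finU dec(1), of "\<lambda>\<phi>. ennreal (F \<phi> * gw D \<phi> * indicator cluster_event \<phi>)" "\<lambda>_. 0"]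
      by (simp add: dec(2)[symmetric])
  qed
  have eE: "energy D f \<phi> = (\<Sum>z\<in>D. lap f z * \<phi> z)" if "\<And>z. z \<notin> D \<Longrightarrow> \<phi> z = 0" for \<phi>
    using that by (simp add: energy_green[OF finD] mult.commute)
  have m1 [measurable]: "(\<lambda>\<eta>. \<integral>\<^sup>+\<phi>. ennreal (tw \<phi>) \<partial>flat U \<eta>) \<in> borel_measurable cfg"
    by (rule measurable_nn_integral_flat[OF _ finU]) measurable
  have "ennreal (exp (t * gain D B h f k)) * (\<integral>\<^sup>+\<phi>. ennreal (gw D \<phi> * indicator cluster_event \<phi>) \<partial>flat D (\<lambda>_. 0)) =
    (\<integral>\<^sup>+\<eta>. ennreal (exp (t * gain D B h f k)) * (indicator {\<phi>. \<forall>z\<in>K. h \<le> \<phi> z} \<eta> * (\<integral>\<^sup>+\<phi>. ennreal (tw \<phi>) \<partial>flat U \<eta>)) \<partial>flat K (\<lambda>_. 0))"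
    using split[of "\<lambda>_. 1"] by (simp add: nn_integral_cmult)
  also have "\<dots> \<le> (\<integral>\<^sup>+\<eta>. indicator {\<phi>. \<forall>z\<in>K. h \<le> \<phi> z} \<eta> * (\<integral>\<^sup>+\<phi>. ennreal (?E \<phi> * tw \<phi>) \<partial>flat U \<eta>) \<partial>flat K (\<lambda>_. 0))"
  proof (rule nn_integral_flat_mono)
    fix \<eta> assume \<eta>: "\<And>z. z \<notin> K \<Longrightarrow> \<eta> z = (0::real)"
    show "ennreal (exp (t * gain D B h f k)) * (indicator {\<phi>. \<forall>z\<in>K. h \<le> \<phi> z} \<eta> * (\<integral>\<^sup>+\<phi>. ennreal (tw \<phi>) \<partial>flat U \<eta>))
      \<le> indicator {\<phi>. \<forall>z\<in>K. h \<le> \<phi> z} \<eta> * (\<integral>\<^sup>+\<phi>. ennreal (?E \<phi> * tw \<phi>) \<partial>flat U \<eta>)"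
    proof (cases "\<forall>z\<in>K. h \<le> \<eta> z")
      case True
      then show ?thesis using tilt_above[OF f k \<open>0 \<le> t\<close>, of \<eta>] \<eta> KD by (auto simp: indicator_def)
    qed simp
  qed
  also have "\<dots> = (\<integral>\<^sup>+\<phi>. ennreal (?E \<phi> * gw D \<phi> * indicator cluster_event \<phi>) \<partial>flat D (\<lambda>_. 0))"
    by (rule split[symmetric]) auto
  also have "\<dots> = (\<integral>\<^sup>+\<phi>. ennreal (exp (t * energy D f \<phi>) * gw D \<phi> * indicator cluster_event \<phi>) \<partial>flat D (\<lambda>_. 0))"
    by (rule nn_integral_flat_cong) (simp add: eE)
  finally show ?thesis .
qed

end

section \<open>A profile of small energy that decays slowly at the boundary\<close>

lemma sum_telescope_int:
  fixes T :: "int \<Rightarrow> real"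
  assumes "m \<le> n + 1"
  shows "(\<Sum>y=m..n. T y - T (y + 1)) = T m - T (n + 1)"
proof -
  have "(\<Sum>y=m..m + int k - 1. T y - T (y + 1)) = T m - T (m + int k)" for k
  proof (induction k)
    case (Suc k)
    have "{m..m + int (Suc k) - 1} = insert (m + int k) {m..m + int k - 1}" by auto
    then show ?case using Suc by (simp add: algebra_simps)
  qed simp
  from this[of "nat (n + 1 - m)"] show ?thesis using assms by simp
qed

text \<open>The even function on \<open>{-N..N}\<close> vanishing at \<open>\<plusminus>(N + 1)\<close> whose increments, counted from the boundary
  inwards, are \<open>a 1, a 2, \<dots>\<close>.\<close>

definition prof :: "(nat \<Rightarrow> real) \<Rightarrow> nat \<Rightarrow> int \<Rightarrow> real" where
  "prof a N y = (\<Sum>i=1..nat (int N + 1 - \<bar>y\<bar>). a i)"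

lemma prof_off: "int N < \<bar>y\<bar> \<Longrightarrow> prof a N y = 0"
  unfolding prof_def by simp

lemma prof_nonneg: "(\<And>i. 0 \<le> a i) \<Longrightarrow> 0 \<le> prof a N y"
  unfolding prof_def by (rule sum_nonneg) simp

lemma prof_diff_left:
  assumes "- int N \<le> y" "y \<le> 0"
  shows "prof a N y - prof a N (y - 1) = a (nat (int N + 1 + y))"
proof -
  have e: "nat (int N + 1 - \<bar>y\<bar>) = Suc (nat (int N + 1 - \<bar>y - 1\<bar>))"
    "nat (int N + 1 + y) = Suc (nat (int N + 1 - \<bar>y - 1\<bar>))" using assms by auto
  show ?thesis unfolding prof_def e by simp
qed

lemma prof_diff_right:
  assumes "1 \<le> y" "y \<le> int N + 1"
  shows "prof a N y - prof a N (y - 1) = - a (nat (int N + 2 - y))"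
proof -
  have e: "nat (int N + 1 - \<bar>y - 1\<bar>) = Suc (nat (int N + 1 - \<bar>y\<bar>))"
    "nat (int N + 2 - y) = Suc (nat (int N + 1 - \<bar>y\<bar>))" using assms by auto
  show ?thesis unfolding prof_def e by simp
qed

lemma prof_concave:
  assumes a: "\<And>i. 0 \<le> a i" "\<And>i. 1 \<le> i \<Longrightarrow> a (Suc i) \<le> a i" and "\<bar>y\<bar> \<le> int N"
  shows "0 \<le> 2 * prof a N y - prof a N (y + 1) - prof a N (y - 1)"
proof -
  consider "y \<le> - 1" | "y = 0" | "1 \<le> y" by linarith
  then show ?thesis
  proof cases
    case 1
    have e: "nat (int N + 1 + (y + 1)) = Suc (nat (int N + 1 + y))" "1 \<le> nat (int N + 1 + y)"
      using assms(3) by auto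
    show ?thesis
      using a(2)[OF e(2)] e(1) prof_diff_left[of N y a] prof_diff_left[of N "y + 1" a] 1 assms(3)
      by simp
  next
    case 2
    then show ?thesis
      using prof_diff_left[of N 0 a] prof_diff_right[of 1 N a] a(1)[of "nat (int N + 1)"]
        a(1)[of "nat (1 + int N)"] by simp
  next
    case 3
    have e: "nat (int N + 2 - y) = Suc (nat (int N + 2 - (y + 1)))" "1 \<le> nat (int N + 2 - (y + 1))"
      using assms(3) by auto
    show ?thesis
      using a(2)[OF e(2)] e(1) prof_diff_right[of y N a] prof_diff_right[of "y + 1" N a] 3 assms(3)
      by simp
  qed
qed

lemma prof_energy:
  "(\<Sum>y=- int N..int N. prof a N y * (2 * prof a N y - prof a N (y + 1) - prof a N (y - 1)))
     = 2 * (\<Sum>j=1..Suc N. (a j)\<^sup>2)"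
proof -
  let ?u = "prof a N"
  define d where "d y = ?u y - ?u (y - 1)" for y
  have "(\<Sum>y=- int N..int N. ?u y * (2 * ?u y - ?u (y + 1) - ?u (y - 1))) =
      (\<Sum>y=- int N..int N. (d y)\<^sup>2 + (?u (y - 1) * d y - ?u (y + 1 - 1) * d (y + 1)))"
    by (intro sum.cong refl) (simp add: d_def power2_eq_square algebra_simps)
  also have "\<dots> = (\<Sum>y=- int N..int N. (d y)\<^sup>2) + (\<Sum>y=- int N..int N. ?u (y - 1) * d y - ?u (y + 1 - 1) * d (y + 1))"
    by (rule sum.distrib)
  also have "(\<Sum>y=- int N..int N. ?u (y - 1) * d y - ?u (y + 1 - 1) * d (y + 1)) =
      ?u (- int N - 1) * d (- int N) - ?u (int N + 1 - 1) * d (int N + 1)"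
    by (rule sum_telescope_int) simp
  also have "\<dots> = (d (int N + 1))\<^sup>2"
    by (simp add: prof_off d_def power2_eq_square)
  also have "(\<Sum>y=- int N..int N. (d y)\<^sup>2) + (d (int N + 1))\<^sup>2 = (\<Sum>y\<in>{- int N..0} \<union> {1..int N + 1}. (d y)\<^sup>2)"
  proof -
    have "{- int N..0} \<union> {1..int N + 1} = insert (int N + 1) {- int N..int N}" by auto
    then show ?thesis by simp
  qed
  also have "\<dots> = (\<Sum>y=- int N..0. (d y)\<^sup>2) + (\<Sum>y=1..int N + 1. (d y)\<^sup>2)"
    by (rule sum.union_disjoint) auto
  also have "(\<Sum>y=- int N..0. (d y)\<^sup>2) = (\<Sum>j=1..Suc N. (a j)\<^sup>2)"
    by (rule sum.reindex_bij_witness[of _ "\<lambda>j. int j - int N - 1" "\<lambda>y. nat (int N + 1 + y)"])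
       (auto simp: d_def prof_diff_left)
  also have "(\<Sum>y=1..int N + 1. (d y)\<^sup>2) = (\<Sum>j=1..Suc N. (a j)\<^sup>2)"
    by (rule sum.reindex_bij_witness[of _ "\<lambda>j. int N + 2 - int j" "\<lambda>y. nat (int N + 2 - y)"])
       (auto simp: d_def prof_diff_right)
  finally show ?thesis by simp
qed

definition rt4 :: "nat \<Rightarrow> real" where "rt4 i = sqrt (sqrt (real i))"

lemma rt4_pos: "1 \<le> i \<Longrightarrow> 0 < rt4 i" and rt4_nonneg: "0 \<le> rt4 i" and rt4_sq: "(rt4 i)\<^sup>2 = sqrt (real i)"
  and rt4_4: "rt4 i ^ 4 = real i" and rt4_mono: "i \<le> j \<Longrightarrow> rt4 i \<le> rt4 j"
proof -
  show sq: "(rt4 i)\<^sup>2 = sqrt (real i)" unfolding rt4_def by simp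
  have "rt4 i ^ 4 = ((rt4 i)\<^sup>2)\<^sup>2" by (simp add: power_mult[symmetric])
  then show "rt4 i ^ 4 = real i" unfolding sq by simp
qed (auto simp: rt4_def)

text \<open>The sums of these increments grow like \<open>(i / (N + 1)) powr (3/4)\<close>. Fourth roots avoid real powers.\<close>

definition inc4 :: "nat \<Rightarrow> nat \<Rightarrow> real" where
  "inc4 N i = 1 / (rt4 i * rt4 (Suc N) ^ 3)"

lemma inc4_nonneg: "0 \<le> inc4 N i"
  unfolding inc4_def by (simp add: rt4_nonneg)

lemma inc4_antimono: "1 \<le> i \<Longrightarrow> i \<le> j \<Longrightarrow> inc4 N j \<le> inc4 N i"
  unfolding inc4_def using rt4_pos[of i] rt4_pos[of "Suc N"] rt4_mono[of i j]
  by (intro divide_left_mono mult_right_mono mult_pos_pos zero_less_power) auto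

lemma sum_inv_sqrt: "(\<Sum>i=1..n. 1 / sqrt (real i)) \<le> 2 * sqrt (real n)"
proof (induction n)
  case (Suc n)
  have "1 / sqrt (real (Suc n)) \<le> 2 * (sqrt (real (Suc n)) - sqrt (real n))"
  proof -
    have "(sqrt (real (Suc n)) - sqrt (real n)) * (sqrt (real (Suc n)) + sqrt (real n)) = 1"
      by (simp add: algebra_simps)
    moreover have "(sqrt (real (Suc n)) - sqrt (real n)) * (sqrt (real (Suc n)) + sqrt (real n))
        \<le> (sqrt (real (Suc n)) - sqrt (real n)) * (2 * sqrt (real (Suc n)))"
      by (intro mult_left_mono) auto
    ultimately show ?thesis by (simp add: field_simps)
  qed
  then show ?case using Suc by (simp add: algebra_simps)
qed simp

lemma inc4_squares: "(\<Sum>j=1..Suc N. (inc4 N j)\<^sup>2) \<le> 2 / real (Suc N)"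
proof -
  let ?n = "real (Suc N)"
  have n: "(rt4 (Suc N) ^ 3)\<^sup>2 = ?n * sqrt ?n"
  proof -
    have "(rt4 (Suc N) ^ 3)\<^sup>2 = rt4 (Suc N) ^ 4 * (rt4 (Suc N))\<^sup>2"
      by (simp add: power_mult[symmetric] power_add[symmetric])
    then show ?thesis unfolding rt4_4 rt4_sq .
  qed
  have "(\<Sum>j=1..Suc N. (inc4 N j)\<^sup>2) = (\<Sum>j=1..Suc N. 1 / sqrt (real j) * (1 / (?n * sqrt ?n)))"
    by (intro sum.cong refl)
       (simp only: inc4_def power_divide power_mult_distrib rt4_sq n power_one times_divide_times_eq mult_1)
  also have "\<dots> = (\<Sum>j=1..Suc N. 1 / sqrt (real j)) * (1 / (?n * sqrt ?n))"
    by (rule sum_distrib_right[symmetric])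
  also have "\<dots> \<le> (2 * sqrt ?n) * (1 / (?n * sqrt ?n))"
    by (intro mult_right_mono sum_inv_sqrt) simp
  also have "\<dots> = 2 / ?n" by simp
  finally show ?thesis .
qed

lemma sum_inv_rt4_cube: "(\<Sum>j=1..n. 1 / rt4 j ^ 3) \<le> 4 * rt4 n"
proof (induction n)
  case 0 then show ?case by (simp add: rt4_def)
next
  case (Suc n)
  let ?p = "rt4 n" and ?q = "rt4 (Suc n)"
  have pq: "0 \<le> ?p" "?p \<le> ?q" "0 < ?q" using rt4_nonneg rt4_mono rt4_pos by auto
  have "1 = ?q ^ 4 - ?p ^ 4" by (simp add: rt4_4)
  also have "\<dots> = (?q - ?p) * (?q ^ 3 + ?q\<^sup>2 * ?p + ?q * ?p\<^sup>2 + ?p ^ 3)"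
    by (simp add: algebra_simps power_numeral_reduce)
  also have "\<dots> \<le> (?q - ?p) * (?q ^ 3 + ?q\<^sup>2 * ?q + ?q * ?q\<^sup>2 + ?q ^ 3)"
  proof -
    have "?q\<^sup>2 * ?p \<le> ?q\<^sup>2 * ?q" "?p\<^sup>2 \<le> ?q\<^sup>2" "?p ^ 3 \<le> ?q ^ 3"
      using pq by (auto intro: mult_left_mono power_mono)
    moreover from this(2) have "?q * ?p\<^sup>2 \<le> ?q * ?q\<^sup>2" using pq by (intro mult_left_mono) auto
    ultimately show ?thesis using pq by (intro mult_left_mono add_mono order_refl) auto
  qed
  also have "\<dots> = 4 * (?q - ?p) * ?q ^ 3" by (simp add: power_numeral_reduce algebra_simps)
  finally have "1 / ?q ^ 3 \<le> 4 * (?q - ?p)" using pq by (simp add: field_simps)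
  then show ?case using Suc by simp
qed

lemma prof_inc4_bounds:
  assumes "\<bar>y\<bar> \<le> int N"
  shows "(prof (inc4 N) N y)\<^sup>2 \<le> 2" "0 < prof (inc4 N) N y"
    "1 / prof (inc4 N) N y \<le> rt4 (Suc N) ^ 3 * (1 / rt4 (nat (int N + 1 - \<bar>y\<bar>)) ^ 3)"
proof -
  define j where "j = nat (int N + 1 - \<bar>y\<bar>)"
  have j: "1 \<le> j" "j \<le> Suc N" using assms unfolding j_def by auto
  have p: "prof (inc4 N) N y = (\<Sum>i=1..j. inc4 N i)" unfolding prof_def j_def ..
  have "(\<Sum>i=1..j. inc4 N i)\<^sup>2 \<le> (\<Sum>i=1..j. (inc4 N i)\<^sup>2) * card {1..j}"
    by (rule sum_squared_le_sum_of_squares)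
  also have "\<dots> \<le> (\<Sum>i=1..Suc N. (inc4 N i)\<^sup>2) * real (Suc N)"
    using j by (intro mult_mono sum_mono2 sum_nonneg) auto
  also have "\<dots> \<le> 2 / real (Suc N) * real (Suc N)" by (intro mult_right_mono inc4_squares) simp
  also have "\<dots> = 2" by (simp del: of_nat_Suc)
  finally show "(prof (inc4 N) N y)\<^sup>2 \<le> 2" unfolding p .
  have "real j * inc4 N j = (\<Sum>i=1..j. inc4 N j)" by simp
  also have "\<dots> \<le> (\<Sum>i=1..j. inc4 N i)" by (intro sum_mono inc4_antimono) auto
  finally have lower: "real j * inc4 N j \<le> prof (inc4 N) N y" unfolding p .
  have pos: "0 < rt4 j" "0 < rt4 (Suc N)" using j rt4_pos by auto
  have eq: "real j * inc4 N j = rt4 j ^ 3 / rt4 (Suc N) ^ 3"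
    unfolding inc4_def rt4_4[symmetric] using pos by (simp add: field_simps power_numeral_reduce)
  have lb: "rt4 j ^ 3 / rt4 (Suc N) ^ 3 \<le> prof (inc4 N) N y" using lower eq by simp
  moreover have p3: "0 < rt4 j ^ 3 / rt4 (Suc N) ^ 3" using pos by simp
  ultimately show "0 < prof (inc4 N) N y" by linarith
  have "1 / prof (inc4 N) N y \<le> 1 / (rt4 j ^ 3 / rt4 (Suc N) ^ 3)"
    using lb p3 by (intro divide_left_mono mult_pos_pos) linarith+
  then show "1 / prof (inc4 N) N y \<le> rt4 (Suc N) ^ 3 * (1 / rt4 (nat (int N + 1 - \<bar>y\<bar>)) ^ 3)"
    unfolding j_def[symmetric] by simp
qed

lemma prof_inc4_inverse_sum: "(\<Sum>y=- int N..int N. 1 / prof (inc4 N) N y) \<le> 8 * real (Suc N)"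
proof -
  let ?c = "rt4 (Suc N) ^ 3"
  define S where "S = (\<Sum>j=1..Suc N. 1 / rt4 j ^ 3)"
  have "(\<Sum>y=- int N..int N. 1 / prof (inc4 N) N y) \<le>
      (\<Sum>y=- int N..int N. ?c * (1 / rt4 (nat (int N + 1 - \<bar>y\<bar>)) ^ 3))"
    by (intro sum_mono prof_inc4_bounds) auto
  also have "\<dots> = ?c * (\<Sum>y\<in>{- int N..0} \<union> {1..int N}. 1 / rt4 (nat (int N + 1 - \<bar>y\<bar>)) ^ 3)"
    unfolding sum_distrib_left by (rule sum.cong) auto
  also have "(\<Sum>y\<in>{- int N..0} \<union> {1..int N}. 1 / rt4 (nat (int N + 1 - \<bar>y\<bar>)) ^ 3) =
      (\<Sum>y=- int N..0. 1 / rt4 (nat (int N + 1 - \<bar>y\<bar>)) ^ 3) + (\<Sum>y=1..int N. 1 / rt4 (nat (int N + 1 - \<bar>y\<bar>)) ^ 3)"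
    by (rule sum.union_disjoint) auto
  also have "(\<Sum>y=- int N..0. 1 / rt4 (nat (int N + 1 - \<bar>y\<bar>)) ^ 3) = S"
    unfolding S_def
    by (rule sum.reindex_bij_witness[of _ "\<lambda>j. int j - int N - 1" "\<lambda>y. nat (int N + 1 + y)"]) auto
  also have "(\<Sum>y=1..int N. 1 / rt4 (nat (int N + 1 - \<bar>y\<bar>)) ^ 3) = (\<Sum>j=1..N. 1 / rt4 j ^ 3)"
    by (rule sum.reindex_bij_witness[of _ "\<lambda>j. int N + 1 - int j" "\<lambda>y. nat (int N + 1 - y)"]) auto
  also have "\<dots> \<le> S" unfolding S_def using rt4_nonneg by simp
  also have "?c * (S + S) \<le> ?c * (8 * rt4 (Suc N))"
    unfolding S_def using sum_inv_rt4_cube[of "Suc N"] rt4_nonneg by (intro mult_left_mono) auto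
  also have "\<dots> = 8 * rt4 (Suc N) ^ 4" by (simp add: power_numeral_reduce)
  finally show ?thesis unfolding rt4_4 using rt4_nonneg by (simp add: mult_left_mono)
qed

text \<open>The test function: a tent in the horizontal direction, times the profile
  \<open>(distance to the horizontal sides / N) powr (3/4)\<close> up to constants. The exponent \<open>3/4\<close> lies
  strictly between \<open>1/2\<close> (where the energy would diverge) and \<open>1\<close> (where the sum of inverses along
  a column would diverge).\<close>

definition test_fun :: "nat \<Rightarrow> site \<Rightarrow> real" where
  "test_fun N z = prof (\<lambda>_. 1 / real (Suc N)) N (fst z) * prof (inc4 N) N (snd z)"

lemma lattice_box_eq: "lattice_box (real N) = {- int N..int N} \<times> {- int N..int N}"
  unfolding lattice_box_def by auto

lemma finite_box [simp]: "finite (lattice_box (real N))"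
  unfolding lattice_box_eq by simp

lemma test_fun_off: "z \<notin> lattice_box (real N) \<Longrightarrow> test_fun N z = 0"
  unfolding lattice_box_eq test_fun_def by (cases z) (auto simp: prof_off)

lemma test_fun_nonneg: "0 \<le> test_fun N z"
  unfolding test_fun_def by (intro mult_nonneg_nonneg prof_nonneg inc4_nonneg) simp

lemma lap_test_fun:
  "lap (test_fun N) (x, y) =
    (prof (inc4 N) N y * (2 * prof (\<lambda>_. 1 / real (Suc N)) N x - prof (\<lambda>_. 1 / real (Suc N)) N (x + 1) - prof (\<lambda>_. 1 / real (Suc N)) N (x - 1)) +
     prof (\<lambda>_. 1 / real (Suc N)) N x * (2 * prof (inc4 N) N y - prof (inc4 N) N (y + 1) - prof (inc4 N) N (y - 1))) / 4"
  unfolding lap_def lavg_def sum_nbrs test_fun_def by (simp add: field_simps)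

lemma lap_test_fun_nonneg: "z \<in> lattice_box (real N) \<Longrightarrow> 0 \<le> lap (test_fun N) z"
  unfolding lattice_box_eq
  by (cases z) (auto simp: lap_test_fun intro!: add_nonneg_nonneg mult_nonneg_nonneg prof_nonneg
      prof_concave inc4_nonneg inc4_antimono)

lemma tent_le_1: "prof (\<lambda>_. 1 / real (Suc N)) N x \<le> 1"
  unfolding prof_def by (simp add: field_simps)

lemma energy_test_fun: "energy (lattice_box (real N)) (test_fun N) (test_fun N) \<le> 4"
proof -
  let ?D = "lattice_box (real N)" and ?I = "{- int N..int N}" and ?n = "real (Suc N)"
  let ?g = "prof (\<lambda>_. 1 / ?n) N" and ?b = "prof (inc4 N) N"
  define G where "G x = ?g x * (2 * ?g x - ?g (x + 1) - ?g (x - 1))" for x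
  define H where "H y = ?b y * (2 * ?b y - ?b (y + 1) - ?b (y - 1))" for y
  have cardI: "real (card ?I) \<le> 2 * ?n" by simp
  have "energy ?D (test_fun N) (test_fun N) = (\<Sum>z\<in>?D. test_fun N z * lap (test_fun N) z)"
    by (rule energy_green) (auto simp: test_fun_off)
  also have "\<dots> = (\<Sum>x\<in>?I. \<Sum>y\<in>?I. (G x * (?b y)\<^sup>2 + (?g x)\<^sup>2 * H y) / 4)"
    unfolding lattice_box_eq sum.cartesian_product
  proof (intro sum.cong refl)
    fix z assume "z \<in> ?I \<times> ?I"
    obtain x y where "z = (x, y)" by (cases z)
    then show "test_fun N z * lap (test_fun N) z = (case z of (x, y) \<Rightarrow> (G x * (?b y)\<^sup>2 + (?g x)\<^sup>2 * H y) / 4)"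
      unfolding G_def H_def by (simp add: lap_test_fun test_fun_def power2_eq_square algebra_simps)
  qed
  also have "\<dots> = ((\<Sum>x\<in>?I. G x) * (\<Sum>y\<in>?I. (?b y)\<^sup>2) + (\<Sum>x\<in>?I. (?g x)\<^sup>2) * (\<Sum>y\<in>?I. H y)) / 4"
    by (simp add: sum_product sum.distrib sum_divide_distrib[symmetric])
  also have "(\<Sum>x\<in>?I. G x) = 2 / ?n"
    unfolding G_def prof_energy by (simp add: power2_eq_square del: of_nat_Suc)
  also have "(\<Sum>y\<in>?I. H y) = 2 * (\<Sum>j=1..Suc N. (inc4 N j)\<^sup>2)" unfolding H_def by (rule prof_energy)
  also have "(2 / ?n * (\<Sum>y\<in>?I. (?b y)\<^sup>2) + (\<Sum>x\<in>?I. (?g x)\<^sup>2) * (2 * (\<Sum>j=1..Suc N. (inc4 N j)\<^sup>2))) / 4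
      \<le> (2 / ?n * (\<Sum>y\<in>?I. 2) + (\<Sum>x\<in>?I. 1) * (2 * (2 / ?n))) / 4"
  proof (intro divide_right_mono add_mono mult_mono sum_mono mult_left_mono inc4_squares)
    show "(?b y)\<^sup>2 \<le> 2" if "y \<in> ?I" for y using that by (intro prof_inc4_bounds) auto
    show "(?g x)\<^sup>2 \<le> 1" for x
      using tent_le_1[of N x] prof_nonneg[of "\<lambda>_. 1 / ?n" N x] by (simp add: power_le_one)
  qed (auto intro!: sum_nonneg mult_nonneg_nonneg add_nonneg_nonneg)
  also have "(\<Sum>y\<in>?I. 2) = (2 * real (card ?I) :: real)" by simp
  also have "(\<Sum>x\<in>?I. 1) = (real (card ?I) :: real)" by simp
  also have "(2 / ?n * (2 * real (card ?I)) + real (card ?I) * (2 * (2 / ?n))) / 4 = 2 * (real (card ?I) / ?n)"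
  proof -
    have "(2 / n * (2 * c) + c * (2 * (2 / n))) / 4 = 2 * (c / n)" for c n :: real
    proof -
      have "2 / n * (2 * c) = 4 * (c / n)" "c * (2 * (2 / n)) = 4 * (c / n)" by simp_all
      then show ?thesis by simp
    qed
    then show ?thesis .
  qed
  also have "\<dots> \<le> 2 * (2 * ?n / ?n)" using cardI by (intro mult_left_mono divide_right_mono) auto
  also have "\<dots> = 4" by (simp del: of_nat_Suc)
  finally show ?thesis .
qed

lemma test_fun_left_side: "(\<Sum>z\<in>left_side (real N). test_fun N z) \<le> 4"
proof -
  have sub: "left_side (real N) \<subseteq> {- int N} \<times> {- int N..int N}"
  proof
    fix z assume z: "z \<in> left_side (real N)"
    moreover have "(- int N, 0) \<in> lattice_box (real N)" unfolding lattice_box_eq by auto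
    ultimately have "fst z \<le> fst (- int N, 0 :: int)" "z \<in> lattice_box (real N)"
      unfolding left_side_def by blast+
    then show "z \<in> {- int N} \<times> {- int N..int N}" unfolding lattice_box_eq by (cases z) auto
  qed
  have "(\<Sum>z\<in>left_side (real N). test_fun N z) \<le> (\<Sum>z\<in>{- int N} \<times> {- int N..int N}. test_fun N z)"
    using sub by (intro sum_mono2) (auto simp: test_fun_nonneg)
  also have "\<dots> \<le> (\<Sum>z\<in>{- int N} \<times> {- int N..int N}. 2 / real (Suc N))"
  proof (intro sum_mono)
    fix z assume z: "z \<in> {- int N} \<times> {- int N..int N}"
    have "prof (inc4 N) N (snd z) \<le> 2"
    proof (rule power2_le_imp_le)
      have "\<bar>snd z\<bar> \<le> int N" using z by (cases z) (simp add: abs_le_iff)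
      from prof_inc4_bounds(1)[OF this] show "(prof (inc4 N) N (snd z))\<^sup>2 \<le> 2\<^sup>2" by simp
    qed simp
    moreover have "prof (\<lambda>_. 1 / real (Suc N)) N (fst z) = 1 / real (Suc N)"
      using z unfolding prof_def by (cases z) simp
    ultimately show "test_fun N z \<le> 2 / real (Suc N)"
      unfolding test_fun_def by (simp add: divide_right_mono del: of_nat_Suc)
  qed
  also have "\<dots> \<le> 4" by (simp add: card_cartesian_product field_simps)
  finally show ?thesis .
qed

text \<open>A cluster that contains a crossing of the box of radius \<open>N\<close> or \<open>N/2\<close> meets every column of the central
  half; this is all that is used of a crossing.\<close>

definition spans :: "nat \<Rightarrow> site set \<Rightarrow> bool" where
  "spans N K \<longleftrightarrow> (\<forall>x. 2 * \<bar>x\<bar> \<le> int N \<longrightarrow> (\<exists>y. (x, y) \<in> K))"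

text \<open>Since \<open>k\<close> is \<open>1\<close> on \<open>K\<close> and harmonic elsewhere, the sum equals \<open>energy D k (f * k)\<close>, and, \<open>f\<close> being
  superharmonic, this dominates the energy of \<open>k\<close> weighted by \<open>f\<close>. Along each central column \<open>k\<close> drops from \<open>1\<close> to \<open>0\<close>,
  which costs weighted energy of order \<open>1/N\<close> by the Cauchy--Schwarz inequality.\<close>

lemma hitting_lower_bound:
  assumes N: "1 \<le> N" and K: "K \<subseteq> lattice_box (real N)" "spans N K"
    and k: "\<And>z. z \<in> K \<Longrightarrow> k z = 1" "\<And>z. z \<notin> lattice_box (real N) \<Longrightarrow> k z = 0"
      "\<And>z. z \<in> lattice_box (real N) - K \<Longrightarrow> lap k z = 0" "\<And>z. 0 \<le> k z" "\<And>z. z \<in> K \<Longrightarrow> 0 \<le> lap k z"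
  shows "1 / 512 \<le> (\<Sum>z\<in>lattice_box (real N). lap (test_fun N) z * k z)"
proof -
  let ?D = "lattice_box (real N)" and ?f = "test_fun N" and ?n = "real (Suc N)"
  let ?I = "{- int N..int N}" and ?J = "{x. 2 * \<bar>x\<bar> \<le> int N}"
  let ?h = "\<lambda>u v. (?f u + ?f v) * (k u - k v)\<^sup>2"
  have hnn: "0 \<le> ?h u v" for u v using test_fun_nonneg by (intro mult_nonneg_nonneg add_nonneg_nonneg) auto
  have finJ: "finite ?J" by (rule finite_subset[of _ "{- int N..int N}"]) auto
  \<comment> \<open>a discrete product rule; the second summand becomes the energy of \<open>f\<close> and \<open>k\<^sup>2\<close>\<close>
  have pt: "(k u - k v) * (?f u * k u - ?f v * k v) = ?h u v / 2 + (?f u - ?f v) * ((k u)\<^sup>2 - (k v)\<^sup>2) / 2" for u v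
    by (simp add: power2_eq_square field_simps)
  have "energy ?D k (\<lambda>z. ?f z * k z) =
      ((\<Sum>(u, v)\<in>darts ?D. ?h u v) / 2 + (\<Sum>(u, v)\<in>darts ?D. (?f u - ?f v) * ((k u)\<^sup>2 - (k v)\<^sup>2)) / 2) / 8"
    unfolding energy_def pt split_beta sum.distrib sum_divide_distrib[symmetric] ..
  also have "\<dots> = (\<Sum>(u, v)\<in>darts ?D. ?h u v) / 16 + energy ?D ?f (\<lambda>z. (k z)\<^sup>2) / 2"
    unfolding energy_def by simp
  also have "energy ?D ?f (\<lambda>z. (k z)\<^sup>2) = (\<Sum>z\<in>?D. (k z)\<^sup>2 * lap ?f z)"
    by (rule energy_green) (auto simp: k(2))
  finally have "(\<Sum>(u, v)\<in>darts ?D. ?h u v) / 16 \<le> energy ?D k (\<lambda>z. ?f z * k z)"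
    using lap_test_fun_nonneg by (simp add: sum_nonneg)
  also have "\<dots> = (\<Sum>z\<in>?D. ?f z * k z * lap k z)"
    by (rule energy_green) (auto simp: k(2))
  also have "\<dots> = (\<Sum>z\<in>?D. ?f z * lap k z)"
  proof (intro sum.cong refl)
    fix z assume "z \<in> ?D"
    then show "?f z * k z * lap k z = ?f z * lap k z" using k(1)[of z] k(3)[of z] by (cases "z \<in> K") auto
  qed
  also have "\<dots> = energy ?D k ?f" by (rule energy_green[symmetric]) (auto simp: test_fun_off)
  also have "\<dots> = (\<Sum>z\<in>?D. k z * lap ?f z)"
    by (subst energy_sym, rule energy_green) (auto simp: k(2))
  finally have main: "(\<Sum>(u, v)\<in>darts ?D. ?h u v) / 16 \<le> (\<Sum>z\<in>?D. lap ?f z * k z)"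
    by (simp add: mult.commute)
  define col where "col x y = ((x, y), (x, y + 1))" for x y :: int
  have injc: "inj_on (\<lambda>(x, y). col x y) (?J \<times> ?I)" by (auto simp: inj_on_def col_def)
  have subc: "(\<lambda>(x, y). col x y) ` (?J \<times> ?I) \<subseteq> darts ?D"
    unfolding darts_def lattice_box_eq adjacent_def col_def by auto
  have "(\<Sum>x\<in>?J. \<Sum>y\<in>?I. ?h (x, y) (x, y + 1)) = (\<Sum>(x, y)\<in>?J \<times> ?I. ?h (x, y) (x, y + 1))"
    by (rule sum.cartesian_product)
  also have "\<dots> = (\<Sum>(u, v)\<in>(\<lambda>(x, y). col x y) ` (?J \<times> ?I). ?h u v)"
    by (subst sum.reindex[OF injc]) (auto simp: col_def intro!: sum.cong)
  also have "\<dots> \<le> (\<Sum>(u, v)\<in>darts ?D. ?h u v)"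
    using subc hnn by (intro sum_mono2 finite_darts) auto
  finally have cols: "(\<Sum>x\<in>?J. \<Sum>y\<in>?I. ?h (x, y) (x, y + 1)) \<le> (\<Sum>(u, v)\<in>darts ?D. ?h u v)" .
  have column: "1 / (16 * ?n) \<le> (\<Sum>y\<in>?I. ?h (x, y) (x, y + 1))" if x: "x \<in> ?J" for x
  proof -
    obtain y0 where y0: "(x, y0) \<in> K" using K(2) x unfolding spans_def by auto
    then have y0I: "y0 \<in> ?I" using K(1) unfolding lattice_box_eq by auto
    let ?L = "{y0..int N}"
    let ?d = "\<lambda>y. k (x, y) - k (x, y + 1)"
    have LI: "?L \<subseteq> ?I" using y0I by auto
    have half: "1 / 2 \<le> prof (\<lambda>_. 1 / ?n) N x"
      unfolding prof_def using x by (auto simp: field_simps)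
    have fpos: "0 < ?f (x, y)" "1 / ?f (x, y) \<le> 2 * (1 / prof (inc4 N) N y)" if "y \<in> ?I" for y
    proof -
      have y: "\<bar>y\<bar> \<le> int N" using that by auto
      note b = prof_inc4_bounds(2)[OF y]
      show "0 < ?f (x, y)" unfolding test_fun_def using half b by simp
      have "1 / 2 * prof (inc4 N) N y \<le> ?f (x, y)"
        unfolding test_fun_def using half b by (simp add: mult_right_mono)
      then have "1 / ?f (x, y) \<le> 1 / (1 / 2 * prof (inc4 N) N y)"
        using b by (intro divide_left_mono) auto
      then show "1 / ?f (x, y) \<le> 2 * (1 / prof (inc4 N) N y)" by simp
    qed
    have "(\<Sum>y\<in>?L. ?d y) = k (x, y0) - k (x, int N + 1)"
      using sum_telescope_int[of y0 "int N" "\<lambda>y. k (x, y)"] y0I by simp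
    then have "1 = (\<Sum>y\<in>?L. ?d y)\<^sup>2"
      using k(1)[OF y0] k(2)[of "(x, int N + 1)"] unfolding lattice_box_eq by simp
    also have "\<dots> = (\<Sum>y\<in>?L. (sqrt (?f (x, y)) * ?d y) * (1 / sqrt (?f (x, y))))\<^sup>2"
    proof (intro arg_cong[of _ _ "\<lambda>s. s\<^sup>2"] sum.cong refl)
      fix y assume "y \<in> ?L"
      then have "0 < sqrt (?f (x, y))" using fpos(1)[of y] LI by auto
      then show "?d y = sqrt (?f (x, y)) * ?d y * (1 / sqrt (?f (x, y)))" by simp
    qed
    also have "\<dots> \<le> (\<Sum>y\<in>?L. (sqrt (?f (x, y)) * ?d y)\<^sup>2) * (\<Sum>y\<in>?L. (1 / sqrt (?f (x, y)))\<^sup>2)"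
      by (rule Cauchy_Schwarz_ineq_sum)
    also have "\<dots> = (\<Sum>y\<in>?L. ?f (x, y) * (?d y)\<^sup>2) * (\<Sum>y\<in>?L. 1 / ?f (x, y))"
      using test_fun_nonneg by (simp add: power_mult_distrib power_divide)
    also have "\<dots> \<le> (\<Sum>y\<in>?I. ?h (x, y) (x, y + 1)) * (16 * ?n)"
    proof (intro mult_mono)
      have "(\<Sum>y\<in>?L. ?f (x, y) * (?d y)\<^sup>2) \<le> (\<Sum>y\<in>?L. ?h (x, y) (x, y + 1))"
        using test_fun_nonneg by (intro sum_mono mult_right_mono) auto
      also have "\<dots> \<le> (\<Sum>y\<in>?I. ?h (x, y) (x, y + 1))"
        using LI hnn by (intro sum_mono2) auto
      finally show "(\<Sum>y\<in>?L. ?f (x, y) * (?d y)\<^sup>2) \<le> (\<Sum>y\<in>?I. ?h (x, y) (x, y + 1))" .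
      have "(\<Sum>y\<in>?L. 1 / ?f (x, y)) \<le> (\<Sum>y\<in>?I. 1 / ?f (x, y))"
        using LI test_fun_nonneg by (intro sum_mono2) auto
      also have "\<dots> \<le> (\<Sum>y\<in>?I. 2 * (1 / prof (inc4 N) N y))"
        by (intro sum_mono fpos)
      also have "\<dots> \<le> 16 * ?n"
        using prof_inc4_inverse_sum[of N] unfolding sum_distrib_left[symmetric] by simp
      finally show "(\<Sum>y\<in>?L. 1 / ?f (x, y)) \<le> 16 * ?n" .
    qed (auto intro!: sum_nonneg hnn test_fun_nonneg)
    finally show ?thesis by (simp add: field_simps)
  qed
  have "{- int (N div 2)..int (N div 2)} \<subseteq> ?J" by auto
  then have "card {- int (N div 2)..int (N div 2)} \<le> card ?J" using finJ by (rule card_mono[rotated])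
  then have "real N \<le> real (card ?J)" by simp
  moreover have "?n \<le> 2 * real N" using N by simp
  ultimately have "1 / 32 \<le> real (card ?J) * (1 / (16 * ?n))"
    using N by (simp add: field_simps)
  also have "\<dots> = (\<Sum>x\<in>?J. 1 / (16 * ?n))" by simp
  also have "\<dots> \<le> (\<Sum>x\<in>?J. \<Sum>y\<in>?I. ?h (x, y) (x, y + 1))" by (intro sum_mono column)
  also note cols
  finally show ?thesis using main by simp
qed

section \<open>The Gaussian free field\<close>

definition gauss_mass :: "site set \<Rightarrow> real" where
  "gauss_mass D = (\<integral>\<phi>. gw D \<phi> \<partial>flat D (\<lambda>_. 0))"

text \<open>The Gaussian free field with zero boundary values. Its covariance is the inverse of \<open>lap\<close> on \<open>D\<close>, the
  Green function of the walk with jump rate \<open>1/4\<close> along every edge, killed outside \<open>D\<close>.\<close>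

definition gff :: "site set \<Rightarrow> (site \<Rightarrow> real) measure" where
  "gff D = density (flat D (\<lambda>_. 0)) (\<lambda>\<phi>. ennreal (gw D \<phi> / gauss_mass D))"

lemma gauss_mass:
  assumes "finite D"
  shows "(\<integral>\<^sup>+\<phi>. ennreal (gw D \<phi>) \<partial>flat D (\<lambda>_. 0)) = ennreal (gauss_mass D)" "0 < gauss_mass D"
proof -
  have "integrable (flat D (\<lambda>_. 0)) (gw D)"
    by (rule integrable_flat[OF assms subset_refl, where A = 1 and c = 0]) auto
  then show 1: "(\<integral>\<^sup>+\<phi>. ennreal (gw D \<phi>) \<partial>flat D (\<lambda>_. 0)) = ennreal (gauss_mass D)"
    unfolding gauss_mass_def by (rule nn_integral_eq_integral) simp
  have "0 < (\<integral>\<^sup>+\<phi>. ennreal (gw D \<phi>) \<partial>flat D (\<lambda>_. 0))"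
    by (rule nn_integral_flat_pos[OF assms measurable_gw]) (rule gw_pos)
  then show "0 < gauss_mass D" unfolding 1 by simp
qed

lemma sets_gff [simp, measurable_cong]: "sets (gff D) = sets cfg"
  unfolding gff_def by simp

lemma space_gff [simp]: "space (gff D) = UNIV"
  unfolding gff_def by simp

lemma nn_integral_gff:
  assumes [measurable]: "F \<in> borel_measurable cfg"
  shows "(\<integral>\<^sup>+\<phi>. F \<phi> \<partial>gff D) = (\<integral>\<^sup>+\<phi>. ennreal (gw D \<phi> / gauss_mass D) * F \<phi> \<partial>flat D (\<lambda>_. 0))"
  unfolding gff_def by (rule nn_integral_density) measurable

lemma nn_integral_gff':
  assumes "finite D" and m [measurable]: "F \<in> borel_measurable cfg" and F: "\<And>\<phi>. 0 \<le> F \<phi>"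
  shows "(\<integral>\<^sup>+\<phi>. ennreal (F \<phi>) \<partial>gff D) =
    ennreal (1 / gauss_mass D) * (\<integral>\<^sup>+\<phi>. ennreal (F \<phi> * gw D \<phi>) \<partial>flat D (\<lambda>_. 0))"
proof -
  have "(\<integral>\<^sup>+\<phi>. ennreal (F \<phi>) \<partial>gff D) =
      (\<integral>\<^sup>+\<phi>. ennreal (1 / gauss_mass D) * ennreal (F \<phi> * gw D \<phi>) \<partial>flat D (\<lambda>_. 0))"
    using gauss_mass(2)[OF assms(1)] F
    by (subst nn_integral_gff) (auto intro!: nn_integral_cong simp: ennreal_mult[symmetric] mult_ac)
  then show ?thesis by (simp add: nn_integral_cmult)
qed

lemma prob_space_gff: assumes "finite D" shows "prob_space (gff D)"
proof
  have "emeasure (gff D) (space (gff D)) = (\<integral>\<^sup>+\<phi>. ennreal 1 \<partial>gff D)" by simp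
  also have "\<dots> = ennreal (1 / gauss_mass D) * ennreal (gauss_mass D)"
    using nn_integral_gff'[OF assms, of "\<lambda>_. 1"] gauss_mass(1)[OF assms] by simp
  also have "\<dots> = 1" using gauss_mass(2)[OF assms] by (simp add: ennreal_mult[symmetric])
  finally show "emeasure (gff D) (space (gff D)) = 1" .
qed

lemma AE_gff:
  assumes "finite D"
  shows "AE \<phi> in gff D. \<forall>z. z \<notin> D \<longrightarrow> \<phi> z = 0"
  unfolding gff_def using AE_flat[of D "\<lambda>_. 0"] by (subst AE_density) auto

lemma gff_tilt:
  assumes "finite D" "\<And>z. z \<notin> D \<Longrightarrow> f z = 0"
  shows "(\<integral>\<^sup>+\<phi>. ennreal (exp (energy D f \<phi>)) \<partial>gff D) = ennreal (exp (energy D f f / 2))"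
proof -
  have "(\<integral>\<^sup>+\<phi>. ennreal (exp (energy D f \<phi>)) \<partial>gff D) =
      ennreal (1 / gauss_mass D) * (ennreal (exp (energy D f f / 2)) * ennreal (gauss_mass D))"
    by (subst nn_integral_gff'[OF assms(1)])
       (simp_all add: gauss_tilt[OF assms(1,1,2)] gauss_mass(1)[OF assms(1)])
  then show ?thesis using gauss_mass(2)[OF assms(1)] by (simp add: ennreal_mult[symmetric])
qed

lemma gff_uminus:
  assumes "finite D" "{\<phi>. P \<phi>} \<in> sets cfg"
  shows "measure (gff D) {\<phi>. P (\<lambda>z. - \<phi> z)} = measure (gff D) {\<phi>. P \<phi>}"
proof -
  have g: "gw D (\<lambda>z. - \<phi> z) = gw D \<phi>" for \<phi> unfolding gw_def energy_def by (simp add: algebra_simps)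
  let ?F = "\<lambda>\<phi>. ennreal (gw D \<phi> / gauss_mass D) * indicator {\<phi>. P \<phi>} \<phi>"
  have [measurable]: "{\<phi>. P \<phi>} \<in> sets cfg" by fact
  have "(\<lambda>\<phi> z. - \<phi> z) \<in> measurable cfg cfg" by (rule measurable_cfgI) measurable
  from measurable_sets[OF this assms(2)] have [measurable]: "{\<phi>. P (\<lambda>z. - \<phi> z)} \<in> sets cfg"
    by (simp add: vimage_def)
  have "emeasure (gff D) {\<phi>. P (\<lambda>z. - \<phi> z)} = (\<integral>\<^sup>+\<phi>. ?F (\<lambda>z. - \<phi> z) \<partial>flat D (\<lambda>_. 0))"
    unfolding gff_def by (subst emeasure_density) (auto simp: g indicator_def intro!: nn_integral_cong)
  also have "\<dots> = (\<integral>\<^sup>+\<phi>. ?F \<phi> \<partial>flat D (\<lambda>_. 0))"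
    using flat_uminus[OF assms(1), of ?F "\<lambda>_. 0"] by simp
  also have "\<dots> = emeasure (gff D) {\<phi>. P \<phi>}"
    unfolding gff_def by (subst emeasure_density) auto
  finally show ?thesis unfolding measure_def by simp
qed

lemma gff_reindex:
  assumes "finite D" "inj \<sigma>" "\<sigma> ` D = D" "\<And>u v. adjacent (\<sigma> u) (\<sigma> v) \<longleftrightarrow> adjacent u v" "surj \<sigma>"
    and "{\<phi>. P \<phi>} \<in> sets cfg"
  shows "measure (gff D) {\<phi>. P (\<lambda>z. \<phi> (\<sigma> z))} = measure (gff D) {\<phi>. P \<phi>}"
proof -
  have D: "\<sigma> u \<in> D \<longleftrightarrow> u \<in> D" for u using assms(3) inj_image_mem_iff[OF assms(2)] by metis
  have bij: "bij_betw (\<lambda>(u, v). (\<sigma> u, \<sigma> v)) (darts D) (darts D)"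
  proof (rule bij_betw_imageI)
    show "inj_on (\<lambda>(u, v). (\<sigma> u, \<sigma> v)) (darts D)" 
    proof (rule inj_onI)
      fix e e' assume "(case e of (u, v) \<Rightarrow> (\<sigma> u, \<sigma> v)) = (case e' of (u, v) \<Rightarrow> (\<sigma> u, \<sigma> v))"
      then have "\<sigma> (fst e) = \<sigma> (fst e')" "\<sigma> (snd e) = \<sigma> (snd e')" by (simp_all only: split_beta prod.inject)
      then have "fst e = fst e'" "snd e = snd e'" using assms(2) by (simp_all only: inj_eq)
      then show "e = e'" by (rule prod_eqI)
    qed
    show "(\<lambda>(u, v). (\<sigma> u, \<sigma> v)) ` darts D = darts D"
    proof (intro equalityI subsetI)
      fix e assume "e \<in> darts D"
      obtain u v where e: "e = (\<sigma> u, \<sigma> v)" using assms(5) by (metis surj_def surj_pair)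
      with \<open>e \<in> darts D\<close> have "(u, v) \<in> darts D" unfolding darts_def using assms(4) D by auto
      then show "e \<in> (\<lambda>(u, v). (\<sigma> u, \<sigma> v)) ` darts D" using e by force
    next
      fix e assume "e \<in> (\<lambda>(u, v). (\<sigma> u, \<sigma> v)) ` darts D"
      then obtain u v where "(u, v) \<in> darts D" "e = (\<sigma> u, \<sigma> v)" by auto
      then show "e \<in> darts D" unfolding darts_def using assms(4) D by auto
    qed
  qed
  have g: "gw D (\<lambda>z. \<phi> (\<sigma> z)) = gw D \<phi>" for \<phi>
    using sum.reindex_bij_betw[OF bij, of "\<lambda>(u, v). (\<phi> u - \<phi> v) * (\<phi> u - \<phi> v)"]
    unfolding gw_def energy_def by (simp add: split_beta)
  let ?F = "\<lambda>\<phi>. ennreal (gw D \<phi> / gauss_mass D) * indicator {\<phi>. P \<phi>} \<phi>"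
  have [measurable]: "{\<phi>. P \<phi>} \<in> sets cfg" by fact
  have "(\<lambda>\<phi> z. \<phi> (\<sigma> z)) \<in> measurable cfg cfg" by (rule measurable_cfgI) measurable
  from measurable_sets[OF this assms(6)] have [measurable]: "{\<phi>. P (\<lambda>z. \<phi> (\<sigma> z))} \<in> sets cfg"
    by (simp add: vimage_def)
  have "emeasure (gff D) {\<phi>. P (\<lambda>z. \<phi> (\<sigma> z))} = (\<integral>\<^sup>+\<phi>. ?F (\<lambda>z. \<phi> (\<sigma> z)) \<partial>flat (\<sigma> ` D) (\<lambda>_. 0))"
    unfolding gff_def assms(3) by (subst emeasure_density) (auto simp: g indicator_def intro!: nn_integral_cong)
  also have "\<dots> = (\<integral>\<^sup>+\<phi>. ?F \<phi> \<partial>flat D (\<lambda>_. 0))"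
    using flat_reindex[OF assms(1,2), of ?F "\<lambda>_. 0"] by simp
  also have "\<dots> = emeasure (gff D) {\<phi>. P \<phi>}"
    unfolding gff_def by (subst emeasure_density) auto
  finally show ?thesis unfolding measure_def by simp
qed

text \<open>The gradient is \<open>energy D f \<phi>\<close> for a difference \<open>f\<close> of Green functions. Its variance \<open>V\<close>, the energy of \<open>f\<close>, is also
  the gradient of \<open>f\<close> across the edge; hence \<open>V\<^sup>2 \<le> 4 * V\<close>.\<close>

lemma gff_gradient_tail:
  assumes "finite D" "v \<in> nbrs u" "u \<in> D" "v \<in> D" "0 \<le> r"
  shows "measure (gff D) {\<phi>. r \<le> \<phi> u - \<phi> v} \<le> exp (- r\<^sup>2 / 8)"
proof -
  interpret prob_space "gff D" by (rule prob_space_gff[OF assms(1)])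
  obtain a where a: "\<forall>z. z \<notin> D \<longrightarrow> a z = 0" "\<forall>z\<in>D. lap a z = (if z = u then 1 else 0)"
    using poisson_indicator[OF assms(1), of "\<lambda>z. z = u"] by blast
  obtain b where b: "\<forall>z. z \<notin> D \<longrightarrow> b z = 0" "\<forall>z\<in>D. lap b z = (if z = v then 1 else 0)"
    using poisson_indicator[OF assms(1), of "\<lambda>z. z = v"] by blast
  define f where "f z = a z - b z" for z
  have f0: "z \<notin> D \<Longrightarrow> f z = 0" for z using a(1) b(1) unfolding f_def by (metis diff_0_right)
  have eval: "energy D f \<phi> = \<phi> u - \<phi> v" if "\<And>z. z \<notin> D \<Longrightarrow> \<phi> z = 0" for \<phi>
  proof -
    have "energy D f \<phi> = (\<Sum>z\<in>D. \<phi> z * lap f z)" using that by (rule energy_green[OF assms(1)])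
    also have "\<dots> = (\<Sum>z\<in>D. (if z = u then \<phi> z else 0) - (if z = v then \<phi> z else 0))"
      unfolding f_def lap_diff using a(2) b(2) by (intro sum.cong refl) (simp add: right_diff_distrib)
    also have "\<dots> = \<phi> u - \<phi> v" using assms by (simp add: sum_subtractf sum.delta)
    finally show ?thesis .
  qed
  have V: "energy D f f \<le> 4"
  proof -
    have "(energy D f f)\<^sup>2 \<le> 4 * energy D f f"
      using energy_edge[OF assms(1,2), of f] assms eval[of f] f0 by simp
    then show ?thesis using energy_nonneg[of D f] by (cases "energy D f f = 0") (auto simp: power2_eq_square)
  qed
  have "{\<phi>. r \<le> \<phi> u - \<phi> v} = {\<phi> \<in> space cfg. r \<le> \<phi> u - \<phi> v}" by simp
  also have "\<dots> \<in> sets cfg" by measurable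
  finally have [measurable]: "{\<phi>. r \<le> \<phi> u - \<phi> v} \<in> sets cfg" .
  \<comment> \<open>the minimiser of \<open>t\<^sup>2 * 4 / 2 - t * r\<close>\<close>
  let ?t = "r / 4"
  have "ennreal (exp (?t * r)) * emeasure (gff D) {\<phi>. r \<le> \<phi> u - \<phi> v} =
      (\<integral>\<^sup>+\<phi>. ennreal (exp (?t * r)) * indicator {\<phi>. r \<le> \<phi> u - \<phi> v} \<phi> \<partial>gff D)"
    by (simp add: nn_integral_cmult_indicator)
  also have "\<dots> \<le> (\<integral>\<^sup>+\<phi>. ennreal (exp (energy D (\<lambda>z. ?t * f z) \<phi>)) \<partial>gff D)"
  proof (rule nn_integral_mono_AE)
    show "AE \<phi> in gff D. ennreal (exp (?t * r)) * indicator {\<phi>. r \<le> \<phi> u - \<phi> v} \<phi> \<le>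
        ennreal (exp (energy D (\<lambda>z. ?t * f z) \<phi>))"
      using AE_gff[OF assms(1)]
    proof eventually_elim
      case (elim \<phi>)
      then have "energy D (\<lambda>z. ?t * f z) \<phi> = ?t * (\<phi> u - \<phi> v)" 
      proof -
        have "energy D f \<phi> = \<phi> u - \<phi> v" using elim by (intro eval) blast
        then show ?thesis by (simp only: energy_cmult_left)
      qed
      then show ?case using assms(5) by (auto simp: indicator_def intro!: ennreal_leI mult_left_mono)
    qed
  qed
  also have "\<dots> = ennreal (exp (?t\<^sup>2 * energy D f f / 2))"
  proof -
    have "energy D (\<lambda>z. ?t * f z) (\<lambda>z. ?t * f z) = ?t\<^sup>2 * energy D f f"
      by (simp only: energy_cmult_left energy_cmult_right power2_eq_square mult.assoc)
    moreover have "(\<integral>\<^sup>+\<phi>. ennreal (exp (energy D (\<lambda>z. ?t * f z) \<phi>)) \<partial>gff D) =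
        ennreal (exp (energy D (\<lambda>z. ?t * f z) (\<lambda>z. ?t * f z) / 2))"
      by (rule gff_tilt[OF assms(1)]) (simp add: f0)
    ultimately show ?thesis by (simp only:)
  qed
  also have "\<dots> \<le> ennreal (exp (?t\<^sup>2 * 4 / 2))"
    using mult_left_mono[OF V, of "?t\<^sup>2"] by (intro ennreal_leI) (simp add: mult.commute)
  finally have "exp (?t * r) * measure (gff D) {\<phi>. r \<le> \<phi> u - \<phi> v} \<le> exp (?t\<^sup>2 * 4 / 2)"
    by (simp add: emeasure_eq_measure ennreal_mult[symmetric])
  then have "measure (gff D) {\<phi>. r \<le> \<phi> u - \<phi> v} \<le> exp (?t\<^sup>2 * 4 / 2) / exp (?t * r)"
    by (simp add: field_simps)
  also have "\<dots> = exp (- r\<^sup>2 / 8)"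
    unfolding exp_diff[symmetric] by (rule arg_cong[of _ _ exp]) (simp add: power2_eq_square)
  finally show ?thesis .
qed

section \<open>Exploration of a level-set cluster\<close>

inductive_set reach :: "site set \<Rightarrow> site set \<Rightarrow> site set" for S A where
  start: "z \<in> S \<Longrightarrow> z \<in> A \<Longrightarrow> z \<in> reach S A"
| step: "z \<in> reach S A \<Longrightarrow> w \<in> nbrs z \<Longrightarrow> w \<in> A \<Longrightarrow> w \<in> reach S A"

lemma reach_subset: "z \<in> reach S A \<Longrightarrow> z \<in> A"
  by (induction rule: reach.induct) auto

definition cluster :: "site set \<Rightarrow> site set \<Rightarrow> real \<Rightarrow> (site \<Rightarrow> real) \<Rightarrow> site set" where
  "cluster S D h \<phi> = reach S {z \<in> D. h \<le> \<phi> z}"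

text \<open>On the event that the explored cluster equals \<open>K\<close> the tilted measure gains a factor
  \<open>exp (t * m)\<close>. These events are disjoint, so that the gains add up: no union bound over clusters
  is needed.\<close>

lemma cluster_bound:
  assumes "finite D" "B \<subseteq> S" "S \<subseteq> D" "\<And>y. y \<in> B \<Longrightarrow> nbrs y - D \<noteq> {}" "0 \<le> h"
    and f: "\<And>z. z \<notin> D \<Longrightarrow> f z = 0" "\<And>z. z \<in> D \<Longrightarrow> 0 \<le> lap f z"
    and V: "energy D f f \<le> V" "0 < V" and "0 \<le> m"
    and gain: "\<And>K k. \<lbrakk>K \<subseteq> D; P K; \<And>z. z \<in> K \<Longrightarrow> k z = 1; \<And>z. z \<notin> D \<Longrightarrow> k z = 0;
      \<And>z. z \<in> D - K \<Longrightarrow> lap k z = 0; \<And>z. 0 \<le> k z; \<And>z. z \<in> K \<Longrightarrow> 0 \<le> lap k z\<rbrakk>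
      \<Longrightarrow> m \<le> gain D B h f k"
    and start: "\<And>K. P K \<Longrightarrow> S - B \<subseteq> K"
  shows "{\<phi>. P (cluster S D h \<phi>)} \<in> sets cfg"
    and "measure (gff D) {\<phi>. P (cluster S D h \<phi>)} \<le> exp (- m\<^sup>2 / (2 * V))"
proof -
  interpret prob_space "gff D" by (rule prob_space_gff[OF assms(1)])
  let ?C = "cluster S D h"
  define \<K> where "\<K> = {K \<in> Pow D. P K \<and> (\<exists>\<phi>. ?C \<phi> = K)}"
  define E where "E K = pinned.cluster_event D K B h" for K
  have fin: "finite \<K>" unfolding \<K>_def using assms(1) by auto
  have pin: "pinned D K B h" if "K \<in> \<K>" for K
    using that assms unfolding \<K>_def by unfold_locales auto
  have CD: "?C \<phi> \<subseteq> {z \<in> D. h \<le> \<phi> z}" for \<phi> unfolding cluster_def using reach_subset by blast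
  \<comment> \<open>as \<open>P K\<close> forces \<open>S - B \<subseteq> K\<close>, the only starting vertices outside \<open>K\<close> are in \<open>B\<close> and thus recorded in \<open>Y\<close>\<close>
  have event: "{\<phi>. ?C \<phi> = K} = E K" if K: "K \<in> \<K>" for K
  proof (intro equalityI subsetI)
    interpret pinned D K B h by (rule pin[OF K])
    fix \<phi> assume "\<phi> \<in> {\<phi>. ?C \<phi> = K}"
    then have C: "?C \<phi> = K" by simp
    have "\<phi> y < h" if y: "y \<in> Y" for y
    proof (rule ccontr)
      assume "\<not> \<phi> y < h"
      then have A: "y \<in> {z \<in> D. h \<le> \<phi> z}" using y YU UD by auto
      have "y \<in> ?C \<phi>"
      proof (cases "y \<in> B")
        case True
        then show ?thesis unfolding cluster_def using A assms(2) by (intro reach.start) auto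
      next
        case False
        then obtain x where "x \<in> nbrs y" "x \<in> K" using y unfolding Y_def by auto
        then show ?thesis using A C nbrs_sym unfolding cluster_def by (metis reach.step)
      qed
      then show False using y C unfolding Y_def by auto
    qed
    then show "\<phi> \<in> E K" unfolding E_def cluster_event_def using CD[of \<phi>] C by auto
  next
    interpret pinned D K B h by (rule pin[OF K])
    fix \<phi> assume "\<phi> \<in> E K"
    then have \<phi>: "\<And>z. z \<in> K \<Longrightarrow> h \<le> \<phi> z" "\<And>y. y \<in> Y \<Longrightarrow> \<phi> y < h"
      unfolding E_def cluster_event_def by auto
    obtain \<phi>0 where \<phi>0: "reach S {z \<in> D. h \<le> \<phi>0 z} = K" and PK: "P K"
      using K unfolding \<K>_def cluster_def by auto
    have "z \<in> ?C \<phi>" if "z \<in> reach S {z \<in> D. h \<le> \<phi>0 z}" for z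
      using that
    proof (induction rule: reach.induct)
      case (start z)
      have "z \<in> K" using reach.start[OF start] unfolding \<phi>0 .
      then have "z \<in> {z \<in> D. h \<le> \<phi> z}" using \<phi>(1) KD by auto
      then show ?case unfolding cluster_def by (rule reach.start[OF start(1)])
    next
      case (step z w)
      have "w \<in> K" using reach.step[OF step(1,2,3)] unfolding \<phi>0 .
      then have "w \<in> {z \<in> D. h \<le> \<phi> z}" using \<phi>(1) KD by auto
      then show ?case using reach.step[OF step(4)[unfolded cluster_def] step(2)] unfolding cluster_def by blast
    qed
    moreover have "z \<in> K" if "z \<in> reach S {z \<in> D. h \<le> \<phi> z}" for z
      using that
    proof (induction rule: reach.induct)
      case (start z)
      show ?case
      proof (rule ccontr)
        assume "z \<notin> K"
        moreover from this have "z \<in> B" using start(1) assms(12)[OF PK] by blast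
        ultimately have "z \<in> Y" unfolding Y_def by blast
        then show False using \<phi>(2)[of z] start(2) by simp
      qed
    next
      case (step z w)
      show ?case
      proof (rule ccontr)
        assume "w \<notin> K"
        moreover have "w \<in> D" "h \<le> \<phi> w" using step(3) by simp_all
        moreover have "z \<in> nbrs w" using step(2) nbrs_sym[of z w] by simp
        ultimately have "w \<in> Y" using step(4) unfolding Y_def by blast
        then show False using \<phi>(2)[of w] \<open>h \<le> \<phi> w\<close> by simp
      qed
    qed
    ultimately show "\<phi> \<in> {\<phi>. ?C \<phi> = K}" using \<phi>0 unfolding cluster_def by auto
  qed
  have Em [measurable]: "E K \<in> sets cfg" if "K \<in> \<K>" for K
    unfolding E_def by (rule pinned.measurable_cluster_event[OF pin[OF that]])
  have un: "{\<phi>. P (?C \<phi>)} = (\<Union>K\<in>\<K>. E K)"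
  proof (intro equalityI subsetI)
    fix \<phi> assume "\<phi> \<in> {\<phi>. P (?C \<phi>)}"
    then have "?C \<phi> \<in> \<K>" unfolding \<K>_def using CD[of \<phi>] by auto
    then show "\<phi> \<in> (\<Union>K\<in>\<K>. E K)" using event[of "?C \<phi>"] by auto
  next
    fix \<phi> assume "\<phi> \<in> (\<Union>K\<in>\<K>. E K)"
    then obtain K where K: "K \<in> \<K>" "\<phi> \<in> E K" by blast
    then have "?C \<phi> = K" using event[OF K(1)] by blast
    moreover have "P K" using K(1) unfolding \<K>_def by blast
    ultimately show "\<phi> \<in> {\<phi>. P (?C \<phi>)}" by simp
  qed
  show meas: "{\<phi>. P (?C \<phi>)} \<in> sets cfg" unfolding un using fin Em by auto
  have disj: "disjoint_family_on E \<K>"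
    unfolding disjoint_family_on_def using event by blast
  \<comment> \<open>the minimiser of \<open>t\<^sup>2 * V / 2 - t * m\<close>\<close>
  define t where "t = m / V"
  have t0: "0 \<le> t" unfolding t_def using \<open>0 \<le> m\<close> V by simp
  let ?G = "ennreal (1 / gauss_mass D)"
  have one: "ennreal (exp (t * m)) * emeasure (gff D) (E K) \<le> (\<integral>\<^sup>+\<phi>. ennreal (exp (t * energy D f \<phi>) * indicator (E K) \<phi>) \<partial>gff D)"
    if K: "K \<in> \<K>" for K
  proof -
    interpret pinned D K B h by (rule pin[OF K])
    have KD': "K \<subseteq> D" "P K" using K unfolding \<K>_def by auto
    obtain k where k: "\<And>z. z \<in> K \<Longrightarrow> k z = 1" "\<And>z. z \<notin> D \<Longrightarrow> k z = 0"
      "\<And>z. z \<in> D - K \<Longrightarrow> lap k z = 0" "\<And>z. 0 \<le> k z" "\<And>z. k z \<le> 1" "\<And>z. z \<in> K \<Longrightarrow> 0 \<le> lap k z"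
      using hitting_potential[OF KD'(1)] by metis
    note [measurable] = Em[OF K]
    have "emeasure (gff D) (E K) = (\<integral>\<^sup>+\<phi>. ennreal (indicator (E K) \<phi>) \<partial>gff D)"
      unfolding ennreal_indicator using Em[OF K] by (subst nn_integral_indicator) simp_all
    also have "\<dots> = ?G * (\<integral>\<^sup>+\<phi>. ennreal (gw D \<phi> * indicator (E K) \<phi>) \<partial>flat D (\<lambda>_. 0))"
      by (subst nn_integral_gff'[OF assms(1)]) (simp_all add: mult.commute)
    finally have "ennreal (exp (t * m)) * emeasure (gff D) (E K) =
        ?G * (ennreal (exp (t * m)) * (\<integral>\<^sup>+\<phi>. ennreal (gw D \<phi> * indicator (E K) \<phi>) \<partial>flat D (\<lambda>_. 0)))"
      by (simp only: mult.left_commute)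
    also have "\<dots> \<le> ?G * (ennreal (exp (t * gain D B h f k)) * (\<integral>\<^sup>+\<phi>. ennreal (gw D \<phi> * indicator (E K) \<phi>) \<partial>flat D (\<lambda>_. 0)))"
      using t0 by (intro mult_left_mono mult_right_mono ennreal_leI)
        (auto intro!: mult_left_mono assms(11)[OF KD'] k)
    also have "\<dots> \<le> ?G * (\<integral>\<^sup>+\<phi>. ennreal (exp (t * energy D f \<phi>) * gw D \<phi> * indicator (E K) \<phi>) \<partial>flat D (\<lambda>_. 0))"
      unfolding E_def by (intro mult_left_mono cluster_tilt f k t0) auto
    also have "\<dots> = (\<integral>\<^sup>+\<phi>. ennreal (exp (t * energy D f \<phi>) * indicator (E K) \<phi>) \<partial>gff D)"
      by (subst nn_integral_gff'[OF assms(1)]) (simp_all add: ac_simps)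
    finally show ?thesis .
  qed
  have "ennreal (exp (t * m)) * emeasure (gff D) {\<phi>. P (?C \<phi>)} = (\<Sum>K\<in>\<K>. ennreal (exp (t * m)) * emeasure (gff D) (E K))"
    unfolding un using fin Em disj by (subst sum_emeasure[symmetric]) (auto simp: sum_distrib_left)
  also have "\<dots> \<le> (\<Sum>K\<in>\<K>. \<integral>\<^sup>+\<phi>. ennreal (exp (t * energy D f \<phi>) * indicator (E K) \<phi>) \<partial>gff D)"
    by (intro sum_mono one)
  also have "\<dots> = (\<integral>\<^sup>+\<phi>. (\<Sum>K\<in>\<K>. ennreal (exp (t * energy D f \<phi>) * indicator (E K) \<phi>)) \<partial>gff D)"
    by (rule nn_integral_sum[symmetric]) measurable
  also have "\<dots> \<le> (\<integral>\<^sup>+\<phi>. ennreal (exp (energy D (\<lambda>z. t * f z) \<phi>)) \<partial>gff D)"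
  proof (rule nn_integral_mono)
    fix \<phi>
    have "(\<Sum>K\<in>\<K>. indicator (E K) \<phi>) \<le> (1 :: real)"
    proof (cases "\<phi> \<in> (\<Union>K\<in>\<K>. E K)")
      case True
      then obtain K where "K \<in> \<K>" "\<phi> \<in> E K" by auto
      then have "(\<Sum>L\<in>\<K>. indicator (E L) \<phi>) = (\<Sum>L\<in>\<K>. if L = K then 1 else 0 :: real)"
        using disj unfolding disjoint_family_on_def by (intro sum.cong) (auto simp: indicator_def)
      then show ?thesis using fin by simp
    next
      case False
      then show ?thesis by (simp add: indicator_def)
    qed
    then have "exp (t * energy D f \<phi>) * (\<Sum>K\<in>\<K>. indicator (E K) \<phi>) \<le> exp (t * energy D f \<phi>) * 1"
      by (intro mult_left_mono) auto
    then show "(\<Sum>K\<in>\<K>. ennreal (exp (t * energy D f \<phi>) * indicator (E K) \<phi>)) \<le> ennreal (exp (energy D (\<lambda>z. t * f z) \<phi>))"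
      by (subst sum_ennreal) (auto simp: sum_distrib_left energy_cmult_left intro!: ennreal_leI)
  qed
  also have "\<dots> = ennreal (exp (t\<^sup>2 * energy D f f / 2))"
  proof -
    have "energy D (\<lambda>z. t * f z) (\<lambda>z. t * f z) = t\<^sup>2 * energy D f f"
      by (simp only: energy_cmult_left energy_cmult_right power2_eq_square mult.assoc)
    moreover have "(\<integral>\<^sup>+\<phi>. ennreal (exp (energy D (\<lambda>z. t * f z) \<phi>)) \<partial>gff D) =
        ennreal (exp (energy D (\<lambda>z. t * f z) (\<lambda>z. t * f z) / 2))"
      by (rule gff_tilt[OF assms(1)]) (simp add: f(1))
    ultimately show ?thesis by (simp only:)
  qed
  also have "\<dots> \<le> ennreal (exp (t\<^sup>2 * V / 2))"
    using V by (intro ennreal_leI) (simp add: mult_left_mono)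
  finally have "exp (t * m) * measure (gff D) {\<phi>. P (?C \<phi>)} \<le> exp (t\<^sup>2 * V / 2)"
    by (simp add: emeasure_eq_measure ennreal_mult[symmetric])
  then have "measure (gff D) {\<phi>. P (?C \<phi>)} \<le> exp (t\<^sup>2 * V / 2) / exp (t * m)"
    by (simp add: field_simps)
  also have "\<dots> = exp (- m\<^sup>2 / (2 * V))"
    unfolding exp_diff[symmetric] t_def using V by (intro arg_cong[of _ _ exp]) (simp add: power2_eq_square field_simps)
  finally show "measure (gff D) {\<phi>. P (?C \<phi>)} \<le> exp (- m\<^sup>2 / (2 * V))" .
qed

lemma reach_start: "w \<in> reach S A \<Longrightarrow> \<exists>z\<in>S. z \<in> reach S A"
  by (induction rule: reach.induct) (blast intro: reach.start)+

lemma left_side_fst: "z \<in> left_side (real N) \<Longrightarrow> z \<in> lattice_box (real N) \<and> fst z = - int N"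
proof -
  assume z: "z \<in> left_side (real N)"
  moreover have "(- int N, 0) \<in> lattice_box (real N)" unfolding lattice_box_eq by auto
  ultimately have "fst z \<le> fst (- int N, 0 :: int)" "z \<in> lattice_box (real N)"
    unfolding left_side_def by blast+
  then show ?thesis unfolding lattice_box_eq by (cases z) auto
qed

text \<open>Exploring from the left side also reveals the vertices of that side below \<open>h\<close>; as the test function is of order
  \<open>1/N\<close> there, their total effect is bounded. Exploring from a single vertex reveals nothing besides the
  cluster, and the cluster is empty unless this vertex belongs to it. The sum in \<open>gain\<close> is at least
  \<open>1/512\<close>, and the condition on \<open>h\<close> makes half of its contribution absorb the losses, so that \<open>m = h / 1024\<close>
  is admissible; the energy of the test function gives \<open>V = 4\<close>.\<close>

lemma spanning_cluster_bound:
  assumes N: "1 \<le> N" and h: "(32 + 4096) * loss \<le> h"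
    and S: "S = left_side (real N) \<or> S = {z} \<and> z \<in> lattice_box (real N)"
  shows "{\<phi>. spans N (cluster S (lattice_box (real N)) h \<phi>)} \<in> sets cfg" (is ?T1)
    and "measure (gff (lattice_box (real N))) {\<phi>. spans N (cluster S (lattice_box (real N)) h \<phi>)}
      \<le> exp (- (h / 1024)\<^sup>2 / 8)" (is ?T2)
proof -
  let ?D = "lattice_box (real N)"
  define B where "B = (if S = left_side (real N) then S else {})"
  have l0: "0 < loss" unfolding loss_def by (simp add: add_pos_pos)
  have SD: "S \<subseteq> ?D" using S left_side_fst by blast
  have BS: "B \<subseteq> S" unfolding B_def by auto
  have Bf: "(\<Sum>z\<in>B. test_fun N z) \<le> 4" unfolding B_def using test_fun_left_side by auto
  have Bout: "nbrs y - ?D \<noteq> {}" if "y \<in> B" for y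
  proof -
    have "fst y = - int N" using that left_side_fst[of y N] unfolding B_def by (auto split: if_splits)
    then have "(fst y - 1, snd y) \<in> nbrs y - ?D" unfolding nbrs_def lattice_box_eq by auto
    then show ?thesis by blast
  qed
  let ?P = "\<lambda>K. spans N K \<and> S - B \<subseteq> K"
  have nonempty: "S - B \<subseteq> cluster S ?D h \<phi>" if "spans N (cluster S ?D h \<phi>)" for \<phi>
  proof (cases "S = left_side (real N)")
    case True then show ?thesis unfolding B_def by auto
  next
    case False
    then have z: "S = {z}" using S by auto
    obtain y where "(0, y) \<in> cluster S ?D h \<phi>" using \<open>spans N _\<close> unfolding spans_def by force
    then have "\<exists>z\<in>S. z \<in> cluster S ?D h \<phi>" unfolding cluster_def by (rule reach_start)
    then show ?thesis unfolding z by auto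
  qed
  then have eq: "{\<phi>. spans N (cluster S ?D h \<phi>)} = {\<phi>. ?P (cluster S ?D h \<phi>)}" by blast
  have gain: "h / 1024 \<le> gain ?D B h (test_fun N) k"
    if "K \<subseteq> ?D" "?P K" "\<And>z. z \<in> K \<Longrightarrow> k z = 1" "\<And>z. z \<notin> ?D \<Longrightarrow> k z = 0"
      "\<And>z. z \<in> ?D - K \<Longrightarrow> lap k z = 0" "\<And>z. 0 \<le> k z" "\<And>z. z \<in> K \<Longrightarrow> 0 \<le> lap k z" for K k
  proof -
    have "1 / 512 \<le> (\<Sum>z\<in>?D. lap (test_fun N) z * k z)"
      using that by (intro hitting_lower_bound[OF N, of K k]) auto
    then have "(h - 16 * loss) * (1 / 512) \<le> (h - 16 * loss) * (\<Sum>z\<in>?D. lap (test_fun N) z * k z)"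
      using h l0 by (intro mult_left_mono) auto
    moreover have "loss * (\<Sum>z\<in>B. test_fun N z) \<le> loss * 4" using Bf l0 by (intro mult_left_mono) auto
    ultimately show ?thesis unfolding gain_def using h by simp
  qed
  have h0: "0 \<le> h" using h l0 by (meson less_eq_real_def mult_nonneg_nonneg order_trans zero_le_numeral add_nonneg_nonneg)
  note * = cluster_bound[OF finite_box BS SD Bout h0 test_fun_off lap_test_fun_nonneg energy_test_fun,
      where P = ?P and m = "h / 1024"]
  show ?T1 unfolding eq by (rule *(1)) (use gain h0 in auto)
  have "measure (gff ?D) {\<phi>. ?P (cluster S ?D h \<phi>)} \<le> exp (- (h / 1024)\<^sup>2 / (2 * 4))"
    by (rule *(2)) (use gain h0 in auto)
  then show ?T2 unfolding eq by simp
qed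

section \<open>Lattice crossings\<close>

lemma path_in_reach:
  assumes "successively adjacent p" "set p \<subseteq> A" "p \<noteq> []" "hd p \<in> reach S A"
  shows "set p \<subseteq> reach S A"
  using assms
proof (induction p)
  case (Cons a p)
  show ?case
  proof (cases p)
    case Nil then show ?thesis using Cons by simp
  next
    case (Cons b l)
    then have "b \<in> nbrs a" "b \<in> A" "a \<in> reach S A"
      using Cons.prems by (auto simp: adjacent_iff_nbrs)
    then have "b \<in> reach S A" by (metis reach.step)
    then show ?thesis using Cons.IH Cons.prems Cons by simp
  qed
qed simp

lemma path_meets_column:
  assumes "successively adjacent p" "p \<noteq> []" "fst (hd p) \<le> x" "x \<le> fst (last p)"
  shows "\<exists>y. (x, y) \<in> set p"
  using assms
proof (induction p)
  case (Cons a p)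
  show ?case
  proof (cases "fst a = x")
    case True then show ?thesis by (metis list.set_intros(1) prod.collapse)
  next
    case False
    then obtain b l where p: "p = b # l" using Cons.prems by (cases p) auto
    then have "adjacent a b" using Cons.prems by simp
    then have "fst b \<le> fst a + 1" unfolding adjacent_def by simp
    then have "\<exists>y. (x, y) \<in> set p" using Cons False p by simp
    then show ?thesis by auto
  qed
qed simp

lemma side_coordinates:
  assumes "0 \<le> r"
  shows "z \<in> left_side r \<Longrightarrow> z \<in> lattice_box r \<and> fst z = - \<lfloor>r\<rfloor>"
    and "z \<in> right_side r \<Longrightarrow> z \<in> lattice_box r \<and> fst z = \<lfloor>r\<rfloor>"
proof -
  have r: "real_of_int \<lfloor>r\<rfloor> \<le> r" "0 \<le> \<lfloor>r\<rfloor>" using assms by auto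
  have in_box: "(- \<lfloor>r\<rfloor>, 0) \<in> lattice_box r" "(\<lfloor>r\<rfloor>, 0) \<in> lattice_box r"
    unfolding lattice_box_def using r assms by auto
  have bound: "\<bar>fst z\<bar> \<le> \<lfloor>r\<rfloor>" if "z \<in> lattice_box r" for z
    using that unfolding lattice_box_def by (auto simp: le_floor_iff)
  show "z \<in> lattice_box r \<and> fst z = - \<lfloor>r\<rfloor>" if "z \<in> left_side r"
  proof -
    have "z \<in> lattice_box r" "fst z \<le> fst (- \<lfloor>r\<rfloor>, 0 :: int)" using that in_box unfolding left_side_def by blast+
    then show ?thesis using bound[of z] by simp
  qed
  show "z \<in> lattice_box r \<and> fst z = \<lfloor>r\<rfloor>" if "z \<in> right_side r"
  proof -
    have "z \<in> lattice_box r" "fst (\<lfloor>r\<rfloor>, 0 :: int) \<le> fst z" using that in_box unfolding right_side_def by blast+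
    then show ?thesis using bound[of z] by simp
  qed
qed

lemma crossing_reach:
  assumes "0 \<le> r" "crossing r A"
  obtains z where "z \<in> left_side r" "z \<in> A"
    "\<And>x S. \<lbrakk>\<bar>x\<bar> \<le> \<lfloor>r\<rfloor>; z \<in> S\<rbrakk> \<Longrightarrow> \<exists>y. (x, y) \<in> reach S A"
proof -
  obtain p where p: "p \<noteq> []" "successively adjacent p" "set p \<subseteq> A \<inter> lattice_box r"
    "hd p \<in> left_side r" "last p \<in> right_side r"
    using assms(2) unfolding crossing_def by auto
  have hdA: "hd p \<in> A" using p(1,3) by (auto dest: hd_in_set)
  show ?thesis
  proof (rule that[OF p(4) hdA])
    fix x S assume x: "\<bar>x\<bar> \<le> \<lfloor>r\<rfloor>" and "hd p \<in> S"
    then have "set p \<subseteq> reach S A" using p hdA by (intro path_in_reach reach.start) auto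
    moreover have "\<exists>y. (x, y) \<in> set p"
      using x side_coordinates[OF assms(1)] p by (intro path_meets_column) auto
    ultimately show "\<exists>y. (x, y) \<in> reach S A" by blast
  qed
qed

lemma crossing_mono: "crossing r A \<Longrightarrow> A \<subseteq> A' \<Longrightarrow> crossing r A'"
  unfolding crossing_def by blast

definition embed :: "site \<Rightarrow> real^2" where
  "embed z = vector [real_of_int (fst z), real_of_int (snd z)]"

lemma embed_nth [simp]: "embed z $ 1 = real_of_int (fst z)" "embed z $ 2 = real_of_int (snd z)"
  unfolding embed_def by simp_all

fun polyline :: "site list \<Rightarrow> real \<Rightarrow> real^2" where
  "polyline [] = linepath 0 0"
| "polyline [a] = linepath (embed a) (embed a)"
| "polyline (a # b # l) = linepath (embed a) (embed b) +++ polyline (b # l)"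

lemma polyline_ends:
  "p \<noteq> [] \<Longrightarrow> pathstart (polyline p) = embed (hd p)"
  "p \<noteq> [] \<Longrightarrow> pathfinish (polyline p) = embed (last p)"
  by (induction p rule: polyline.induct) auto

lemma path_polyline: "path (polyline p)"
proof (induction p rule: polyline.induct)
  case (3 a b l)
  then show ?case unfolding polyline.simps by (intro path_join_imp path_linepath) (simp_all add: polyline_ends)
qed (unfold polyline.simps, rule path_linepath, rule path_linepath)

lemma floor_segment:
  assumes "a = b \<or> adjacent a b" "x \<in> closed_segment (embed a) (embed b)"
  shows "(\<lfloor>x $ 1\<rfloor>, \<lfloor>x $ 2\<rfloor>) \<in> {a, b}"
proof -
  obtain u where u: "0 \<le> u" "u \<le> 1" "x = (1 - u) *\<^sub>R embed a + u *\<^sub>R embed b"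
    using assms(2) unfolding closed_segment_def by auto
  have x: "x $ 1 = of_int (fst a) + u * of_int (fst b - fst a)"
    "x $ 2 = of_int (snd a) + u * of_int (snd b - snd a)"
    unfolding u(3) by (simp_all add: algebra_simps)
  have fl: "\<lfloor>real_of_int c + u\<rfloor> = (if u = 1 then c + 1 else c)"
    "\<lfloor>real_of_int c - u\<rfloor> = (if u = 0 then c else c - 1)" for c
    using u(1,2) by (auto simp: floor_eq_iff)
  show ?thesis
  proof (cases "a = b")
    case True
    then show ?thesis using x by simp
  next
    case False
    then have adj: "\<bar>fst a - fst b\<bar> + \<bar>snd a - snd b\<bar> = 1" using assms(1) unfolding adjacent_def by simp
    obtain a1 a2 b1 b2 where ab: "a = (a1, a2)" "b = (b1, b2)" by (cases a; cases b)
    consider "b1 = a1 + 1" "b2 = a2" | "b1 = a1 - 1" "b2 = a2" | "b1 = a1" "b2 = a2 + 1" | "b1 = a1" "b2 = a2 - 1"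
      using adj unfolding ab fst_conv snd_conv by (smt (verit))
    then show ?thesis
      by cases (use x fl in \<open>simp_all add: ab\<close>)
  qed
qed

lemma polyline_image:
  assumes "successively adjacent p" "p \<noteq> []" "x \<in> path_image (polyline p)"
  shows "\<exists>a\<in>set p. \<exists>b\<in>set p. (a = b \<or> adjacent a b) \<and> x \<in> closed_segment (embed a) (embed b)"
  using assms
proof (induction p rule: polyline.induct)
  case (3 a b l)
  then have "x \<in> closed_segment (embed a) (embed b) \<or> x \<in> path_image (polyline (b # l))"
    by (auto simp: path_image_join polyline_ends)
  then show ?case
  proof
    assume "x \<in> closed_segment (embed a) (embed b)"
    then show ?thesis using 3 by (intro bexI[of _ a] bexI[of _ b]) auto
  next
    assume "x \<in> path_image (polyline (b # l))"
    then show ?thesis using 3 by auto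
  qed
qed auto

text \<open>Joined by unit segments, the two paths satisfy the hypotheses of the Fashoda theorem. Rounding down the
  coordinates of a common point gives a common vertex, because it gives an endpoint of every unit segment through
  that point.\<close>

lemma crossings_meet:
  assumes "0 \<le> r" "crossing r A" "crossing r {z. prod.swap z \<in> B}"
  shows "A \<inter> B \<noteq> {}"
proof -
  obtain p where p: "p \<noteq> []" "successively adjacent p" "set p \<subseteq> A \<inter> lattice_box r"
    "hd p \<in> left_side r" "last p \<in> right_side r"
    using assms(2) unfolding crossing_def by auto
  obtain q' where q': "q' \<noteq> []" "successively adjacent q'" "set q' \<subseteq> {z. prod.swap z \<in> B} \<inter> lattice_box r"
    "hd q' \<in> left_side r" "last q' \<in> right_side r"
    using assms(3) unfolding crossing_def by auto
  define q where "q = map prod.swap q'"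
  have q: "q \<noteq> []" "successively adjacent q" "set q \<subseteq> B \<inter> lattice_box r"
  proof -
    show "q \<noteq> []" using q' by (simp add: q_def)
    have "adjacent (prod.swap a) (prod.swap b) = adjacent a b" for a b by (auto simp: adjacent_def)
    then show "successively adjacent q" using q'(2) unfolding q_def successively_map by simp
    show "set q \<subseteq> B \<inter> lattice_box r"
      using q'(3) unfolding q_def by (auto simp: lattice_box_def)
  qed
  define M where "M = \<lfloor>r\<rfloor>"
  have box: "embed z \<in> cbox (embed (- M, - M)) (embed (M, M))" if "z \<in> lattice_box r" for z
  proof -
    have "\<bar>fst z\<bar> \<le> M" "\<bar>snd z\<bar> \<le> M" using that unfolding lattice_box_def M_def by (auto simp: le_floor_iff)
    then show ?thesis by (simp add: mem_box_cart forall_2 abs_le_iff)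
  qed
  have img: "path_image (polyline l) \<subseteq> cbox (embed (- M, - M)) (embed (M, M))"
    if l: "l \<noteq> []" "successively adjacent l" "set l \<subseteq> lattice_box r" for l
  proof
    fix x assume x: "x \<in> path_image (polyline l)"
    obtain a b where "a \<in> set l" "b \<in> set l" "x \<in> closed_segment (embed a) (embed b)"
      using polyline_image[OF l(2,1) x] by blast
    moreover have "closed_segment (embed a) (embed b) \<subseteq> cbox (embed (- M, - M)) (embed (M, M))"
      if "a \<in> set l" "b \<in> set l" for a b
    proof (rule closed_segment_subset)
      show "embed a \<in> cbox (embed (- M, - M)) (embed (M, M))" using that(1) l(3) by (intro box) blast
      show "embed b \<in> cbox (embed (- M, - M)) (embed (M, M))" using that(2) l(3) by (intro box) blast
    qed (rule convex_box)
    ultimately show "x \<in> cbox (embed (- M, - M)) (embed (M, M))" by blast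
  qed
  obtain x where x: "x \<in> path_image (polyline p)" "x \<in> path_image (polyline q)"
  proof (rule fashoda[of "polyline p" "polyline q" "embed (- M, - M)" "embed (M, M)"])
    show "pathstart (polyline p) $ 1 = embed (- M, - M) $ 1" "pathfinish (polyline p) $ 1 = embed (M, M) $ 1"
      using side_coordinates[OF assms(1)] p by (simp_all add: polyline_ends M_def)
    show "pathstart (polyline q) $ 2 = embed (- M, - M) $ 2" "pathfinish (polyline q) $ 2 = embed (M, M) $ 2"
      using side_coordinates[OF assms(1)] q' q(1)
      by (simp_all add: polyline_ends M_def q_def hd_map last_map)
  qed (use p q img path_polyline in auto)
  have "(\<lfloor>x $ 1\<rfloor>, \<lfloor>x $ 2\<rfloor>) \<in> set l" if "l \<noteq> []" "successively adjacent l" "x \<in> path_image (polyline l)" for l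
    using polyline_image[OF that(2,1,3)] floor_segment by blast
  then have "(\<lfloor>x $ 1\<rfloor>, \<lfloor>x $ 2\<rfloor>) \<in> set p \<inter> set q" using x p q by blast
  then show ?thesis using p(3) q(3) by blast
qed

section \<open>Crossings of level sets of the free field\<close>

text \<open>The level set takes finitely many values, and the event is the union over those that satisfy \<open>P\<close>.\<close>

lemma measurable_level_event:
  assumes "finite D" "\<And>z. z \<in> D \<Longrightarrow> {x \<in> space M. R z x} \<in> sets M"
  shows "{x \<in> space M. P {z \<in> D. R z x}} \<in> sets M"
proof -
  have "{x \<in> space M. P {z \<in> D. R z x}} =
      (\<Union>A\<in>{A \<in> Pow D. P A}. {x \<in> space M. \<forall>z\<in>D. R z x = (z \<in> A)})"
  proof (intro equalityI subsetI)
    fix x assume x: "x \<in> {x \<in> space M. P {z \<in> D. R z x}}"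
    then have "{z \<in> D. R z x} \<in> {A \<in> Pow D. P A}" by blast
    moreover have "x \<in> {x' \<in> space M. \<forall>z\<in>D. R z x' = (z \<in> {z \<in> D. R z x})}" using x by simp
    ultimately show "x \<in> (\<Union>A\<in>{A \<in> Pow D. P A}. {x \<in> space M. \<forall>z\<in>D. R z x = (z \<in> A)})" by (rule UN_I)
  next
    fix x assume "x \<in> (\<Union>A\<in>{A \<in> Pow D. P A}. {x \<in> space M. \<forall>z\<in>D. R z x = (z \<in> A)})"
    then obtain A where A: "A \<subseteq> D" "P A" "x \<in> space M" "\<forall>z\<in>D. R z x = (z \<in> A)" by blast
    then have "{z \<in> D. R z x} = A" by blast
    then show "x \<in> {x \<in> space M. P {z \<in> D. R z x}}" using A by simp
  qed
  moreover have "{x \<in> space M. \<forall>z\<in>D. R z x = (z \<in> A)} \<in> sets M" for A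
  proof (rule sets.sets_Collect_finite_All[OF _ assms(1)])
    fix z assume "z \<in> D"
    then show "{x \<in> space M. R z x = (z \<in> A)} \<in> sets M"
      using assms(2)[of z] by (cases "z \<in> A") (auto intro: sets.sets_Collect_neg)
  qed
  ultimately show ?thesis using assms(1) by auto
qed

definition up_crossing :: "real \<Rightarrow> nat \<Rightarrow> real \<Rightarrow> (site \<Rightarrow> real) set" where
  "up_crossing r N h = {\<phi>. crossing r {z \<in> lattice_box (real N). h \<le> \<phi> z}}"

lemma measurable_up_crossing [measurable]: "up_crossing r N h \<in> sets cfg"
proof -
  have "{\<phi> \<in> space cfg. h \<le> \<phi> z} \<in> sets cfg" for z by measurable
  from measurable_level_event[OF finite_box this] show ?thesis unfolding up_crossing_def by simp
qed

lemma gff_full_crossing: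
  assumes "1 \<le> N" "(32 + 4096) * loss \<le> h"
  shows "measure (gff (lattice_box (real N))) (up_crossing (real N) N h) \<le> exp (- (h / 1024)\<^sup>2 / 8)"
proof -
  let ?D = "lattice_box (real N)"
  interpret prob_space "gff ?D" by (rule prob_space_gff) simp
  have "up_crossing (real N) N h \<subseteq> {\<phi>. spans N (cluster (left_side (real N)) ?D h \<phi>)}"
  proof
    fix \<phi> assume "\<phi> \<in> up_crossing (real N) N h"
    then have c: "crossing (real N) {z \<in> ?D. h \<le> \<phi> z}" unfolding up_crossing_def by simp
    obtain z where z: "z \<in> left_side (real N)" "z \<in> {z \<in> ?D. h \<le> \<phi> z}"
      "\<And>x S. \<lbrakk>\<bar>x\<bar> \<le> \<lfloor>real N\<rfloor>; z \<in> S\<rbrakk> \<Longrightarrow> \<exists>y. (x, y) \<in> reach S {z \<in> ?D. h \<le> \<phi> z}"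
      by (rule crossing_reach[OF of_nat_0_le_iff c]) blast
    have "\<exists>y. (x, y) \<in> reach (left_side (real N)) {z \<in> ?D. h \<le> \<phi> z}" if "2 * \<bar>x\<bar> \<le> int N" for x
      using that by (intro z(3) z(1)) simp
    then show "\<phi> \<in> {\<phi>. spans N (cluster (left_side (real N)) ?D h \<phi>)}"
      unfolding spans_def cluster_def by simp
  qed
  then have "measure (gff ?D) (up_crossing (real N) N h) \<le>
      measure (gff ?D) {\<phi>. spans N (cluster (left_side (real N)) ?D h \<phi>)}"
    using spanning_cluster_bound(1)[OF assms] by (intro finite_measure_mono) auto
  also have "\<dots> \<le> exp (- (h / 1024)\<^sup>2 / 8)" by (rule spanning_cluster_bound(2)[OF assms]) simp
  finally show ?thesis .
qed

lemma floor_half: "\<lfloor>real N / 2\<rfloor> = int (N div 2)"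
  using floor_divide_of_nat_eq[of N 2] by simp

text \<open>A union bound over the starting vertex of the crossing. The left side of the smaller box has no neighbours
  outside the large one, so it cannot be explored as a whole.\<close>

lemma gff_half_crossing:
  assumes "1 \<le> N" "(32 + 4096) * loss \<le> h"
  shows "measure (gff (lattice_box (real N))) (up_crossing (real N / 2) N h)
    \<le> (2 * real N + 1) * exp (- (h / 1024)\<^sup>2 / 8)"
proof -
  let ?D = "lattice_box (real N)" and ?L = "left_side (real N / 2)"
  interpret prob_space "gff ?D" by (rule prob_space_gff) simp
  have L: "z \<in> ?D" "z \<in> {- int (N div 2)} \<times> {- int N..int N}" if "z \<in> ?L" for z
  proof -
    have z: "z \<in> lattice_box (real N / 2)" "fst z = - int (N div 2)"
      using side_coordinates(1)[of "real N / 2" z] that by (simp_all add: floor_half)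
    then show zD: "z \<in> ?D" unfolding lattice_box_def by auto
    show "z \<in> {- int (N div 2)} \<times> {- int N..int N}" using z zD unfolding lattice_box_eq by (cases z) auto
  qed
  have finL: "finite ?L" by (rule finite_subset[of _ "{- int (N div 2)} \<times> {- int N..int N}"]) (use L in auto)
  have "card ?L \<le> card ({- int (N div 2)} \<times> {- int N..int N})" by (rule card_mono) (use L in auto)
  then have card: "real (card ?L) \<le> 2 * real N + 1" by (simp add: card_cartesian_product)
  have sub: "up_crossing (real N / 2) N h \<subseteq> (\<Union>z\<in>?L. {\<phi>. spans N (cluster {z} ?D h \<phi>)})"
  proof
    fix \<phi> assume "\<phi> \<in> up_crossing (real N / 2) N h"
    then have c: "crossing (real N / 2) {z \<in> ?D. h \<le> \<phi> z}" unfolding up_crossing_def by simp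
    have "0 \<le> real N / 2" by simp
    then obtain z where z: "z \<in> ?L" "z \<in> {z \<in> ?D. h \<le> \<phi> z}"
      "\<And>x S. \<lbrakk>\<bar>x\<bar> \<le> \<lfloor>real N / 2\<rfloor>; z \<in> S\<rbrakk> \<Longrightarrow> \<exists>y. (x, y) \<in> reach S {z \<in> ?D. h \<le> \<phi> z}"
      by (rule crossing_reach[OF _ c]) blast
    have "spans N (cluster {z} ?D h \<phi>)"
      unfolding spans_def cluster_def
    proof (intro allI impI)
      fix x :: int assume "2 * \<bar>x\<bar> \<le> int N"
      then have "\<bar>x\<bar> \<le> \<lfloor>real N / 2\<rfloor>" unfolding floor_half by auto
      then show "\<exists>y. (x, y) \<in> reach {z} {z \<in> ?D. h \<le> \<phi> z}" by (rule z(3)) simp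
    qed
    then show "\<phi> \<in> (\<Union>z\<in>?L. {\<phi>. spans N (cluster {z} ?D h \<phi>)})" using z(1) by blast
  qed
  have ms: "{\<phi>. spans N (cluster {z} ?D h \<phi>)} \<in> sets (gff ?D)" if "z \<in> ?L" for z
    using spanning_cluster_bound(1)[OF assms, of "{z}" z] L(1)[OF that] by simp
  have "measure (gff ?D) (up_crossing (real N / 2) N h) \<le>
      measure (gff ?D) (\<Union>z\<in>?L. {\<phi>. spans N (cluster {z} ?D h \<phi>)})"
    using finL ms by (intro finite_measure_mono sub sets.finite_UN) auto
  also have "\<dots> \<le> (\<Sum>z\<in>?L. measure (gff ?D) {\<phi>. spans N (cluster {z} ?D h \<phi>)})"
    using finL ms by (intro finite_measure_subadditive_finite) auto
  also have "\<dots> \<le> (\<Sum>z\<in>?L. exp (- (h / 1024)\<^sup>2 / 8))"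
    using L(1) by (intro sum_mono spanning_cluster_bound(2)[OF assms]) auto
  also have "\<dots> \<le> (2 * real N + 1) * exp (- (h / 1024)\<^sup>2 / 8)"
    using card by (simp add: mult_right_mono)
  finally show ?thesis .
qed

text \<open>The event that \<open>{\<phi> \<ge> h}\<close> crosses horizontally and the event that \<open>{\<phi> \<le> - h}\<close> crosses vertically are
  disjoint for \<open>h > 0\<close>, and have the same probability by symmetry.\<close>

lemma gff_crossing_le_half:
  assumes "0 \<le> r" "0 < h"
  shows "measure (gff (lattice_box (real N))) (up_crossing r N h) \<le> 1 / 2"
proof -
  let ?D = "lattice_box (real N)" and ?A = "up_crossing r N h"
  interpret prob_space "gff ?D" by (rule prob_space_gff) simp
  let ?V = "{\<phi>. (\<lambda>z. - \<phi> (prod.swap z)) \<in> ?A}"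
  have m1: "{\<phi>. \<phi> \<in> ?A} \<in> sets cfg" by simp
  have "(\<lambda>\<phi> z. - \<phi> z) \<in> measurable cfg cfg" by (rule measurable_cfgI) measurable
  from measurable_sets[OF this m1] have m2: "{\<phi>. (\<lambda>z. - \<phi> z) \<in> ?A} \<in> sets cfg" by (simp add: vimage_def)
  have "(\<lambda>\<phi> z. - \<phi> (prod.swap z)) \<in> measurable cfg cfg" by (rule measurable_cfgI) measurable
  from measurable_sets[OF this m1] have m3: "?V \<in> sets cfg" by (simp add: vimage_def)
  have "measure (gff ?D) ?V = measure (gff ?D) {\<phi>. (\<lambda>z. - \<phi> z) \<in> ?A}"
  proof (rule gff_reindex[where P = "\<lambda>\<phi>. (\<lambda>z. - \<phi> z) \<in> ?A", OF _ _ _ _ _ m2])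
    show "prod.swap ` ?D = ?D" unfolding lattice_box_eq by (auto simp: image_iff)
    show "adjacent (prod.swap u) (prod.swap v) = adjacent u v" for u v by (auto simp: adjacent_def)
  qed auto
  also have "\<dots> = measure (gff ?D) {\<phi>. \<phi> \<in> ?A}" by (rule gff_uminus[OF _ m1]) simp
  finally have eq: "measure (gff ?D) ?V = measure (gff ?D) ?A" by simp
  have "?A \<inter> ?V = {}"
  proof (rule ccontr)
    assume "?A \<inter> ?V \<noteq> {}"
    then obtain \<phi> where \<phi>: "crossing r {z \<in> ?D. h \<le> \<phi> z}" "crossing r {z \<in> ?D. h \<le> - \<phi> (prod.swap z)}"
      unfolding up_crossing_def by auto
    have "crossing r {z. prod.swap z \<in> {z \<in> ?D. h \<le> - \<phi> z}}"
      by (rule crossing_mono[OF \<phi>(2)]) (auto simp: lattice_box_eq)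
    from crossings_meet[OF assms(1) \<phi>(1) this] show False using assms(2) by auto
  qed
  then have "measure (gff ?D) ?A + measure (gff ?D) ?V = measure (gff ?D) (?A \<union> ?V)"
    using m3 by (intro finite_measure_Union[symmetric]) auto
  then show ?thesis using eq prob_le_1[of "?A \<union> ?V"] by linarith
qed

text \<open>Crossings of \<open>{\<bar>\<phi> + m\<bar> \<ge> m + h}\<close>: along such a path \<open>\<phi> + m\<close> keeps its sign unless the field jumps by
  at least \<open>2 * m\<close> across some edge.\<close>

definition far_crossing :: "real \<Rightarrow> nat \<Rightarrow> real \<Rightarrow> real \<Rightarrow> (site \<Rightarrow> real) set" where
  "far_crossing r N m h = {\<phi>. crossing r {z \<in> lattice_box (real N). m + h \<le> \<bar>\<phi> z + m\<bar>}}"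

lemma constant_sign:
  assumes "successively adjacent p" "p \<noteq> []" "\<And>z. z \<in> set p \<Longrightarrow> P z \<or> Q z"
    and "\<And>u v. \<lbrakk>u \<in> set p; v \<in> set p; adjacent u v; P u; Q v\<rbrakk> \<Longrightarrow> False"
    and "\<And>u v. \<lbrakk>u \<in> set p; v \<in> set p; adjacent u v; Q u; P v\<rbrakk> \<Longrightarrow> False"
  shows "(\<forall>z\<in>set p. P z) \<or> (\<forall>z\<in>set p. Q z)"
  using assms
proof (induction p)
  case (Cons a p)
  show ?case
  proof (cases p)
    case Nil then show ?thesis using Cons.prems by auto
  next
    case (Cons b l)
    then have p: "successively adjacent p" "p \<noteq> []" "adjacent a b" "b \<in> set p" using Cons.prems by auto
    have "(\<forall>z\<in>set p. P z) \<or> (\<forall>z\<in>set p. Q z)"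
      using Cons.prems(3-5) by (intro Cons.IH p) (auto, blast+)
    moreover have "P a \<or> Q a" using Cons.prems(3) by simp
    ultimately show ?thesis using Cons.prems(4)[of a b] Cons.prems(5)[of a b] p by auto
  qed
qed simp

text \<open>The last two terms bound the crossings where \<open>\<phi> + m\<close> is negative and the existence of an edge with a large
  gradient.\<close>

lemma gff_far_crossing:
  assumes "0 < m" "0 < h"
  shows "measure (gff (lattice_box (real N))) (far_crossing r N m h) \<le>
    measure (gff (lattice_box (real N))) (up_crossing r N h) +
    measure (gff (lattice_box (real N))) (up_crossing r N (2 * m)) +
    4 * (2 * real N + 1)\<^sup>2 * exp (- (2 * m)\<^sup>2 / 8)"
proof -
  let ?D = "lattice_box (real N)"
  interpret prob_space "gff ?D" by (rule prob_space_gff) simp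
  define G where "G = (\<Union>u\<in>?D. \<Union>v\<in>nbrs u \<inter> ?D. {\<phi>. 2 * m \<le> \<phi> u - \<phi> v})"
  let ?N = "{\<phi>. (\<lambda>z. - \<phi> z) \<in> up_crossing r N (2 * m)}"
  have m1: "{\<phi>. \<phi> \<in> up_crossing r N (2 * m)} \<in> sets cfg" by simp
  have "(\<lambda>\<phi> z. - \<phi> z) \<in> measurable cfg cfg" by (rule measurable_cfgI) measurable
  from measurable_sets[OF this m1] have mN: "?N \<in> sets cfg" by (simp add: vimage_def)
  have mg: "{\<phi>. 2 * m \<le> \<phi> u - \<phi> v} \<in> sets cfg" for u v
  proof -
    have "{\<phi> \<in> space cfg. 2 * m \<le> \<phi> u - \<phi> v} \<in> sets cfg" by measurable
    then show ?thesis by simp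
  qed
  have mG: "G \<in> sets cfg" unfolding G_def by (intro sets.finite_UN) (auto simp: mg)
  have "far_crossing r N m h \<subseteq> up_crossing r N h \<union> ?N \<union> G"
  proof
    fix \<phi> assume "\<phi> \<in> far_crossing r N m h"
    then obtain p where p: "p \<noteq> []" "successively adjacent p"
      "set p \<subseteq> {z \<in> ?D. m + h \<le> \<bar>\<phi> z + m\<bar>} \<inter> lattice_box r" "hd p \<in> left_side r" "last p \<in> right_side r"
      unfolding far_crossing_def crossing_def by auto
    show "\<phi> \<in> up_crossing r N h \<union> ?N \<union> G"
    proof (cases "\<phi> \<in> G")
      case False
      have noG: "\<phi> u - \<phi> v < 2 * m" if "u \<in> ?D" "v \<in> ?D" "adjacent u v" for u v
      proof (rule ccontr)
        assume "\<not> \<phi> u - \<phi> v < 2 * m"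
        then have "\<phi> \<in> {\<phi>. 2 * m \<le> \<phi> u - \<phi> v}" "v \<in> nbrs u \<inter> ?D"
          using that by (simp_all add: adjacent_iff_nbrs)
        then have "\<phi> \<in> G" unfolding G_def using that(1) by blast
        then show False using False by simp
      qed
      have pD: "z \<in> ?D" "h \<le> \<phi> z \<or> 2 * m \<le> - \<phi> z" if "z \<in> set p" for z
      proof -
        have z: "z \<in> {z \<in> ?D. m + h \<le> \<bar>\<phi> z + m\<bar>}" using p(3) that by blast
        then show "z \<in> ?D" by simp
        have "m + h \<le> \<bar>\<phi> z + m\<bar>" using z by simp
        then show "h \<le> \<phi> z \<or> 2 * m \<le> - \<phi> z" using assms by linarith
      qed
      have "(\<forall>z\<in>set p. h \<le> \<phi> z) \<or> (\<forall>z\<in>set p. 2 * m \<le> - \<phi> z)"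
      proof (rule constant_sign[OF p(2,1) pD(2)])
        show False if "u \<in> set p" "v \<in> set p" "adjacent u v" "h \<le> \<phi> u" "2 * m \<le> - \<phi> v" for u v
          using noG[of u v] pD(1) that assms by fastforce
        show False if "u \<in> set p" "v \<in> set p" "adjacent u v" "2 * m \<le> - \<phi> u" "h \<le> \<phi> v" for u v
          using noG[of v u] pD(1) that assms adjacent_sym[of u v] by fastforce
      qed
      then show ?thesis
      proof
        assume "\<forall>z\<in>set p. h \<le> \<phi> z"
        then have "set p \<subseteq> {z \<in> ?D. h \<le> \<phi> z} \<inter> lattice_box r" using p(3) by blast
        then show ?thesis unfolding up_crossing_def crossing_def using p by blast
      next
        assume "\<forall>z\<in>set p. 2 * m \<le> - \<phi> z"
        then have "set p \<subseteq> {z \<in> ?D. 2 * m \<le> - \<phi> z} \<inter> lattice_box r" using p(3) by blast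
        then show ?thesis unfolding up_crossing_def crossing_def using p by blast
      qed
    qed simp
  qed
  then have "measure (gff ?D) (far_crossing r N m h) \<le> measure (gff ?D) (up_crossing r N h \<union> ?N \<union> G)"
    using mN mG by (intro finite_measure_mono) auto
  also have "\<dots> \<le> measure (gff ?D) (up_crossing r N h) + measure (gff ?D) ?N + measure (gff ?D) G"
  proof -
    have "measure (gff ?D) (up_crossing r N h \<union> ?N \<union> G) \<le>
        measure (gff ?D) (up_crossing r N h \<union> ?N) + measure (gff ?D) G"
      using mN mG by (intro measure_Un_le) auto
    moreover have "measure (gff ?D) (up_crossing r N h \<union> ?N) \<le>
        measure (gff ?D) (up_crossing r N h) + measure (gff ?D) ?N"
      using mN by (intro measure_Un_le) auto
    ultimately show ?thesis by linarith
  qed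
  also have "measure (gff ?D) ?N = measure (gff ?D) (up_crossing r N (2 * m))"
    using gff_uminus[OF _ m1, of ?D] by simp
  also have "measure (gff ?D) G \<le> (\<Sum>u\<in>?D. measure (gff ?D) (\<Union>v\<in>nbrs u \<inter> ?D. {\<phi>. 2 * m \<le> \<phi> u - \<phi> v}))"
    unfolding G_def by (intro finite_measure_subadditive_finite) (auto simp: mg)
  also have "\<dots> \<le> (\<Sum>u\<in>?D. \<Sum>v\<in>nbrs u \<inter> ?D. measure (gff ?D) {\<phi>. 2 * m \<le> \<phi> u - \<phi> v})"
    by (intro sum_mono finite_measure_subadditive_finite) (auto simp: mg)
  also have "\<dots> \<le> (\<Sum>u\<in>?D. \<Sum>v\<in>nbrs u \<inter> ?D. exp (- (2 * m)\<^sup>2 / 8))"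
    using assms by (intro sum_mono gff_gradient_tail) auto
  also have "\<dots> \<le> (\<Sum>u\<in>?D. 4 * exp (- (2 * m)\<^sup>2 / 8))"
  proof (intro sum_mono)
    fix u
    have "card (nbrs u \<inter> ?D) \<le> card (nbrs u)" by (intro card_mono) auto
    then show "(\<Sum>v\<in>nbrs u \<inter> ?D. exp (- (2 * m)\<^sup>2 / 8)) \<le> 4 * exp (- (2 * m)\<^sup>2 / 8)"
      by (simp add: mult_right_mono)
  qed
  also have "\<dots> = 4 * (2 * real N + 1)\<^sup>2 * exp (- (2 * m)\<^sup>2 / 8)"
    unfolding lattice_box_eq by (simp add: card_cartesian_product power2_eq_square algebra_simps)
  finally show ?thesis by simp
qed

section \<open>A race between exponential clocks\<close>

abbreviation clk :: "real measure" where
  "clk \<equiv> density lborel (\<lambda>x. ennreal (exponential_density (1/4) x))"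

lemma prob_space_clk: "prob_space clk"
  by (rule prob_space_exponential_density) simp

interpretation clk: prob_space clk by (rule prob_space_clk)

interpretation clocks: product_prob_space "\<lambda>_::'i. clk" UNIV
  by standard

lemma nn_integral_clk:
  assumes [measurable]: "f \<in> borel_measurable borel"
  shows "(\<integral>\<^sup>+x. f x \<partial>clk) = (\<integral>\<^sup>+x. f x * ennreal (exp (- x / 4) / 4) * indicator {0..} x \<partial>lborel)"
proof -
  have "(\<integral>\<^sup>+x. f x \<partial>clk) = (\<integral>\<^sup>+x. ennreal (exponential_density (1/4) x) * f x \<partial>lborel)"
    by (rule nn_integral_density) (use assms in simp_all)
  also have "\<dots> = (\<integral>\<^sup>+x. f x * ennreal (exp (- x / 4) / 4) * indicator {0..} x \<partial>lborel)"
    by (intro nn_integral_cong) (auto simp: exponential_density_def indicator_def mult.commute)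
  finally show ?thesis .
qed

lemma exp_tail:
  assumes "0 < q"
  shows "(\<integral>\<^sup>+x\<in>{a..}. ennreal (q * exp (- q * x)) \<partial>lborel) = ennreal (exp (- q * a))"
proof -
  have "(\<integral>\<^sup>+x\<in>{a..}. ennreal (q * exp (- q * x)) \<partial>lborel) = ennreal (0 - (- exp (- q * a)))"
  proof (rule nn_integral_FTC_atLeast[where F = "\<lambda>x. - exp (- q * x)"])
    show "((\<lambda>x. - exp (- q * x)) has_real_derivative q * exp (- q * x)) (at x)" for x
      by (auto intro!: derivative_eq_intros)
    have "filterlim (\<lambda>x. q * x) at_top at_top"
      using assms by (intro filterlim_tendsto_pos_mult_at_top[OF tendsto_const]) (auto simp: filterlim_ident)
    then have "((\<lambda>x. exp (- (q * x))) \<longlongrightarrow> 0) at_top"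
      by (intro filterlim_compose[OF exp_at_bot]) (simp add: filterlim_uminus_at_top[symmetric] filterlim_uminus_at_bot)
    then show "((\<lambda>x. - exp (- q * x)) \<longlongrightarrow> 0) at_top" using tendsto_minus by fastforce
  qed (use assms in auto)
  then show ?thesis by simp
qed

lemma clk_tail:
  assumes "0 \<le> s" shows "(\<integral>\<^sup>+x. indicator {s<..} x \<partial>clk) = ennreal (exp (- s / 4))"
proof -
  have "(\<integral>\<^sup>+x. indicator {s<..} x \<partial>clk) =
      (\<integral>\<^sup>+x\<in>{s..}. ennreal (1 / 4 * exp (- (1 / 4) * x)) \<partial>lborel)"
    using assms AE_lborel_singleton[of s]
    by (subst nn_integral_clk) (auto intro!: nn_integral_cong_AE simp: indicator_def)
  then show ?thesis using exp_tail[of "1 / 4" s] by simp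
qed

text \<open>The density of the winning time of \<open>d\<close> clocks of rate \<open>1/4\<close>, restricted to the victory of a given one.\<close>

definition race_weight :: "nat \<Rightarrow> real \<Rightarrow> ennreal" where
  "race_weight d s = ennreal (exp (- (real d / 4) * s) / 4) * indicator {0..} s"

lemma measurable_race_weight [measurable]: "race_weight d \<in> borel_measurable borel"
  unfolding race_weight_def[abs_def] by measurable

lemma race_weight_total:
  assumes "0 < d" shows "of_nat d * (\<integral>\<^sup>+s. race_weight d s \<partial>lborel) = 1"
proof -
  have "of_nat d * (\<integral>\<^sup>+s. race_weight d s \<partial>lborel) = (\<integral>\<^sup>+s. of_nat d * race_weight d s \<partial>lborel)"
    by (simp add: nn_integral_cmult)
  also have "\<dots> = (\<integral>\<^sup>+s\<in>{0..}. ennreal (real d / 4 * exp (- (real d / 4) * s)) \<partial>lborel)"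
    by (intro nn_integral_cong)
       (auto simp: race_weight_def indicator_def ennreal_of_nat_eq_real_of_nat ennreal_mult[symmetric])
  also have "\<dots> = 1" using assms by (subst exp_tail) auto
  finally show ?thesis .
qed

lemma arg_min_on_unique:
  fixes f :: "'e \<Rightarrow> real"
  assumes "e \<in> S" "\<And>e'. e' \<in> S - {e} \<Longrightarrow> f e < f e'"
  shows "arg_min_on f S = e"
proof -
  have le: "f e \<le> f x" if "x \<in> S" for x using assms(2)[of x] that by (cases "x = e") auto
  have "f (arg_min_on f S) \<le> f e"
    unfolding arg_min_on_def using assms(1) le arg_min_equality[of "\<lambda>x. x \<in> S" e f] by simp
  moreover have "arg_min_on f S \<in> S"
    unfolding arg_min_on_def by (rule arg_minI[of "\<lambda>x. x \<in> S" e f]) (use assms(1) le in \<open>auto simp: not_less\<close>)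
  ultimately show ?thesis using assms(2)[of "arg_min_on f S"] by force
qed

lemma Min_unique:
  fixes f :: "'e \<Rightarrow> real"
  assumes "finite S" "e \<in> S" "\<And>e'. e' \<in> S - {e} \<Longrightarrow> f e < f e'"
  shows "Min (f ` S) = f e"
proof (rule Min_eqI)
  fix y assume "y \<in> f ` S"
  then obtain e' where "e' \<in> S" "y = f e'" by auto
  then show "f e \<le> y" using assms(3)[of e'] by (cases "e' = e") auto
qed (use assms in auto)

text \<open>Given the winning time \<open>s\<close>, each of the other clocks exceeds \<open>s\<close> with probability \<open>exp (- s / 4)\<close>.\<close>

lemma race_strict:
  fixes g :: "real \<Rightarrow> ennreal" and E S :: "'e set"
  assumes "finite E" "S \<subseteq> E" "e \<in> S" and [measurable]: "g \<in> borel_measurable borel"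
  shows "(\<integral>\<^sup>+\<omega>. g (\<omega> (n, e)) * indicator {\<omega>. \<forall>e'\<in>S - {e}. \<omega> (n, e) < \<omega> (n, e')} \<omega> \<partial>PiM ({n} \<times> E) (\<lambda>_. clk))
    = (\<integral>\<^sup>+s. g s * race_weight (card S) s \<partial>lborel)"
proof -
  let ?J = "{n} \<times> E - {(n, e)}"
  have J: "{n} \<times> E = insert (n, e) ?J" using assms by auto
  have fin: "finite ?J" "(n, e) \<notin> ?J" using assms(1) by auto
  have finS: "finite S" using assms finite_subset by auto
  let ?F = "\<lambda>\<omega>. g (\<omega> (n, e)) * indicator {\<omega>. \<forall>e'\<in>S - {e}. \<omega> (n, e) < \<omega> (n, e')} \<omega>"
  let ?h = "\<lambda>s j x. if j \<in> {n} \<times> S then indicator {s<..} x else 1 :: ennreal"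
  have mF: "?F \<in> borel_measurable (PiM (insert (n, e) ?J) (\<lambda>_. clk))"
  proof -
    have c: "(\<lambda>\<omega>. \<omega> (n, x)) \<in> borel_measurable (PiM (insert (n, e) ?J) (\<lambda>_. clk))" if "x \<in> S" for x
      using measurable_component_singleton[of "(n, x)" "insert (n, e) ?J" "\<lambda>_. clk"] that assms(2)
      by (auto cong: measurable_cong_sets)
    note [measurable] = c[OF assms(3)]
    have "{\<omega> \<in> space (PiM (insert (n, e) ?J) (\<lambda>_. clk)). \<forall>e'\<in>S - {e}. \<omega> (n, e) < \<omega> (n, e')}
      \<in> sets (PiM (insert (n, e) ?J) (\<lambda>_. clk))"
    proof (rule sets.sets_Collect_finite_All)
      fix e' assume "e' \<in> S - {e}"
      then have [measurable]: "(\<lambda>\<omega>. \<omega> (n, e')) \<in> borel_measurable (PiM (insert (n, e) ?J) (\<lambda>_. clk))" using c by auto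
      show "{\<omega> \<in> space (PiM (insert (n, e) ?J) (\<lambda>_. clk)). \<omega> (n, e) < \<omega> (n, e')} \<in> sets (PiM (insert (n, e) ?J) (\<lambda>_. clk))"
        by measurable
    qed (use finS in auto)
    then have [measurable]: "(indicator {\<omega>. \<forall>e'\<in>S - {e}. \<omega> (n, e) < \<omega> (n, e')} :: _ \<Rightarrow> ennreal)
        \<in> borel_measurable (PiM (insert (n, e) ?J) (\<lambda>_. clk))"
      by (subst borel_measurable_indicator_iff) (simp add: Int_def conj_commute)
    show ?thesis by measurable
  qed
  have "(\<integral>\<^sup>+\<omega>. ?F \<omega> \<partial>PiM ({n} \<times> E) (\<lambda>_. clk)) =
      (\<integral>\<^sup>+s. (\<integral>\<^sup>+\<omega>. ?F (fun_upd \<omega> (n, e) s) \<partial>(PiM ?J (\<lambda>_. clk))) \<partial>clk)"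
    by (subst J, rule clocks.product_nn_integral_insert_rev[OF fin mF])
  also have "\<dots> = (\<integral>\<^sup>+s. g s * (\<integral>\<^sup>+\<omega>. (\<Prod>j\<in>?J. ?h s j (\<omega> j)) \<partial>(PiM ?J (\<lambda>_. clk))) \<partial>clk)"
  proof (intro nn_integral_cong)
    fix s
    have "?F (fun_upd \<omega> (n, e) s) = g s * (\<Prod>j\<in>?J. ?h s j (\<omega> j))" for \<omega>
    proof (cases "\<forall>e'\<in>S - {e}. s < \<omega> (n, e')")
      case True
      have "(\<Prod>j\<in>?J. ?h s j (\<omega> j)) = (\<Prod>j\<in>?J. 1)"
      proof (intro prod.cong refl)
        fix j assume j: "j \<in> ?J"
        show "?h s j (\<omega> j) = 1"
        proof (cases "j \<in> {n} \<times> S")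
          case jS: True
          then obtain e' where e': "j = (n, e')" "e' \<in> S" by blast
          with j have "e' \<in> S - {e}" by blast
          then have "s < \<omega> j" using True e'(1) by blast
          then show ?thesis using jS by simp
        qed simp
      qed
      then show ?thesis using True by (auto simp: indicator_def)
    next
      case False
      then obtain e' where e': "e' \<in> S - {e}" "\<not> s < \<omega> (n, e')" by auto
      then have "(\<Prod>j\<in>?J. ?h s j (\<omega> j)) = 0" using assms(2) fin(1) by (intro prod_zero bexI[of _ "(n, e')"]) auto
      moreover have "?F (fun_upd \<omega> (n, e) s) = 0" using e' by (auto simp: indicator_def)
      ultimately show ?thesis by (simp only: mult_zero_right)
    qed
    moreover have "(\<lambda>\<omega>. \<Prod>j\<in>?J. ?h s j (\<omega> j)) \<in> borel_measurable (PiM ?J (\<lambda>_. clk))"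
    proof (rule borel_measurable_prod_ennreal)
      fix j assume "j \<in> ?J"
      then have "(\<lambda>\<omega>. \<omega> j) \<in> measurable (PiM ?J (\<lambda>_. clk)) borel"
        using measurable_component_singleton[of j ?J "\<lambda>_. clk"] by (simp cong: measurable_cong_sets)
      then show "(\<lambda>\<omega>. ?h s j (\<omega> j)) \<in> borel_measurable (PiM ?J (\<lambda>_. clk))"
        by (rule measurable_compose) measurable
    qed
    ultimately show "(\<integral>\<^sup>+\<omega>. ?F (fun_upd \<omega> (n, e) s) \<partial>PiM ?J (\<lambda>_. clk)) = g s * (\<integral>\<^sup>+\<omega>. (\<Prod>j\<in>?J. ?h s j (\<omega> j)) \<partial>(PiM ?J (\<lambda>_. clk)))"
      by (simp add: nn_integral_cmult)
  qed
  also have "\<dots> = (\<integral>\<^sup>+s. g s * (\<Prod>j\<in>?J. (\<integral>\<^sup>+x. ?h s j x \<partial>clk)) \<partial>clk)"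
    by (intro nn_integral_cong arg_cong2[of _ _ _ _ "(*)"] refl clocks.product_nn_integral_prod fin) auto
  also have "\<dots> = (\<integral>\<^sup>+s. g s * (\<integral>\<^sup>+x. indicator {s<..} x \<partial>clk) ^ (card S - 1) \<partial>clk)"
  proof (intro nn_integral_cong arg_cong2[of _ _ _ _ "(*)"] refl)
    fix s
    have "(\<Prod>j\<in>?J. (\<integral>\<^sup>+x. ?h s j x \<partial>clk)) = (\<Prod>j\<in>{n} \<times> (S - {e}). (\<integral>\<^sup>+x. indicator {s<..} x \<partial>clk))"
      using assms(2) fin(1) clk.emeasure_space_1
      by (intro prod.mono_neutral_cong_right) auto
    also have "\<dots> = (\<integral>\<^sup>+x. indicator {s<..} x \<partial>clk) ^ (card S - 1)"
      using assms(3) finS by (simp add: card_cartesian_product_singleton)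
    finally show "(\<Prod>j\<in>?J. (\<integral>\<^sup>+x. ?h s j x \<partial>clk)) = (\<integral>\<^sup>+x. indicator {s<..} x \<partial>clk) ^ (card S - 1)" .
  qed
  also have "\<dots> = (\<integral>\<^sup>+s. g s * ennreal (exp (- \<bar>s\<bar> / 4) ^ (card S - 1)) \<partial>clk)"
  proof (rule nn_integral_cong_AE)
    have "AE s in clk. 0 \<le> s"
      by (subst AE_density) (auto simp: exponential_density_def intro!: AE_I2)
    then show "AE s in clk. g s * (\<integral>\<^sup>+x. indicator {s<..} x \<partial>clk) ^ (card S - 1) =
        g s * ennreal (exp (- \<bar>s\<bar> / 4) ^ (card S - 1))"
      by eventually_elim (simp add: clk_tail ennreal_power del: nn_integral_indicator)
  qed
  also have "\<dots> = (\<integral>\<^sup>+s. g s * race_weight (card S) s \<partial>lborel)"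
  proof (subst nn_integral_clk)
    show "(\<integral>\<^sup>+s. g s * ennreal (exp (- \<bar>s\<bar> / 4) ^ (card S - 1)) * ennreal (exp (- s / 4) / 4) * indicator {0..} s \<partial>lborel) =
      (\<integral>\<^sup>+s. g s * race_weight (card S) s \<partial>lborel)"
    proof (intro nn_integral_cong)
      fix s :: real
      have "exp (- s / 4) ^ (card S - 1) * exp (- s / 4) = exp (- (real (card S) / 4) * s)" 
      proof -
        have "card S = Suc (card S - 1)" using assms(3) finS by (simp add: card_gt_0_iff) (metis Suc_pred card_gt_0_iff empty_iff)
        then have "exp (- s / 4) ^ (card S - 1) * exp (- s / 4) = exp (- s / 4) ^ card S" by (metis power_Suc2)
        then show ?thesis by (simp add: exp_of_nat_mult[symmetric] mult.commute)
      qed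
      then show "g s * ennreal (exp (- \<bar>s\<bar> / 4) ^ (card S - 1)) * ennreal (exp (- s / 4) / 4) * indicator {0..} s =
          g s * race_weight (card S) s"
        by (auto simp: race_weight_def indicator_def mult.assoc ennreal_mult[symmetric])
    qed
  qed measurable
  finally show ?thesis .
qed

text \<open>That ties have probability zero follows by counting: the strict victories already have total mass
  one.\<close>

lemma race:
  fixes g :: "'e \<Rightarrow> real \<Rightarrow> ennreal" and E S :: "'e set"
  assumes "finite E" "S \<subseteq> E" "S \<noteq> {}" and g [measurable]: "\<And>e. g e \<in> borel_measurable borel"
  shows "(\<integral>\<^sup>+\<omega>. g (arg_min_on (\<lambda>e. \<omega> (n, e)) S) (Min ((\<lambda>e. \<omega> (n, e)) ` S)) \<partial>PiM ({n} \<times> E) (\<lambda>_. clk))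
    = (\<Sum>e\<in>S. \<integral>\<^sup>+s. g e s * race_weight (card S) s \<partial>lborel)"
proof -
  let ?P = "PiM ({n} \<times> E) (\<lambda>_. clk) :: (('a \<times> 'e) \<Rightarrow> real) measure"
  interpret P: prob_space ?P by (rule prob_space_PiM) (rule prob_space_clk)
  have finS: "finite S" using assms finite_subset by auto
  let ?W = "\<lambda>e. {\<omega>. \<forall>e'\<in>S - {e}. \<omega> (n, e) < (\<omega> (n, e') :: real)}"
  have c: "(\<lambda>\<omega>. \<omega> (n, x)) \<in> borel_measurable ?P" if "x \<in> S" for x
    using measurable_component_singleton[of "(n, x)" "{n} \<times> E" "\<lambda>_. clk"] that assms(2)
    by (auto cong: measurable_cong_sets)
  have mW: "(indicator (?W e) :: _ \<Rightarrow> ennreal) \<in> borel_measurable ?P" if "e \<in> S" for e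
  proof -
    have "{\<omega> \<in> space ?P. \<forall>e'\<in>S - {e}. \<omega> (n, e) < \<omega> (n, e')} \<in> sets ?P"
    proof (rule sets.sets_Collect_finite_All)
      fix e' assume "e' \<in> S - {e}"
      then have [measurable]: "(\<lambda>\<omega>. \<omega> (n, e')) \<in> borel_measurable ?P" "(\<lambda>\<omega>. \<omega> (n, e)) \<in> borel_measurable ?P"
        using c that by auto
      show "{\<omega> \<in> space ?P. \<omega> (n, e) < \<omega> (n, e')} \<in> sets ?P" by measurable
    qed (use finS in auto)
    then show ?thesis by (subst borel_measurable_indicator_iff) (simp add: Int_def conj_commute)
  qed
  have disj: "(\<Sum>e\<in>S. g' e * indicator (?W e) \<omega>) = g' e0" if "e0 \<in> S" "\<omega> \<in> ?W e0" for g' :: "'e \<Rightarrow> ennreal" and e0 \<omega>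
  proof -
    have "(\<Sum>e\<in>S. g' e * indicator (?W e) \<omega>) = (\<Sum>e\<in>S. if e = e0 then g' e0 else 0)"
    proof (intro sum.cong refl)
      fix e assume e: "e \<in> S"
      show "g' e * indicator (?W e) \<omega> = (if e = e0 then g' e0 else 0)"
      proof (cases "e = e0")
        case False
        then have "\<omega> (n, e0) < \<omega> (n, e)" using that e by auto
        moreover have "\<omega> (n, e) < \<omega> (n, e0)" if "\<omega> \<in> ?W e"
          using that \<open>e0 \<in> S\<close> False by auto
        ultimately have "\<omega> \<notin> ?W e" by fastforce
        then show ?thesis using False by simp
      qed (use that in simp)
    qed
    then show ?thesis using finS that by simp
  qed
  have "(\<integral>\<^sup>+\<omega>. (\<Sum>e\<in>S. 1 * indicator (?W e) \<omega>) \<partial>?P) = (\<Sum>e\<in>S. \<integral>\<^sup>+\<omega>. 1 * indicator (?W e) \<omega> \<partial>?P)"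
    by (rule nn_integral_sum) (use mW in auto)
  also have "\<dots> = (\<Sum>e\<in>S. \<integral>\<^sup>+s. 1 * race_weight (card S) s \<partial>lborel)"
    using race_strict[OF assms(1,2), of _ "\<lambda>_. 1" n] by (intro sum.cong) auto
  also have "\<dots> = 1" using race_weight_total[of "card S"] finS assms(3) by (simp add: card_gt_0_iff)
  finally have total: "(\<integral>\<^sup>+\<omega>. (\<Sum>e\<in>S. 1 * indicator (?W e) \<omega>) \<partial>?P) = 1" .
  have le1: "(\<Sum>e\<in>S. 1 * indicator (?W e) \<omega>) \<le> (1 :: ennreal)" for \<omega>
  proof (cases "\<exists>e0\<in>S. \<omega> \<in> ?W e0")
    case True then show ?thesis using disj[of _ \<omega> "\<lambda>_. 1"] by auto
  next
    case False
    then have "(\<Sum>e\<in>S. 1 * indicator (?W e) \<omega>) = (0 :: ennreal)"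
    proof (intro sum.neutral ballI)
      fix e assume "e \<in> S"
      then have "\<omega> \<notin> ?W e" using False by blast
      then have "indicator (?W e) \<omega> = (0 :: ennreal)" by (rule indicator_simps(2))
      then show "1 * indicator (?W e) \<omega> = (0 :: ennreal)" by (simp only: mult_zero_right)
    qed
    then show ?thesis by simp
  qed
  have AEw: "AE \<omega> in ?P. (\<Sum>e\<in>S. 1 * indicator (?W e) \<omega>) = (1 :: ennreal)"
  proof -
    have "(\<integral>\<^sup>+\<omega>. 1 - (\<Sum>e\<in>S. 1 * indicator (?W e) \<omega>) \<partial>?P) = (\<integral>\<^sup>+\<omega>. 1 \<partial>?P) - (\<integral>\<^sup>+\<omega>. (\<Sum>e\<in>S. 1 * indicator (?W e) \<omega>) \<partial>?P)"
      using mW le1 total by (intro nn_integral_diff) auto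
    also have "\<dots> = 0" using total P.emeasure_space_1 by simp
    finally have "AE \<omega> in ?P. 1 - (\<Sum>e\<in>S. 1 * indicator (?W e) \<omega>) = (0 :: ennreal)"
      using mW by (subst (asm) nn_integral_0_iff_AE) auto
    then show ?thesis
    proof eventually_elim
      case (elim \<omega>)
      then have "1 \<le> (\<Sum>e\<in>S. 1 * indicator (?W e) \<omega> :: ennreal)" by (simp add: diff_eq_0_iff_ennreal)
      then show ?case using le1 by (intro antisym)
    qed
  qed
  have "(\<integral>\<^sup>+\<omega>. g (arg_min_on (\<lambda>e. \<omega> (n, e)) S) (Min ((\<lambda>e. \<omega> (n, e)) ` S)) \<partial>?P) =
      (\<integral>\<^sup>+\<omega>. (\<Sum>e\<in>S. g e (\<omega> (n, e)) * indicator (?W e) \<omega>) \<partial>?P)"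
  proof (rule nn_integral_cong_AE)
    show "AE \<omega> in ?P. g (arg_min_on (\<lambda>e. \<omega> (n, e)) S) (Min ((\<lambda>e. \<omega> (n, e)) ` S)) =
        (\<Sum>e\<in>S. g e (\<omega> (n, e)) * indicator (?W e) \<omega>)"
      using AEw
    proof eventually_elim
      case (elim \<omega>)
      have "\<exists>e0\<in>S. \<omega> \<in> ?W e0"
      proof (rule ccontr)
        assume "\<not> ?thesis"
        then have "(\<Sum>e\<in>S. 1 * indicator (?W e) \<omega>) = (0 :: ennreal)"
          by (intro sum.neutral) (auto simp: indicator_def)
        then show False using elim by simp
      qed
      then obtain e0 where e0: "e0 \<in> S" "\<omega> \<in> ?W e0" by blast
      then have lt: "\<And>e'. e' \<in> S - {e0} \<Longrightarrow> \<omega> (n, e0) < \<omega> (n, e')" by simp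
      have "arg_min_on (\<lambda>e. \<omega> (n, e)) S = e0" by (rule arg_min_on_unique[where f = "\<lambda>e. \<omega> (n, e)", OF e0(1) lt])
      moreover have "Min ((\<lambda>e. \<omega> (n, e)) ` S) = \<omega> (n, e0)" by (rule Min_unique[where f = "\<lambda>e. \<omega> (n, e)", OF finS e0(1) lt])
      ultimately show ?case using disj[OF e0, of "\<lambda>e. g e (\<omega> (n, e))"] by simp
    qed
  qed
  also have "\<dots> = (\<Sum>e\<in>S. \<integral>\<^sup>+\<omega>. g e (\<omega> (n, e)) * indicator (?W e) \<omega> \<partial>?P)"
    by (rule nn_integral_sum) (use mW c g in \<open>auto intro!: borel_measurable_times_ennreal measurable_compose[OF c g]\<close>)
  also have "\<dots> = (\<Sum>e\<in>S. \<integral>\<^sup>+s. g e s * race_weight (card S) s \<partial>lborel)"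
    by (intro sum.cong refl race_strict assms(1,2) g)
  finally show ?thesis .
qed

section \<open>The Laplace functional of the local times\<close>

lemma out_darts_subset: "out_darts D x \<subseteq> darts D"
  unfolding out_darts_def by auto

lemma out_darts_Some: "z \<in> D \<Longrightarrow> out_darts D (Some z) = Pair z ` nbrs z"
  unfolding out_darts_def darts_def contract_def by (auto simp: adjacent_iff_nbrs split: if_splits)

lemma card_out_darts_Some: "z \<in> D \<Longrightarrow> card (out_darts D (Some z)) = 4"
  by (simp add: out_darts_Some card_image inj_on_def)

lemma out_darts_None: "out_darts D None = {(u, v). adjacent u v \<and> u \<notin> D \<and> v \<in> D}"
  unfolding out_darts_def darts_def contract_def by (auto split: if_splits)

lemma finite_out_darts: "finite D \<Longrightarrow> finite (out_darts D x)"
  using finite_subset[OF out_darts_subset finite_darts] by blast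

lemma out_darts_None_nonempty:
  assumes "finite D" "D \<noteq> {}" shows "out_darts D None \<noteq> {}"
proof -
  have "Max (fst ` D) \<in> fst ` D" using assms by (intro Max_in) auto
  then obtain v where v: "v \<in> D" "fst v = Max (fst ` D)" by auto
  have "(fst v + 1, snd v) \<notin> D"
  proof
    assume "(fst v + 1, snd v) \<in> D"
    then have "fst (fst v + 1, snd v) \<in> fst ` D" by (rule imageI)
    then have "fst (fst v + 1, snd v) \<le> Max (fst ` D)" using assms by (intro Max_ge) auto
    then show False using v by simp
  qed
  then have "((fst v + 1, snd v), v) \<in> out_darts D None"
    using v unfolding out_darts_None by (auto simp: adjacent_def)
  then show ?thesis by blast
qed

lemma skeleton_state: "skeleton D \<omega> n \<in> insert None (Some ` D)"
proof (cases n)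
  case (Suc m)
  then show ?thesis by (auto simp: contract_def)
qed simp

lemma arg_min_on_cong:
  assumes "\<And>e. e \<in> S \<Longrightarrow> f e = g e"
  shows "arg_min_on f S = arg_min_on g S"
proof -
  have "is_arg_min f (\<lambda>x. x \<in> S) = is_arg_min g (\<lambda>x. x \<in> S)"
    using assms by (auto simp: is_arg_min_def fun_eq_iff)
  then show ?thesis unfolding arg_min_on_def arg_min_def by simp
qed

lemma skeleton_cong:
  assumes "\<And>k e. k < n \<Longrightarrow> e \<in> darts D \<Longrightarrow> \<omega> (k, e) = \<omega>' (k, e)"
  shows "skeleton D \<omega> n = skeleton D \<omega>' n"
  using assms
proof (induction n)
  case (Suc n)
  have "skeleton D \<omega> n = skeleton D \<omega>' n" using Suc by simp
  moreover have "arg_min_on (\<lambda>e. \<omega> (n, e)) (out_darts D x) = arg_min_on (\<lambda>e. \<omega>' (n, e)) (out_darts D x)" for x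
    using Suc(2)[of n] out_darts_subset[of D x] by (intro arg_min_on_cong) auto
  ultimately show ?case by simp
qed simp

lemma holding_cong:
  assumes "\<And>k e. k \<le> n \<Longrightarrow> e \<in> darts D \<Longrightarrow> \<omega> (k, e) = \<omega>' (k, e)"
  shows "holding_time D \<omega> n = holding_time D \<omega>' n"
proof -
  have "skeleton D \<omega> n = skeleton D \<omega>' n" using assms by (intro skeleton_cong) auto
  moreover have "(\<lambda>e. \<omega> (n, e)) ` out_darts D x = (\<lambda>e. \<omega>' (n, e)) ` out_darts D x" for x
    using assms[of n] out_darts_subset[of D x] by (intro image_cong) auto
  ultimately show ?thesis unfolding holding_time_def by simp
qed

abbreviation clocks_on :: "site set \<Rightarrow> nat set \<Rightarrow> (nat \<times> site \<times> site \<Rightarrow> real) measure" where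
  "clocks_on D I \<equiv> PiM (I \<times> darts D) (\<lambda>_. clk)"

lemma measurable_clock:
  "n \<in> I \<Longrightarrow> e \<in> darts D \<Longrightarrow> (\<lambda>\<omega>. \<omega> (n, e)) \<in> borel_measurable (clocks_on D I)"
  using measurable_component_singleton[of "(n, e)" "I \<times> darts D" "\<lambda>_. clk"] by (simp cong: measurable_cong_sets)

lemma measurable_arg_min:
  assumes "finite D" "n \<in> I"
  shows "(\<lambda>\<omega>. arg_min_on (\<lambda>e. \<omega> (n, e)) (out_darts D x)) \<in> measurable (clocks_on D I) (count_space UNIV)"
proof (rule measurable_count_space_eq2_countable[THEN iffD2], intro conjI ballI)
  let ?O = "out_darts D x"
  define h where "h T = (SOME e :: site \<times> site. e \<in> T)" for T
  have eq: "arg_min_on f ?O = h {e \<in> ?O. \<forall>y\<in>?O. \<not> f y < f e}" for f :: "site \<times> site \<Rightarrow> real"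
    unfolding arg_min_on_def arg_min_def h_def is_arg_min_def
    by (rule arg_cong[of _ _ Eps]) (auto simp: fun_eq_iff)
  fix a
  have "{\<omega> \<in> space (clocks_on D I). h {e \<in> ?O. \<forall>y\<in>?O. \<not> \<omega> (n, y) < \<omega> (n, e)} = a} \<in> sets (clocks_on D I)"
  proof (rule measurable_level_event[OF finite_out_darts[OF assms(1)]])
    fix e assume e: "e \<in> ?O"
    show "{\<omega> \<in> space (clocks_on D I). \<forall>y\<in>?O. \<not> \<omega> (n, y) < \<omega> (n, e)} \<in> sets (clocks_on D I)"
    proof (rule sets.sets_Collect_finite_All[OF _ finite_out_darts[OF assms(1)]])
      fix y assume "y \<in> ?O"
      then have [measurable]: "(\<lambda>\<omega>. \<omega> (n, y)) \<in> borel_measurable (clocks_on D I)"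
        "(\<lambda>\<omega>. \<omega> (n, e)) \<in> borel_measurable (clocks_on D I)"
        using e out_darts_subset[of D x] assms(2) by (auto intro!: measurable_clock)
      show "{\<omega> \<in> space (clocks_on D I). \<not> \<omega> (n, y) < \<omega> (n, e)} \<in> sets (clocks_on D I)" by measurable
    qed
  qed
  then show "(\<lambda>\<omega>. arg_min_on (\<lambda>e. \<omega> (n, e)) ?O) -` {a} \<inter> space (clocks_on D I) \<in> sets (clocks_on D I)"
    unfolding eq by (simp add: vimage_def Int_def conj_commute)
qed auto

lemma measurable_skeleton:
  assumes "finite D" "{..<n} \<subseteq> I"
  shows "(\<lambda>\<omega>. skeleton D \<omega> n) \<in> measurable (clocks_on D I) (count_space UNIV)"
  using assms(2)
proof (induction n)
  case (Suc n)
  have "(\<lambda>\<omega>. contract D (snd (arg_min_on (\<lambda>e. \<omega> (n, e)) (out_darts D x)))) \<in> measurable (clocks_on D I) (count_space UNIV)" for x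
    using Suc(2) by (intro measurable_compose[OF measurable_arg_min[OF assms(1)]]) auto
  moreover have "(\<lambda>\<omega>. skeleton D \<omega> n) \<in> measurable (clocks_on D I) (count_space UNIV)"
    using Suc(2) by (intro Suc(1)) auto
  ultimately show ?case unfolding skeleton.simps by (rule measurable_compose_countable)
qed simp

lemma measurable_holding:
  assumes "finite D" "{..n} \<subseteq> I"
  shows "(\<lambda>\<omega>. holding_time D \<omega> n) \<in> borel_measurable (clocks_on D I)"
  unfolding holding_time_def
proof (rule measurable_compose_countable[where g = "\<lambda>\<omega>. skeleton D \<omega> n"])
  show "(\<lambda>\<omega>. Min ((\<lambda>e. \<omega> (n, e)) ` out_darts D x)) \<in> borel_measurable (clocks_on D I)" for x
    using assms(2) out_darts_subset[of D x]
    by (intro borel_measurable_Min finite_out_darts assms measurable_clock) auto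
  show "(\<lambda>\<omega>. skeleton D \<omega> n) \<in> measurable (clocks_on D I) (count_space UNIV)"
    using assms by (intro measurable_skeleton) auto
qed

definition root_time :: "site set \<Rightarrow> (nat \<times> site \<times> site \<Rightarrow> real) \<Rightarrow> nat \<Rightarrow> real" where
  "root_time D \<omega> n = (\<Sum>k<n. if skeleton D \<omega> k = None then holding_time D \<omega> k else 0)"

text \<open>Only the visits that begin while the local time at the contracted point is at most \<open>t\<close> are counted. Once it has
  exceeded \<open>t\<close>, the sum is the local time at \<open>z\<close> at the inverse local time \<open>t\<close>.\<close>

definition stopped_time ::
    "site set \<Rightarrow> real \<Rightarrow> (nat \<times> site \<times> site \<Rightarrow> real) \<Rightarrow> site \<Rightarrow> nat \<Rightarrow> real" where
  "stopped_time D t \<omega> z n =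
     (\<Sum>k<n. if skeleton D \<omega> k = Some z \<and> root_time D \<omega> k \<le> t then holding_time D \<omega> k else 0)"

lemma root_time_cong:
  assumes "\<And>k e. k < n \<Longrightarrow> e \<in> darts D \<Longrightarrow> \<omega> (k, e) = \<omega>' (k, e)"
  shows "root_time D \<omega> n = root_time D \<omega>' n"
  unfolding root_time_def
  by (intro sum.cong refl) (use assms skeleton_cong[of _ D \<omega> \<omega>'] holding_cong[of _ D \<omega> \<omega>'] in auto)

lemma stopped_time_cong:
  assumes "\<And>k e. k < n \<Longrightarrow> e \<in> darts D \<Longrightarrow> \<omega> (k, e) = \<omega>' (k, e)"
  shows "stopped_time D t \<omega> z n = stopped_time D t \<omega>' z n"
  unfolding stopped_time_def
  by (intro sum.cong refl)
     (use assms skeleton_cong[of _ D \<omega> \<omega>'] holding_cong[of _ D \<omega> \<omega>'] root_time_cong[of _ D \<omega> \<omega>'] in auto)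

lemma measurable_is_state:
  assumes "finite D" "{..<n} \<subseteq> I"
  shows "{\<omega> \<in> space (clocks_on D I). skeleton D \<omega> n = x} \<in> sets (clocks_on D I)"
  using measurable_sets[OF measurable_skeleton[OF assms], of "{x}"] by (simp add: vimage_def Int_def conj_commute)

lemma measurable_root_time:
  assumes "finite D" "{..<n} \<subseteq> I"
  shows "(\<lambda>\<omega>. root_time D \<omega> n) \<in> borel_measurable (clocks_on D I)"
  unfolding root_time_def using assms
  by (intro borel_measurable_sum measurable_If measurable_holding measurable_is_state) auto

lemma measurable_stopped_time:
  assumes "finite D" "{..<n} \<subseteq> I"
  shows "(\<lambda>\<omega>. stopped_time D t \<omega> z n) \<in> borel_measurable (clocks_on D I)"
  unfolding stopped_time_def
proof (intro borel_measurable_sum measurable_If)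
  fix k assume k: "k \<in> {..<n}"
  show "(\<lambda>\<omega>. holding_time D \<omega> k) \<in> borel_measurable (clocks_on D I)"
    using assms k by (intro measurable_holding) auto
  have a: "{\<omega> \<in> space (clocks_on D I). skeleton D \<omega> k = Some z} \<in> sets (clocks_on D I)"
    using assms k by (intro measurable_is_state) auto
  have [measurable]: "(\<lambda>\<omega>. root_time D \<omega> k) \<in> borel_measurable (clocks_on D I)"
    using assms k by (intro measurable_root_time) auto
  have b: "{\<omega> \<in> space (clocks_on D I). root_time D \<omega> k \<le> t} \<in> sets (clocks_on D I)" by measurable
  show "{\<omega> \<in> space (clocks_on D I). skeleton D \<omega> k = Some z \<and> root_time D \<omega> k \<le> t} \<in> sets (clocks_on D I)"
    by (intro sets.sets_Collect_conj a b)
qed simp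

text \<open>The clocks of the step \<open>n\<close> are independent of the past, so that given the past the step is a race between the
  darts that leave the current state.\<close>

lemma one_step:
  assumes "finite D" "D \<noteq> {}" and \<omega>: "\<omega> \<in> space (clocks_on D {..<n})"
    and m: "F \<in> borel_measurable (clocks_on D {..<Suc n})" and g: "\<And>e. g e \<in> borel_measurable borel"
    and F: "\<And>\<omega>'. (\<And>k e. k < n \<Longrightarrow> e \<in> darts D \<Longrightarrow> \<omega>' (k, e) = \<omega> (k, e)) \<Longrightarrow>
      F \<omega>' = g (arg_min_on (\<lambda>e. \<omega>' (n, e)) (out_darts D (skeleton D \<omega> n))) (holding_time D \<omega>' n)"
  shows "(\<integral>\<^sup>+\<omega>'. F (merge ({..<n} \<times> darts D) ({n} \<times> darts D) (\<omega>, \<omega>')) \<partial>clocks_on D {n}) =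
    (\<Sum>e\<in>out_darts D (skeleton D \<omega> n). \<integral>\<^sup>+s. g e s * race_weight (card (out_darts D (skeleton D \<omega> n))) s \<partial>lborel)"
proof -
  let ?S = "out_darts D (skeleton D \<omega> n)" and ?m = "\<lambda>\<omega>'. merge ({..<n} \<times> darts D) ({n} \<times> darts D) (\<omega>, \<omega>')"
  have ne: "?S \<noteq> {}"
    using skeleton_state[of D \<omega> n] out_darts_None_nonempty[OF assms(1,2)] card_out_darts_Some[of _ D] by fastforce
  have mm: "?m \<omega>' (k, e) = \<omega> (k, e)" if "k < n" "e \<in> darts D" for \<omega>' k e
    using that by (simp add: merge_def)
  have mn: "?m \<omega>' (n, e) = \<omega>' (n, e)" if "e \<in> darts D" for \<omega>' e
    using that by (simp add: merge_def)
  have "F (?m \<omega>') = g (arg_min_on (\<lambda>e. \<omega>' (n, e)) ?S) (Min ((\<lambda>e. \<omega>' (n, e)) ` ?S))" for \<omega>'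
  proof -
    have sk: "skeleton D (?m \<omega>') n = skeleton D \<omega> n" by (rule skeleton_cong) (rule mm)
    have "arg_min_on (\<lambda>e. ?m \<omega>' (n, e)) ?S = arg_min_on (\<lambda>e. \<omega>' (n, e)) ?S"
      by (rule arg_min_on_cong) (use mn out_darts_subset in blast)
    moreover have "(\<lambda>e. ?m \<omega>' (n, e)) ` ?S = (\<lambda>e. \<omega>' (n, e)) ` ?S"
      by (rule image_cong[OF refl]) (use mn out_darts_subset in blast)
    ultimately show ?thesis using F[of "?m \<omega>'", OF mm] unfolding holding_time_def sk by simp
  qed
  then have "(\<integral>\<^sup>+\<omega>'. F (?m \<omega>') \<partial>clocks_on D {n}) =
      (\<integral>\<^sup>+\<omega>'. g (arg_min_on (\<lambda>e. \<omega>' (n, e)) ?S) (Min ((\<lambda>e. \<omega>' (n, e)) ` ?S)) \<partial>clocks_on D {n})" by simp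
  also have "\<dots> = (\<Sum>e\<in>?S. \<integral>\<^sup>+s. g e s * race_weight (card ?S) s \<partial>lborel)"
    by (rule race[OF finite_darts[OF assms(1)] out_darts_subset ne g])
  finally show ?thesis .
qed

lemma level_fubini:
  assumes "finite D" "F \<in> borel_measurable (clocks_on D {..<Suc n})"
  shows "(\<integral>\<^sup>+\<omega>. F \<omega> \<partial>clocks_on D {..<Suc n}) =
    (\<integral>\<^sup>+\<omega>. (\<integral>\<^sup>+\<omega>'. F (merge ({..<n} \<times> darts D) ({n} \<times> darts D) (\<omega>, \<omega>')) \<partial>clocks_on D {n}) \<partial>clocks_on D {..<n})"
proof -
  have un: "{..<Suc n} \<times> darts D = {..<n} \<times> darts D \<union> {n} \<times> darts D" by auto
  show ?thesis
    using assms(2) unfolding un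
    by (intro clocks.product_nn_integral_fold) (use finite_darts[OF assms(1)] in auto)
qed

lemma nn_integral_clock_space:
  assumes "finite D" and m: "F \<in> borel_measurable (clocks_on D {..<n})"
    and dep: "\<And>\<omega> \<omega>'. (\<And>k e. k < n \<Longrightarrow> e \<in> darts D \<Longrightarrow> \<omega> (k, e) = \<omega>' (k, e)) \<Longrightarrow> F \<omega> = F \<omega>'"
  shows "(\<integral>\<^sup>+\<omega>. F \<omega> \<partial>clock_space D) = (\<integral>\<^sup>+\<omega>. F \<omega> \<partial>clocks_on D {..<n})"
proof -
  interpret P: product_prob_space "\<lambda>_. clk" "UNIV \<times> darts D :: (nat \<times> site \<times> site) set" by standard
  let ?J = "{..<n} \<times> darts D"
  have d: "distr (clock_space D) (clocks_on D {..<n}) (\<lambda>x. restrict x ?J) = clocks_on D {..<n}"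
    unfolding clock_space_def
    by (rule P.distr_PiM_restrict_finite) (use finite_darts[OF assms(1)] in auto)
  have "(\<integral>\<^sup>+\<omega>. F \<omega> \<partial>clocks_on D {..<n}) = (\<integral>\<^sup>+\<omega>. F (restrict \<omega> ?J) \<partial>clock_space D)"
    by (subst d[symmetric], rule nn_integral_distr)
       (use m in \<open>auto simp: clock_space_def intro!: measurable_restrict_subset\<close>)
  also have "\<dots> = (\<integral>\<^sup>+\<omega>. F \<omega> \<partial>clock_space D)"
    by (intro nn_integral_cong dep) auto
  finally show ?thesis ..
qed

lemma contract_Some: "z \<in> D \<Longrightarrow> contract D z = Some z"
  by (simp add: contract_def)

definition extend :: "(site \<Rightarrow> real) \<Rightarrow> site option \<Rightarrow> real" where
  "extend u x = (case x of None \<Rightarrow> 1 | Some z \<Rightarrow> u z)"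

text \<open>Excursions into \<open>D\<close> start at rate \<open>1/4\<close> along each edge at the contracted point, and each of them
  multiplies the Laplace functional by the value of \<open>u\<close> at its first vertex.\<close>

definition root_rate :: "site set \<Rightarrow> (site \<Rightarrow> real) \<Rightarrow> real" where
  "root_rate D u = (\<Sum>e\<in>out_darts D None. (1 - u (snd e)) / 4)"

text \<open>If \<open>u z\<close> is the Laplace functional of the local times of one excursion started at \<open>z\<close>, the
  process below is the conditional expectation, given the first \<open>n\<close> steps, of the Laplace functional of
  the local times at the inverse local time \<open>t\<close> of the contracted point.\<close>

definition laplace_mart ::
    "site set \<Rightarrow> real \<Rightarrow> (site \<Rightarrow> real) \<Rightarrow> (site \<Rightarrow> real) \<Rightarrow> nat \<Rightarrow> (nat \<times> site \<times> site \<Rightarrow> real) \<Rightarrow> real" where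
  "laplace_mart D t v u n \<omega> = exp (- (\<Sum>z\<in>D. v z * stopped_time D t \<omega> z n)) *
     (if root_time D \<omega> n \<le> t then extend u (skeleton D \<omega> n) * exp (- root_rate D u * (t - root_time D \<omega> n)) else 1)"

lemma measurable_laplace_mart:
  assumes "finite D" "{..<n} \<subseteq> I"
  shows "laplace_mart D t v u n \<in> borel_measurable (clocks_on D I)"
proof -
  note [measurable] = measurable_stopped_time[OF assms] measurable_root_time[OF assms]
  have [measurable]: "(\<lambda>\<omega>. extend u (skeleton D \<omega> n)) \<in> borel_measurable (clocks_on D I)"
    by (rule measurable_compose[OF measurable_skeleton[OF assms]]) simp
  show ?thesis unfolding laplace_mart_def[abs_def] by measurable
qed

text \<open>At a vertex of \<open>D\<close> the holding time has rate \<open>1\<close>, so that the factor \<open>exp (- v z * holding time)\<close> has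
  mean \<open>1 / (1 + v z)\<close>; this is compensated by the equation for \<open>u\<close>. At the contracted point the excursions
  weighted by \<open>u\<close> are compensated by \<open>root_rate\<close>.\<close>

lemma laplace_mart_step:
  assumes "finite D" "D \<noteq> {}" "0 \<le> t" and v: "\<And>z. z \<in> D \<Longrightarrow> 0 \<le> v z"
    and u: "\<And>z. z \<notin> D \<Longrightarrow> u z = 1" "\<And>z. z \<in> D \<Longrightarrow> (1 + v z) * u z = lavg u z" "\<And>z. 0 \<le> u z" "\<And>z. u z \<le> 1"
  shows "(\<integral>\<^sup>+\<omega>. ennreal (laplace_mart D t v u (Suc n) \<omega>) \<partial>clocks_on D {..<Suc n}) =
    (\<integral>\<^sup>+\<omega>. ennreal (laplace_mart D t v u n \<omega>) \<partial>clocks_on D {..<n})"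
proof -
  let ?M = "laplace_mart D t v u" and ?c = "root_rate D u"
  have mM: "(\<lambda>\<omega>. ennreal (?M (Suc n) \<omega>)) \<in> borel_measurable (clocks_on D {..<Suc n})"
    using measurable_laplace_mart[OF assms(1) subset_refl] by measurable
  have "(\<integral>\<^sup>+\<omega>'. ennreal (?M (Suc n) (merge ({..<n} \<times> darts D) ({n} \<times> darts D) (\<omega>, \<omega>'))) \<partial>clocks_on D {n}) =
      ennreal (?M n \<omega>)" if \<omega>: "\<omega> \<in> space (clocks_on D {..<n})" for \<omega>
  proof -
    define x where "x = skeleton D \<omega> n"
    define A where "A = root_time D \<omega> n"
    define W where "W = (\<Sum>z\<in>D. v z * stopped_time D t \<omega> z n)"
    define O' where "O' = out_darts D x"
    define r where "r s = (if x = None then s else 0)" for s :: real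
    define vx where "vx = (case x of None \<Rightarrow> 0 | Some z \<Rightarrow> if A \<le> t then v z else 0)"
    define g where "g e s = ennreal (exp (- (W + vx * s)) *
        (if A + r s \<le> t then extend u (contract D (snd e)) * exp (- ?c * (t - (A + r s))) else 1))"
      for e :: "site \<times> site" and s
    have finO: "finite O'" unfolding O'_def using finite_out_darts[OF assms(1)] .
    have Mn: "?M n \<omega> = exp (- W) * (if A \<le> t then extend u x * exp (- ?c * (t - A)) else 1)"
      unfolding laplace_mart_def x_def A_def W_def ..
    have mr [measurable]: "r \<in> borel_measurable borel" unfolding r_def[abs_def] by (cases "x = None") simp_all
    have mg [measurable]: "g e \<in> borel_measurable borel" for e unfolding g_def[abs_def] by measurable
    have x: "x \<in> insert None (Some ` D)" unfolding x_def by (rule skeleton_state)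
    have "(\<integral>\<^sup>+\<omega>'. ennreal (?M (Suc n) (merge ({..<n} \<times> darts D) ({n} \<times> darts D) (\<omega>, \<omega>'))) \<partial>clocks_on D {n}) =
        (\<Sum>e\<in>O'. \<integral>\<^sup>+s. g e s * race_weight (card O') s \<partial>lborel)"
      unfolding O'_def x_def
    proof (rule one_step[OF assms(1,2) \<omega> mM mg])
      fix \<omega>' assume same: "\<And>k e. k < n \<Longrightarrow> e \<in> darts D \<Longrightarrow> \<omega>' (k, e) = \<omega> (k, e)"
      let ?e = "arg_min_on (\<lambda>e. \<omega>' (n, e)) (out_darts D (skeleton D \<omega> n))" and ?H = "holding_time D \<omega>' n"
      have sk: "skeleton D \<omega>' n = x" unfolding x_def by (rule skeleton_cong) (rule same)
      have rt: "root_time D \<omega>' n = A" unfolding A_def by (rule root_time_cong) (rule same)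
      have st: "stopped_time D t \<omega>' z n = stopped_time D t \<omega> z n" for z by (rule stopped_time_cong) (rule same)
      have 1: "root_time D \<omega>' (Suc n) = A + r ?H"
        using rt unfolding root_time_def r_def by (simp add: sk)
      have 2: "(\<Sum>z\<in>D. v z * stopped_time D t \<omega>' z (Suc n)) = W + vx * ?H"
      proof -
        have "stopped_time D t \<omega>' z (Suc n) = stopped_time D t \<omega> z n + (if x = Some z \<and> A \<le> t then ?H else 0)" for z
          using st[of z] rt unfolding stopped_time_def by (simp add: sk)
        then have "(\<Sum>z\<in>D. v z * stopped_time D t \<omega>' z (Suc n)) =
            W + (\<Sum>z\<in>D. if x = Some z \<and> A \<le> t then v z * ?H else 0)"
          unfolding W_def sum.distrib[symmetric] by (intro sum.cong) (simp_all add: distrib_left)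
        also have "(\<Sum>z\<in>D. if x = Some z \<and> A \<le> t then v z * ?H else 0) = vx * ?H"
          using x assms(1) by (cases x; cases "A \<le> t") (auto simp: vx_def)
        finally show ?thesis .
      qed
      have 3: "skeleton D \<omega>' (Suc n) = contract D (snd ?e)" by (simp add: sk x_def)
      show "ennreal (?M (Suc n) \<omega>') = g ?e ?H"
        unfolding laplace_mart_def g_def 1 2 3 ..
    qed
    also have "\<dots> = ennreal (?M n \<omega>)"
    proof (cases "A \<le> t")
      case False
      have "g e s * race_weight (card O') s = ennreal (exp (- W)) * race_weight (card O') s" for e s
        using False x by (auto simp: g_def race_weight_def indicator_def vx_def r_def split: option.splits)
      then have "(\<Sum>e\<in>O'. \<integral>\<^sup>+s. g e s * race_weight (card O') s \<partial>lborel) =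
          ennreal (exp (- W)) * (of_nat (card O') * (\<integral>\<^sup>+s. race_weight (card O') s \<partial>lborel))"
        by (simp add: nn_integral_cmult mult.left_commute)
      also have "\<dots> = ennreal (exp (- W))"
      proof -
        have "O' \<noteq> {}" using x out_darts_None_nonempty[OF assms(1,2)] card_out_darts_Some[of _ D]
          unfolding O'_def by fastforce
        then show ?thesis using race_weight_total[of "card O'"] finO by (simp add: card_gt_0_iff)
      qed
      finally show ?thesis using False unfolding Mn by simp
    next
      case At: True
      show ?thesis
      proof (cases x)
        case (Some z)
        have z: "z \<in> D" using x Some by auto
        define K where "K e = exp (- W) * (extend u (contract D (snd e)) * exp (- ?c * (t - A))) / (4 * (1 + v z))" for e :: "site \<times> site"
        have ext: "extend u (contract D w) = u w" for w using u(1)[of w] by (simp add: extend_def contract_def)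
        have vz: "0 < 1 + v z" using v[OF z] by simp
        have Knn: "0 \<le> K e" for e unfolding K_def ext using u(3) vz by simp
        have "(\<integral>\<^sup>+s. g e s * race_weight (card O') s \<partial>lborel) = ennreal (K e)" for e
        proof -
          have "g e s * race_weight (card O') s = ennreal (K e) * (ennreal ((1 + v z) * exp (- (1 + v z) * s)) * indicator {0..} s)" for s
          proof (cases "0 \<le> s")
            case True
            have c4: "card O' = 4" unfolding O'_def Some using card_out_darts_Some[OF z] .
            have "exp (- (W + v z * s)) * (extend u (contract D (snd e)) * exp (- ?c * (t - A))) * (exp (- s) / 4) =
                K e * ((1 + v z) * exp (- (1 + v z) * s))"
            proof -
              have "exp (- (W + v z * s)) * exp (- s) = exp (- W) * exp (- (1 + v z) * s)"
                by (simp add: exp_add[symmetric] algebra_simps)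
              moreover have "a * X * (b / 4) = w * X / (4 * V) * (V * e)" if "a * b = w * e" "0 < V" for a b w e X V :: real
              proof -
                have "a * X * (b / 4) = (a * b) * X / 4" by simp
                also have "\<dots> = w * X / (4 * V) * (V * e)" unfolding that(1) using that(2) by (simp add: field_simps)
                finally show ?thesis .
              qed
              ultimately show ?thesis unfolding K_def using vz by blast
            qed
            then show ?thesis
              using True At Knn[of e] vz u(3) unfolding g_def r_def vx_def Some race_weight_def c4 ext
              by (simp add: ennreal_mult[symmetric])
          qed (simp add: race_weight_def)
          then show ?thesis
            using exp_tail[OF vz, of 0] by (simp add: nn_integral_cmult)
        qed
        then have "(\<Sum>e\<in>O'. \<integral>\<^sup>+s. g e s * race_weight (card O') s \<partial>lborel) = ennreal (\<Sum>e\<in>O'. K e)"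
          using Knn by simp
        also have "(\<Sum>e\<in>O'. K e) = (\<Sum>w\<in>nbrs z. K (z, w))"
          unfolding O'_def Some out_darts_Some[OF z] by (subst sum.reindex) (auto simp: inj_on_def)
        also have "\<dots> = exp (- W) * exp (- ?c * (t - A)) / (1 + v z) * lavg u z"
        proof -
          have "K (z, w) = exp (- W) * exp (- ?c * (t - A)) / (1 + v z) * (u w / 4)" for w
          proof -
            have "a * (b * c) / (4 * V) = a * c / V * (b / 4)" if "0 < V" for a b c V :: real
              using that by (simp add: field_simps)
            then show ?thesis unfolding K_def ext snd_conv using vz by blast
          qed
          then show ?thesis
            by (simp only: sum_distrib_left[symmetric] sum_divide_distrib[symmetric] lavg_def)
        qed
        also have "\<dots> = ?M n \<omega>"
          unfolding Mn u(2)[OF z, symmetric] using At vz Some by (simp add: extend_def)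
        finally show ?thesis .
      next
        case None
        define d where "d = card O'"
        define q where "q = real d / 4"
        define \<tau> where "\<tau> = t - A"
        have \<tau>: "0 \<le> \<tau>" using At unfolding \<tau>_def by simp
        have d0: "0 < d" unfolding d_def O'_def None
          using out_darts_None_nonempty[OF assms(1,2)] finite_out_darts[OF assms(1)] by (simp add: card_gt_0_iff)
        have qc: "(\<Sum>e\<in>O'. u (snd e)) / 4 = q - ?c"
          unfolding q_def root_rate_def d_def O'_def None
          by (simp add: sum_subtractf sum_divide_distrib[symmetric] diff_divide_distrib)
        have qc0: "0 \<le> q - ?c" unfolding qc[symmetric] using u(3) by (simp add: sum_nonneg)
        have sndD: "snd e \<in> D" if "e \<in> O'" for e using that unfolding O'_def None out_darts_None by auto
        have ext: "extend u (contract D (snd e)) = u (snd e)" if "e \<in> O'" for e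
          using sndD[OF that] by (simp add: extend_def contract_def)
        let ?F1 = "\<lambda>s. ennreal (exp (- ?c * \<tau>) * ((q - ?c) * exp (- (q - ?c) * s))) * indicator {0..\<tau>} s"
        let ?F2 = "\<lambda>s. ennreal (q * exp (- q * s)) * indicator {\<tau>..} s"
        have sum_g: "(\<Sum>e\<in>O'. g e s * race_weight d s) = ennreal (exp (- W)) * (?F1 s + ?F2 s)" if "s \<noteq> \<tau>" for s
        proof (cases "0 \<le> s")
          case False
          then show ?thesis using \<tau> by (auto simp: race_weight_def indicator_def)
        next
          case s: True
          show ?thesis
          proof (cases "s < \<tau>")
            case True
            have "g e s * race_weight d s = ennreal (exp (- W) * (exp (- ?c * \<tau>) * exp (- (q - ?c) * s)) * (u (snd e) / 4))"
              if "e \<in> O'" for e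
            proof -
              have le: "A + s \<le> t" using True unfolding \<tau>_def by simp
              have "exp (- ?c * (t - (A + s))) * exp (- q * s) = exp (- ?c * \<tau>) * exp (- (q - ?c) * s)"
                unfolding \<tau>_def by (simp add: exp_add[symmetric] algebra_simps)
              then have "exp (- W) * (u (snd e) * exp (- ?c * (t - (A + s)))) * (exp (- q * s) / 4) =
                  exp (- W) * (exp (- ?c * \<tau>) * exp (- (q - ?c) * s)) * (u (snd e) / 4)"
                by (simp add: mult_ac)
              then show ?thesis
                using s le u(3) unfolding g_def race_weight_def vx_def r_def None ext[OF that] q_def
                by (simp add: ennreal_mult[symmetric])
            qed
            then have "(\<Sum>e\<in>O'. g e s * race_weight d s) =
                ennreal (\<Sum>e\<in>O'. exp (- W) * (exp (- ?c * \<tau>) * exp (- (q - ?c) * s)) * (u (snd e) / 4))"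
              using u(3) by (simp add: sum_ennreal)
            also have "(\<Sum>e\<in>O'. exp (- W) * (exp (- ?c * \<tau>) * exp (- (q - ?c) * s)) * (u (snd e) / 4)) =
                exp (- W) * (exp (- ?c * \<tau>) * ((q - ?c) * exp (- (q - ?c) * s)))"
              unfolding sum_distrib_left[symmetric] sum_divide_distrib[symmetric] qc by (simp add: mult_ac)
            finally show ?thesis using True s qc0 by (simp add: ennreal_mult)
          next
            case False
            then have gt: "\<tau> < s" using that by simp
            have "g e s * race_weight d s = ennreal (exp (- W) * (exp (- q * s) / 4))" for e
            proof -
              have "\<not> A + s \<le> t" using gt unfolding \<tau>_def by simp
              then show ?thesis
                using s unfolding g_def race_weight_def vx_def r_def None q_def by (simp add: ennreal_mult[symmetric])
            qed
            then have "(\<Sum>e\<in>O'. g e s * race_weight d s) = ennreal (real d * (exp (- W) * (exp (- q * s) / 4)))"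
              by (simp add: d_def ennreal_of_nat_eq_real_of_nat ennreal_mult[symmetric])
            also have "real d * (exp (- W) * (exp (- q * s) / 4)) = exp (- W) * (q * exp (- q * s))"
              unfolding q_def by simp
            finally show ?thesis using gt s by (simp add: ennreal_mult[symmetric] q_def)
          qed
        qed
        have "(\<Sum>e\<in>O'. \<integral>\<^sup>+s. g e s * race_weight (card O') s \<partial>lborel) = (\<integral>\<^sup>+s. (\<Sum>e\<in>O'. g e s * race_weight d s) \<partial>lborel)"
          unfolding d_def
          by (rule nn_integral_sum[symmetric]) (use mg measurable_race_weight in \<open>simp add: borel_measurable_times_ennreal\<close>)
        also have "\<dots> = (\<integral>\<^sup>+s. ennreal (exp (- W)) * (?F1 s + ?F2 s) \<partial>lborel)"
        proof (rule nn_integral_cong_AE)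
          show "AE s in lborel. (\<Sum>e\<in>O'. g e s * race_weight d s) = ennreal (exp (- W)) * (?F1 s + ?F2 s)"
            using AE_lborel_singleton[of \<tau>] by eventually_elim (rule sum_g)
        qed
        also have "\<dots> = ennreal (exp (- W)) * ((\<integral>\<^sup>+s. ?F1 s \<partial>lborel) + (\<integral>\<^sup>+s. ?F2 s \<partial>lborel))"
          by (simp add: nn_integral_cmult nn_integral_add)
        also have "(\<integral>\<^sup>+s. ?F2 s \<partial>lborel) = ennreal (exp (- q * \<tau>))"
          using d0 by (intro exp_tail) (simp add: q_def)
        also have "(\<integral>\<^sup>+s. ?F1 s \<partial>lborel) = ennreal (exp (- ?c * \<tau>) * (- exp (- (q - ?c) * \<tau>)) - exp (- ?c * \<tau>) * (- exp (- (q - ?c) * 0)))"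
        proof (rule nn_integral_FTC_Icc[where F = "\<lambda>s. exp (- ?c * \<tau>) * (- exp (- (q - ?c) * s))"])
          show "((\<lambda>s. exp (- ?c * \<tau>) * (- exp (- (q - ?c) * s))) has_real_derivative
              exp (- ?c * \<tau>) * ((q - ?c) * exp (- (q - ?c) * s))) (at s)" for s
            by (auto intro!: derivative_eq_intros simp: algebra_simps)
        qed (use qc0 \<tau> in auto)
        also have "exp (- ?c * \<tau>) * (- exp (- (q - ?c) * \<tau>)) - exp (- ?c * \<tau>) * (- exp (- (q - ?c) * 0)) = exp (- ?c * \<tau>) - exp (- q * \<tau>)"
          by (simp add: exp_add[symmetric] algebra_simps)
        also have "ennreal (exp (- ?c * \<tau>) - exp (- q * \<tau>)) + ennreal (exp (- q * \<tau>)) = ennreal (exp (- ?c * \<tau>))"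
        proof -
          have "?c * \<tau> \<le> q * \<tau>" using qc0 \<tau> by (intro mult_right_mono) auto
          then show ?thesis by (subst ennreal_plus[symmetric]) auto
        qed
        also have "ennreal (exp (- W)) * ennreal (exp (- ?c * \<tau>)) = ennreal (?M n \<omega>)"
          unfolding Mn using At None by (simp add: ennreal_mult[symmetric] extend_def \<tau>_def)
        finally show ?thesis .
      qed
    qed
    finally show ?thesis .
  qed
  then show ?thesis
    unfolding level_fubini[OF assms(1) mM] by (intro nn_integral_cong) auto
qed

text \<open>The local time at the contracted point grows to infinity: \<open>exp (- local time)\<close>, multiplied by a
  bounded Lyapunov function of the state, contracts in mean at every step.\<close>

definition lyap :: "real \<Rightarrow> real \<Rightarrow> site option \<Rightarrow> real" where
  "lyap \<epsilon> R x = (case x of None \<Rightarrow> 1 | Some z \<Rightarrow> 1 + \<epsilon> * paraboloid R z)"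

text \<open>At a vertex of \<open>D\<close> the Lyapunov function decreases by at least \<open>\<epsilon>\<close> in mean. At the contracted point it may increase by
  \<open>\<epsilon> * R\<close>, while the holding time of rate \<open>q\<close> contributes the factor \<open>q / (q + 1)\<close>; the choice
  \<open>\<epsilon> * R * q = 1/2\<close> leaves \<open>(q + 1/2) / (q + 1)\<close>.\<close>

lemma lyap_step:
  assumes "finite D" "D \<noteq> {}" and R: "\<And>z. z \<in> D \<Longrightarrow> 1 \<le> paraboloid R z"
    "\<And>z w. z \<in> D \<Longrightarrow> w \<in> nbrs z \<Longrightarrow> 1 \<le> paraboloid R w" "1 \<le> R"
    and q: "q = real (card (out_darts D None)) / 4" and \<epsilon>: "\<epsilon> = 1 / (2 * q * R)"
    and \<kappa>: "\<kappa> = max ((q + 1 / 2) / (q + 1)) (1 - \<epsilon> / (1 + \<epsilon> * R))"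
  shows "(\<integral>\<^sup>+\<omega>. ennreal (exp (- root_time D \<omega> (Suc n)) * lyap \<epsilon> R (skeleton D \<omega> (Suc n))) \<partial>clocks_on D {..<Suc n}) \<le>
    ennreal \<kappa> * (\<integral>\<^sup>+\<omega>. ennreal (exp (- root_time D \<omega> n) * lyap \<epsilon> R (skeleton D \<omega> n)) \<partial>clocks_on D {..<n})"
proof -
  let ?Y = "\<lambda>n \<omega>. exp (- root_time D \<omega> n) * lyap \<epsilon> R (skeleton D \<omega> n)"
  have q0: "0 < q" unfolding q
    using out_darts_None_nonempty[OF assms(1,2)] finite_out_darts[OF assms(1)] by (simp add: card_gt_0_iff)
  have e0: "0 < \<epsilon>" unfolding \<epsilon> using q0 R(3) by simp
  have \<kappa>0: "0 \<le> \<kappa>" unfolding \<kappa> using q0 by (intro max.coboundedI1) simp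
  have par: "paraboloid R z \<le> R" for z unfolding paraboloid_def by simp
  have mY: "(\<lambda>\<omega>. ennreal (?Y n \<omega>)) \<in> borel_measurable (clocks_on D {..<n})" for n
  proof -
    note [measurable] = measurable_root_time[OF assms(1) subset_refl, of n]
    have [measurable]: "(\<lambda>\<omega>. lyap \<epsilon> R (skeleton D \<omega> n)) \<in> borel_measurable (clocks_on D {..<n})"
      by (rule measurable_compose[OF measurable_skeleton[OF assms(1) subset_refl]]) simp
    show ?thesis by measurable
  qed
  have lcon: "0 \<le> lyap \<epsilon> R (contract D w) \<and> lyap \<epsilon> R (contract D w) \<le> 1 + \<epsilon> * paraboloid R w"
    if "1 \<le> paraboloid R w" for w
    using that e0 by (auto simp: lyap_def contract_def)
  have "(\<integral>\<^sup>+\<omega>'. ennreal (?Y (Suc n) (merge ({..<n} \<times> darts D) ({n} \<times> darts D) (\<omega>, \<omega>'))) \<partial>clocks_on D {n}) \<le>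
      ennreal \<kappa> * ennreal (?Y n \<omega>)" if \<omega>: "\<omega> \<in> space (clocks_on D {..<n})" for \<omega>
  proof -
    define x where "x = skeleton D \<omega> n"
    define A where "A = root_time D \<omega> n"
    define O' where "O' = out_darts D x"
    define r where "r s = (if x = None then s else 0)" for s :: real
    define g where "g e s = ennreal (exp (- (A + r s)) * lyap \<epsilon> R (contract D (snd e)))" for e :: "site \<times> site" and s
    have mr [measurable]: "r \<in> borel_measurable borel" unfolding r_def[abs_def] by (cases "x = None") simp_all
    have mg [measurable]: "g e \<in> borel_measurable borel" for e unfolding g_def[abs_def] by measurable
    have x: "x \<in> insert None (Some ` D)" unfolding x_def by (rule skeleton_state)
    have "(\<integral>\<^sup>+\<omega>'. ennreal (?Y (Suc n) (merge ({..<n} \<times> darts D) ({n} \<times> darts D) (\<omega>, \<omega>'))) \<partial>clocks_on D {n}) =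
        (\<Sum>e\<in>O'. \<integral>\<^sup>+s. g e s * race_weight (card O') s \<partial>lborel)"
      unfolding O'_def x_def
    proof (rule one_step[OF assms(1,2) \<omega> mY mg])
      fix \<omega>' assume same: "\<And>k e. k < n \<Longrightarrow> e \<in> darts D \<Longrightarrow> \<omega>' (k, e) = \<omega> (k, e)"
      have sk: "skeleton D \<omega>' n = x" unfolding x_def by (rule skeleton_cong) (rule same)
      have rt: "root_time D \<omega>' n = A" unfolding A_def by (rule root_time_cong) (rule same)
      have 1: "root_time D \<omega>' (Suc n) = A + r (holding_time D \<omega>' n)"
        using rt unfolding root_time_def r_def by (simp add: sk)
      show "ennreal (?Y (Suc n) \<omega>') = g (arg_min_on (\<lambda>e. \<omega>' (n, e)) (out_darts D (skeleton D \<omega> n))) (holding_time D \<omega>' n)"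
        unfolding g_def 1 by (simp add: sk x_def)
    qed
    also have "\<dots> \<le> ennreal (\<kappa> * ?Y n \<omega>)"
    proof (cases x)
      case (Some z)
      have z: "z \<in> D" using x Some by auto
      have c4: "card O' = 4" unfolding O'_def Some using card_out_darts_Some[OF z] .
      have O': "O' = Pair z ` nbrs z" unfolding O'_def Some by (rule out_darts_Some[OF z])
      have rw: "(\<integral>\<^sup>+s. race_weight 4 s \<partial>lborel) = ennreal (1 / 4)"
      proof -
        have "race_weight 4 s = ennreal (1 / 4) * (ennreal (1 * exp (- 1 * s)) * indicator {0..} s)" for s
          by (auto simp: race_weight_def indicator_def ennreal_mult[symmetric])
        then show ?thesis using exp_tail[of 1 0] by (simp add: nn_integral_cmult)
      qed
      have "(\<integral>\<^sup>+s. g e s * race_weight (card O') s \<partial>lborel) = ennreal (exp (- A) * lyap \<epsilon> R (contract D (snd e)) * (1 / 4))"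
        if "e \<in> O'" for e
      proof -
        have "0 \<le> lyap \<epsilon> R (contract D (snd e))" using that R(2)[OF z] lcon unfolding O' by auto
        then show ?thesis unfolding g_def r_def Some c4 by (simp add: nn_integral_cmult rw ennreal_mult[symmetric])
      qed
      then have "(\<Sum>e\<in>O'. \<integral>\<^sup>+s. g e s * race_weight (card O') s \<partial>lborel) =
          (\<Sum>e\<in>O'. ennreal (exp (- A) * lyap \<epsilon> R (contract D (snd e)) * (1 / 4)))" by simp
      also have "\<dots> = ennreal (\<Sum>e\<in>O'. exp (- A) * lyap \<epsilon> R (contract D (snd e)) * (1 / 4))"
        using lcon R(2)[OF z] unfolding O' by (intro sum_ennreal) auto
      also have "(\<Sum>e\<in>O'. exp (- A) * lyap \<epsilon> R (contract D (snd e)) * (1 / 4)) =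
          exp (- A) * lavg (\<lambda>w. lyap \<epsilon> R (contract D w)) z"
        unfolding O' lavg_def by (subst sum.reindex) (auto simp: inj_on_def sum_distrib_left sum_divide_distrib)
      also have "ennreal \<dots> \<le> ennreal (\<kappa> * ?Y n \<omega>)"
      proof (rule ennreal_leI)
        have "lavg (\<lambda>w. lyap \<epsilon> R (contract D w)) z \<le> lavg (\<lambda>w. 1 + \<epsilon> * paraboloid R w) z"
          using lcon R(2)[OF z] by (intro lavg_mono) auto
        also have "\<dots> = 1 + \<epsilon> * (paraboloid R z - 1)"
          using lap_paraboloid[of R z] unfolding lap_def by (simp add: lavg_add lavg_cmult)
        also have "\<dots> \<le> (1 - \<epsilon> / (1 + \<epsilon> * R)) * (1 + \<epsilon> * paraboloid R z)"
        proof -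
          have "\<epsilon> / (1 + \<epsilon> * R) * (1 + \<epsilon> * paraboloid R z) \<le> \<epsilon> / (1 + \<epsilon> * R) * (1 + \<epsilon> * R)"
            using e0 R(3) par by (intro mult_left_mono add_left_mono) auto
          also have "\<dots> = \<epsilon>" using e0 R(3) by (simp add: add_pos_pos less_imp_neq[symmetric])
          finally show ?thesis by (simp add: algebra_simps)
        qed
        also have "\<dots> \<le> \<kappa> * (1 + \<epsilon> * paraboloid R z)"
          using e0 R(1)[OF z] unfolding \<kappa> by (intro mult_right_mono) auto
        finally have "exp (- A) * lavg (\<lambda>w. lyap \<epsilon> R (contract D w)) z \<le> exp (- A) * (\<kappa> * (1 + \<epsilon> * paraboloid R z))"
          by (intro mult_left_mono) auto
        then show "exp (- A) * lavg (\<lambda>w. lyap \<epsilon> R (contract D w)) z \<le> \<kappa> * ?Y n \<omega>"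
          unfolding A_def[symmetric] x_def[symmetric] Some by (simp add: lyap_def mult_ac)
      qed
      finally show ?thesis .
    next
      case None
      have sndD: "snd e \<in> D" if "e \<in> O'" for e using that unfolding O'_def None out_darts_None by auto
      have cq: "real (card O') / 4 = q" unfolding O'_def None q ..
      have one: "(\<integral>\<^sup>+s. g e s * race_weight (card O') s \<partial>lborel) \<le> ennreal (exp (- A) * (1 + \<epsilon> * R) / (4 * (q + 1)))"
        if "e \<in> O'" for e
      proof -
        have "g e s * race_weight (card O') s \<le>
            ennreal (exp (- A) * (1 + \<epsilon> * R) / (4 * (q + 1))) * (ennreal ((q + 1) * exp (- (q + 1) * s)) * indicator {0..} s)" for s
        proof (cases "0 \<le> s")
          case True
          have l: "0 \<le> lyap \<epsilon> R (contract D (snd e))" "lyap \<epsilon> R (contract D (snd e)) \<le> 1 + \<epsilon> * R"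
            using lcon[OF R(1)[OF sndD[OF that]]] par[of "snd e"] e0 by (auto intro: order_trans)
          have "exp (- (A + s)) * lyap \<epsilon> R (contract D (snd e)) * (exp (- q * s) / 4) \<le>
              exp (- (A + s)) * (1 + \<epsilon> * R) * (exp (- q * s) / 4)"
            using l by (intro mult_right_mono mult_left_mono) auto
          also have "\<dots> = exp (- A) * (1 + \<epsilon> * R) / (4 * (q + 1)) * ((q + 1) * exp (- (q + 1) * s))"
          proof -
            have "exp (- (A + s)) * exp (- q * s) = exp (- A) * exp (- (q + 1) * s)"
              by (simp add: exp_add[symmetric] algebra_simps)
            then show ?thesis using q0 by (simp add: field_simps)
          qed
          finally show ?thesis
            using True l q0 e0 R(3) unfolding g_def r_def None race_weight_def cq
            by (simp add: ennreal_mult[symmetric] ennreal_leI)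
        qed (simp add: race_weight_def)
        then have "(\<integral>\<^sup>+s. g e s * race_weight (card O') s \<partial>lborel) \<le>
          (\<integral>\<^sup>+s. ennreal (exp (- A) * (1 + \<epsilon> * R) / (4 * (q + 1))) * (ennreal ((q + 1) * exp (- (q + 1) * s)) * indicator {0..} s) \<partial>lborel)"
          by (rule nn_integral_mono)
        also have "\<dots> = ennreal (exp (- A) * (1 + \<epsilon> * R) / (4 * (q + 1)))"
          using exp_tail[of "q + 1" 0] q0 by (simp add: nn_integral_cmult)
        finally show ?thesis .
      qed
      have "(\<Sum>e\<in>O'. \<integral>\<^sup>+s. g e s * race_weight (card O') s \<partial>lborel) \<le>
          (\<Sum>e\<in>O'. ennreal (exp (- A) * (1 + \<epsilon> * R) / (4 * (q + 1))))" by (intro sum_mono one)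
      also have "\<dots> = ennreal (real (card O') * (exp (- A) * (1 + \<epsilon> * R) / (4 * (q + 1))))"
        using e0 R(3) q0 by (simp add: ennreal_of_nat_eq_real_of_nat ennreal_mult[symmetric])
      also have "real (card O') * (exp (- A) * (1 + \<epsilon> * R) / (4 * (q + 1))) = exp (- A) * ((q + 1 / 2) / (q + 1))"
      proof -
        have "real (card O') = 4 * q" using cq by simp
        moreover have "q * (1 + \<epsilon> * R) = q + 1 / 2" unfolding \<epsilon> using q0 R(3) by (simp add: field_simps)
        moreover have "4 * q * (E * b / (4 * (q + 1))) = E * (q * b / (q + 1))" for E b :: real
          using q0 by (simp add: field_simps)
        ultimately show ?thesis by (simp only:)
      qed
      also have "ennreal \<dots> \<le> ennreal (\<kappa> * ?Y n \<omega>)"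
      proof (rule ennreal_leI)
        have "exp (- A) * ((q + 1 / 2) / (q + 1)) \<le> exp (- A) * \<kappa>"
          unfolding \<kappa> by (intro mult_left_mono) auto
        then show "exp (- A) * ((q + 1 / 2) / (q + 1)) \<le> \<kappa> * ?Y n \<omega>"
          unfolding A_def[symmetric] x_def[symmetric] None by (simp add: lyap_def mult.commute)
      qed
      finally show ?thesis .
    qed
    finally show ?thesis using \<kappa>0 by (simp add: ennreal_mult')
  qed
  then have "(\<integral>\<^sup>+\<omega>. ennreal (?Y (Suc n) \<omega>) \<partial>clocks_on D {..<Suc n}) \<le>
      (\<integral>\<^sup>+\<omega>. ennreal \<kappa> * ennreal (?Y n \<omega>) \<partial>clocks_on D {..<n})"
    unfolding level_fubini[OF assms(1) mY] by (intro nn_integral_mono) auto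
  also have "\<dots> = ennreal \<kappa> * (\<integral>\<^sup>+\<omega>. ennreal (?Y n \<omega>) \<partial>clocks_on D {..<n})"
    by (rule nn_integral_cmult[OF mY])
  finally show ?thesis .
qed

lemma prob_space_clock_space: "prob_space (clock_space D)"
  unfolding clock_space_def by (rule prob_space_PiM) (rule prob_space_clk)

lemma nn_integral_clocks_const: "(\<integral>\<^sup>+\<omega>. c \<partial>clocks_on D I) = c"
proof -
  have "emeasure (clocks_on D I) (space (clocks_on D I)) = 1"
    by (rule prob_space.emeasure_space_1[OF prob_space_PiM]) (rule prob_space_clk)
  then show ?thesis by (simp only: nn_integral_const mult_1_right)
qed

lemma AE_clocks_positive:
  assumes "finite D"
  shows "AE \<omega> in clock_space D. \<forall>k. \<forall>e\<in>darts D. 0 < \<omega> (k, e)"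
proof -
  have "AE s in clk. 0 < s"
  proof (subst AE_density)
    show "AE x in lborel. 0 < ennreal (exponential_density (1 / 4) x) \<longrightarrow> 0 < x"
      using AE_lborel_singleton[of 0] by eventually_elim (auto simp: exponential_density_def)
  qed simp
  then have "AE \<omega> in clock_space D. 0 < \<omega> (k, e)" if "e \<in> darts D" for k e
    unfolding clock_space_def by (intro AE_PiM_component prob_space_clk) (use that in auto)
  then show ?thesis
    unfolding AE_all_countable using finite_darts[OF assms] by (simp add: AE_finite_all)
qed

lemma holding_pos:
  assumes "finite D" "D \<noteq> {}" "\<And>e. e \<in> darts D \<Longrightarrow> 0 < \<omega> (k, e)"
  shows "0 < holding_time D \<omega> k"
proof -
  have ne: "out_darts D (skeleton D \<omega> k) \<noteq> {}"
    using skeleton_state[of D \<omega> k] out_darts_None_nonempty[OF assms(1,2)] card_out_darts_Some[of _ D] by fastforce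
  have "Min ((\<lambda>e. \<omega> (k, e)) ` out_darts D (skeleton D \<omega> k)) \<in> (\<lambda>e. \<omega> (k, e)) ` out_darts D (skeleton D \<omega> k)"
    using ne finite_out_darts[OF assms(1)] by (intro Min_in) auto
  then obtain e where "e \<in> out_darts D (skeleton D \<omega> k)" "holding_time D \<omega> k = \<omega> (k, e)"
    unfolding holding_time_def by blast
  then show ?thesis using assms(3) out_darts_subset by (metis subsetD)
qed

lemma AE_root_time_unbounded:
  assumes "finite D" "D \<noteq> {}"
  shows "AE \<omega> in clock_space D. \<exists>n. t < root_time D \<omega> n"
proof -
  interpret prob_space "clock_space D" by (rule prob_space_clock_space)
  obtain R where R: "\<And>z. z \<in> D \<Longrightarrow> 1 \<le> paraboloid R z"
    "\<And>z w. z \<in> D \<Longrightarrow> w \<in> nbrs z \<Longrightarrow> 1 \<le> paraboloid R w" "1 \<le> R"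
    using paraboloid_positive[OF assms(1)] by metis
  define q where "q = real (card (out_darts D None)) / 4"
  define \<epsilon> where "\<epsilon> = 1 / (2 * q * R)"
  define \<kappa> where "\<kappa> = max ((q + 1 / 2) / (q + 1)) (1 - \<epsilon> / (1 + \<epsilon> * R))"
  have q0: "0 < q" unfolding q_def
    using out_darts_None_nonempty[OF assms] finite_out_darts[OF assms(1)] by (simp add: card_gt_0_iff)
  have e0: "0 < \<epsilon>" unfolding \<epsilon>_def using q0 R(3) by simp
  have \<kappa>: "0 \<le> \<kappa>" "\<kappa> < 1"
    unfolding \<kappa>_def using q0 e0 R(3) by (auto simp: le_max_iff_disj add_pos_pos)
  let ?Y = "\<lambda>n \<omega>. exp (- root_time D \<omega> n) * lyap \<epsilon> R (skeleton D \<omega> n)"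
  have small: "(\<integral>\<^sup>+\<omega>. ennreal (?Y n \<omega>) \<partial>clocks_on D {..<n}) \<le> ennreal (\<kappa> ^ n)" for n
  proof (induction n)
    case 0
    have "(\<integral>\<^sup>+\<omega>. ennreal (?Y 0 \<omega>) \<partial>clocks_on D {..<0}) = (\<integral>\<^sup>+\<omega>. 1 \<partial>clocks_on D {..<0})"
      by (simp add: root_time_def lyap_def)
    also have "\<dots> = 1" by (rule nn_integral_clocks_const)
    finally show ?case by simp
  next
    case (Suc n)
    have "(\<integral>\<^sup>+\<omega>. ennreal (?Y (Suc n) \<omega>) \<partial>clocks_on D {..<Suc n}) \<le>
        ennreal \<kappa> * (\<integral>\<^sup>+\<omega>. ennreal (?Y n \<omega>) \<partial>clocks_on D {..<n})"
      by (rule lyap_step[OF assms R q_def \<epsilon>_def \<kappa>_def])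
    also have "\<dots> \<le> ennreal \<kappa> * ennreal (\<kappa> ^ n)" by (intro mult_left_mono Suc) simp
    finally show ?case using \<kappa> by (simp add: ennreal_mult)
  qed
  define B where "B = {\<omega> \<in> space (clock_space D). \<forall>n. root_time D \<omega> n \<le> t}"
  have mR: "(\<lambda>\<omega>. root_time D \<omega> n) \<in> borel_measurable (clock_space D)" for n
    unfolding clock_space_def by (rule measurable_root_time[OF assms(1)]) simp
  note [measurable] = mR
  have mB: "B \<in> sets (clock_space D)" unfolding B_def by measurable
  have bound: "emeasure (clock_space D) B \<le> ennreal (exp t * \<kappa> ^ n)" for n
  proof -
    have m: "(\<lambda>\<omega>. ennreal (?Y n \<omega>)) \<in> borel_measurable (clocks_on D {..<n})"
    proof -
      note [measurable] = measurable_root_time[OF assms(1) subset_refl, of n]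
      have [measurable]: "(\<lambda>\<omega>. lyap \<epsilon> R (skeleton D \<omega> n)) \<in> borel_measurable (clocks_on D {..<n})"
        by (rule measurable_compose[OF measurable_skeleton[OF assms(1) subset_refl]]) simp
      show ?thesis by measurable
    qed
    have lge: "1 \<le> lyap \<epsilon> R (skeleton D \<omega> n)" for \<omega>
    proof (cases "skeleton D \<omega> n")
      case (Some z)
      then have "1 \<le> paraboloid R z" using skeleton_state[of D \<omega> n] R(1)[of z] by auto
      then show ?thesis using e0 Some by (simp add: lyap_def)
    qed (simp add: lyap_def)
    have mC: "(\<lambda>\<omega>. ennreal (?Y n \<omega>)) \<in> borel_measurable (clock_space D)"
    proof -
      have [measurable]: "(\<lambda>\<omega>. lyap \<epsilon> R (skeleton D \<omega> n)) \<in> borel_measurable (clock_space D)"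
        unfolding clock_space_def
        by (rule measurable_compose[OF measurable_skeleton[OF assms(1)]]) simp_all
      show ?thesis by measurable
    qed
    have "emeasure (clock_space D) B = (\<integral>\<^sup>+\<omega>. indicator B \<omega> \<partial>clock_space D)" using mB by simp
    also have "\<dots> \<le> (\<integral>\<^sup>+\<omega>. ennreal (exp t) * ennreal (?Y n \<omega>) \<partial>clock_space D)"
    proof (rule nn_integral_mono)
      fix \<omega>
      show "indicator B \<omega> \<le> ennreal (exp t) * ennreal (?Y n \<omega>)"
      proof (cases "\<omega> \<in> B")
        case True
        then have "1 \<le> exp t * exp (- root_time D \<omega> n)" unfolding B_def by (simp add: exp_add[symmetric])
        then have "1 * 1 \<le> exp t * exp (- root_time D \<omega> n) * lyap \<epsilon> R (skeleton D \<omega> n)"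
          using lge by (intro mult_mono) auto
        moreover have "0 \<le> lyap \<epsilon> R (skeleton D \<omega> n)" using lge[of \<omega>] by simp
        ultimately show ?thesis using True by (simp add: ennreal_mult[symmetric] mult.assoc)
      qed simp
    qed
    also have "\<dots> = ennreal (exp t) * (\<integral>\<^sup>+\<omega>. ennreal (?Y n \<omega>) \<partial>clock_space D)"
      by (rule nn_integral_cmult[OF mC])
    also have "(\<integral>\<^sup>+\<omega>. ennreal (?Y n \<omega>) \<partial>clock_space D) = (\<integral>\<^sup>+\<omega>. ennreal (?Y n \<omega>) \<partial>clocks_on D {..<n})"
    proof (rule nn_integral_clock_space[OF assms(1) m])
      fix \<omega> \<omega>' assume same: "\<And>k e. k < n \<Longrightarrow> e \<in> darts D \<Longrightarrow> \<omega> (k, e) = (\<omega>' (k, e) :: real)"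
      have "skeleton D \<omega> n = skeleton D \<omega>' n" by (rule skeleton_cong) (rule same)
      moreover have "root_time D \<omega> n = root_time D \<omega>' n" by (rule root_time_cong) (rule same)
      ultimately show "ennreal (?Y n \<omega>) = ennreal (?Y n \<omega>')" by (simp only:)
    qed
    also have "ennreal (exp t) * \<dots> \<le> ennreal (exp t) * ennreal (\<kappa> ^ n)" by (intro mult_left_mono small) simp
    finally show ?thesis using \<kappa> by (simp add: ennreal_mult)
  qed
  have "(\<lambda>n. exp t * \<kappa> ^ n) \<longlonglongrightarrow> exp t * 0"
    using \<kappa> by (intro tendsto_mult_left LIMSEQ_power_zero) simp
  then have "measure (clock_space D) B \<le> exp t * 0"
  proof (rule LIMSEQ_le_const)
    have "measure (clock_space D) B \<le> exp t * \<kappa> ^ n" for n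
      using bound[of n] \<kappa> by (simp add: emeasure_eq_measure ennreal_le_iff)
    then show "\<exists>N. \<forall>n\<ge>N. measure (clock_space D) B \<le> exp t * \<kappa> ^ n" by blast
  qed
  then have "emeasure (clock_space D) B = 0" by (simp add: emeasure_eq_measure measure_le_0_iff)
  then have "AE \<omega> in clock_space D. \<omega> \<notin> B" using mB by (intro AE_not_in) (simp add: null_sets_def)
  then show ?thesis
    by (rule AE_mp) (auto intro!: AE_I2 simp: B_def not_le)
qed

section \<open>Local times in terms of holding times\<close>

text \<open>The almost sure properties under which the walk is a right-continuous step function and the inverse local
  time at \<open>t\<close> is attained after finitely many steps.\<close>

locale trajectory =
  fixes D :: "site set" and \<omega> :: "nat \<times> site \<times> site \<Rightarrow> real" and t :: real
  assumes finD: "finite D" and neD: "D \<noteq> {}" and t0: "0 \<le> t"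
    and pos: "\<And>k e. e \<in> darts D \<Longrightarrow> 0 < \<omega> (k, e)"
    and unbounded: "\<exists>n. t < root_time D \<omega> n"
begin

abbreviation "st \<equiv> skeleton D \<omega>"
abbreviation "hold \<equiv> holding_time D \<omega>"
abbreviation "T \<equiv> jump_time D \<omega>"

lemma hold: "0 < hold k" using holding_pos[where \<omega> = \<omega>, OF finD neD pos] .

lemma T_Suc: "T (Suc n) = T n + hold n" and T_0: "T 0 = 0"
  unfolding jump_time_def by simp_all

lemma T_mono: "m \<le> n \<Longrightarrow> T m \<le> T n"
  unfolding jump_time_def using hold by (intro sum_mono2) (auto intro: less_imp_le)

lemma walk_on_step: "T n \<le> s \<Longrightarrow> s < T (Suc n) \<Longrightarrow> walk D \<omega> s = st n"
proof -
  assume s: "T n \<le> s" "s < T (Suc n)"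
  have "(LEAST m. s < T (Suc m)) = n"
  proof (rule Least_equality)
    fix m assume m: "s < T (Suc m)"
    show "n \<le> m"
    proof (rule ccontr)
      assume "\<not> n \<le> m"
      then have "T (Suc m) \<le> T n" by (intro T_mono) simp
      then show False using s m by simp
    qed
  qed (rule s)
  then show ?thesis unfolding walk_def by simp
qed

lemma root_time_mono: "m \<le> n \<Longrightarrow> root_time D \<omega> m \<le> root_time D \<omega> n"
  unfolding root_time_def using hold by (intro sum_mono2) (auto intro: less_imp_le)

lemma occupation_steps:
  "indicator {x} (walk D \<omega> s) * indicator {0..<T n} s =
    (\<Sum>k<n. (if st k = x then 1 else 0) * (indicator {T k..<T (Suc k)} s :: real))"
proof (induction n)
  case 0 then show ?case by (simp add: T_0)
next
  case (Suc n)
  have TT: "0 \<le> T n" "T n \<le> T (Suc n)" using T_mono[of 0 n] T_mono[of n "Suc n"] T_0 by auto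
  have "(indicator {0..<T (Suc n)} s :: real) = indicator {0..<T n} s + indicator {T n..<T (Suc n)} s"
    using TT by (auto simp: indicator_def)
  then have "indicator {x} (walk D \<omega> s) * indicator {0..<T (Suc n)} s =
      indicator {x} (walk D \<omega> s) * indicator {0..<T n} s +
      indicator {x} (walk D \<omega> s) * (indicator {T n..<T (Suc n)} s :: real)"
    by (simp add: distrib_left)
  also have "indicator {x} (walk D \<omega> s) * (indicator {T n..<T (Suc n)} s :: real) =
      (if st n = x then 1 else 0) * indicator {T n..<T (Suc n)} s"
    using walk_on_step[of n s] by (auto simp: indicator_def)
  finally show ?case using Suc by simp
qed

lemma local_time_formula:
  assumes "T n \<le> s" "s \<le> T (Suc n)"
  shows "local_time (walk D \<omega>) s x =
    (\<Sum>k<n. if st k = x then hold k else 0) + (if st n = x then s - T n else 0)"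
proof -
  let ?f = "\<lambda>u. (\<Sum>k<n. (if st k = x then 1 else 0) * (indicator {T k..<T (Suc k)} u :: real)) +
    (if st n = x then 1 else 0) * indicator {T n..<s} u"
  have T0n: "0 \<le> T n" using T_mono[of 0 n] T_0 by simp
  have eq: "indicator {0..s} u * indicator {x} (walk D \<omega> u) = ?f u" if "u \<noteq> s" for u
  proof -
    have "(indicator {0..s} u :: real) = indicator {0..<T n} u + indicator {T n..<s} u"
      using that assms T0n by (auto simp: indicator_def)
    then have "indicator {0..s} u * indicator {x} (walk D \<omega> u) =
        indicator {x} (walk D \<omega> u) * indicator {0..<T n} u + indicator {x} (walk D \<omega> u) * (indicator {T n..<s} u :: real)"
      by (simp add: algebra_simps)
    also have "indicator {x} (walk D \<omega> u) * (indicator {T n..<s} u :: real) = (if st n = x then 1 else 0) * indicator {T n..<s} u"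
      using walk_on_step[of n u] assms by (auto simp: indicator_def)
    finally show ?thesis unfolding occupation_steps .
  qed
  have int: "integrable lborel (\<lambda>u. indicator {a..<b} u :: real)" "(\<integral>u. indicator {a..<b} u \<partial>lborel) = b - a"
    if "a \<le> b" for a b :: real
    using that by auto
  have mf: "?f \<in> borel_measurable lborel" by measurable
  have "local_time (walk D \<omega>) s x = (\<integral>u. indicator {0..s} u * indicator {x} (walk D \<omega> u) \<partial>lborel)"
    unfolding local_time_def set_lebesgue_integral_def by simp
  also have "\<dots> = integral\<^sup>L lborel ?f"
  proof (rule integral_cong_AE)
    have AEeq: "AE u in lborel. ?f u = indicator {0..s} u * indicator {x} (walk D \<omega> u)"
      using AE_lborel_singleton[of s] by eventually_elim (simp add: eq)
    define c :: real where "c = indicator {0..s} s * indicator {x} (walk D \<omega> s)"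
    have all: "(\<lambda>u. indicator {0..s} u * indicator {x} (walk D \<omega> u) :: real) = (\<lambda>u. if u = s then c else ?f u)"
      by (rule ext) (use eq in \<open>simp add: c_def\<close>)
    have "(\<lambda>u. if u = s then c else ?f u) \<in> borel_measurable lborel"
      using mf by measurable
    then show "(\<lambda>u. indicator {0..s} u * indicator {x} (walk D \<omega> u) :: real) \<in> borel_measurable lborel"
      unfolding all .
    show "AE u in lborel. indicator {0..s} u * indicator {x} (walk D \<omega> u) = ?f u" using AEeq by eventually_elim simp
  qed (rule mf)
  also have "\<dots> = (\<integral>u. (\<Sum>k<n. (if st k = x then 1 else 0) * (indicator {T k..<T (Suc k)} u :: real)) \<partial>lborel) +
      (\<integral>u. (if st n = x then 1 else 0) * (indicator {T n..<s} u :: real) \<partial>lborel)"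
    using assms(1) T_mono
    by (intro Bochner_Integration.integral_add Bochner_Integration.integrable_sum integrable_mult_right int(1)) simp_all
  also have "(\<integral>u. (\<Sum>k<n. (if st k = x then 1 else 0) * (indicator {T k..<T (Suc k)} u :: real)) \<partial>lborel) =
      (\<Sum>k<n. \<integral>u. (if st k = x then 1 else 0) * (indicator {T k..<T (Suc k)} u :: real) \<partial>lborel)"
    using T_mono by (intro Bochner_Integration.integral_sum integrable_mult_right int(1)) simp
  also have "\<dots> = (\<Sum>k<n. (if st k = x then 1 else 0) * (T (Suc k) - T k))"
    using T_mono by (intro sum.cong refl) (simp only: integral_mult_right_zero, subst int(2), simp_all)
  also have "(\<integral>u. (if st n = x then 1 else 0) * (indicator {T n..<s} u :: real) \<partial>lborel) = (if st n = x then 1 else 0) * (s - T n)"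
    using assms(1) by (simp only: integral_mult_right_zero int(2))
  finally have total: "local_time (walk D \<omega>) s x =
    (\<Sum>k<n. (if st k = x then 1 else 0) * (T (Suc k) - T k)) + (if st n = x then 1 else 0) * (s - T n)" .
  have "(if b then 1 else 0) * y = (if b then y else 0)" for b and y :: real by simp
  then show ?thesis unfolding total by (simp only: T_Suc add_diff_cancel_left')
qed

definition stop :: nat where "stop = (LEAST n. t < root_time D \<omega> (Suc n))"

lemma stop: "t < root_time D \<omega> (Suc stop)" "root_time D \<omega> stop \<le> t" "st stop = None"
proof -
  obtain n where n: "t < root_time D \<omega> n" using unbounded by auto
  have "n \<noteq> 0"
  proof
    assume "n = 0"
    then show False using n t0 by (simp add: root_time_def)
  qed
  then have ex: "\<exists>n. t < root_time D \<omega> (Suc n)" using n by (metis not0_implies_Suc)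
  show 1: "t < root_time D \<omega> (Suc stop)" unfolding stop_def by (rule LeastI_ex[OF ex])
  show 2: "root_time D \<omega> stop \<le> t"
  proof (cases stop)
    case 0 then show ?thesis using t0 by (simp add: root_time_def)
  next
    case (Suc m)
    then have "\<not> t < root_time D \<omega> (Suc m)" unfolding stop_def by (intro not_less_Least) simp
    then show ?thesis using Suc by simp
  qed
  show "st stop = None" using 1 2 by (auto simp: root_time_def split: if_splits)
qed

text \<open>During the step \<open>stop\<close> the walk rests at the contracted point, where the local time grows at unit speed
  and passes \<open>t\<close>.\<close>

lemma inverse_local_time_eq:
  "inverse_local_time (walk D \<omega>) None t = T stop + (t - root_time D \<omega> stop)" (is "_ = ?s")
proof -
  let ?X = "{s. 0 \<le> s \<and> t < local_time (walk D \<omega>) s None}"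
  have end_: "?s < T (Suc stop)" using stop by (simp add: T_Suc root_time_def)
  have T0: "0 \<le> T n" for n using T_mono[of 0 n] T_0 by simp
  have root: "(\<Sum>k<n. if st k = None then hold k else 0) = root_time D \<omega> n" for n unfolding root_time_def ..
  have above: "s \<in> ?X" if "?s < s" "s \<le> T (Suc stop)" for s
  proof -
    have "T stop \<le> s" using that stop(2) by simp
    then have "local_time (walk D \<omega>) s None = root_time D \<omega> stop + (s - T stop)"
      using that stop(3) by (simp add: local_time_formula root)
    then show ?thesis using that T0[of stop] \<open>T stop \<le> s\<close> by simp
  qed
  have below: "?s \<le> s" if "s \<in> ?X" for s
  proof (rule ccontr)
    assume "\<not> ?s \<le> s"
    then have s: "s < ?s" "0 \<le> s" using that by auto
    show False
    proof (cases "T stop \<le> s")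
      case True
      then have "local_time (walk D \<omega>) s None = root_time D \<omega> stop + (s - T stop)"
        using s end_ stop(3) by (simp add: local_time_formula root)
      then show False using that s by simp
    next
      case False
      define m where "m = (LEAST m. s < T (Suc m))"
      have ex: "\<exists>m. s < T (Suc m)" using False T_mono[of stop "Suc stop"] by (intro exI[of _ stop]) simp
      have m1: "s < T (Suc m)" unfolding m_def by (rule LeastI_ex[OF ex])
      have m2: "T m \<le> s"
      proof (cases m)
        case 0 then show ?thesis using s by (simp add: T_0)
      next
        case (Suc l)
        then have "\<not> s < T (Suc l)" unfolding m_def by (intro not_less_Least) simp
        then show ?thesis using Suc by simp
      qed
      have "m < stop"
      proof (rule ccontr)
        assume "\<not> m < stop"
        then have "T stop \<le> T m" by (intro T_mono) simp
        then show False using m2 False by simp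
      qed
      have "local_time (walk D \<omega>) s None = root_time D \<omega> m + (if st m = None then s - T m else 0)"
        using local_time_formula[of m s None] m1 m2 root[of m] by simp
      also have "\<dots> \<le> root_time D \<omega> m + (if st m = None then hold m else 0)"
        using m1 by (simp add: T_Suc)
      also have "\<dots> = root_time D \<omega> (Suc m)" by (simp add: root_time_def)
      also have "\<dots> \<le> root_time D \<omega> stop" using \<open>m < stop\<close> by (intro root_time_mono) simp
      finally show False using that stop(2) by simp
    qed
  qed
  show ?thesis
    unfolding inverse_local_time_def
  proof (rule cInf_eq_non_empty)
    show "?X \<noteq> {}" using above[of "T (Suc stop)"] end_ by blast
    show "?s \<le> s" if "s \<in> ?X" for s using below[OF that] .
    fix y assume y: "\<And>s. s \<in> ?X \<Longrightarrow> y \<le> s"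
    show "y \<le> ?s"
    proof (rule dense_ge_bounded[OF end_])
      fix w assume "?s < w" "w < T (Suc stop)"
      then show "y \<le> w" by (intro y above) auto
    qed
  qed
qed

lemma wired_local_time_eq:
  assumes "Suc stop \<le> n"
  shows "wired_local_time D \<omega> t (Some z) = stopped_time D t \<omega> z n"
proof -
  have rl: "root_time D \<omega> k \<le> t \<longleftrightarrow> k \<le> stop" for k
  proof
    assume "root_time D \<omega> k \<le> t"
    then show "k \<le> stop" using stop(1) root_time_mono[of "Suc stop" k] by (meson not_less_eq_eq order_trans not_le)
  next
    assume "k \<le> stop"
    then show "root_time D \<omega> k \<le> t" using stop(2) root_time_mono[of k stop] by simp
  qed
  have "wired_local_time D \<omega> t (Some z) = (\<Sum>k<stop. if st k = Some z then hold k else 0)"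
    unfolding wired_local_time_def inverse_local_time_eq
    using stop by (subst local_time_formula[of stop]) (auto simp: T_Suc root_time_def)
  also have "\<dots> = (\<Sum>k<n. if st k = Some z \<and> root_time D \<omega> k \<le> t then hold k else 0)"
    unfolding rl using assms stop(3)
    by (intro sum.mono_neutral_cong_left) (auto simp: le_less)
  finally show ?thesis unfolding stopped_time_def .
qed

end

text \<open>A measurable version of the local times at the inverse local time \<open>t\<close>: on almost every trajectory the sequence is
  eventually constant.\<close>

definition final_time :: "site set \<Rightarrow> real \<Rightarrow> (nat \<times> site \<times> site \<Rightarrow> real) \<Rightarrow> site \<Rightarrow> real" where
  "final_time D t \<omega> z = lim (\<lambda>n. stopped_time D t \<omega> z n)"

lemma measurable_final_time:
  assumes "finite D" shows "(\<lambda>\<omega>. final_time D t \<omega> z) \<in> borel_measurable (clock_space D)"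
  unfolding final_time_def clock_space_def
  by (intro borel_measurable_lim_metric measurable_stopped_time assms) simp

lemma AE_trajectory:
  assumes "finite D" "D \<noteq> {}" "0 \<le> t"
  shows "AE \<omega> in clock_space D. trajectory D \<omega> t"
  using AE_clocks_positive[OF assms(1)] AE_root_time_unbounded[OF assms(1,2), of t]
  by eventually_elim (use assms in \<open>unfold_locales, auto\<close>)

lemma (in trajectory) final_time_eq: "final_time D t \<omega> z = wired_local_time D \<omega> t (Some z)"
proof -
  have "(\<lambda>n. stopped_time D t \<omega> z n) \<longlonglongrightarrow> wired_local_time D \<omega> t (Some z)"
    by (intro tendsto_eventually eventually_sequentiallyI[of "Suc stop"]) (rule wired_local_time_eq[symmetric])
  then show ?thesis unfolding final_time_def by (rule limI)
qed

lemma (in trajectory) stopped_time_nonneg: "0 \<le> stopped_time D t \<omega> z n"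
  unfolding stopped_time_def using hold by (intro sum_nonneg) (auto intro: less_imp_le)

lemma (in trajectory) final_time_nonneg: "0 \<le> final_time D t \<omega> z"
  unfolding final_time_eq wired_local_time_eq[OF order_refl] by (rule stopped_time_nonneg)

text \<open>The martingale is bounded by \<open>1\<close> and eventually equal to the functional on the left.\<close>

lemma local_time_laplace:
  assumes "finite D" "D \<noteq> {}" "0 \<le> t" and v: "\<And>z. z \<in> D \<Longrightarrow> 0 \<le> v z"
    and u: "\<And>z. z \<notin> D \<Longrightarrow> u z = 1" "\<And>z. z \<in> D \<Longrightarrow> (1 + v z) * u z = lavg u z" "\<And>z. 0 \<le> u z" "\<And>z. u z \<le> 1"
  shows "(\<integral>\<^sup>+\<omega>. ennreal (exp (- (\<Sum>z\<in>D. v z * final_time D t \<omega> z))) \<partial>clock_space D) =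
    ennreal (exp (- root_rate D u * t))"
proof -
  interpret prob_space "clock_space D" by (rule prob_space_clock_space)
  let ?M = "laplace_mart D t v u"
  have c0: "0 \<le> root_rate D u" unfolding root_rate_def using u(4) by (intro sum_nonneg) auto
  have mM: "(\<lambda>\<omega>. ennreal (?M n \<omega>)) \<in> borel_measurable (clocks_on D I)" if "{..<n} \<subseteq> I" for n I
    using measurable_laplace_mart[OF assms(1) that] by measurable
  have const: "(\<integral>\<^sup>+\<omega>. ennreal (?M n \<omega>) \<partial>clocks_on D {..<n}) = ennreal (exp (- root_rate D u * t))" for n
  proof (induction n)
    case 0
    have "(\<integral>\<^sup>+\<omega>. ennreal (?M 0 \<omega>) \<partial>clocks_on D {..<0}) = (\<integral>\<^sup>+\<omega>. ennreal (exp (- root_rate D u * t)) \<partial>clocks_on D {..<0})"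
      using assms(3) by (simp add: laplace_mart_def stopped_time_def root_time_def extend_def)
    also have "\<dots> = ennreal (exp (- root_rate D u * t))" by (rule nn_integral_clocks_const)
    finally show ?case .
  next
    case (Suc n)
    then show ?case using laplace_mart_step[where v = v and u = u, OF assms(1-3) v u] by simp
  qed
  have E: "(\<integral>\<^sup>+\<omega>. ennreal (?M n \<omega>) \<partial>clock_space D) = ennreal (exp (- root_rate D u * t))" for n
  proof -
    have "(\<integral>\<^sup>+\<omega>. ennreal (?M n \<omega>) \<partial>clock_space D) = (\<integral>\<^sup>+\<omega>. ennreal (?M n \<omega>) \<partial>clocks_on D {..<n})"
    proof (rule nn_integral_clock_space[OF assms(1) mM[OF subset_refl]])
      fix \<omega> \<omega>' assume same: "\<And>k e. k < n \<Longrightarrow> e \<in> darts D \<Longrightarrow> \<omega> (k, e) = (\<omega>' (k, e) :: real)"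
      have "skeleton D \<omega> n = skeleton D \<omega>' n" by (rule skeleton_cong) (rule same)
      moreover have "root_time D \<omega> n = root_time D \<omega>' n" by (rule root_time_cong) (rule same)
      moreover have "stopped_time D t \<omega> z n = stopped_time D t \<omega>' z n" for z by (rule stopped_time_cong) (rule same)
      ultimately show "ennreal (?M n \<omega>) = ennreal (?M n \<omega>')" unfolding laplace_mart_def by (simp only:)
    qed
    then show ?thesis using const by simp
  qed
  have "(\<lambda>n. \<integral>\<^sup>+\<omega>. ennreal (?M n \<omega>) \<partial>clock_space D) \<longlonglongrightarrow>
      (\<integral>\<^sup>+\<omega>. ennreal (exp (- (\<Sum>z\<in>D. v z * final_time D t \<omega> z))) \<partial>clock_space D)"
  proof (rule nn_integral_dominated_convergence[where w = "\<lambda>_. 1"])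
    show "(\<lambda>\<omega>. ennreal (?M n \<omega>)) \<in> borel_measurable (clock_space D)" for n
      unfolding clock_space_def by (rule mM) simp
    note [measurable] = measurable_final_time[OF assms(1)]
    show "(\<lambda>\<omega>. ennreal (exp (- (\<Sum>z\<in>D. v z * final_time D t \<omega> z)))) \<in> borel_measurable (clock_space D)" by measurable
    show "AE \<omega> in clock_space D. ennreal (?M n \<omega>) \<le> 1" for n
      using AE_trajectory[OF assms(1-3)]
    proof eventually_elim
      case (elim \<omega>)
      interpret trajectory D \<omega> t by (rule elim)
      have "0 \<le> (\<Sum>z\<in>D. v z * stopped_time D t \<omega> z n)" using v stopped_time_nonneg by (intro sum_nonneg) auto
      moreover have "0 \<le> extend u x" "extend u x \<le> 1" for x using u(3,4) by (auto simp: extend_def split: option.splits)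
      ultimately have "?M n \<omega> \<le> 1 * 1"
        unfolding laplace_mart_def using c0
        by (intro mult_mono) (auto intro!: mult_le_one)
      then show ?case by simp
    qed
    show "AE \<omega> in clock_space D. (\<lambda>n. ennreal (?M n \<omega>)) \<longlonglongrightarrow> ennreal (exp (- (\<Sum>z\<in>D. v z * final_time D t \<omega> z)))"
      using AE_trajectory[OF assms(1-3)]
    proof eventually_elim
      case (elim \<omega>)
      interpret trajectory D \<omega> t by (rule elim)
      have "?M n \<omega> = exp (- (\<Sum>z\<in>D. v z * final_time D t \<omega> z))" if "Suc stop \<le> n" for n
      proof -
        have "\<not> root_time D \<omega> n \<le> t" using stop(1) root_time_mono[OF that] by simp
        then show ?thesis unfolding laplace_mart_def using wired_local_time_eq[OF that] by (simp add: final_time_eq)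
      qed
      then show ?case
        by (intro tendsto_eventually) (auto simp: eventually_sequentially intro!: exI[of _ "Suc stop"])
    qed
  qed (use emeasure_space_1 in auto)
  then have "(\<lambda>n. ennreal (exp (- root_rate D u * t))) \<longlonglongrightarrow>
      (\<integral>\<^sup>+\<omega>. ennreal (exp (- (\<Sum>z\<in>D. v z * final_time D t \<omega> z))) \<partial>clock_space D)" unfolding E .
  then show ?thesis by (simp add: LIMSEQ_const_iff)
qed

(* As a rule for real functions in general, this one would be tried on every goal below. *)
declare measurable_site [measurable del]

section \<open>Uniqueness of Laplace transforms\<close>

text \<open>The substitution \<open>y = exp (- x)\<close> turns the transform at the integers into the moments of a
  measure on \<open>[0, 1]\<close>. By Weierstrass these determine the integral of every continuous function, and
  indicators of half-lines are limits of continuous functions.\<close>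

lemma laplace_uniqueness:
  fixes \<mu> \<nu> :: "real measure"
  assumes fin: "finite_measure \<mu>" "finite_measure \<nu>" and sets: "sets \<mu> = sets borel" "sets \<nu> = sets borel"
    and pos: "AE x in \<mu>. 0 \<le> x" "AE x in \<nu>. 0 \<le> x"
    and eq: "\<And>k::nat. (\<integral>x. exp (- (real k * x)) \<partial>\<mu>) = (\<integral>x. exp (- (real k * x)) \<partial>\<nu>)"
  shows "\<mu> = \<nu>"
proof -
  have [measurable_cong]: "sets \<mu> = sets borel" "sets \<nu> = sets borel" by fact+
  have intb: "integrable \<rho> (\<lambda>x. g (exp (- x)))"
    if "finite_measure \<rho>" "sets \<rho> = sets borel" "AE x in \<rho>. 0 \<le> x" "g \<in> borel_measurable borel"
      "\<And>y. y \<in> {0..1} \<Longrightarrow> \<bar>g y\<bar> \<le> B" for \<rho> :: "real measure" and g :: "real \<Rightarrow> real" and B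
  proof -
    have [measurable_cong]: "sets \<rho> = sets borel" by fact
    have [measurable]: "g \<in> borel_measurable borel" by fact
    show ?thesis
    proof (rule finite_measure.integrable_const_bound[OF that(1), where B=B])
      show "AE x in \<rho>. norm (g (exp (- x))) \<le> B" using that(3) by eventually_elim (use that(5) in simp)
    qed measurable
  qed
  have contB: "\<exists>B. \<forall>y\<in>{0..1}. \<bar>g y\<bar> \<le> B" if "continuous_on UNIV g" for g :: "real \<Rightarrow> real"
  proof -
    have "compact (g ` {0..1})"
      using that by (intro compact_continuous_image continuous_on_subset[OF that]) auto
    then show ?thesis using compact_imp_bounded[THEN bounded_iff[THEN iffD1]] by fastforce
  qed
  have powI: "(\<integral>x. (\<Sum>i\<le>n. a i * exp (- x) ^ i) \<partial>\<rho>) = (\<Sum>i\<le>n. a i * (\<integral>x. exp (- (real i * x)) \<partial>\<rho>))"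
    if "finite_measure \<rho>" "sets \<rho> = sets borel" "AE x in \<rho>. 0 \<le> x" for \<rho> :: "real measure" and a :: "nat \<Rightarrow> real" and n
  proof -
    have "integrable \<rho> (\<lambda>x. a i * exp (- x) ^ i)" for i
      by (rule intb[OF that, where g="\<lambda>y. a i * y ^ i" and B="\<bar>a i\<bar>"])
        (auto simp: abs_mult power_le_one intro!: mult_left_le)
    moreover have "exp (- x) ^ i = exp (- (real i * x))" for x :: real and i
      by (simp add: exp_of_nat_mult[symmetric])
    ultimately show ?thesis by (simp add: Bochner_Integration.integral_sum)
  qed
  have cont: "(\<integral>x. g (exp (- x)) \<partial>\<mu>) = (\<integral>x. g (exp (- x)) \<partial>\<nu>)" if g: "continuous_on UNIV g" for g :: "real \<Rightarrow> real"
  proof -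
    let ?T = "measure \<mu> UNIV + measure \<nu> UNIV"
    have gm: "g \<in> borel_measurable borel" using g by (rule borel_measurable_continuous_onI)
    obtain B where B: "\<And>y. y \<in> {0..1} \<Longrightarrow> \<bar>g y\<bar> \<le> B" using contB[OF g] by blast
    \<comment> \<open>polynomials in \<open>exp (- x)\<close> have equal integrals and are uniformly dense\<close>
    have le: "\<bar>(\<integral>x. g (exp (- x)) \<partial>\<mu>) - (\<integral>x. g (exp (- x)) \<partial>\<nu>)\<bar> \<le> e * ?T" if e0: "0 < e" for e
    proof -
      obtain q where "real_polynomial_function q" and qe: "\<And>y. y \<in> {0..1} \<Longrightarrow> \<bar>g y - q y\<bar> < e"
        using Stone_Weierstrass_real_polynomial_function[OF compact_Icc[of "0::real" 1]
          continuous_on_subset[OF g subset_UNIV] e0] by blast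
      then obtain a n where q: "q = (\<lambda>x. \<Sum>i\<le>n. a i * x ^ i)" using real_polynomial_function_imp_sum by blast
      have qm: "continuous_on UNIV q" unfolding q by (intro continuous_intros)
      then obtain B' where B': "\<And>y. y \<in> {0..1} \<Longrightarrow> \<bar>q y\<bar> \<le> B'" using contB by blast
      have qb: "q \<in> borel_measurable borel" using qm by (rule borel_measurable_continuous_onI)
      have near: "\<bar>(\<integral>x. g (exp (- x)) \<partial>\<rho>) - (\<integral>x. q (exp (- x)) \<partial>\<rho>)\<bar> \<le> e * measure \<rho> UNIV"
        if r: "finite_measure \<rho>" "sets \<rho> = sets borel" "AE x in \<rho>. 0 \<le> x" for \<rho> :: "real measure"
      proof -
        interpret finite_measure \<rho> by fact
        note ig = intb[OF r gm B] and iq = intb[OF r qb B']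
        have sp: "space \<rho> = UNIV" using sets_eq_imp_space_eq[OF r(2)] by simp
        have "\<bar>(\<integral>x. g (exp (- x)) \<partial>\<rho>) - (\<integral>x. q (exp (- x)) \<partial>\<rho>)\<bar> = \<bar>\<integral>x. g (exp (- x)) - q (exp (- x)) \<partial>\<rho>\<bar>"
          using ig iq by simp
        also have "\<dots> \<le> (\<integral>x. \<bar>g (exp (- x)) - q (exp (- x))\<bar> \<partial>\<rho>)" by (rule integral_abs_bound)
        also have "\<dots> \<le> (\<integral>x. e \<partial>\<rho>)"
        proof (rule integral_mono_AE)
          show "AE x in \<rho>. \<bar>g (exp (- x)) - q (exp (- x))\<bar> \<le> e"
            using r(3) by eventually_elim (use qe in \<open>simp add: less_imp_le\<close>)
        qed (use ig iq in \<open>auto intro!: integrable_abs\<close>)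
        also have "\<dots> = e * measure \<rho> UNIV" by (simp add: sp)
        finally show ?thesis .
      qed
      have "(\<integral>x. q (exp (- x)) \<partial>\<mu>) = (\<integral>x. q (exp (- x)) \<partial>\<nu>)"
        unfolding q powI[OF fin(1) sets(1) pos(1)] powI[OF fin(2) sets(2) pos(2)] eq ..
      then show ?thesis
        using near[OF fin(1) sets(1) pos(1)] near[OF fin(2) sets(2) pos(2)]
        by (simp add: distrib_left abs_le_iff)
    qed
    have T: "0 \<le> ?T" by simp
    show ?thesis
    proof (rule ccontr)
      assume ne: "\<not> ?thesis"
      define d where "d = \<bar>(\<integral>x. g (exp (- x)) \<partial>\<mu>) - (\<integral>x. g (exp (- x)) \<partial>\<nu>)\<bar>"
      have d: "0 < d" using ne unfolding d_def by simp
      have "d \<le> d / (?T + 1) * ?T" using le[of "d / (?T + 1)"] d T unfolding d_def[symmetric] by (simp add: divide_pos_pos)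
      then have "d * (?T + 1) \<le> d * ?T" using T by (simp add: pos_le_divide_eq)
      then show False using d by (simp add: distrib_left)
    qed
  qed
  \<comment> \<open>the half-line is \<open>exp (- y) < exp (- x)\<close>, approximated from below by steep ramps\<close>
  have tail: "measure \<mu> {x<..} = measure \<nu> {x<..}" for x
  proof -
    define g where "g n y = min 1 (max 0 (real n * (exp (- x) - y)))" for n and y :: real
    have gc: "continuous_on UNIV (g n)" for n unfolding g_def by (intro continuous_intros)
    have gl: "(\<lambda>n. g n (exp (- y))) \<longlonglongrightarrow> indicator {x<..} y" for y
    proof (cases "x < y")
      case True
      then have p: "0 < exp (- x) - exp (- y)" by simp
      obtain n0 :: nat where n0: "1 / (exp (- x) - exp (- y)) < real n0" using reals_Archimedean2 by blast
      have "g n (exp (- y)) = 1" if "n0 \<le> n" for n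
      proof -
        have "1 / (exp (- x) - exp (- y)) \<le> real n" using n0 that by linarith
        then have "1 \<le> real n * (exp (- x) - exp (- y))" using p by (simp only: pos_divide_le_eq)
        then show ?thesis unfolding g_def by simp
      qed
      then have "(\<lambda>n. g n (exp (- y))) \<longlonglongrightarrow> 1"
        by (intro tendsto_eventually) (auto simp: eventually_sequentially)
      then show ?thesis using True by simp
    next
      case False
      then have "real n * (exp (- x) - exp (- y)) \<le> 0" for n by (intro mult_nonneg_nonpos) auto
      then have "g n (exp (- y)) = 0" for n unfolding g_def by (simp add: max_absorb1)
      then show ?thesis using False by simp
    qed
    have lim: "(\<lambda>n. \<integral>y. g n (exp (- y)) \<partial>\<rho>) \<longlonglongrightarrow> measure \<rho> {x<..}"
      if "finite_measure \<rho>" "sets \<rho> = sets borel" for \<rho> :: "real measure"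
    proof -
      interpret finite_measure \<rho> by fact
      have [measurable_cong]: "sets \<rho> = sets borel" by fact
      have [measurable]: "g n \<in> borel_measurable borel" for n using gc by (rule borel_measurable_continuous_onI)
      have "(\<lambda>n. \<integral>y. g n (exp (- y)) \<partial>\<rho>) \<longlonglongrightarrow> (\<integral>y. indicator {x<..} y \<partial>\<rho>)"
        by (rule integral_dominated_convergence[where w="\<lambda>_. 1"]) (auto simp: gl, auto simp: g_def)
      then show ?thesis by (simp add: that(2))
    qed
    show ?thesis
      using LIMSEQ_unique[OF lim[OF fin(1) sets(1)]] lim[OF fin(2) sets(2)] cont[OF gc] by simp
  qed
  show ?thesis
  proof (rule measure_eqI_lessThan[OF sets])
    fix x show "emeasure \<mu> {x<..} < \<infinity>"
      using finite_measure.emeasure_finite[OF fin(1)] by (simp add: less_top[symmetric])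
    show "emeasure \<mu> {x<..} = emeasure \<nu> {x<..}"
      using tail[of x] by (simp add: finite_measure.emeasure_eq_measure[OF fin(1)] finite_measure.emeasure_eq_measure[OF fin(2)])
  qed
qed

text \<open>The weights are the densities of finite measures, which are compared after transport to the line.\<close>

lemma weighted_laplace_uniqueness:
  fixes X W :: "'a \<Rightarrow> real" and Y V :: "'b \<Rightarrow> real"
  assumes "prob_space M" "prob_space N"
    and X: "X \<in> borel_measurable M" "\<And>\<omega>. 0 \<le> X \<omega>" and Y: "Y \<in> borel_measurable N" "\<And>\<omega>. 0 \<le> Y \<omega>"
    and W: "W \<in> borel_measurable M" "\<And>\<omega>. 0 \<le> W \<omega>" "\<And>\<omega>. W \<omega> \<le> 1"
    and V: "V \<in> borel_measurable N" "\<And>\<omega>. 0 \<le> V \<omega>" "\<And>\<omega>. V \<omega> \<le> 1"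
    and eq: "\<And>k::nat. (\<integral>\<omega>. W \<omega> * exp (- (real k * X \<omega>)) \<partial>M) = (\<integral>\<omega>. V \<omega> * exp (- (real k * Y \<omega>)) \<partial>N)"
    and A: "A \<in> sets borel"
  shows "(\<integral>\<omega>. W \<omega> * indicator A (X \<omega>) \<partial>M) = (\<integral>\<omega>. V \<omega> * indicator A (Y \<omega>) \<partial>N)"
proof -
  let ?d = "\<lambda>M W X. distr (density M (\<lambda>\<omega>. ennreal (W \<omega>))) borel X"
  have gen: "finite_measure (?d M W X) \<and> (AE x in ?d M W X. 0 \<le> x) \<and>
      (\<forall>g\<in>borel_measurable borel. (\<integral>x. g x \<partial>?d M W X) = (\<integral>\<omega>. W \<omega> * g (X \<omega>) \<partial>M))"
    if "prob_space M" "X \<in> borel_measurable M" "\<And>\<omega>. 0 \<le> X \<omega>" "W \<in> borel_measurable M" "\<And>\<omega>. 0 \<le> W \<omega>" "\<And>\<omega>. W \<omega> \<le> 1"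
    for M :: "'c measure" and X W :: "'c \<Rightarrow> real"
  proof (intro conjI ballI)
    interpret prob_space M by fact
    have [measurable]: "X \<in> borel_measurable M" "W \<in> borel_measurable M" by fact+
    have "emeasure (density M (\<lambda>\<omega>. ennreal (W \<omega>))) (space M) = (\<integral>\<^sup>+\<omega>. ennreal (W \<omega>) * indicator (space M) \<omega> \<partial>M)"
      by (rule emeasure_density) auto
    also have "\<dots> \<le> (\<integral>\<^sup>+\<omega>. 1 \<partial>M)"
      by (rule nn_integral_mono) (use that(6) in \<open>auto simp: indicator_def\<close>)
    also have "\<dots> = 1" by (simp add: emeasure_space_1)
    finally have "finite_measure (density M (\<lambda>\<omega>. ennreal (W \<omega>)))"
      by (intro finite_measureI) (auto simp: top_unique)
    then show "finite_measure (?d M W X)" by (rule finite_measure.finite_measure_distr) simp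
    show "AE x in ?d M W X. 0 \<le> x" by (subst AE_distr_iff) (use that(3) in auto)
    fix g :: "real \<Rightarrow> real" assume [measurable]: "g \<in> borel_measurable borel"
    show "(\<integral>x. g x \<partial>?d M W X) = (\<integral>\<omega>. W \<omega> * g (X \<omega>) \<partial>M)"
      by (subst integral_distr) (auto simp: integral_density that(5))
  qed
  note gM = gen[OF assms(1) X W] and gN = gen[OF assms(2) Y V]
  have "?d M W X = ?d N V Y"
  proof (rule laplace_uniqueness)
    fix k :: nat
    have e: "(\<lambda>x. exp (- (real k * x))) \<in> borel_measurable borel" by measurable
    show "(\<integral>x. exp (- (real k * x)) \<partial>?d M W X) = (\<integral>x. exp (- (real k * x)) \<partial>?d N V Y)"
      using gM e gN eq[of k] by simp
  qed (use gM gN in auto)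
  moreover have "(indicator A :: real \<Rightarrow> real) \<in> borel_measurable borel" using A by measurable
  ultimately show ?thesis using gM gN by metis
qed

text \<open>The exponentials are replaced by indicators of Borel sets one coordinate at a time: with the
  other factors as a weight, each replacement is a one-dimensional statement.\<close>

lemma joint_laplace_uniqueness:
  fixes X :: "'i \<Rightarrow> 'a \<Rightarrow> real" and Y :: "'i \<Rightarrow> 'b \<Rightarrow> real"
  assumes M: "prob_space M" and N: "prob_space N" and D: "finite D"
    and X: "\<And>z. X z \<in> borel_measurable M" "\<And>z \<omega>. 0 \<le> X z \<omega>"
    and Y: "\<And>z. Y z \<in> borel_measurable N" "\<And>z \<omega>. 0 \<le> Y z \<omega>"
    and eq: "\<And>v :: 'i \<Rightarrow> nat. (\<integral>\<omega>. exp (- (\<Sum>z\<in>D. real (v z) * X z \<omega>)) \<partial>M) =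
                              (\<integral>\<omega>. exp (- (\<Sum>z\<in>D. real (v z) * Y z \<omega>)) \<partial>N)"
  shows "distr M (PiM D (\<lambda>_. borel)) (\<lambda>\<omega>. \<lambda>z\<in>D. X z \<omega>) = distr N (PiM D (\<lambda>_. borel)) (\<lambda>\<omega>. \<lambda>z\<in>D. Y z \<omega>)"
proof -
  interpret M: prob_space M by fact
  interpret N: prob_space N by fact
  let ?W = "\<lambda>X J A v \<omega>. (\<Prod>z\<in>J. indicator (A z) (X z \<omega>)) * exp (- (\<Sum>z\<in>D - J. real (v z) * X z \<omega>))"
  have Wm: "?W X J A v \<in> borel_measurable M" if "\<And>z. A z \<in> sets borel" "\<And>z. X z \<in> borel_measurable M"
    for X :: "'i \<Rightarrow> 'c \<Rightarrow> real" and M J A and v :: "'i \<Rightarrow> nat"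
  proof -
    have [measurable]: "A z \<in> sets borel" "X z \<in> borel_measurable M" for z using that by auto
    show ?thesis by measurable
  qed
  have W0: "0 \<le> ?W X J A v \<omega>" for X :: "'i \<Rightarrow> 'c \<Rightarrow> real" and J A \<omega> and v :: "'i \<Rightarrow> nat"
    by (intro mult_nonneg_nonneg prod_nonneg) auto
  have W1: "?W X J A v \<omega> \<le> 1" if "\<And>z \<omega>. 0 \<le> X z \<omega>" for X :: "'i \<Rightarrow> 'c \<Rightarrow> real" and J A \<omega> and v :: "'i \<Rightarrow> nat"
  proof -
    have "(\<Prod>z\<in>J. indicator (A z) (X z \<omega>) :: real) \<le> 1" by (intro prod_le_1) (auto simp: indicator_def)
    moreover have "exp (- (\<Sum>z\<in>D - J. real (v z) * X z \<omega>)) \<le> 1" using that by (simp add: sum_nonneg)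
    ultimately show ?thesis by (intro mult_le_one) auto
  qed
  have step: "(\<integral>\<omega>. ?W X J A v \<omega> \<partial>M) = (\<integral>\<omega>. ?W Y J A v \<omega> \<partial>N)"
    if "finite J" "J \<subseteq> D" "\<And>z. A z \<in> sets borel" for J A and v :: "'i \<Rightarrow> nat"
    using that(1,2)
  proof (induction J arbitrary: v rule: finite_induct)
    case empty then show ?case using eq[of v] by simp
  next
    case (insert j J)
    have j: "j \<in> D" "j \<notin> J" "finite J" using insert by auto
    let ?V = "\<lambda>X \<omega>. (\<Prod>z\<in>J. indicator (A z) (X z \<omega>)) * exp (- (\<Sum>z\<in>D - insert j J. real (v z) * X z \<omega>))"
    have eV: "?W X J A (v(j := k)) \<omega> = ?V X \<omega> * exp (- (real k * X j \<omega>))"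
      for X :: "'i \<Rightarrow> 'c \<Rightarrow> real" and k \<omega>
    proof -
      have K: "D - J = insert j (D - insert j J)" "finite (D - insert j J)" "j \<notin> D - insert j J" using j D by auto
      have "(\<Sum>z\<in>D - J. real ((v(j := k)) z) * X z \<omega>) =
          real ((v(j := k)) j) * X j \<omega> + (\<Sum>z\<in>D - insert j J. real ((v(j := k)) z) * X z \<omega>)"
        by (subst K(1)) (rule sum.insert[OF K(2,3)])
      also have "real ((v(j := k)) j) = real k" by simp
      also have "(\<Sum>z\<in>D - insert j J. real ((v(j := k)) z) * X z \<omega>) = (\<Sum>z\<in>D - insert j J. real (v z) * X z \<omega>)"
        by (intro sum.cong) auto
      finally show ?thesis by (simp only: minus_add_distrib exp_add mult.assoc mult.commute[of "exp (- (real k * X j \<omega>))"])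
    qed
    have iV: "?W X (insert j J) A v \<omega> = ?V X \<omega> * indicator (A j) (X j \<omega>)" for X :: "'i \<Rightarrow> 'c \<Rightarrow> real" and \<omega>
      using j by simp
    have V1: "?V X \<omega> \<le> 1" if "\<And>z \<omega>. 0 \<le> X z \<omega>" for X :: "'i \<Rightarrow> 'c \<Rightarrow> real" and \<omega>
    proof -
      have "(\<Prod>z\<in>J. indicator (A z) (X z \<omega>) :: real) \<le> 1" by (intro prod_le_1) (auto simp: indicator_def)
      moreover have "exp (- (\<Sum>z\<in>D - insert j J. real (v z) * X z \<omega>)) \<le> 1" using that by (simp add: sum_nonneg)
      ultimately show ?thesis by (intro mult_le_one) auto
    qed
    have Vm: "?V X \<in> borel_measurable M" if "\<And>z. X z \<in> borel_measurable M" for X :: "'i \<Rightarrow> 'c \<Rightarrow> real" and M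
    proof -
      have [measurable]: "A z \<in> sets borel" "X z \<in> borel_measurable M" for z using that \<open>\<And>z. A z \<in> sets borel\<close> by auto
      show ?thesis by measurable
    qed
    have V0: "0 \<le> ?V X \<omega>" for X :: "'i \<Rightarrow> 'c \<Rightarrow> real" and \<omega> by (intro mult_nonneg_nonneg prod_nonneg) auto
    show ?case unfolding iV
    proof (rule weighted_laplace_uniqueness[OF M N])
      fix k :: nat
      show "(\<integral>\<omega>. ?V X \<omega> * exp (- (real k * X j \<omega>)) \<partial>M) = (\<integral>\<omega>. ?V Y \<omega> * exp (- (real k * Y j \<omega>)) \<partial>N)"
        unfolding eV[symmetric] using insert by blast
    qed (rule X Y V0 V1 Vm that(3) | assumption)+
  qed
  have box: "emeasure (distr M (PiM D (\<lambda>_. borel)) (\<lambda>\<omega>. \<lambda>z\<in>D. X z \<omega>)) (PiE D A) = ennreal (\<integral>\<omega>. ?W X D A (\<lambda>_. 0) \<omega> \<partial>M)"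
    if "\<And>z. A z \<in> sets borel" "\<And>z. X z \<in> borel_measurable M" "prob_space M" for M :: "'c measure" and X A
  proof -
    interpret prob_space M by fact
    have [measurable]: "A z \<in> sets borel" "X z \<in> borel_measurable M" for z using that by auto
    let ?E = "{\<omega>\<in>space M. \<forall>z\<in>D. X z \<omega> \<in> A z}"
    have E: "?E \<in> sets M" using D by (intro sets.sets_Collect_finite_All) auto
    have "emeasure (distr M (PiM D (\<lambda>_. borel)) (\<lambda>\<omega>. \<lambda>z\<in>D. X z \<omega>)) (PiE D A) =
        emeasure M ((\<lambda>\<omega>. \<lambda>z\<in>D. X z \<omega>) -` PiE D A \<inter> space M)"
      using D that(1) by (intro emeasure_distr measurable_restrict sets_PiM_I_finite) auto
    also have "(\<lambda>\<omega>. \<lambda>z\<in>D. X z \<omega>) -` PiE D A \<inter> space M = ?E" by (auto simp: PiE_iff)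
    also have "emeasure M ?E = ennreal (measure M ?E)" by (rule emeasure_eq_measure)
    also have "measure M ?E = (\<integral>\<omega>. indicator ?E \<omega> \<partial>M)" using E by simp
    also have "\<dots> = (\<integral>\<omega>. ?W X D A (\<lambda>_. 0) \<omega> \<partial>M)"
    proof (rule Bochner_Integration.integral_cong[OF refl])
      fix \<omega> assume "\<omega> \<in> space M"
      then show "indicator ?E \<omega> = ?W X D A (\<lambda>_. 0) \<omega>"
        using D by (auto simp: indicator_def prod_zero_iff)
    qed
    finally show ?thesis .
  qed
  show ?thesis
  proof (rule measure_eqI_PiM_finite[OF D])
    show "emeasure (distr M (PiM D (\<lambda>_. borel)) (\<lambda>\<omega>. \<lambda>z\<in>D. X z \<omega>)) (PiE D A) =
        emeasure (distr N (PiM D (\<lambda>_. borel)) (\<lambda>\<omega>. \<lambda>z\<in>D. Y z \<omega>)) (PiE D A)" if "\<And>i. i \<in> D \<Longrightarrow> A i \<in> sets borel" for A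
    proof -
      define B where "B i = (if i \<in> D then A i else UNIV)" for i
      have B: "B i \<in> sets borel" for i using that unfolding B_def by auto
      have P: "PiE D A = PiE D B" unfolding B_def by (rule PiE_cong) simp
      show ?thesis unfolding P
        by (simp only: box[OF B X(1) M] box[OF B Y(1) N] step[OF D subset_refl B])
    qed
    show "range (\<lambda>_::nat. space (PiM D (\<lambda>_. borel :: real measure))) \<subseteq> prod_algebra D (\<lambda>_. borel)"
      using D by (auto simp: space_PiM prod_algebra_eq_finite intro!: exI[of _ "\<lambda>_. UNIV"])
    show "(\<Union>i::nat. space (PiM D (\<lambda>_. borel :: real measure))) = space (PiM D (\<lambda>_. borel))" by simp
    interpret L: prob_space "distr M (PiM D (\<lambda>_. borel)) (\<lambda>\<omega>. \<lambda>z\<in>D. X z \<omega>)"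
      using X(1) by (intro M.prob_space_distr measurable_restrict) auto
    show "emeasure (distr M (PiM D (\<lambda>_. borel)) (\<lambda>\<omega>. \<lambda>z\<in>D. X z \<omega>)) (space (PiM D (\<lambda>_. borel))) \<noteq> \<infinity>" for i :: nat
      using L.emeasure_finite by simp
  qed simp_all
qed

lemma measurable_exp: "f \<in> borel_measurable M \<Longrightarrow> (\<lambda>x. exp (f x :: real)) \<in> borel_measurable M"
  by (rule measurable_compose[OF _ borel_measurable_exp])

section \<open>The isomorphism between local times and the free field\<close>

text \<open>Both sides are a quarter of the flux of \<open>1 - u\<close> out of \<open>D\<close>: the contributions of the edges
  inside \<open>D\<close> to the sum of the Laplacian cancel.\<close>

lemma root_rate_eq:
  assumes D: "finite D" and u: "\<And>z. z \<notin> D \<Longrightarrow> u z = 1" "\<And>z. z \<in> D \<Longrightarrow> (1 + v z) * u z = lavg u z"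
  shows "root_rate D u = (\<Sum>z\<in>D. v z * u z)"
proof -
  let ?S = "SIGMA z:D. nbrs z"
  let ?I = "?S \<inter> (UNIV \<times> D)" and ?O = "?S \<inter> (UNIV \<times> (- D))"
  let ?f = "\<lambda>e. (u (snd e) - u (fst e)) / 4"
  have fS: "finite ?S" using D by simp
  have "v z * u z = (\<Sum>w\<in>nbrs z. ?f (z, w))" if "z \<in> D" for z
  proof -
    have "v z * u z = lavg u z - u z" using u(2)[OF that] by (simp add: algebra_simps)
    also have "\<dots> = (\<Sum>w\<in>nbrs z. ?f (z, w))"
      unfolding lavg_def by (simp add: sum_divide_distrib[symmetric] sum_subtractf)
    finally show ?thesis .
  qed
  then have "(\<Sum>z\<in>D. v z * u z) = (\<Sum>z\<in>D. \<Sum>w\<in>nbrs z. ?f (z, w))" by (rule sum.cong[OF refl])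
  also have "\<dots> = (\<Sum>e\<in>?S. ?f e)" using D by (subst sum.Sigma) (simp_all add: case_prod_beta')
  also have "\<dots> = (\<Sum>e\<in>?I. ?f e) + (\<Sum>e\<in>?O. ?f e)"
  proof -
    have e: "?S = ?I \<union> ?O" and d: "?I \<inter> ?O = {}" by blast+
    show ?thesis by (subst e, rule sum.union_disjoint[OF _ _ d]) (use fS in blast)+
  qed
  also have "(\<Sum>e\<in>?I. ?f e) = 0"
  proof -
    have sw: "e \<in> ?I \<Longrightarrow> (snd e, fst e) \<in> ?I" for e
      using nbrs_sym[of "fst e" "snd e"] by (cases e) simp
    have "(\<Sum>e\<in>?I. ?f e) = (\<Sum>e\<in>?I. - ?f e)"
      by (rule sum.reindex_bij_witness[of _ "\<lambda>e. (snd e, fst e)" "\<lambda>e. (snd e, fst e)"])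
        (use sw in \<open>auto simp: minus_divide_left\<close>)
    then show ?thesis by (simp add: sum_negf)
  qed
  also have "(\<Sum>e\<in>?O. ?f e) = root_rate D u"
  proof -
    have sw: "e \<in> ?O \<longleftrightarrow> (snd e, fst e) \<in> out_darts D None" for e
      unfolding out_darts_None adjacent_iff_nbrs using nbrs_sym[of "fst e" "snd e"] by (cases e) auto
    have sw2: "(snd e, fst e) \<in> ?O" if "e \<in> out_darts D None" for e
      using that sw[of "(snd e, fst e)"] by simp
    have val: "?f e = (1 - u (snd (snd e, fst e))) / 4" if "e \<in> ?O" for e
      using that u(1)[of "snd e"] by (cases e) simp
    show ?thesis unfolding root_rate_def
      by (rule sum.reindex_bij_witness[of _ "\<lambda>e. (snd e, fst e)" "\<lambda>e. (snd e, fst e)"])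
        (simp, erule sw[THEN iffD1], simp, erule sw2, erule val[symmetric])
  qed
  finally show ?thesis by simp
qed

text \<open>The shift of the field by \<open>m * (u - 1)\<close>, which is admissible because it vanishes off \<open>D\<close>,
  turns \<open>\<phi> + m\<close> into \<open>\<phi> + m * u\<close>. As \<open>u\<close> is harmonic for the Laplacian with killing rates \<open>v\<close>,
  the terms linear in \<open>\<phi>\<close> cancel and only a constant remains.\<close>

lemma gff_laplace_shift:
  assumes D: "finite D"
    and u: "\<And>z. z \<notin> D \<Longrightarrow> u z = 1" "\<And>z. z \<in> D \<Longrightarrow> (1 + v z) * u z = lavg u z"
  shows "(\<integral>\<^sup>+\<phi>. ennreal (exp (- (\<Sum>z\<in>D. v z * ((\<phi> z + m)\<^sup>2 / 2)))) \<partial>gff D) =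
    ennreal (exp (- root_rate D u * (m\<^sup>2 / 2))) * (\<integral>\<^sup>+\<phi>. ennreal (exp (- (\<Sum>z\<in>D. v z * ((\<phi> z)\<^sup>2 / 2)))) \<partial>gff D)"
proof -
  define f where "f z = m * (u z - 1)" for z
  let ?F = "\<lambda>m \<phi>. exp (- (\<Sum>z\<in>D. v z * ((\<phi> z + m)\<^sup>2 / 2)))"
  let ?c = "exp (- root_rate D u * (m\<^sup>2 / 2))"
  have Fm: "?F m \<in> borel_measurable cfg" for m
    by (intro measurable_exp borel_measurable_uminus borel_measurable_sum borel_measurable_times
        borel_measurable_const borel_measurable_divide borel_measurable_power borel_measurable_add measurable_site)
  have f0: "f z = 0" if "z \<notin> D" for z using u(1)[OF that] unfolding f_def by simp
  have rr: "root_rate D u = (\<Sum>z\<in>D. v z * u z)" by (rule root_rate_eq[OF D u])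
  have lapf: "lap f z = - (m * (v z * u z))" if "z \<in> D" for z
  proof -
    have "lap f z = m * lap u z"
      unfolding f_def lap_def lavg_def by (simp add: sum_distrib_left[symmetric] sum_subtractf diff_divide_distrib algebra_simps)
    also have "lap u z = - (v z * u z)" unfolding lap_def using u(2)[OF that] by (simp add: algebra_simps)
    finally show ?thesis by simp
  qed
  have shifted: "?F m (\<lambda>z. \<phi> z + f z) * gw D (\<lambda>z. \<phi> z + f z) = ?c * (?F 0 \<phi> * gw D \<phi>)"
    if \<phi>: "\<And>z. z \<notin> D \<Longrightarrow> \<phi> z = 0" for \<phi>
  proof -
    have "energy D f \<phi> = (\<Sum>z\<in>D. \<phi> z * lap f z)" by (rule energy_green[OF D \<phi>])
    also have "\<dots> = (\<Sum>z\<in>D. - m * (v z * u z * \<phi> z))" by (rule sum.cong) (simp_all add: lapf)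
    finally have e1: "energy D f \<phi> = - m * (\<Sum>z\<in>D. v z * u z * \<phi> z)" by (simp only: sum_distrib_left)
    have "energy D f f = (\<Sum>z\<in>D. f z * lap f z)" by (rule energy_green[OF D f0])
    also have "\<dots> = (\<Sum>z\<in>D. m\<^sup>2 * (v z * u z) - m\<^sup>2 * (v z * (u z)\<^sup>2))"
      by (rule sum.cong) (simp_all add: lapf f_def power2_eq_square algebra_simps)
    finally have e2: "energy D f f = m\<^sup>2 * root_rate D u - m\<^sup>2 * (\<Sum>z\<in>D. v z * (u z)\<^sup>2)"
      unfolding rr by (simp only: sum_distrib_left sum_subtractf)
    have e3: "energy D (\<lambda>z. \<phi> z + f z) (\<lambda>z. \<phi> z + f z) = energy D \<phi> \<phi> + 2 * energy D f \<phi> + energy D f f"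
      using energy_square_add[of D \<phi> 1 f] by simp
    have "(\<Sum>z\<in>D. v z * ((\<phi> z + f z + m)\<^sup>2 / 2)) =
        (\<Sum>z\<in>D. v z * ((\<phi> z)\<^sup>2 / 2) + m * (v z * u z * \<phi> z) + m\<^sup>2 / 2 * (v z * (u z)\<^sup>2))"
      by (rule sum.cong) (simp_all add: f_def power2_eq_square field_simps)
    also have "\<dots> = (\<Sum>z\<in>D. v z * ((\<phi> z)\<^sup>2 / 2)) + m * (\<Sum>z\<in>D. v z * u z * \<phi> z) + m\<^sup>2 / 2 * (\<Sum>z\<in>D. v z * (u z)\<^sup>2)"
      by (simp only: sum.distrib sum_distrib_left)
    finally have "(\<Sum>z\<in>D. v z * ((\<phi> z + f z + m)\<^sup>2 / 2)) + energy D (\<lambda>z. \<phi> z + f z) (\<lambda>z. \<phi> z + f z) / 2 =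
        root_rate D u * (m\<^sup>2 / 2) + (\<Sum>z\<in>D. v z * ((\<phi> z)\<^sup>2 / 2)) + energy D \<phi> \<phi> / 2"
      unfolding e3 e1 e2 by (simp add: field_simps)
    then have "exp (- ((\<Sum>z\<in>D. v z * ((\<phi> z + f z + m)\<^sup>2 / 2)) + energy D (\<lambda>z. \<phi> z + f z) (\<lambda>z. \<phi> z + f z) / 2)) =
        exp (- (root_rate D u * (m\<^sup>2 / 2) + (\<Sum>z\<in>D. v z * ((\<phi> z)\<^sup>2 / 2)) + energy D \<phi> \<phi> / 2))" by simp
    then show ?thesis unfolding gw_def by (simp add: exp_add[symmetric] algebra_simps)
  qed
  have m: "(\<lambda>\<phi>. ennreal (?F m \<phi> * gw D \<phi>)) \<in> borel_measurable cfg" for m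
    by (intro measurable_compose[OF _ measurable_ennreal] borel_measurable_times Fm measurable_gw)
  have "(\<integral>\<^sup>+\<phi>. ennreal (?F m \<phi> * gw D \<phi>) \<partial>flat D (\<lambda>_. 0)) =
      (\<integral>\<^sup>+\<phi>. ennreal (?F m \<phi> * gw D \<phi>) \<partial>flat D (\<lambda>z. 0 + f z))"
    using flat_cong[of D "\<lambda>_. 0" "\<lambda>z. 0 + f z"] f0 by simp
  also have "\<dots> = (\<integral>\<^sup>+\<phi>. ennreal (?F m (\<lambda>z. \<phi> z + f z) * gw D (\<lambda>z. \<phi> z + f z)) \<partial>flat D (\<lambda>_. 0))"
    using flat_shift[OF D m, where f=f and \<xi>="\<lambda>_. 0"] by simp
  also have "\<dots> = (\<integral>\<^sup>+\<phi>. ennreal ?c * ennreal (?F 0 \<phi> * gw D \<phi>) \<partial>flat D (\<lambda>_. 0))"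
  proof (rule nn_integral_cong_AE)
    show "AE \<phi> in flat D (\<lambda>_. 0). ennreal (?F m (\<lambda>z. \<phi> z + f z) * gw D (\<lambda>z. \<phi> z + f z)) =
        ennreal ?c * ennreal (?F 0 \<phi> * gw D \<phi>)"
      using AE_flat[of D "\<lambda>_. 0"]
    proof eventually_elim
      case (elim \<phi>)
      have nn: "0 \<le> ?F 0 \<phi> * gw D \<phi>" using gw_pos[of D \<phi>] by simp
      have \<phi>: "z \<notin> D \<Longrightarrow> \<phi> z = 0" for z using elim by blast
      have "ennreal (?F m (\<lambda>z. \<phi> z + f z) * gw D (\<lambda>z. \<phi> z + f z)) = ennreal (?c * (?F 0 \<phi> * gw D \<phi>))"
        by (rule arg_cong[OF shifted[OF \<phi>]])
      also have "\<dots> = ennreal ?c * ennreal (?F 0 \<phi> * gw D \<phi>)" by (rule ennreal_mult[OF exp_ge_zero nn])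
      finally show ?case .
    qed
  qed
  also have "\<dots> = ennreal ?c * (\<integral>\<^sup>+\<phi>. ennreal (?F 0 \<phi> * gw D \<phi>) \<partial>flat D (\<lambda>_. 0))"
    using m[of 0] by (intro nn_integral_cmult) (simp add: measurable_cong_sets[OF sets_flat refl])
  finally have key: "(\<integral>\<^sup>+\<phi>. ennreal (?F m \<phi> * gw D \<phi>) \<partial>flat D (\<lambda>_. 0)) =
      ennreal ?c * (\<integral>\<^sup>+\<phi>. ennreal (?F 0 \<phi> * gw D \<phi>) \<partial>flat D (\<lambda>_. 0))" .
  have "(\<integral>\<^sup>+\<phi>. ennreal (?F m \<phi>) \<partial>gff D) = ennreal ?c * (\<integral>\<^sup>+\<phi>. ennreal (?F 0 \<phi>) \<partial>gff D)"
    unfolding nn_integral_gff'[OF D Fm exp_ge_zero] key by (simp only: mult.left_commute)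
  then show ?thesis by simp
qed

text \<open>The generalized second Ray--Knight theorem: twice the local times, at the time when the local
  time at the root reaches \<open>t\<close>, plus the square of an independent free field, have the law of the
  square of the field raised by \<open>sqrt (2 * t)\<close>. Both Laplace transforms are computed by the
  same function \<open>u\<close>, harmonic with killing rates \<open>v\<close> and equal to \<open>1\<close> off \<open>D\<close>.\<close>

lemma local_time_isomorphism:
  fixes D :: "site set" and t :: real
  assumes D: "finite D" "D \<noteq> {}" and t: "0 \<le> t"
  shows "distr (clock_space D \<Otimes>\<^sub>M gff D) (PiM D (\<lambda>_. borel))
            (\<lambda>p. \<lambda>z\<in>D. max 0 (final_time D t (fst p) z) + (snd p z)\<^sup>2 / 2) =
         distr (gff D) (PiM D (\<lambda>_. borel)) (\<lambda>\<phi>. \<lambda>z\<in>D. (\<phi> z + sqrt (2 * t))\<^sup>2 / 2)"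
proof -
  let ?m = "sqrt (2 * t)"
  interpret P: prob_space "clock_space D" by (rule prob_space_clock_space)
  interpret G: prob_space "gff D" by (rule prob_space_gff[OF D(1)])
  interpret PG: pair_prob_space "clock_space D" "gff D" ..
  have site: "(\<lambda>\<phi>. \<phi> z) \<in> borel_measurable (gff D)" for z
    using measurable_site by (simp add: measurable_cong_sets[OF sets_gff refl])
  have time: "(\<lambda>\<omega>. max 0 (final_time D t \<omega> z)) \<in> borel_measurable (clock_space D)" for z
    by (intro borel_measurable_max borel_measurable_const measurable_final_time D(1))
  have Xm: "(\<lambda>p. max 0 (final_time D t (fst p) z) + (snd p z)\<^sup>2 / 2) \<in> borel_measurable (clock_space D \<Otimes>\<^sub>M gff D)" for z
    by (intro measurable_compose[OF measurable_fst time] measurable_compose[OF measurable_snd site] borel_measurable_add borel_measurable_divide borel_measurable_power borel_measurable_const)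
  have Ym: "(\<lambda>\<phi>. (\<phi> z + ?m)\<^sup>2 / 2) \<in> borel_measurable (gff D)" for z
    by (intro borel_measurable_add borel_measurable_divide borel_measurable_power borel_measurable_const site)
  show ?thesis
  proof (rule joint_laplace_uniqueness[OF PG.prob_space_axioms G.prob_space_axioms D(1) Xm _ Ym])
    fix n :: "site \<Rightarrow> nat"
    let ?v = "\<lambda>z. real (n z)"
    have "\<exists>u. (\<forall>z. z \<notin> D \<longrightarrow> u z = 1) \<and> (\<forall>z\<in>D. u z = 0 + 1 / (1 + ?v z) * lavg u z) \<and> (\<forall>z. 0 \<le> u z \<and> u z \<le> 1)"
      by (rule dirichlet_solution[where S="\<lambda>_. 1"]) simp_all
    then obtain u where dir: "\<forall>z. z \<notin> D \<longrightarrow> u z = 1" "\<forall>z\<in>D. u z = 0 + 1 / (1 + ?v z) * lavg u z"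
        "\<forall>z. 0 \<le> u z \<and> u z \<le> 1" by (elim exE conjE)
    have u: "z \<notin> D \<Longrightarrow> u z = 1" "z \<in> D \<Longrightarrow> u z = 1 / (1 + ?v z) * lavg u z" "0 \<le> u z" "u z \<le> 1" for z
      using spec[OF dir(1), of z] bspec[OF dir(2), of z] spec[OF dir(3), of z] by (simp_all only: add_0 simp_thms)
    have u': "(1 + ?v z) * u z = lavg u z" if "z \<in> D" for z
    proof -
      have "1 + ?v z \<noteq> 0" by (simp add: add_nonneg_eq_0_iff)
      then have "(1 + ?v z) * (1 / (1 + ?v z) * lavg u z) = lavg u z" by (simp del: of_nat_Suc)
      then show ?thesis using u(2)[OF that] by metis
    qed
    let ?L = "\<lambda>\<omega>. exp (- (\<Sum>z\<in>D. ?v z * max 0 (final_time D t \<omega> z)))"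
    let ?Q = "\<lambda>\<phi>. exp (- (\<Sum>z\<in>D. ?v z * ((\<phi> z)\<^sup>2 / 2)))"
    have Lm: "?L \<in> borel_measurable (clock_space D)"
      by (intro measurable_exp borel_measurable_uminus borel_measurable_sum borel_measurable_times borel_measurable_const time)
    have Qm: "?Q \<in> borel_measurable (gff D)"
      by (intro measurable_exp borel_measurable_uminus borel_measurable_sum borel_measurable_times
          borel_measurable_divide borel_measurable_power borel_measurable_const site)
    have "(\<integral>\<^sup>+\<omega>. ennreal (?L \<omega>) \<partial>clock_space D) =
        (\<integral>\<^sup>+\<omega>. ennreal (exp (- (\<Sum>z\<in>D. ?v z * final_time D t \<omega> z))) \<partial>clock_space D)"
    proof (rule nn_integral_cong_AE)
      show "AE \<omega> in clock_space D. ennreal (?L \<omega>) = ennreal (exp (- (\<Sum>z\<in>D. ?v z * final_time D t \<omega> z)))"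
        using AE_trajectory[OF D t]
        by eventually_elim (simp add: max_absorb2[OF trajectory.final_time_nonneg])
    qed
    also have "\<dots> = ennreal (exp (- root_rate D u * t))"
      by (rule local_time_laplace[OF D t]) (use u u' in simp_all)
    finally have L: "(\<integral>\<^sup>+\<omega>. ennreal (?L \<omega>) \<partial>clock_space D) = ennreal (exp (- root_rate D u * t))" .
    let ?X = "\<lambda>p. exp (- (\<Sum>z\<in>D. ?v z * (max 0 (final_time D t (fst p) z) + (snd p z)\<^sup>2 / 2)))"
    let ?Y = "\<lambda>\<phi>. exp (- (\<Sum>z\<in>D. ?v z * ((\<phi> z + ?m)\<^sup>2 / 2)))"
    have Xm': "?X \<in> borel_measurable (clock_space D \<Otimes>\<^sub>M gff D)"
      by (intro measurable_exp borel_measurable_uminus borel_measurable_sum borel_measurable_times borel_measurable_const Xm)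
    have Ym': "?Y \<in> borel_measurable (gff D)"
      by (intro measurable_exp borel_measurable_uminus borel_measurable_sum borel_measurable_times borel_measurable_const Ym)
    have XLQ: "?X p = ?L (fst p) * ?Q (snd p)" for p
      by (simp add: exp_add[symmetric] distrib_left sum.distrib)
    have "(\<integral>\<^sup>+p. ennreal (?X p) \<partial>(clock_space D \<Otimes>\<^sub>M gff D)) =
        (\<integral>\<^sup>+\<omega>. \<integral>\<^sup>+\<phi>. ennreal (?X (\<omega>, \<phi>)) \<partial>gff D \<partial>clock_space D)"
      by (rule G.nn_integral_fst[symmetric]) (rule measurable_compose[OF Xm' measurable_ennreal])
    also have "\<dots> = (\<integral>\<^sup>+\<omega>. \<integral>\<^sup>+\<phi>. ennreal (?L \<omega>) * ennreal (?Q \<phi>) \<partial>gff D \<partial>clock_space D)"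
      unfolding XLQ by (simp only: fst_conv snd_conv ennreal_mult[OF exp_ge_zero exp_ge_zero])
    also have "\<dots> = (\<integral>\<^sup>+\<omega>. ennreal (?L \<omega>) * (\<integral>\<^sup>+\<phi>. ennreal (?Q \<phi>) \<partial>gff D) \<partial>clock_space D)"
      by (subst nn_integral_cmult) (rule measurable_compose[OF Qm measurable_ennreal], rule refl)
    also have "\<dots> = (\<integral>\<^sup>+\<omega>. ennreal (?L \<omega>) \<partial>clock_space D) * (\<integral>\<^sup>+\<phi>. ennreal (?Q \<phi>) \<partial>gff D)"
      by (rule nn_integral_multc) (rule measurable_compose[OF Lm measurable_ennreal])
    also have "\<dots> = (\<integral>\<^sup>+\<phi>. ennreal (?Y \<phi>) \<partial>gff D)"
      using gff_laplace_shift[OF D(1) u(1) u', of ?m] t unfolding L by simp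
    finally have "(\<integral>\<^sup>+p. ennreal (?X p) \<partial>(clock_space D \<Otimes>\<^sub>M gff D)) = (\<integral>\<^sup>+\<phi>. ennreal (?Y \<phi>) \<partial>gff D)" .
    then show "(\<integral>p. ?X p \<partial>(clock_space D \<Otimes>\<^sub>M gff D)) = (\<integral>\<phi>. ?Y \<phi> \<partial>gff D)"
      by (simp only: integral_eq_nn_integral[OF Xm' AE_I2[OF exp_ge_zero]] integral_eq_nn_integral[OF Ym' AE_I2[OF exp_ge_zero]])
  qed simp_all
qed

text \<open>Adding a square can only enlarge the set of points above a level.\<close>

lemma local_time_crossing_le_far_crossing:
  fixes N :: nat
  assumes m: "0 \<le> m" and h: "0 \<le> h"
  defines "D \<equiv> lattice_box (real N)"
  shows "measure (clock_space D) {\<omega> \<in> space (clock_space D). crossing r {z \<in> D. (m + h)\<^sup>2 / 2 \<le> wired_local_time D \<omega> (m\<^sup>2 / 2) (Some z)}}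
    \<le> measure (gff D) (far_crossing r N m h)"
proof -
  let ?t = "m\<^sup>2 / 2" and ?s = "(m + h)\<^sup>2 / 2"
  have D: "finite D" "D \<noteq> {}" unfolding D_def using finite_box by (auto simp: lattice_box_def intro: exI[of _ "0::int"])
  have t: "0 \<le> ?t" and sm: "sqrt (2 * ?t) = m" using m by simp_all
  interpret P: prob_space "clock_space D" by (rule prob_space_clock_space)
  interpret G: prob_space "gff D" by (rule prob_space_gff[OF D(1)])
  interpret PG: pair_prob_space "clock_space D" "gff D" ..
  let ?X = "\<lambda>p. \<lambda>z\<in>D. max 0 (final_time D ?t (fst p) z) + (snd p z)\<^sup>2 / 2"
  let ?Y = "\<lambda>\<phi>. \<lambda>z\<in>D. (\<phi> z + m)\<^sup>2 / 2"
  have site: "(\<lambda>\<phi>. \<phi> z) \<in> borel_measurable (gff D)" for z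
    using measurable_site by (simp add: measurable_cong_sets[OF sets_gff refl])
  have time: "(\<lambda>\<omega>. max 0 (final_time D ?t \<omega> z)) \<in> borel_measurable (clock_space D)" for z
    by (intro borel_measurable_max borel_measurable_const measurable_final_time D(1))
  have Xm: "?X \<in> measurable (clock_space D \<Otimes>\<^sub>M gff D) (PiM D (\<lambda>_. borel))"
    by (intro measurable_restrict measurable_compose[OF measurable_fst time] measurable_compose[OF measurable_snd site] borel_measurable_add borel_measurable_divide borel_measurable_power borel_measurable_const)
  have Ym: "?Y \<in> measurable (gff D) (PiM D (\<lambda>_. borel))"
    by (intro measurable_restrict borel_measurable_add borel_measurable_divide borel_measurable_power borel_measurable_const site)
  let ?E = "{x \<in> space (PiM D (\<lambda>_. borel :: real measure)). crossing r {z \<in> D. ?s \<le> x z}}"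
  have Em: "?E \<in> sets (PiM D (\<lambda>_. borel))"
  proof (rule measurable_level_event[OF D(1)])
    fix z assume z: "z \<in> D"
    have "(\<lambda>x. x z) \<in> measurable (PiM D (\<lambda>_. borel :: real measure)) borel" using z by (rule measurable_component_singleton)
    then show "{x \<in> space (PiM D (\<lambda>_. borel :: real measure)). ?s \<le> x z} \<in> sets (PiM D (\<lambda>_. borel))"
      by (intro borel_measurable_le borel_measurable_const)
  qed
  let ?C = "\<lambda>R. {z \<in> D. ?s \<le> R z}"
  let ?F = "{\<omega> \<in> space (clock_space D). crossing r (?C (\<lambda>z. max 0 (final_time D ?t \<omega> z)))}"
  have Fm: "?F \<in> sets (clock_space D)"
    by (rule measurable_level_event[OF D(1)]) (intro borel_measurable_le borel_measurable_const time)
  have "measure (clock_space D) {\<omega> \<in> space (clock_space D). crossing r (?C (\<lambda>z. wired_local_time D \<omega> ?t (Some z)))}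
      \<le> measure (clock_space D) ?F"
  proof (rule P.finite_measure_mono_AE[OF _ Fm])
    show "AE \<omega> in clock_space D. \<omega> \<in> {\<omega> \<in> space (clock_space D). crossing r (?C (\<lambda>z. wired_local_time D \<omega> ?t (Some z)))} \<longrightarrow> \<omega> \<in> ?F"
      using AE_trajectory[OF D t]
    proof eventually_elim
      case (elim \<omega>)
      have "max 0 (final_time D ?t \<omega> z) = wired_local_time D \<omega> ?t (Some z)" for z
        using trajectory.final_time_nonneg[OF elim, of z] trajectory.final_time_eq[OF elim, of z] by simp
      then show ?case by simp
    qed
  qed
  also have "measure (clock_space D) ?F = measure (clock_space D \<Otimes>\<^sub>M gff D) (?F \<times> space (gff D))"
    unfolding measure_def by (simp only: G.emeasure_pair_measure_Times[OF Fm sets.top] G.emeasure_space_1 mult_1_right)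
  also have "\<dots> \<le> measure (clock_space D \<Otimes>\<^sub>M gff D) (?X -` ?E \<inter> space (clock_space D \<Otimes>\<^sub>M gff D))"
  proof (rule PG.finite_measure_mono[OF _ measurable_sets[OF Xm Em]])
    show "?F \<times> space (gff D) \<subseteq> ?X -` ?E \<inter> space (clock_space D \<Otimes>\<^sub>M gff D)"
    proof
      fix p assume p: "p \<in> ?F \<times> space (gff D)"
      then have sp: "p \<in> space (clock_space D \<Otimes>\<^sub>M gff D)" by (auto simp: space_pair_measure)
      have "fst p \<in> ?F" using p unfolding mem_Times_iff by (rule conjunct1)
      then have cr: "crossing r (?C (\<lambda>z. max 0 (final_time D ?t (fst p) z)))" unfolding mem_Collect_eq by (rule conjunct2)
      have sub: "?C (\<lambda>z. max 0 (final_time D ?t (fst p) z)) \<subseteq> ?C (?X p)"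
      proof
        fix z assume z: "z \<in> ?C (\<lambda>z. max 0 (final_time D ?t (fst p) z))"
        have zD: "z \<in> D" and le: "?s \<le> max 0 (final_time D ?t (fst p) z)" using z by blast+
        have zX: "(?X p) z = max 0 (final_time D ?t (fst p) z) + (snd p z)\<^sup>2 / 2" using zD by (rule restrict_apply')
        have "?s + 0 \<le> max 0 (final_time D ?t (fst p) z) + (snd p z)\<^sup>2 / 2" by (rule add_mono[OF le]) simp
        then have le': "?s \<le> (?X p) z" unfolding zX add_0_right .
        show "z \<in> ?C (?X p)" unfolding mem_Collect_eq by (rule conjI[OF zD le'])
      qed
      have XE: "?X p \<in> ?E"
        unfolding mem_Collect_eq by (rule conjI[OF measurable_space[OF Xm sp] crossing_mono[OF cr sub]])
      show "p \<in> ?X -` ?E \<inter> space (clock_space D \<Otimes>\<^sub>M gff D)"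
        by (intro IntI vimageI2 XE sp)
    qed
  qed
  also have "\<dots> = measure (distr (clock_space D \<Otimes>\<^sub>M gff D) (PiM D (\<lambda>_. borel)) ?X) ?E"
    by (rule measure_distr[OF Xm Em, symmetric])
  also have "\<dots> = measure (distr (gff D) (PiM D (\<lambda>_. borel)) ?Y) ?E"
    using local_time_isomorphism[OF D t] unfolding sm by simp
  also have "\<dots> = measure (gff D) (?Y -` ?E \<inter> space (gff D))" by (rule measure_distr[OF Ym Em])
  also have "?Y -` ?E \<inter> space (gff D) = far_crossing r N m h"
  proof -
    have lev: "?s \<le> (x + m)\<^sup>2 / 2 \<longleftrightarrow> m + h \<le> \<bar>x + m\<bar>" for x
    proof -
      have "?s \<le> (x + m)\<^sup>2 / 2 \<longleftrightarrow> \<bar>m + h\<bar> \<le> \<bar>x + m\<bar>" by (simp add: abs_le_square_iff)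
      then show ?thesis using m h by simp
    qed
    have C: "?C (?Y \<phi>) = {z \<in> D. m + h \<le> \<bar>\<phi> z + m\<bar>}" for \<phi>
      by (rule Collect_cong) (use lev in \<open>simp cong: conj_cong\<close>)
    have "?Y \<phi> \<in> space (PiM D (\<lambda>_. borel))" for \<phi> by (rule measurable_space[OF Ym]) simp
    then show ?thesis unfolding far_crossing_def D_def[symmetric] using C by auto
  qed
  finally show ?thesis .
qed

section \<open>Crossings of thick points\<close>

text \<open>With \<open>m = sqrt (2 * t)\<close>, a local time of at least \<open>(m + h)\<^sup>2 / 2\<close> is the condition of the set of
  thick points, and the level is chosen so that \<open>h\<close> is \<open>C * sqrt (ln (ln N))\<close>.\<close>

lemma crossing_prob_le:
  fixes N :: nat
  assumes \<theta>: "0 < \<theta>" and C: "0 < C" and N: "1 < ln (real N)" and r: "0 \<le> r"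
  defines "h \<equiv> C * sqrt (ln (ln (real N)))" and "m \<equiv> sqrt (2 * \<theta> / pi) * ln (real N)"
  shows "crossing_prob r N \<theta> (thick_level C N) \<le>
    measure (gff (lattice_box (real N))) (up_crossing r N h) +
    measure (gff (lattice_box (real N))) (up_crossing r N (2 * m)) +
    4 * (2 * real N + 1)\<^sup>2 * exp (- (2 * m)\<^sup>2 / 8)"
proof -
  let ?l = "ln (real N)" and ?D = "lattice_box (real N)"
  have h: "0 < h" unfolding h_def using C N by simp
  have m: "0 < m" unfolding m_def using \<theta> N by simp
  have m2: "m\<^sup>2 / 2 = \<theta> / pi * ?l\<^sup>2"
    unfolding m_def using \<theta> by (simp add: power_mult_distrib)
  have mh: "(m + h)\<^sup>2 / 2 = (sqrt \<theta> + thick_level C N)\<^sup>2 / pi * ?l\<^sup>2"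
  proof -
    have s: "sqrt (2 / pi) * sqrt (pi / 2) = 1" by (simp add: real_sqrt_mult[symmetric])
    have "(sqrt \<theta> + thick_level C N) * sqrt (2 / pi) * ?l =
        sqrt \<theta> * sqrt (2 / pi) * ?l + C * (sqrt (2 / pi) * sqrt (pi / 2)) * sqrt (ln ?l)"
      unfolding thick_level_def using N by (simp add: field_simps)
    also have "\<dots> = m + h"
      unfolding s m_def h_def by (simp add: real_sqrt_mult[symmetric] mult.commute)
    finally have "(m + h)\<^sup>2 = (sqrt \<theta> + thick_level C N)\<^sup>2 * (2 / pi) * ?l\<^sup>2"
      by (metis power_mult_distrib real_sqrt_pow2 pi_ge_zero zero_le_divide_iff zero_le_numeral)
    then show ?thesis by simp
  qed
  have "crossing_prob r N \<theta> (thick_level C N) \<le> measure (gff ?D) (far_crossing r N m h)"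
    unfolding crossing_prob_def thick_points_def mh[symmetric] m2[symmetric]
    by (rule local_time_crossing_le_far_crossing) (use m h in simp_all)
  also note gff_far_crossing[OF m h]
  finally show ?thesis .
qed

text \<open>A Gaussian tail at a height of order \<open>ln N\<close> beats every power of \<open>N\<close>.\<close>

lemma gaussian_at_log_scale:
  fixes \<mu> p :: real
  assumes "0 < \<mu>" "0 < p"
  shows "(\<lambda>N::nat. exp (- (2 * (\<mu> * ln (real N)) / 1024)\<^sup>2 / 8)) \<in> O(\<lambda>N. ln (real N) powr (- p))"
    "(\<lambda>N::nat. 4 * (2 * real N + 1)\<^sup>2 * exp (- (2 * (\<mu> * ln (real N)))\<^sup>2 / 8)) \<in> O(\<lambda>N. ln (real N) powr (- p))"
    "(\<lambda>N::nat. (2 * real N + 1) * exp (- (2 * (\<mu> * ln (real N)) / 1024)\<^sup>2 / 8)) \<longlonglongrightarrow> 0"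
    "(\<lambda>N::nat. 4 * (2 * real N + 1)\<^sup>2 * exp (- (2 * (\<mu> * ln (real N)))\<^sup>2 / 8)) \<longlonglongrightarrow> 0"
  subgoal using assms by real_asymp
  subgoal using assms by real_asymp
  subgoal using assms by real_asymp
  subgoal using assms by real_asymp
  done

theorem theorem1p4:
  "\<exists>c\<^sub>0 C\<^sub>0 :: real. c\<^sub>0 > 0 \<and> C\<^sub>0 > 0 \<and>
     (\<forall>\<theta>>0. \<forall>C\<ge>C\<^sub>0.
        (\<lambda>N. crossing_prob (real N) N \<theta> (thick_level C N))
          \<in> O(\<lambda>N. ln (real N) powr (- c\<^sub>0 * C\<^sup>2))) \<and>
     (\<forall>\<theta>>0. \<forall>C\<ge>C\<^sub>0.
        limsup (\<lambda>N. ereal (crossing_prob (real N / 2) N \<theta> (thick_level C N))) < 1)"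
proof -
  \<comment> \<open>the exponent in \<open>exp (- (h / 1024)\<^sup>2 / 8)\<close> for \<open>h = C * sqrt (ln (ln N))\<close>\<close>
  define c :: real where "c = 1 / (8 * 1024\<^sup>2)"
  let ?h = "\<lambda>C N. C * sqrt (ln (ln (real N)))" and ?m = "\<lambda>\<theta> N. sqrt (2 * \<theta> / pi) * ln (real N)"
  have c: "0 < c" unfolding c_def by simp
  have large: "eventually (\<lambda>N::nat. 1 < ln (real N) \<and> 1 \<le> N) sequentially"
  proof (rule eventually_conj)
    show "eventually (\<lambda>N::nat. 1 < ln (real N)) sequentially" by real_asymp
  qed (rule eventually_ge_at_top)
  have h_large: "eventually (\<lambda>N. (32 + 4096) * loss \<le> ?h C N) sequentially" if "0 < C" for C
    using that by real_asymp
  have m_large: "eventually (\<lambda>N. (32 + 4096) * loss \<le> 2 * ?m \<theta> N) sequentially" if "0 < \<theta>" for \<theta>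
  proof -
    have "0 < sqrt (2 * \<theta> / pi)" using that by simp
    then show ?thesis by real_asymp
  qed
  have one: "(\<lambda>N. crossing_prob (real N) N \<theta> (thick_level C N)) \<in> O(\<lambda>N. ln (real N) powr (- c * C\<^sup>2))"
    if \<theta>: "0 < \<theta>" and C: "1 \<le> C" for \<theta> C
  proof -
    let ?b = "\<lambda>N. exp (- (?h C N / 1024)\<^sup>2 / 8) + exp (- (2 * ?m \<theta> N / 1024)\<^sup>2 / 8) +
        4 * (2 * real N + 1)\<^sup>2 * exp (- (2 * ?m \<theta> N)\<^sup>2 / 8)"
    have C0: "0 < C" using C by simp
    have bound: "eventually (\<lambda>N. crossing_prob (real N) N \<theta> (thick_level C N) \<le> ?b N) sequentially"
      using large h_large[OF C0] m_large[OF \<theta>]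
    proof eventually_elim
      case (elim N)
      then have N: "1 < ln (real N)" "1 \<le> N" by auto
      show ?case
        using crossing_prob_le[OF \<theta> C0 N(1), of "real N"] gff_full_crossing[OF N(2) elim(2)]
          gff_full_crossing[OF N(2) elim(3)] by simp
    qed
    have main: "eventually (\<lambda>N. exp (- (?h C N / 1024)\<^sup>2 / 8) = ln (real N) powr (- c * C\<^sup>2)) sequentially"
      using large
    proof eventually_elim
      case (elim N)
      have "- (?h C N / 1024)\<^sup>2 / 8 = - c * C\<^sup>2 * ln (ln (real N))"
        using elim unfolding c_def by (simp add: power_mult_distrib power_divide)
      then show ?case using elim by (simp only: powr_def) auto
    qed
    have pos: "0 < sqrt (2 * \<theta> / pi)" "0 < c * C\<^sup>2" using \<theta> c C by simp_all
    have "(\<lambda>N. exp (- (2 * ?m \<theta> N / 1024)\<^sup>2 / 8)) \<in> O(\<lambda>N. ln (real N) powr (- c * C\<^sup>2))"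
      using gaussian_at_log_scale(1)[OF pos] by simp
    moreover have "(\<lambda>N. 4 * (2 * real N + 1)\<^sup>2 * exp (- (2 * ?m \<theta> N)\<^sup>2 / 8)) \<in> O(\<lambda>N. ln (real N) powr (- c * C\<^sup>2))"
      using gaussian_at_log_scale(2)[OF pos] by simp
    moreover have "(\<lambda>N. exp (- (?h C N / 1024)\<^sup>2 / 8)) \<in> O(\<lambda>N. ln (real N) powr (- c * C\<^sup>2))"
      using landau_o.big.in_cong[OF main] by simp
    ultimately have b: "?b \<in> O(\<lambda>N. ln (real N) powr (- c * C\<^sup>2))" by (intro sum_in_bigo)
    have "(\<lambda>N. crossing_prob (real N) N \<theta> (thick_level C N)) \<in> O(?b)"
    proof (rule bigoI[where c=1])
      show "eventually (\<lambda>N. norm (crossing_prob (real N) N \<theta> (thick_level C N)) \<le> 1 * norm (?b N)) sequentially"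
        using bound
      proof eventually_elim
        case (elim N)
        have "0 \<le> crossing_prob (real N) N \<theta> (thick_level C N)" unfolding crossing_prob_def by simp
        then show ?case using elim by simp
      qed
    qed
    then show ?thesis using b by (rule landau_o.big_trans)
  qed
  have two: "limsup (\<lambda>N. ereal (crossing_prob (real N / 2) N \<theta> (thick_level C N))) < 1"
    if \<theta>: "0 < \<theta>" and C: "1 \<le> C" for \<theta> C
  proof -
    let ?e = "\<lambda>N. (2 * real N + 1) * exp (- (2 * ?m \<theta> N / 1024)\<^sup>2 / 8) +
        4 * (2 * real N + 1)\<^sup>2 * exp (- (2 * ?m \<theta> N)\<^sup>2 / 8)"
    have pos: "0 < sqrt (2 * \<theta> / pi)" using \<theta> by simp
    have small: "eventually (\<lambda>N. ?e N \<le> 1 / 4) sequentially" 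
    proof -
      have "eventually (\<lambda>N. ?e N < 1 / 4) sequentially"
        by (rule order_tendstoD(2)[OF tendsto_add[OF gaussian_at_log_scale(3,4)[OF pos zero_less_one]]]) simp
      then show ?thesis by eventually_elim simp
    qed
    have "eventually (\<lambda>N. crossing_prob (real N / 2) N \<theta> (thick_level C N) \<le> 3 / 4) sequentially"
      using large m_large[OF \<theta>] small
    proof eventually_elim
      case (elim N)
      then have C0: "0 < C" and N: "1 < ln (real N)" "1 \<le> N" using C by auto
      have h: "0 < ?h C N" using C0 ln_gt_zero[OF N(1)] by simp
      show ?case
        using crossing_prob_le[OF \<theta> C0 N(1), of "real N / 2"] gff_half_crossing[OF N(2) elim(2)]
          gff_crossing_le_half[OF _ h, of "real N / 2" N] elim(3) by simp
    qed
    then have "eventually (\<lambda>N. ereal (crossing_prob (real N / 2) N \<theta> (thick_level C N)) \<le> ereal (3 / 4)) sequentially"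
      by simp
    then have "limsup (\<lambda>N. ereal (crossing_prob (real N / 2) N \<theta> (thick_level C N))) \<le> ereal (3 / 4)"
      by (rule Limsup_bounded)
    also have "\<dots> < 1" by (simp add: one_ereal_def)
    finally show ?thesis .
  qed
  show ?thesis using c one two by (intro exI[of _ c] exI[of _ 1]) simp
qed

end
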